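(* Let $f\colon\mathbb{N}^s\to\mathbb{C}$ be a function that satisfies the box asymptotic (A1) of the context, and that furthermore is real and non-negative or satisfies the upper bound (A2) of the context. Assume that the polytope $\mathcal{P}$ is bounded, that its maximal face $\mathcal{F}$ is of dimension $d$ and not contained in a coordinate hyperplane, and that $\boldsymbol{\ell}$ is of convergent type for $\mathcal{F}$. Let $a=\max_{\boldsymbol{x}\in\mathcal{P}}|\boldsymbol{x}|_1$ and $\ell=\ell_1+\dots+\ell_s$. Then there exist $\varepsilon>0$ and a constant $c_{\mathcal{P}}$, which depends only on $\boldsymbol{\ell}$ and the polytope $\mathcal{P}$, such that, as $B\to\infty$, $$\sum_{\substack{\boldsymbol{x}\in\mathbb{N}^s\\ \prod_{j=1}^sx_j^{\varpi_{ij}}\le B\ \forall 1\le i\le k}}f(\boldsymbol{x})=\frac{c_f\,c_{\mathcal{P}}}{\prod_{i=1}^s\alpha_i^{\ell_i}}B^a(\log B)^{d+\ell}+O_{\boldsymbol{\varpi},\boldsymbol{\alpha},\boldsymbol{\ell}}\bigl(C_fB^a(\log B)^{d+\ell-\varepsilon}\bigr).$$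
   Context: $\mathbb{N}$ denotes the positive integers, $|\boldsymbol{t}|_1=\sum_i|t_i|$, and inequalities between vectors are coordinatewise. Fix integers $s,k\ge1$, $\boldsymbol{\alpha}\in\mathbb{R}_{>0}^s$, $\boldsymbol{\ell}\in\mathbb{R}^s$, $\boldsymbol{\varpi}_i=(\varpi_{i1},\dots,\varpi_{is})\in\mathbb{R}_{\ge0}^s$ for $1\le i\le k$, $0<\delta\le1$ and $A>0$; implicit constants may depend on all of these (and on the implicit constants in (A1), (A2)), but not otherwise on $f$, $c_f$, $C_f$. (A1): there are constants $c_f\in\mathbb{C}$, $C_f\in\mathbb{R}_{\ge0}$ with $|c_f|\le C_f$ such that for all $\boldsymbol{B}\in\mathbb{R}_{\ge1}^s$ $$\sum_{\boldsymbol{x}\le\boldsymbol{B}}f(\boldsymbol{x})=c_f\prod_{i=1}^sB_i^{\alpha_i}(1+\log B_i)^{\ell_i}+O\Bigl(C_f(1+\min_i\log B_i)^{-\delta}\prod_{i=1}^sB_i^{\alpha_i}(1+\log B_i)^{\ell_i}\Bigr).$$ (A2): for all $1<\theta\le2$ and all $\boldsymbol{B}\in\mathbb{R}_{\ge1}^s$ $$\sum_{\boldsymbol{B}\le\boldsymbol{x}\le\theta\boldsymbol{B}}|f(\boldsymbol{x})|\ll C_f\Bigl((\log\theta)^s+(\log\theta)^{-A}(1+\min_i\log B_i)^{-\delta}\Bigr)\prod_{i=1}^sB_i^{\alpha_i}(1+\log B_i)^{\ell_i}.$$ Polytope: $\mathcal{P}=\{\boldsymbol{t}\in\mathbb{R}_{\ge0}^s:\sum_{j=1}^s\frac{\varpi_{ij}}{\alpha_j}t_j\le1\text{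 for }i=1,\dots,k\}$; its maximal face $\mathcal{F}$ is the set of points of $\mathcal{P}$ at which $|\boldsymbol{t}|_1$ attains its maximum over $\mathcal{P}$. The vector $\boldsymbol{\ell}$ is of convergent type for $\mathcal{F}$ if $\int_{\mathcal{F}}\prod_{i=1}^st_i^{\ell_i}\,d\mu<\infty$, where $d\mu$ is the $d$-dimensional Lebesgue measure on $\mathcal{F}$, $d=\dim\mathcal{F}$ (counting measure if $d=0$). *)

theory Defs
  imports "HOL-Analysis.Analysis"
begin

text \<open>
  Functions on s-tuples of positive integers are modelled as functions on \<open>nat ^ 's\<close>; only their
  values at vectors with all coordinates at least 1 are ever used.
\<close>

definition l1_norm :: "real ^ 's \<Rightarrow> real" where
  "l1_norm t = (\<Sum>i\<in>UNIV. \<bar>t $ i\<bar>)"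

definition growth :: "real ^ 's \<Rightarrow> real ^ 's \<Rightarrow> real ^ 's \<Rightarrow> real" where
  "growth \<alpha> \<l> B = (\<Prod>i\<in>UNIV. (B $ i) powr (\<alpha> $ i) * (1 + ln (B $ i)) powr (\<l> $ i))"

definition min_log :: "real ^ 's \<Rightarrow> real" where
  "min_log B = Min (range (\<lambda>i. ln (B $ i)))"

text \<open>\<open>K\<close> is the implicit constant of the O-term.\<close>

definition box_asymptotic ::
  "real ^ 's \<Rightarrow> real ^ 's \<Rightarrow> real \<Rightarrow> real \<Rightarrow> (nat ^ 's \<Rightarrow> complex) \<Rightarrow> complex \<Rightarrow> real \<Rightarrow> bool" where
  "box_asymptotic \<alpha> \<l> \<delta> K f c C \<longleftrightarrow>
     norm c \<le> C \<and>
     (\<forall>B. (\<forall>i. 1 \<le> B $ i) \<longrightarrow>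
       norm ((\<Sum>x | \<forall>i. 1 \<le> x $ i \<and> real (x $ i) \<le> B $ i. f x) - c * of_real (growth \<alpha> \<l> B))
         \<le> K * (C * (1 + min_log B) powr (- \<delta>) * growth \<alpha> \<l> B))"

definition box_upper_bound ::
  "real ^ 's \<Rightarrow> real ^ 's \<Rightarrow> real \<Rightarrow> real \<Rightarrow> real \<Rightarrow> (nat ^ 's \<Rightarrow> complex) \<Rightarrow> real \<Rightarrow> bool" where
  "box_upper_bound \<alpha> \<l> \<delta> A K f C \<longleftrightarrow>
     (\<forall>\<theta> B. 1 < \<theta> \<longrightarrow> \<theta> \<le> 2 \<longrightarrow> (\<forall>i. 1 \<le> B $ i) \<longrightarrow>
       (\<Sum>x | \<forall>i. 1 \<le> x $ i \<and> B $ i \<le> real (x $ i) \<and> real (x $ i) \<le> \<theta> * B $ i. norm (f x))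
         \<le> K * (C * (ln \<theta> ^ CARD('s) + ln \<theta> powr (- A) * (1 + min_log B) powr (- \<delta>))
                 * growth \<alpha> \<l> B))"

definition real_nonneg :: "(nat ^ 's \<Rightarrow> complex) \<Rightarrow> bool" where
  "real_nonneg f \<longleftrightarrow> (\<forall>x. (\<forall>i. 1 \<le> x $ i) \<longrightarrow> f x \<in> \<real> \<and> 0 \<le> Re (f x))"

definition exponent_polytope :: "nat \<Rightarrow> real ^ 's \<Rightarrow> (nat \<Rightarrow> real ^ 's) \<Rightarrow> (real ^ 's) set" where
  "exponent_polytope k \<alpha> \<omega> =
     {t. (\<forall>j. 0 \<le> t $ j) \<and> (\<forall>i\<in>{1..k}. (\<Sum>j\<in>UNIV. \<omega> i $ j / \<alpha> $ j * t $ j) \<le> 1)}"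

definition maximal_face :: "(real ^ 's) set \<Rightarrow> (real ^ 's) set" where
  "maximal_face P = {t \<in> P. \<forall>u\<in>P. l1_norm u \<le> l1_norm t}"

text \<open>
  The d-dimensional Lebesgue measure on the affine hull of a nonempty set \<open>S\<close> of affine dimension
  \<open>d\<close>: the image of Lebesgue measure in \<open>d\<close> real coordinates under an orthonormal affine
  parametrisation \<open>y \<mapsto> p + (\<Sum>i<d. y i *\<^sub>R e i)\<close> of that hull. It does not depend on the choice of
  \<open>p\<close> and \<open>e\<close>. For \<open>d = 0\<close> the product measure is the unit mass on a one-point space, so this is
  the counting measure on \<open>S\<close>.
\<close>

definition affine_lebesgue :: "'a::euclidean_space set \<Rightarrow> 'a measure" where
  "affine_lebesgue S = (let d = nat (aff_dim S) in
     SOME M. \<exists>p e. p \<in> S \<and>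
       (\<forall>i<d. p + e i \<in> affine hull S) \<and>
       (\<forall>i<d. \<forall>j<d. e i \<bullet> e j = (if i = j then 1 else 0)) \<and>
       M = distr (\<Pi>\<^sub>M i\<in>{..<d}. lborel) borel (\<lambda>y. p + (\<Sum>i<d. y i *\<^sub>R e i)))"

text \<open>
  The convention \<open>0 powr r = 0\<close> only affects points on the coordinate hyperplanes; they form a null
  set for every convex \<open>F\<close> that is contained in none of these hyperplanes and lies in the
  nonnegative orthant.
\<close>

definition convergent_type :: "real ^ 's \<Rightarrow> (real ^ 's) set \<Rightarrow> bool" where
  "convergent_type \<l> F \<longleftrightarrow>
     (\<integral>\<^sup>+t\<in>F. ennreal (\<Prod>i\<in>UNIV. (t $ i) powr (\<l> $ i)) \<partial>affine_lebesgue F) < \<infinity>"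

end

theory Submission
  imports Defs
begin

text \<open>
  Put \<open>u\<^sub>j = ln x\<^sub>j\<close> and \<open>L = ln B\<close>. In these coordinates the summation region is the dilate by \<open>L\<close>
  of a fixed polytope, and \<open>f\<close> has density \<open>c\<^sub>f \<cdot> \<Prod>\<^sub>j \<alpha>\<^sub>j exp (\<alpha>\<^sub>j u\<^sub>j) (1 + u\<^sub>j) powr \<l>\<^sub>j\<close> on average. After
  rescaling, one integrates \<open>exp (- L \<tau>(t)) \<cdot> \<Prod>\<^sub>j (\<alpha>\<^sub>j / L + t\<^sub>j) powr \<l>\<^sub>j\<close> over \<open>P\<close>, where
  \<open>\<tau>(t) = a - \<bar>t\<bar>\<^sub>1\<close> vanishes exactly on \<open>F\<close>, so the mass sits within distance about \<open>1 / L\<close> of \<open>F\<close>.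
  Since \<open>\<l>\<close> is of convergent type, all exponent sums belonging to faces of \<open>F\<close> are positive, and even
  after lowering the exponents by a small \<open>\<epsilon>\<close> the integral is \<open>O(L powr (d - s))\<close>: cover \<open>P\<close> by
  simplices on vertices of \<open>P\<close> (Caratheodory) and estimate the monomials in barycentric coordinates.

  Scaling transversally to \<open>F\<close> by \<open>L / L'\<close> maps the integral at \<open>L\<close> to the one at \<open>L'\<close> up to a
  relative error \<open>O(L powr (- \<epsilon>))\<close>, for \<open>L \<le> L' \<le> 2 L\<close>. Summing over dyadic scales shows that the
  normalized integral converges with a power saving. The limit does not depend on the shifts \<open>\<alpha>\<^sub>j\<close>
  and is the constant \<open>c\<^sub>P\<close>.

  Finally the sum is compared with the integral on logarithmic cells of mesh \<open>h\<close>. Cells inside the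
  region and away from the coordinate hyperplanes are evaluated by inclusion-exclusion from (A1);
  the cells at the boundary or near a coordinate hyperplane are bounded by (A2), which for
  nonnegative \<open>f\<close> follows from (A1) up to constants.
\<close>

text \<open>Negative exponents make the limiting density singular along the boundary of
  \<open>F\<close>, and a plain limit argument would give convergence without a rate. The rate comes
  from the following: convergence of the integral over \<open>F\<close> forces finitely many strict
  inequalities, one for each affinely independent set of vertices of \<open>P\<close> lying in
  \<open>F\<close>. Strict inequalities survive a small decrease of all exponents, and this slack
  \<epsilon> buys the power saving in every integral estimate, including the smallness of the slices
  near the coordinate hyperplanes, where (A1) gives no saving. The limit is not computed. Showing
  that the normalized integral is Cauchy avoids a disintegration of Lebesgue measure into
  \<open>F\<close> and its transversal directions. That the limit ignores the shifts matters because
  the shifts that occur are the \<open>\<alpha> $ j\<close>, whereas the constant may depend only on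
  \<open>\<l>\<close> and \<open>P\<close>. The final exponent balances \<epsilon>, \<delta> and the
  loss from cells of mesh \<open>h\<close>: a cell error that is not proportional to the cell volume
  costs a negative power of \<open>h\<close>.\<close>

subsection \<open>Integrals under affine changes of variables\<close>

text \<open>Uniqueness of Haar measure: the integral of
  \<open>indicator E x * indicator Q (x + y)\<close> against both measures is evaluated in the two
  orders, using invariance of Lebesgue measure in one and of \<open>M\<close> in the other. A test
  set \<open>Q\<close> of Lebesgue measure 1 fixes the factor.\<close>

lemma translation_invariant_emeasure:
  fixes M :: "'a::euclidean_space measure"
  assumes [measurable_cong]: "sets M = sets borel" and "sigma_finite_measure M"
    and inv: "\<And>a. distr M borel ((+) a) = M"
    and [measurable]: "E \<in> sets borel" "Q \<in> sets borel" and Q: "emeasure lborel Q = 1"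
  shows "emeasure M E = emeasure M Q * emeasure lborel E"
proof -
  interpret M: sigma_finite_measure M by fact
  interpret MP: pair_sigma_finite M "lborel :: 'a measure" ..
  have inv_M: "(\<integral>\<^sup>+x. f (a + x) \<partial>M) = (\<integral>\<^sup>+x. f x \<partial>M)"
    if [measurable]: "f \<in> borel_measurable borel" for a and f :: "'a \<Rightarrow> ennreal"
    by (subst (2) inv[of a, symmetric]) (simp add: nn_integral_distr)
  have inv_l: "(\<integral>\<^sup>+x. f (a + x) \<partial>lborel) = (\<integral>\<^sup>+x. f x \<partial>lborel)"
    if [measurable]: "f \<in> borel_measurable borel" for a and f :: "'a \<Rightarrow> ennreal"
    by (subst (2) lborel_distr_plus[of a, symmetric]) (simp add: nn_integral_distr)
  \<comment> \<open>Replacing \<open>x\<close> by \<open>x - y\<close> below leaves \<open>y\<close>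
    with a negative sign, so reflection invariance of Lebesgue measure enters too.\<close>
  have refl_l: "(\<integral>\<^sup>+y. indicator E (a - y) \<partial>lborel) = emeasure lborel E" for a
  proof -
    have "(\<integral>\<^sup>+y. indicator E (a - y) \<partial>lborel)
        = (\<integral>\<^sup>+y. indicator E (a - y) \<partial>distr (lborel :: 'a measure) borel (\<lambda>x. a + (-1) *\<^sub>R x))"
      using lborel_affine[of "-1" a] by (simp add: density_1)
    also have "\<dots> = (\<integral>\<^sup>+y. indicator E y \<partial>lborel)"
      by (subst nn_integral_distr) auto
    finally show ?thesis by simp
  qed
  have "emeasure M E * emeasure lborel Q = (\<integral>\<^sup>+x. indicator E x * (\<integral>\<^sup>+y. indicator Q y \<partial>lborel) \<partial>M)"
    by (simp add: nn_integral_multc)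
  also have "\<dots> = (\<integral>\<^sup>+x. (\<integral>\<^sup>+y. indicator E x * indicator Q (x + y) \<partial>lborel) \<partial>M)"
    by (intro nn_integral_cong) (simp add: nn_integral_cmult inv_l)
  also have "\<dots> = (\<integral>\<^sup>+y. (\<integral>\<^sup>+x. indicator E x * indicator Q (x + y) \<partial>M) \<partial>lborel)"
    by (intro MP.Fubini'[symmetric]) measurable
  also have "\<dots> = (\<integral>\<^sup>+y. (\<integral>\<^sup>+x. indicator E (x - y) * indicator Q x \<partial>M) \<partial>lborel)"
  proof (rule nn_integral_cong)
    fix y
    have m: "(\<lambda>x. indicator E (x - y) * indicator Q x :: ennreal) \<in> borel_measurable borel"
      by measurable
    show "(\<integral>\<^sup>+x. indicator E x * indicator Q (x + y) \<partial>M) = (\<integral>\<^sup>+x. indicator E (x - y) * indicator Q x \<partial>M)"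
      using inv_M[OF m, of y] by (simp add: add.commute)
  qed
  also have "\<dots> = (\<integral>\<^sup>+x. (\<integral>\<^sup>+y. indicator E (x - y) * indicator Q x \<partial>lborel) \<partial>M)"
    by (intro MP.Fubini') measurable
  also have "\<dots> = (\<integral>\<^sup>+x. emeasure lborel E * indicator Q x \<partial>M)"
    by (simp add: nn_integral_multc refl_l)
  also have "\<dots> = emeasure lborel E * emeasure M Q"
    by (simp add: nn_integral_cmult)
  finally show ?thesis using Q by (simp add: mult.commute)
qed

text \<open>The image of Lebesgue measure under \<open>A\<close> is again translation invariant,
  hence a multiple of Lebesgue measure. No determinant appears: in the applications the factor
  \<open>m\<close> cancels or disappears into a constant.\<close>

lemma nn_integral_linear_injective:
  fixes A :: "'a::euclidean_space \<Rightarrow> 'a"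
  assumes "linear A" "inj A"
  shows "\<exists>m>0. \<forall>f\<in>borel_measurable borel.
    (\<integral>\<^sup>+x. f (A x) \<partial>lborel) = ennreal m * (\<integral>\<^sup>+x. f x \<partial>lborel)"
proof -
  have surj: "surj A"
    using assms linear_injective_imp_surjective by blast
  obtain B where B: "linear B" "\<And>x. B (A x) = x" "\<And>x. A (B x) = x"
    by (metis assms(1) linear_injective_isomorphism assms(2))
  have vim: "A -` S = B ` S" for S
  proof
    show "A -` S \<subseteq> B ` S"
    proof
      fix x assume "x \<in> A -` S"
      then have "B (A x) \<in> B ` S" by (intro imageI) simp
      then show "x \<in> B ` S" unfolding B(2) .
    qed
    show "B ` S \<subseteq> A -` S"
    proof
      fix x assume "x \<in> B ` S"
      then obtain y where "y \<in> S" "x = B y" by blast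
      then show "x \<in> A -` S" by (simp add: B(3))
    qed
  qed
  have [measurable]: "A \<in> borel_measurable borel" "B \<in> borel_measurable borel"
    using assms(1) B(1) by (auto intro!: borel_measurable_continuous_onI linear_continuous_on linear_linear[THEN iffD2]
      simp: linear_conv_bounded_linear)
  define M where "M = distr lborel borel A"
  have sM: "sets M = sets borel" by (simp add: M_def)
  have "sigma_finite_measure M"
  proof
    have bd: "emeasure M (ball 0 (real n)) \<noteq> \<infinity>" for n
    proof -
      have "emeasure M (ball 0 (real n)) = emeasure lborel (A -` ball 0 (real n))"
        by (simp add: M_def emeasure_distr)
      also have "A -` ball 0 (real n) = B ` ball 0 (real n)"
        by (rule vim)
      also have "bounded (B ` ball 0 (real n))"
        using B(1) by (intro bounded_linear_image) (auto simp: linear_conv_bounded_linear)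
      then have "emeasure lborel (B ` ball 0 (real n)) < \<infinity>"
        by (rule emeasure_bounded_finite)
      finally show ?thesis by simp
    qed
    have cov: "\<Union> (range (\<lambda>n. ball 0 (real n))) = (UNIV :: 'a set)"
      by (auto simp: reals_Archimedean2)
    show "\<exists>C. countable C \<and> C \<subseteq> sets M \<and> \<Union> C = space M \<and> (\<forall>a\<in>C. emeasure M a \<noteq> \<infinity>)"
      by (rule exI[of _ "range (\<lambda>n. ball 0 (real n))"]) (use bd cov in \<open>auto simp: sM M_def\<close>)
  qed
  moreover have "distr M borel ((+) a) = M" for a
  proof -
    have "distr M borel ((+) a) = distr lborel borel (\<lambda>x. a + A x)"
      by (simp add: M_def distr_distr o_def)
    \<comment> \<open>Translating by \<open>a\<close> after \<open>A\<close> is translating by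
      \<open>B a\<close> before it, and Lebesgue measure does not see the latter.\<close>
    also have "\<dots> = distr lborel borel (\<lambda>x. A (B a + x))"
      using B by (simp add: linear_add[OF assms(1)])
    also have "\<dots> = distr (distr lborel borel ((+) (B a))) borel A"
      by (simp add: distr_distr o_def)
    finally show ?thesis by (simp add: lborel_distr_plus M_def)
  qed
  ultimately have *: "emeasure M E = emeasure M (cbox 0 One) * emeasure lborel E" if "E \<in> sets borel" for E
    using that sM by (intro translation_invariant_emeasure) auto
  have fin: "emeasure M (cbox 0 One) < \<infinity>"
  proof -
    have "emeasure M (cbox 0 One) = emeasure lborel (A -` cbox 0 One)"
      by (simp add: M_def emeasure_distr)
    also have "A -` cbox 0 One = B ` cbox 0 One"
      by (rule vim)
    also have "bounded (B ` cbox 0 One)"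
      using B(1) by (intro bounded_linear_image) (auto simp: linear_conv_bounded_linear)
    then have "emeasure lborel (B ` cbox 0 One) < \<infinity>"
      by (rule emeasure_bounded_finite)
    finally show ?thesis .
  qed
  have pos: "emeasure M (cbox 0 One) \<noteq> 0"
  proof
    assume "emeasure M (cbox 0 One) = 0"
    then have "emeasure M UNIV = 0" using *[of UNIV] by simp
    then show False by (simp add: M_def emeasure_distr)
  qed
  define m where "m = enn2real (emeasure M (cbox 0 One))"
  have m: "m > 0" "ennreal m = emeasure M (cbox 0 One)"
    using fin pos by (auto simp: m_def enn2real_positive_iff less_top zero_less_iff_neq_zero)
  have M_eq: "M = density lborel (\<lambda>_. ennreal m)"
  proof (rule measure_eqI)
    fix E assume "E \<in> sets M"
    then have E: "E \<in> sets borel" by (simp add: sM)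
    then show "emeasure M E = emeasure (density lborel (\<lambda>_. ennreal m)) E"
      unfolding m(2) by (subst *[OF E]) (simp add: emeasure_density nn_integral_cmult)
  qed (simp add: sM)
  show ?thesis
  proof (intro exI[of _ m] conjI ballI m)
    fix f :: "'a \<Rightarrow> ennreal" assume [measurable]: "f \<in> borel_measurable borel"
    have "(\<integral>\<^sup>+x. f (A x) \<partial>lborel) = (\<integral>\<^sup>+x. f x \<partial>M)"
      by (simp add: M_def nn_integral_distr)
    also have "\<dots> = ennreal m * (\<integral>\<^sup>+x. f x \<partial>lborel)"
      by (subst M_eq) (simp add: nn_integral_density nn_integral_cmult)
    finally show "(\<integral>\<^sup>+x. f (A x) \<partial>lborel) = ennreal m * (\<integral>\<^sup>+x. f x \<partial>lborel)" .
  qed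
qed

subsection \<open>Monomial integrals over simplices\<close>

text \<open>Exponents of both signs occur, so bounding a power requires control of the base from
  both sides; the factor \<open>R powr \<bar>l\<bar>\<close> covers either sign.\<close>

lemma powr_comparable:
  fixes x y R l :: real
  assumes "0 < x" "0 < y" "x \<le> R * y" "y \<le> R * x"
  shows "x powr l \<le> R powr \<bar>l\<bar> * y powr l"
proof -
  have R: "R > 0" using assms by (smt (verit) zero_less_mult_pos2)
  show ?thesis
  proof (cases "l \<ge> 0")
    case True
    have "x powr l \<le> (R * y) powr l" using True assms by (intro powr_mono2) auto
    then show ?thesis using True R assms by (simp add: powr_mult)
  next
    case False
    have "y / R \<le> x" using R assms by (simp add: field_simps)
    then have "x powr l \<le> (y / R) powr l" using False R assms by (intro powr_mono2') auto
    also have "\<dots> = R powr \<bar>l\<bar> * y powr l"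
      using False R assms by (simp add: powr_divide powr_minus field_simps)
    finally show ?thesis .
  qed
qed

text \<open>Half of the exponential decay pays for the power and the other half survives. Polynomial
  losses in \<open>1 + L * \<tau> t\<close> are absorbed in this way later.\<close>

lemma powr_times_exp_bound:
  fixes p g :: real
  assumes "g > 0"
  shows "\<exists>K>0. \<forall>x\<ge>1. x powr p * exp (- g * x) \<le> K * exp (- (g / 2) * x)"
proof -
  obtain n :: nat where n: "n \<ge> 1" "p \<le> real n"
    by (metis real_arch_simple max.cobounded1 max.cobounded2 of_nat_1 of_nat_le_iff order_trans linorder_le_cases)
  \<comment> \<open>Chosen so that \<open>x ^ n = K * (g / 2 * x / n) ^ n\<close>, where the last
    power is at most \<open>exp (g / 2 * x)\<close>.\<close>
  define K where "K = (real n * 2 / g) ^ n"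
  have K: "K > 0" using n assms by (simp add: K_def)
  show ?thesis
  proof (intro exI[of _ K] conjI K allI impI)
    fix x :: real assume x: "x \<ge> 1"
    have "x powr p \<le> x powr real n" using x n by (intro powr_mono) auto
    also have "\<dots> = x ^ n" using x by (simp add: powr_realpow)
    also have "\<dots> = K * ((g / 2 * x) / real n) ^ n"
      using n assms by (simp add: K_def power_divide power_mult_distrib)
    also have "\<dots> \<le> K * (1 + (g / 2 * x) / real n) ^ n"
      using K x assms n by (intro mult_left_mono power_mono) auto
    also have "\<dots> \<le> K * exp (g / 2 * x)"
    proof (intro mult_left_mono)
      show "(1 + g / 2 * x / real n) ^ n \<le> exp (g / 2 * x)"
        by (rule exp_ge_one_plus_x_over_n_power_n) (use n x assms in \<open>auto intro: order_trans[of _ 0]\<close>)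
    qed (use K in auto)
    finally have "x powr p * exp (- g * x) \<le> (K * exp (g / 2 * x)) * exp (- g * x)"
      by (intro mult_right_mono) auto
    also have "\<dots> = K * exp (- (g / 2) * x)"
      by (simp add: mult.assoc flip: exp_add)
    finally show "x powr p * exp (- g * x) \<le> K * exp (- (g / 2) * x)" .
  qed
qed

text \<open>Power counting. A form \<open>j\<close> has the size of the largest \<open>u i\<close>
  with \<open>i\<close> in \<open>S j \<inter> Y\<close>, or of the floor \<open>w\<close> if there
  is no such \<open>i\<close>. Peel off the smallest coordinate and let it become the new floor: by
  \<open>C\<close> the exponent of the floor is nonnegative once the target
  \<open>- \<beta> * (d - card Y)\<close> is split off, so raising the floor only increases the
  bound. Any ordering of the coordinates can occur, hence \<open>C\<close> for all subsets. The
  resulting powers \<open>u i powr (- \<beta>)\<close> are integrable for \<beta> < 1.\<close>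

lemma chain_monomial_bound:
  fixes u :: "'i \<Rightarrow> real" and S :: "'j \<Rightarrow> 'i set" and l :: "'j \<Rightarrow> real" and \<beta> d :: real
  assumes "finite J" "finite Y"
    and C: "\<And>Y'. Y' \<subseteq> Y \<Longrightarrow> 0 \<le> (\<Sum>j | j \<in> J \<and> S j \<inter> Y' = {}. l j) + \<beta> * (d - card Y')"
    and w: "0 < w" "w \<le> 1" "\<And>i. i \<in> Y \<Longrightarrow> w \<le> u i" "\<And>i. i \<in> Y \<Longrightarrow> u i \<le> 1"
  shows "(\<Prod>j | j \<in> J \<and> S j \<inter> Y \<noteq> {}. Max (u ` (S j \<inter> Y)) powr l j)
           * w powr (\<Sum>j | j \<in> J \<and> S j \<inter> Y = {}. l j)
       \<le> (\<Prod>i\<in>Y. u i powr (- \<beta>)) * w powr (- \<beta> * (d - card Y))"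
  using assms(2-)
proof (induction "card Y" arbitrary: Y w)
  case 0
  then have Y: "Y = {}" by simp
  have "w powr (\<Sum>j | j \<in> J. l j) \<le> w powr (- \<beta> * d)"
    using 0(3)[of "{}"] 0 by (intro powr_mono') auto
  then show ?case by (simp add: Y)
next
  case (Suc n)
  have "Y \<noteq> {}" using Suc by auto
  define i0 where "i0 = arg_min_on u Y"
  have i0: "i0 \<in> Y" "\<And>i. i \<in> Y \<Longrightarrow> u i0 \<le> u i"
    using Suc(3) \<open>Y \<noteq> {}\<close> by (auto simp: i0_def arg_min_if_finite arg_min_least)
  define Y' where "Y' = Y - {i0}"
  have Y': "finite Y'" "card Y' = n" "Y' \<subseteq> Y" "card Y = Suc (card Y')" "i0 \<notin> Y'" "Y = insert i0 Y'"
    using Suc i0 by (auto simp: Y'_def)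
  define w1 where "w1 = u i0"
  have w1: "0 < w1" "w \<le> w1" "w1 \<le> 1" using Suc i0 unfolding w1_def by force+
  define \<phi> where "\<phi> Y = (\<Sum>j | j \<in> J \<and> S j \<inter> Y = {}. l j)" for Y
  define M where "M Y = (\<Prod>j | j \<in> J \<and> S j \<inter> Y \<noteq> {}. Max (u ` (S j \<inter> Y)) powr l j)" for Y
  \<comment> \<open>The forms that meet \<open>Y\<close> only in \<open>i0\<close>: their size is
    exactly \<open>w1\<close>, so once \<open>i0\<close> is removed they belong to the
    floor.\<close>
  define N where "N = {j. j \<in> J \<and> S j \<inter> Y' = {} \<and> i0 \<in> S j}"
  have fin: "finite N" using \<open>finite J\<close> by (simp add: N_def)
  have \<phi>: "\<phi> Y' = \<phi> Y + sum l N"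
  proof -
    have "{j. j \<in> J \<and> S j \<inter> Y' = {}} = {j. j \<in> J \<and> S j \<inter> Y = {}} \<union> N"
      using Y'(6) by (auto simp: N_def)
    moreover have "{j. j \<in> J \<and> S j \<inter> Y = {}} \<inter> N = {}" using i0 by (auto simp: N_def)
    ultimately show ?thesis
      using \<open>finite J\<close> fin by (simp add: \<phi>_def sum.union_disjoint)
  qed
  have M: "M Y = M Y' * w1 powr (sum l N)"
  proof -
    have "{j. j \<in> J \<and> S j \<inter> Y \<noteq> {}} = {j. j \<in> J \<and> S j \<inter> Y' \<noteq> {}} \<union> N"
      using Y'(6) by (auto simp: N_def)
    moreover have "{j. j \<in> J \<and> S j \<inter> Y' \<noteq> {}} \<inter> N = {}" by (auto simp: N_def)
    ultimately have "M Y = (\<Prod>j | j \<in> J \<and> S j \<inter> Y' \<noteq> {}. Max (u ` (S j \<inter> Y)) powr l j)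
        * (\<Prod>j\<in>N. Max (u ` (S j \<inter> Y)) powr l j)"
      using \<open>finite J\<close> fin by (simp add: M_def prod.union_disjoint)
    also have "(\<Prod>j\<in>N. Max (u ` (S j \<inter> Y)) powr l j) = (\<Prod>j\<in>N. w1 powr l j)"
    proof (intro prod.cong refl)
      fix j assume "j \<in> N"
      then have "S j \<inter> Y = {i0}" using Y'(6) by (auto simp: N_def)
      then show "Max (u ` (S j \<inter> Y)) powr l j = w1 powr l j" by (simp add: w1_def)
    qed
    also have "\<dots> = w1 powr (sum l N)"
      using w1 by (simp add: powr_sum)
    also have "(\<Prod>j | j \<in> J \<and> S j \<inter> Y' \<noteq> {}. Max (u ` (S j \<inter> Y)) powr l j) = M Y'"
      unfolding M_def
    proof (intro prod.cong refl)
      fix j assume j: "j \<in> {j. j \<in> J \<and> S j \<inter> Y' \<noteq> {}}"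
      have "Max (u ` (S j \<inter> Y)) = Max (u ` (S j \<inter> Y'))"
      proof (cases "i0 \<in> S j")
        case True
        then have "S j \<inter> Y = insert i0 (S j \<inter> Y')" using Y'(6) by auto
        then have "Max (u ` (S j \<inter> Y)) = max (u i0) (Max (u ` (S j \<inter> Y')))"
          using j Y' by (simp)
        moreover have "u i0 \<le> Max (u ` (S j \<inter> Y'))"
        proof -
          obtain i where "i \<in> S j \<inter> Y'" using j by auto
          then show ?thesis using i0(2)[of i] Y' by (intro order_trans[OF i0(2)[of i]] Max_ge) auto
        qed
        ultimately show ?thesis by simp
      next
        case False
        then have "S j \<inter> Y = S j \<inter> Y'" using Y'(6) by auto
        then show ?thesis by simp
      qed
      then show "Max (u ` (S j \<inter> Y)) powr l j = Max (u ` (S j \<inter> Y')) powr l j" by simp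
    qed
    finally show ?thesis .
  qed
  have IH: "M Y' * w1 powr \<phi> Y' \<le> (\<Prod>i\<in>Y'. u i powr (- \<beta>)) * w1 powr (- \<beta> * (d - card Y'))"
    unfolding M_def \<phi>_def
  proof (rule Suc(1))
    show "w1 \<le> u i" "u i \<le> 1" if "i \<in> Y'" for i
      using that i0(2)[of i] Y'(3) Suc(8)[of i] by (auto simp: w1_def)
    show "0 \<le> (\<Sum>j | j \<in> J \<and> S j \<inter> Y'' = {}. l j) + \<beta> * (d - real (card Y''))" if "Y'' \<subseteq> Y'" for Y''
      using Suc(4)[of Y''] that Y'(3) by auto
  qed (use Y' w1 in auto)
  have M0: "M Y' \<ge> 0" by (simp add: M_def prod_nonneg)
  \<comment> \<open>The floor is raised from \<open>w\<close> to \<open>w1\<close>; \<open>C\<close>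
    for \<open>Y\<close> itself makes the exponent nonnegative.\<close>
  have "w powr (\<phi> Y + \<beta> * (d - card Y)) \<le> w1 powr (\<phi> Y + \<beta> * (d - card Y))"
    using Suc(4)[of Y] w1 Suc(5) by (intro powr_mono2) (auto simp: \<phi>_def)
  then have "w powr (\<phi> Y + \<beta> * (d - card Y)) * w powr (- \<beta> * (d - card Y))
     \<le> w1 powr (\<phi> Y + \<beta> * (d - card Y)) * w powr (- \<beta> * (d - card Y))"
    by (intro mult_right_mono) auto
  then have *: "w powr \<phi> Y \<le> w1 powr (\<phi> Y + \<beta> * (d - card Y)) * w powr (- \<beta> * (d - card Y))"
    by (simp flip: powr_add)
  have "M Y * w powr \<phi> Y \<le> M Y * (w1 powr (\<phi> Y + \<beta> * (d - card Y)) * w powr (- \<beta> * (d - card Y)))"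
    by (intro mult_left_mono *) (simp add: M_def prod_nonneg)
  also have "\<dots> = (M Y' * w1 powr \<phi> Y') * w1 powr (\<beta> * (d - card Y)) * w powr (- \<beta> * (d - card Y))"
    by (simp only: M \<phi> powr_add mult_ac)
  also have "\<dots> \<le> ((\<Prod>i\<in>Y'. u i powr (- \<beta>)) * w1 powr (- \<beta> * (d - card Y'))) * w1 powr (\<beta> * (d - card Y)) * w powr (- \<beta> * (d - card Y))"
    by (intro mult_right_mono IH) auto
  also have "\<dots> = (\<Prod>i\<in>Y'. u i powr (- \<beta>)) * (w1 powr (- \<beta> * (d - card Y')) * w1 powr (\<beta> * (d - card Y))) * w powr (- \<beta> * (d - card Y))"
    by (simp add: algebra_simps)
  also have "w1 powr (- \<beta> * (d - card Y')) * w1 powr (\<beta> * (d - card Y)) = u i0 powr (- \<beta>)"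
    using Y'(4) by (simp add: w1_def algebra_simps flip: powr_add)
  also have "(\<Prod>i\<in>Y'. u i powr (- \<beta>)) * u i0 powr (- \<beta>) = (\<Prod>i\<in>Y. u i powr (- \<beta>))"
    using Y' by simp
  finally show ?case by (simp add: M_def \<phi>_def)
qed

text \<open>The base vertex carries weight at least \<open>1 / (CARD('s) + 1)\<close>, so a positive
  value \<open>a\<close> there keeps the form away from 0. If \<open>a = 0\<close>, the form is, up
  to constants and the floor \<open>1 / L\<close>, the largest coordinate on which it depends. This
  turns products of forms into monomials.\<close>

lemma simplex_form_comparable:
  fixes a :: real and b :: "'s::finite \<Rightarrow> real"
  assumes "a \<ge> 0" "\<And>i. b i \<ge> 0" "a > 0 \<or> (\<exists>i. b i > 0)"
  shows "\<exists>R\<ge>1. \<forall>L\<ge>1. \<forall>x. (\<forall>i. 0 \<le> x i) \<and> (\<forall>i. x i + sum x UNIV \<le> 1) \<longrightarrow>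
    (let y = 1 / L + (a * (1 - sum x UNIV) + (\<Sum>i\<in>UNIV. b i * x i));
         M = (if a > 0 then 1 else Max ((\<lambda>i. max (1 / L) (x i)) ` {i. b i > 0}))
     in y \<le> R * M \<and> M \<le> R * y)"
proof -
  \<comment> \<open>The first summands bound the form from above. The last one serves the lower
    bound in the respective case; for \<open>a = 0\<close> the factor \<open>1 / b i\<close>
    recovers \<open>x i\<close> from \<open>b i * x i\<close>.\<close>
  define R where "R = 1 + a + sum b UNIV + (if a > 0 then (real CARD('s) + 1) / a else (\<Sum>i | b i > 0. 1 / b i))"
  have sb: "sum b UNIV \<ge> 0" using assms by (intro sum_nonneg) auto
  have sb': "(\<Sum>i | b i > 0. 1 / b i) \<ge> 0" by (intro sum_nonneg) auto
  have R1: "R \<ge> 1" using assms(1) sb sb' by (auto simp: R_def)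
  show ?thesis
  proof (intro exI[of _ R] conjI R1 allI impI)
    fix L :: real and x :: "'s \<Rightarrow> real"
    assume L: "L \<ge> 1" and x: "(\<forall>i. 0 \<le> x i) \<and> (\<forall>i. x i + sum x UNIV \<le> 1)"
    define s where "s = sum x UNIV"
    define y where "y = 1 / L + (a * (1 - s) + (\<Sum>i\<in>UNIV. b i * x i))"
    have s: "s \<ge> 0" using x by (auto simp: s_def intro!: sum_nonneg)
    have x1: "x i \<le> 1" and s1: "s \<le> 1" for i
      using x[THEN conjunct2, THEN spec, of i] x[THEN conjunct1, THEN spec, of i] s by (auto simp: s_def)
    note s = s s1
    have bx: "(\<Sum>i\<in>UNIV. b i * x i) \<ge> 0" using x assms by (intro sum_nonneg) auto
    have L': "0 < 1 / L" "1 / L \<le> 1" using L by auto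
    define M where "M = (if a > 0 then 1 else Max ((\<lambda>i. max (1 / L) (x i)) ` {i. b i > 0}))"
    have "y \<le> R * M \<and> M \<le> R * y"
    proof (cases "a > 0")
      case True
      \<comment> \<open>Sum \<open>x i \<le> 1 - s\<close> over all \<open>i\<close>.\<close>
      have "(real CARD('s) + 1) * (1 - s) \<ge> 1"
      proof -
        have "(\<Sum>i\<in>UNIV. x i) \<le> (\<Sum>i\<in>(UNIV::'s set). 1 - s)"
          using x by (intro sum_mono) (auto simp: s_def algebra_simps)
        then show ?thesis by (simp add: s_def algebra_simps)
      qed
      then have *: "(real CARD('s) + 1) / a * (a * (1 - s)) \<ge> 1" using True by simp
      have "y \<le> R"
      proof -
        have "(\<Sum>i\<in>UNIV. b i * x i) \<le> sum b UNIV"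
          using assms x1 by (intro sum_mono) (auto intro: mult_left_le)
        moreover have "a * (1 - s) \<le> a" using True s by (auto intro: mult_left_le)
        moreover have "(real CARD('s) + 1) / a \<ge> 0" using True by simp
        ultimately show ?thesis using L' unfolding y_def R_def if_P[OF True] by linarith
      qed
      moreover have "1 \<le> R * y"
      proof -
        have "(real CARD('s) + 1) / a * (a * (1 - s)) \<le> R * y"
          using L' bx sb True assms s by (intro mult_mono) (auto simp: R_def y_def)
        then show ?thesis using * by linarith
      qed
      ultimately show ?thesis using True by (simp add: M_def)
    next
      case False
      then have a: "a = 0" using assms by simp
      then obtain i0 where i0: "b i0 > 0" using assms by auto
      have M_ge: "max (1 / L) (x i) \<le> M" if "b i > 0" for i
        unfolding M_def if_not_P[OF False] using that by (intro Max_ge) auto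
      have MM: "M \<in> (\<lambda>i. max (1 / L) (x i)) ` {i. b i > 0}"
        unfolding M_def using a i0 by (auto intro!: Max_in)
      have M0: "1 / L \<le> M" using M_ge[OF i0] by simp
      then have M1: "M \<ge> 0" using L' by linarith
      have "(\<Sum>i\<in>UNIV. b i * x i) \<le> (\<Sum>i\<in>UNIV. b i * M)"
      proof (intro sum_mono)
        fix i show "b i * x i \<le> b i * M"
          using M_ge[of i] assms(2)[of i] by (cases "b i = 0") (auto intro!: mult_left_mono)
      qed
      also have "\<dots> = sum b UNIV * M" by (simp add: sum_distrib_right)
      finally have "y \<le> (1 + sum b UNIV) * M"
        using M0 by (simp add: y_def a algebra_simps)
      also have "\<dots> \<le> R * M"
        using sb' a M1 by (intro mult_right_mono) (auto simp: R_def)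
      finally have 1: "y \<le> R * M" .
      obtain i where i: "b i > 0" "M = max (1 / L) (x i)" using MM by auto
      have "x i = 1 / b i * (b i * x i)" using i by simp
      also have "\<dots> \<le> (\<Sum>i | b i > 0. 1 / b i) * y"
      proof (intro mult_mono)
        show "1 / b i \<le> (\<Sum>i | b i > 0. 1 / b i)"
          by (rule member_le_sum) (use i in auto)
        have "b i * x i \<le> (\<Sum>i\<in>UNIV. b i * x i)"
          by (rule member_le_sum) (use x assms in auto)
        then show "b i * x i \<le> y" using L' unfolding y_def a by linarith
      qed (use sb' i x in auto)
      finally have xi: "x i \<le> (\<Sum>i | b i > 0. 1 / b i) * y" .
      have "1 / L \<le> y" using bx unfolding y_def a by simp
      then have "M \<le> y + (\<Sum>i | b i > 0. 1 / b i) * y"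
        unfolding i(2) using xi L' mult_nonneg_nonneg[OF sb', of y] by (intro max.boundedI) linarith+
      also have "\<dots> = (1 + (\<Sum>i | b i > 0. 1 / b i)) * y" by (simp add: algebra_simps)
      also have "\<dots> \<le> R * y"
        using sb L' bx a by (intro mult_right_mono) (auto simp: R_def y_def)
      finally show ?thesis using 1 by simp
    qed
    then show "let y = 1 / L + (a * (1 - sum x UNIV) + (\<Sum>i\<in>UNIV. b i * x i));
         M = (if a > 0 then 1 else Max ((\<lambda>i. max (1 / L) (x i)) ` {i. b i > 0}))
     in y \<le> R * M \<and> M \<le> R * y"
      by (simp add: Let_def y_def M_def s_def)
  qed
qed

text \<open>The barycentric coordinate of the base vertex is \<open>1 - sum x UNIV\<close>; it is assumed to be the
  largest one.\<close>

lemma simplex_pointwise_bound: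
  fixes a :: "'j \<Rightarrow> real" and b :: "'j \<Rightarrow> 's::finite \<Rightarrow> real" and l :: "'j \<Rightarrow> real" and c :: "'s \<Rightarrow> real"
    and \<beta> :: real and d :: nat
  assumes "finite J"
    and ab: "\<And>j. j \<in> J \<Longrightarrow> a j \<ge> 0" "\<And>j i. j \<in> J \<Longrightarrow> b j i \<ge> 0" "\<And>j. j \<in> J \<Longrightarrow> a j > 0 \<or> (\<exists>i. b j i > 0)"
    and c: "\<And>i. c i \<ge> 0" and \<beta>: "\<beta> \<le> 1"
    and C: "\<And>Y. Y \<subseteq> {i. c i = 0} \<Longrightarrow> card Y \<le> d \<and>
        0 \<le> (\<Sum>j | j \<in> J \<and> a j = 0 \<and> (\<forall>i\<in>Y. b j i = 0). l j) + \<beta> * (real d - card Y)"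
  shows "\<exists>K g. K > 0 \<and> g > 0 \<and> (\<forall>L\<ge>1. \<forall>x. (\<forall>i. 0 \<le> x i) \<and> (\<forall>i. x i + sum x UNIV \<le> 1) \<longrightarrow>
     exp (- L * (\<Sum>i\<in>UNIV. c i * x i)) *
       (\<Prod>j\<in>J. (1 / L + (a j * (1 - sum x UNIV) + (\<Sum>i\<in>UNIV. b j i * x i))) powr l j)
     \<le> K * (\<Sum>Y | card Y \<le> d. L ^ (d - card Y) *
          (\<Prod>i\<in>UNIV. if i \<in> Y then x i powr (- \<beta>) else exp (- g * L * x i))))"
proof -
  define M where "M L x j = (if a j > 0 then 1 else Max ((\<lambda>i. max (1 / L) (x i)) ` {i. b j i > 0}))"
    for L :: real and x j
  define yy where "yy L x j = 1 / L + (a j * (1 - sum x UNIV) + (\<Sum>i\<in>UNIV. b j i * x i))" for L :: real and x j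
  have "\<forall>j\<in>J. \<exists>R\<ge>1. \<forall>L\<ge>1. \<forall>x. (\<forall>i. 0 \<le> x i) \<and> (\<forall>i. x i + sum x UNIV \<le> 1) \<longrightarrow>
    yy L x j \<le> R * M L x j \<and> M L x j \<le> R * yy L x j"
    using simplex_form_comparable[OF ab] by (simp add: Let_def M_def yy_def)
  then obtain R where R: "\<And>j. j \<in> J \<Longrightarrow> R j \<ge> 1" and RM: "\<And>j L x. j \<in> J \<Longrightarrow> L \<ge> 1 \<Longrightarrow>
      (\<forall>i. 0 \<le> x i) \<and> (\<forall>i. x i + sum x UNIV \<le> 1) \<Longrightarrow> yy L x j \<le> R j * M L x j \<and> M L x j \<le> R j * yy L x j"
    by metis
  define K1 where "K1 = (\<Prod>j\<in>J. R j powr \<bar>l j\<bar>)"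
  have K1: "K1 > 0" unfolding K1_def by (intro prod_pos) (use R in fastforce)
  define p where "p = (\<Sum>j\<in>J. \<bar>l j\<bar>)"
  \<comment> \<open>Smallest positive decay rate; the inserted 1 keeps the minimum defined when all
    rates are 0.\<close>
  define cm where "cm = Min (insert 1 (c ` {i. c i > 0}))"
  have cm: "cm > 0" "cm \<le> 1" "\<And>i. c i > 0 \<Longrightarrow> cm \<le> c i"
    by (auto simp: cm_def)
  obtain K2 where K2: "K2 > 0" "\<And>x. x \<ge> 1 \<Longrightarrow> x powr p * exp (- cm * x) \<le> K2 * exp (- (cm / 2) * x)"
    using powr_times_exp_bound[OF cm(1), of p] by blast
  define g where "g = cm / 2 / real CARD('s)"
  have g: "g > 0" using cm by (simp add: g_def)
  define K where "K = K1 * (exp 1 * K2)"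
  show ?thesis
  proof (rule exI[of _ K], rule exI[of _ g], intro conjI allI impI)
    show "K > 0" using K1 K2 by (simp add: K_def)
    show "g > 0" by fact
    fix L :: real and x :: "'s \<Rightarrow> real"
    assume L: "L \<ge> 1" and x: "(\<forall>i. 0 \<le> x i) \<and> (\<forall>i. x i + sum x UNIV \<le> 1)"
    have L': "0 < 1 / L" "1 / L \<le> 1" using L by auto
    have "sum x UNIV \<ge> 0" using x by (intro sum_nonneg) auto
    then have x1: "x i \<le> 1" for i using x by (smt (verit, best))
    define u where "u i = max (1 / L) (x i)" for i
    have u: "1 / L \<le> u i" "u i \<le> 1" "0 < u i" for i using L' x1 by (auto simp: u_def less_max_iff_disj)
    define X where "X = {i. c i > 0}"
    \<comment> \<open>Size of the largest coordinate in a direction of exponential decay, but at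
      least the floor. Only coordinates exceeding \<open>z\<close> are counted precisely; the others
      are treated as if they sat at the floor.\<close>
    define z where "z = Max (insert (1 / L) (u ` X))"
    have z: "1 / L \<le> z" "\<And>i. i \<in> X \<Longrightarrow> u i \<le> z" by (auto simp: z_def)
    have z0: "z > 0" using z L' by linarith
    have Lz: "L * z \<ge> 1" using z(1) L by (simp add: field_simps)
    define Y where "Y = {i. u i > z}"
    have Y0: "Y \<subseteq> {i. c i = 0}"
    proof
      fix i assume "i \<in> Y"
      then have "i \<notin> X" using z(2)[of i] by (auto simp: Y_def)
      then show "i \<in> {i. c i = 0}" using c[of i] by (auto simp: X_def)
    qed
    define J1 where "J1 = {j\<in>J. a j = 0}"
    define S where "S j = {i. b j i > 0}" for j
    have finJ1: "finite J1" using \<open>finite J\<close> by (simp add: J1_def)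
    have set_eq: "{j. j \<in> J1 \<and> S j \<inter> Y' = {}} = {j. j \<in> J \<and> a j = 0 \<and> (\<forall>i\<in>Y'. b j i = 0)}" for Y'
    proof -
      have "b j i = 0 \<longleftrightarrow> i \<notin> S j" if "j \<in> J" for j i
        using ab(2)[OF that, of i] by (auto simp: S_def)
      then show ?thesis by (auto simp: J1_def)
    qed
    define \<phi> where "\<phi> = (\<Sum>j | j \<in> J1 \<and> S j \<inter> Y = {}. l j)"
    have chain: "(\<Prod>j | j \<in> J1 \<and> S j \<inter> Y \<noteq> {}. Max (u ` (S j \<inter> Y)) powr l j) * (1 / L) powr \<phi>
       \<le> (\<Prod>i\<in>Y. u i powr (- \<beta>)) * (1 / L) powr (- \<beta> * (real d - card Y))"
      unfolding \<phi>_def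
    proof (rule chain_monomial_bound)
      fix Y' assume "Y' \<subseteq> Y"
      then have "Y' \<subseteq> {i. c i = 0}" using Y0 by auto
      then show "0 \<le> (\<Sum>j | j \<in> J1 \<and> S j \<inter> Y' = {}. l j) + \<beta> * (real d - card Y')"
        using C[of Y'] by (simp add: set_eq)
    qed (use finJ1 L' u in auto)
    have Mpos: "M L x j > 0" if "j \<in> J" for j
    proof -
      have "yy L x j > 0"
        using L' ab that x \<open>sum x UNIV \<ge> 0\<close>
        unfolding yy_def by (intro add_pos_nonneg add_nonneg_nonneg mult_nonneg_nonneg sum_nonneg) (auto, smt (verit, best))
      moreover have "yy L x j \<le> R j * M L x j" using RM[OF that L x] by auto
      ultimately have "R j * M L x j > 0" by linarith
      then show ?thesis using R[OF that] by (simp add: zero_less_mult_iff)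
    qed
    have ypos: "yy L x j > 0" if "j \<in> J" for j
      using L' ab that x \<open>sum x UNIV \<ge> 0\<close>
      unfolding yy_def by (intro add_pos_nonneg add_nonneg_nonneg mult_nonneg_nonneg sum_nonneg) (auto, smt (verit, best))
    \<comment> \<open>A form missing \<open>Y\<close> lies between \<open>1 / L\<close> and
      \<open>z\<close>, so replacing it by \<open>1 / L\<close> costs at most
      \<open>(L * z) powr \<bar>l j\<bar>\<close>. The decay in \<open>L * z\<close> pays for
      this.\<close>
    have Mle: "(\<Prod>j\<in>J. M L x j powr l j)
        \<le> (L * z) powr p * ((\<Prod>j | j \<in> J1 \<and> S j \<inter> Y \<noteq> {}. Max (u ` (S j \<inter> Y)) powr l j) * (1 / L) powr \<phi>)"
    proof -
      define Q where "Q j = (if a j > 0 then 1 else if S j \<inter> Y \<noteq> {} then Max (u ` (S j \<inter> Y)) powr l j else (1 / L) powr l j)" for j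
      have "(\<Prod>j\<in>J. M L x j powr l j) \<le> (\<Prod>j\<in>J. (L * z) powr \<bar>l j\<bar> * Q j)"
      proof (intro prod_mono conjI)
        fix j assume j: "j \<in> J"
        have pw: "(L * z) powr \<bar>l j\<bar> \<ge> 1" using Lz by (simp add: ge_one_powr_ge_zero)
        show "M L x j powr l j \<le> (L * z) powr \<bar>l j\<bar> * Q j"
        proof (cases "a j > 0")
          case True
          then show ?thesis using pw by (simp add: M_def Q_def)
        next
          case False
          then have M: "M L x j = Max (u ` S j)" by (simp add: M_def u_def[abs_def] S_def)
          have aj: "a j = 0" using False ab(1)[OF j] by simp
          have ne: "S j \<noteq> {}" using ab(3)[OF j] aj by (auto simp: S_def)
          show ?thesis
          proof (cases "S j \<inter> Y = {}")
            case True
            have "M L x j \<le> z" unfolding M using ne True by (auto simp: Y_def not_less disjoint_iff)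
            moreover have "1 / L \<le> M L x j"
            proof -
              obtain i where "i \<in> S j" using ne by auto
              then show ?thesis unfolding M using u(1)[of i] by (intro order_trans[OF u(1)[of i]] Max_ge) auto
            qed
            ultimately have "M L x j powr l j \<le> (L * z) powr \<bar>l j\<bar> * (1 / L) powr l j"
              using L Mpos[OF j] Lz by (intro powr_comparable) (auto simp: field_simps intro: order_trans[of _ "M L x j * L"])
            then show ?thesis using True False by (simp add: Q_def)
          next
            case False2: False
            have "Max (u ` S j) = Max (u ` (S j \<inter> Y))"
            proof (rule Max_eqI)
              fix w assume "w \<in> u ` S j"
              then obtain i where i: "i \<in> S j" "w = u i" by auto
              obtain i' where i': "i' \<in> S j \<inter> Y" using False2 by auto
              have m: "u i'' \<le> Max (u ` (S j \<inter> Y))" if "i'' \<in> S j \<inter> Y" for i''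
                using that by (intro Max_ge) auto
              show "w \<le> Max (u ` (S j \<inter> Y))"
              proof (cases "i \<in> Y")
                case True then show ?thesis using i m by auto
              next
                case False
                then have "u i \<le> u i'" using i' by (auto simp: Y_def)
                then show ?thesis using i m[OF i'] by linarith
              qed
            next
              have "Max (u ` (S j \<inter> Y)) \<in> u ` (S j \<inter> Y)" using False2 by (intro Max_in) auto
              then show "Max (u ` (S j \<inter> Y)) \<in> u ` S j" by auto
            qed auto
            then have "M L x j powr l j = Q j" using False False2 M by (simp add: Q_def)
            moreover have "Q j \<ge> 0" by (simp add: Q_def)
            ultimately show ?thesis using mult_right_mono[OF pw, of "Q j"] by simp
          qed
        qed
      qed auto
      also have "\<dots> = (L * z) powr p * (\<Prod>j\<in>J. Q j)"
        using z0 L by (simp add: prod.distrib p_def powr_sum)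
      also have "(\<Prod>j\<in>J. Q j) = (\<Prod>j\<in>J1. Q j)"
        using ab(1) by (intro prod.mono_neutral_right \<open>finite J\<close>) (force simp: J1_def Q_def)+
      also have "\<dots> = (\<Prod>j\<in>J1. if S j \<inter> Y \<noteq> {} then Max (u ` (S j \<inter> Y)) powr l j else (1 / L) powr l j)"
        by (intro prod.cong) (auto simp: J1_def Q_def)
      also have "\<dots> = (\<Prod>j\<in>J1 \<inter> {j. S j \<inter> Y \<noteq> {}}. Max (u ` (S j \<inter> Y)) powr l j)
          * (\<Prod>j\<in>J1 \<inter> - {j. S j \<inter> Y \<noteq> {}}. (1 / L) powr l j)"
        by (rule prod.If_cases[OF finJ1])
      also have "(\<Prod>j\<in>J1 \<inter> - {j. S j \<inter> Y \<noteq> {}}. (1 / L) powr l j) = (1 / L) powr \<phi>"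
        using L' by (simp add: \<phi>_def powr_sum Int_def)
      finally show ?thesis by (simp add: Int_def)
    qed
    have "(\<Prod>j\<in>J. yy L x j powr l j) \<le> (\<Prod>j\<in>J. R j powr \<bar>l j\<bar> * M L x j powr l j)"
      using RM[OF _ L x] Mpos ypos by (intro prod_mono conjI powr_comparable) auto
    also have "\<dots> = K1 * (\<Prod>j\<in>J. M L x j powr l j)" by (simp add: prod.distrib K1_def)
    also have "\<dots> \<le> K1 * ((L * z) powr p * ((\<Prod>i\<in>Y. u i powr (- \<beta>)) * (1 / L) powr (- \<beta> * (real d - card Y))))"
      using K1 by (intro mult_left_mono order_trans[OF Mle] mult_left_mono chain) auto
    finally have prod_le: "(\<Prod>j\<in>J. yy L x j powr l j)
       \<le> K1 * (L * z) powr p * (\<Prod>i\<in>Y. u i powr (- \<beta>)) * (1 / L) powr (- \<beta> * (real d - card Y))"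
      by (simp add: mult.assoc)
    have dY: "card Y \<le> d" using C[OF Y0] by simp
    \<comment> \<open>Uses \<beta> \<le> 1 and \<open>card Y \<le> d\<close>. The weaker power makes
      every \<open>Y\<close> contribute the same order in \<open>L\<close> after
      integration.\<close>
    have Lpow: "(1 / L) powr (- \<beta> * (real d - card Y)) \<le> L ^ (d - card Y)"
    proof -
      have "(1 / L) powr (- \<beta> * (real d - card Y)) = L powr (\<beta> * (real d - card Y))"
      proof -
        have "1 / L = L powr (-1)" using L by (simp add: powr_minus divide_inverse)
        then show ?thesis by (simp only: powr_powr) simp
      qed
      also have "\<dots> \<le> L powr (1 * (real d - card Y))"
        using L dY \<beta> by (intro powr_mono mult_right_mono) auto
      also have "\<dots> = L ^ (d - card Y)" using L dY by (simp add: powr_realpow flip: of_nat_diff)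
      finally show ?thesis .
    qed
    have uY: "(\<Prod>i\<in>Y. u i powr (- \<beta>)) = (\<Prod>i\<in>Y. x i powr (- \<beta>))"
    proof (intro prod.cong refl)
      fix i assume "i \<in> Y"
      then have "u i > 1 / L" using z(1) by (simp add: Y_def)
      then have "u i = x i" by (simp add: u_def max_def split: if_splits)
      then show "u i powr (- \<beta>) = x i powr (- \<beta>)" by simp
    qed
    \<comment> \<open>The factor \<open>exp 1\<close> compensates for the floor \<open>1 / L\<close>
      that is contained in \<open>z\<close>.\<close>
    have exp_le: "exp (- L * (\<Sum>i\<in>UNIV. c i * x i)) \<le> exp 1 * exp (- cm * (L * z))"
    proof -
      have "z \<le> 1 / L \<or> (\<exists>i\<in>X. z = u i)"
      proof -
        have "z \<in> insert (1 / L) (u ` X)" unfolding z_def by (rule Max_in) auto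
        then show ?thesis by auto
      qed
      then have "cm * z \<le> 1 / L + (\<Sum>i\<in>UNIV. c i * x i)"
      proof
        assume "z \<le> 1 / L"
        moreover have "cm * z \<le> z" using cm z0 by simp
        moreover have "(\<Sum>i\<in>UNIV. c i * x i) \<ge> 0" using c x by (intro sum_nonneg) auto
        ultimately show ?thesis by linarith
      next
        assume "\<exists>i\<in>X. z = u i"
        then obtain i where i: "i \<in> X" "z = u i" by auto
        have "z \<le> 1 / L + x i" using i L' x by (auto simp: u_def)
        then have "cm * z \<le> cm * (1 / L + x i)" using cm by (intro mult_left_mono) auto
        also have "\<dots> \<le> 1 / L + c i * x i"
        proof -
          have "cm * (1 / L) \<le> 1 * (1 / L)" using cm L' by (intro mult_right_mono) auto
          moreover have "cm * x i \<le> c i * x i" using cm i x by (intro mult_right_mono) (auto simp: X_def)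
          ultimately show ?thesis by (simp add: distrib_left)
        qed
        also have "c i * x i \<le> (\<Sum>i\<in>UNIV. c i * x i)"
          by (rule member_le_sum) (use c x in auto)
        finally show ?thesis by simp
      qed
      then have "L * (cm * z) \<le> L * (1 / L + (\<Sum>i\<in>UNIV. c i * x i))" using L by (intro mult_left_mono) auto
      then have "- L * (\<Sum>i\<in>UNIV. c i * x i) \<le> 1 + - cm * (L * z)" using L by (simp add: algebra_simps)
      then show ?thesis by (simp flip: exp_add)
    qed
    \<comment> \<open>Coordinates outside \<open>Y\<close> are at most \<open>z\<close>, so the
      remaining decay in \<open>z\<close> is shared among them; hence the division by
      \<open>CARD('s)\<close> in \<open>g\<close>.\<close>
    have exp2: "exp (- (cm / 2) * (L * z)) \<le> (\<Prod>i\<in>-Y. exp (- g * L * x i))"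
    proof -
      have "(\<Sum>i\<in>-Y. x i) \<le> (\<Sum>i\<in>-Y. z)"
        by (intro sum_mono) (auto simp: Y_def u_def)
      also have "\<dots> \<le> real CARD('s) * z" using z0 by (auto intro!: mult_right_mono card_mono)
      finally have "g * L * (\<Sum>i\<in>-Y. x i) \<le> g * L * (real CARD('s) * z)"
        using g L by (intro mult_left_mono) auto
      also have "\<dots> = cm / 2 * (L * z)" by (simp add: g_def)
      finally show ?thesis
        by (simp add: sum_distrib_left sum_negf flip: exp_sum)
    qed
    have "exp (- L * (\<Sum>i\<in>UNIV. c i * x i)) * (\<Prod>j\<in>J. yy L x j powr l j)
       \<le> (exp 1 * exp (- cm * (L * z))) * (K1 * (L * z) powr p * (\<Prod>i\<in>Y. u i powr (- \<beta>)) * (1 / L) powr (- \<beta> * (real d - card Y)))"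
      by (intro mult_mono exp_le prod_le prod_nonneg) auto
    also have "\<dots> = K1 * exp 1 * (\<Prod>i\<in>Y. x i powr (- \<beta>)) * (1 / L) powr (- \<beta> * (real d - card Y)) * ((L * z) powr p * exp (- cm * (L * z)))"
      by (simp add: uY)
    also have "\<dots> \<le> K1 * exp 1 * (\<Prod>i\<in>Y. x i powr (- \<beta>)) * L ^ (d - card Y) * (K2 * (\<Prod>i\<in>-Y. exp (- g * L * x i)))"
    proof -
      have "(L * z) powr p * exp (- cm * (L * z)) \<le> K2 * (\<Prod>i\<in>-Y. exp (- g * L * x i))"
        using K2 by (intro order_trans[OF K2(2)[OF Lz]] mult_left_mono exp2) auto
      then show ?thesis
        using K1 K2 L by (intro mult_mono[OF mult_left_mono[OF Lpow]])
          (auto intro!: prod_nonneg mult_nonneg_nonneg)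
    qed
    also have "\<dots> = K * (L ^ (d - card Y) * ((\<Prod>i\<in>Y. x i powr (- \<beta>)) * (\<Prod>i\<in>-Y. exp (- g * L * x i))))"
      by (simp add: K_def mult_ac)
    also have "(\<Prod>i\<in>Y. x i powr (- \<beta>)) * (\<Prod>i\<in>-Y. exp (- g * L * x i))
       = (\<Prod>i\<in>UNIV. if i \<in> Y then x i powr (- \<beta>) else exp (- g * L * x i))"
      by (subst prod.If_cases) auto
    \<comment> \<open>\<open>Y\<close> depends on \<open>x\<close> and \<open>L\<close>; the sum
      over all admissible sets is a bound of one fixed shape, integrable term by term.\<close>
    also have "L ^ (d - card Y) * \<dots> \<le> (\<Sum>Y | card Y \<le> d. L ^ (d - card Y) *
          (\<Prod>i\<in>UNIV. if i \<in> Y then x i powr (- \<beta>) else exp (- g * L * x i)))"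
    proof (rule member_le_sum)
      fix Y' assume "Y' \<in> {Y. card Y \<le> d} - {Y}"
      have "0 \<le> (\<Prod>i\<in>UNIV. if i \<in> Y' then x i powr (- \<beta>) else exp (- g * L * x i))"
        by (intro prod_nonneg) simp
      then show "0 \<le> L ^ (d - card Y') * (\<Prod>i\<in>UNIV. if i \<in> Y' then x i powr (- \<beta>) else exp (- g * L * x i))"
        using L by (intro mult_nonneg_nonneg) auto
    qed (use dY in auto)
    finally show "exp (- L * (\<Sum>i\<in>UNIV. c i * x i)) *
       (\<Prod>j\<in>J. (1 / L + (a j * (1 - sum x UNIV) + (\<Sum>i\<in>UNIV. b j i * x i))) powr l j)
     \<le> K * (\<Sum>Y | card Y \<le> d. L ^ (d - card Y) *
          (\<Prod>i\<in>UNIV. if i \<in> Y then x i powr (- \<beta>) else exp (- g * L * x i)))"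
      using K1 K2 by (simp add: K_def yy_def)
  qed
qed

section \<open>Explicit integrals over simplices and a covering by simplices\<close>

lemma nn_integral_vec_prod:
  fixes f :: "'s::finite \<Rightarrow> real \<Rightarrow> real"
  assumes [measurable]: "\<And>i. f i \<in> borel_measurable borel" and nn: "\<And>i x. 0 \<le> f i x"
  shows "(\<integral>\<^sup>+x. ennreal (\<Prod>i\<in>UNIV. f i (x $ i)) \<partial>lborel) = (\<Prod>i\<in>UNIV. (\<integral>\<^sup>+x. ennreal (f i x) \<partial>lborel))"
proof -
  have Basis: "(Basis :: (real^'s) set) = range (\<lambda>i. axis i 1)"
    by (auto simp: Basis_vec_def)
  have inj: "inj (\<lambda>i. axis i 1 :: real^'s)"
    by (auto simp: inj_on_def axis_eq_axis)
  define h where "h b x = ennreal (f (inv (\<lambda>i. axis i 1 :: real^'s) b) x)" for b x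
  have h: "h (axis i 1) = (\<lambda>x. ennreal (f i x))" for i
    unfolding h_def using inv_f_f[OF inj, of i] by simp
  have [measurable]: "h b \<in> borel_measurable borel" for b
    unfolding h_def by measurable
  have "(\<integral>\<^sup>+x. ennreal (\<Prod>i\<in>UNIV. f i (x $ i)) \<partial>lborel) = (\<integral>\<^sup>+x. (\<Prod>b\<in>Basis. h b (x \<bullet> b)) \<partial>lborel)"
    unfolding Basis by (subst prod.reindex[OF inj]) (simp add: h o_def inner_axis prod_ennreal nn)
  also have "\<dots> = (\<Prod>b\<in>Basis. (\<integral>\<^sup>+x. h b x \<partial>lborel))"
    by (rule nn_integral_lborel_prod) auto
  also have "\<dots> = (\<Prod>i\<in>UNIV. (\<integral>\<^sup>+x. ennreal (f i x) \<partial>lborel))"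
    unfolding Basis by (subst prod.reindex[OF inj]) (simp add: h o_def)
  finally show ?thesis .
qed

lemma nn_integral_powr_01:
  fixes \<beta> :: real
  assumes "\<beta> < 1"
  shows "(\<integral>\<^sup>+x. ennreal (indicator {0..1} x * x powr (- \<beta>)) \<partial>lborel) = ennreal (1 / (1 - \<beta>))"
proof -
  have "((\<lambda>x::real. x powr (- \<beta>)) has_integral (1 powr (- \<beta> + 1) / (- \<beta> + 1))) {0..1}"
    using assms by (intro has_integral_powr_from_0) auto
  from nn_integral_has_integral_lebesgue[OF _ this] show ?thesis
    by (simp add: add.commute)
qed

lemma nn_integral_exp_0_infinity:
  fixes g :: real
  assumes "g > 0"
  shows "(\<integral>\<^sup>+x. ennreal (indicator {0..} x * exp (- g * x)) \<partial>lborel) = ennreal (1 / g)"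
proof -
  have "((\<lambda>x::real. exp (- g * x)) has_integral (exp (- g * 0) / g)) {0..}"
    by (rule has_integral_exp_minus_to_infinity[OF assms])
  from nn_integral_has_integral_lebesgue[OF _ this] show ?thesis
    by simp
qed

text \<open>Barycentric coordinates in which the base vertex, of weight
  \<open>1 - (\<Sum>i\<in>UNIV. x $ i)\<close>, is the heaviest. A point of a simplex has such
  coordinates after a suitable choice of the base, and then the base weight is bounded
  below.\<close>

definition dominant_simplex :: "(real ^ 's) set" where
  "dominant_simplex = {x. (\<forall>i. 0 \<le> x $ i) \<and> (\<forall>i. x $ i + (\<Sum>i\<in>UNIV. x $ i) \<le> 1)}"

lemma dominant_simplex_le_1:
  assumes "x \<in> dominant_simplex"
  shows "x $ i \<le> 1"
proof -
  have "(\<Sum>i\<in>UNIV. x $ i) \<ge> 0" using assms by (intro sum_nonneg) (auto simp: dominant_simplex_def)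
  moreover have "x $ i + (\<Sum>i\<in>UNIV. x $ i) \<le> 1" using assms by (auto simp: dominant_simplex_def)
  ultimately show ?thesis by linarith
qed

lemma compact_dominant_simplex: "compact (dominant_simplex :: (real ^ 's) set)"
proof -
  have "closed (dominant_simplex :: (real ^ 's) set)"
    unfolding dominant_simplex_def
    by (intro closed_Collect_conj closed_Collect_all closed_Collect_le continuous_intros)
  moreover have "dominant_simplex \<subseteq> cbox 0 (\<chi> i. 1)"
    using dominant_simplex_le_1 by (auto simp: mem_box_cart) (auto simp: dominant_simplex_def)
  then have "bounded (dominant_simplex :: (real ^ 's) set)"
    using bounded_cbox bounded_subset by blast
  ultimately show ?thesis by (simp add: compact_eq_bounded_closed)
qed

text \<open>Coordinates in \<open>Y\<close> integrate to at most \<open>1 / (1 - \<beta>)\<close>,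
  the others to at most \<open>1 / (g * L)\<close>. With the prefactor, every \<open>Y\<close>
  yields the same power, since
  \<open>(d - card Y) - (CARD('s) - card Y) = d - CARD('s)\<close>.\<close>

lemma dominant_simplex_integral_bound:
  fixes \<beta> g :: real and d :: nat
  assumes "\<beta> < 1" "g > 0" "d \<le> CARD('s)"
  shows "\<exists>K\<ge>0. \<forall>L\<ge>1. (\<integral>\<^sup>+x. ennreal (indicator (dominant_simplex :: (real ^ 's) set) x *
      (\<Sum>Y | card Y \<le> d. L ^ (d - card Y) *
          (\<Prod>i\<in>UNIV. if i \<in> Y then (x $ i) powr (- \<beta>) else exp (- g * L * x $ i)))) \<partial>lborel)
    \<le> ennreal (K * L powr (real d - CARD('s)))"
proof -
  define K where "K = (\<Sum>Y::'s set | card Y \<le> d. (1 / (1 - \<beta>)) ^ card Y * (1 / g) ^ (CARD('s) - card Y))"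
  have K: "K \<ge> 0" unfolding K_def using assms by (intro sum_nonneg mult_nonneg_nonneg) auto
  show ?thesis
  proof (intro exI[of _ K] conjI K allI impI)
    fix L :: real assume L: "L \<ge> 1"
    define f where "f Y i x = (if i \<in> Y then indicator {0..1} x * x powr (- \<beta>)
      else indicator {0..} x * exp (- (g * L) * x))" for Y :: "'s set" and i and x :: real
    have [measurable]: "f Y i \<in> borel_measurable borel" for Y i
      unfolding f_def by measurable
    have f0: "f Y i x \<ge> 0" for Y i x by (auto simp: f_def)
    have "(\<integral>\<^sup>+x. ennreal (indicator (dominant_simplex :: (real ^ 's) set) x *
      (\<Sum>Y | card Y \<le> d. L ^ (d - card Y) *
          (\<Prod>i\<in>UNIV. if i \<in> Y then (x $ i) powr (- \<beta>) else exp (- g * L * x $ i)))) \<partial>lborel)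
      \<le> (\<integral>\<^sup>+x. (\<Sum>Y | card Y \<le> d. ennreal (L ^ (d - card Y)) * ennreal (\<Prod>i\<in>UNIV. f Y i (x $ i))) \<partial>lborel)"
    proof (intro nn_integral_mono)
      fix x :: "real^'s"
      show "ennreal (indicator (dominant_simplex :: (real ^ 's) set) x * (\<Sum>Y | card Y \<le> d. L ^ (d - card Y) *
          (\<Prod>i\<in>UNIV. if i \<in> Y then (x $ i) powr (- \<beta>) else exp (- g * L * x $ i))))
        \<le> (\<Sum>Y | card Y \<le> d. ennreal (L ^ (d - card Y)) * ennreal (\<Prod>i\<in>UNIV. f Y i (x $ i)))"
      proof (cases "x \<in> dominant_simplex")
        case True
        then have "\<And>i. 0 \<le> x $ i" "\<And>i. x $ i \<le> 1"
          using dominant_simplex_le_1 by (auto simp: dominant_simplex_def)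
        then have "(if i \<in> Y then (x $ i) powr (- \<beta>) else exp (- g * L * x $ i)) = f Y i (x $ i)" for Y i
          by (simp add: f_def)
        moreover have "(\<Sum>Y | card Y \<le> d. ennreal (L ^ (d - card Y)) * ennreal (\<Prod>i\<in>UNIV. f Y i (x $ i)))
          = ennreal (\<Sum>Y | card Y \<le> d. L ^ (d - card Y) * (\<Prod>i\<in>UNIV. f Y i (x $ i)))"
          using L f0 by (subst sum_ennreal[symmetric]) (auto simp: ennreal_mult prod_nonneg)
        ultimately show ?thesis using True by simp
      qed simp
    qed
    also have "\<dots> = (\<Sum>Y | card Y \<le> d. ennreal (L ^ (d - card Y)) * (\<integral>\<^sup>+x. ennreal (\<Prod>i\<in>UNIV. f Y i (x $ i)) \<partial>lborel))"
      by (subst nn_integral_sum) (auto intro!: sum.cong nn_integral_cmult)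
    also have "\<dots> = (\<Sum>Y::'s set | card Y \<le> d. ennreal (L ^ (d - card Y) * ((1 / (1 - \<beta>)) ^ card Y * (1 / (g * L)) ^ (CARD('s) - card Y))))"
    proof (intro sum.cong refl)
      fix Y :: "'s set"
      have "(\<integral>\<^sup>+x. ennreal (\<Prod>i\<in>UNIV. f Y i (x $ i)) \<partial>lborel) = (\<Prod>i\<in>UNIV. (\<integral>\<^sup>+x. ennreal (f Y i x) \<partial>lborel))"
        by (rule nn_integral_vec_prod) (use f0 in auto)
      also have "\<dots> = (\<Prod>i\<in>UNIV. if i \<in> Y then ennreal (1 / (1 - \<beta>)) else ennreal (1 / (g * L)))"
      proof (intro prod.cong refl)
        fix i
        have "g * L > 0" using assms L by simp
        then show "(\<integral>\<^sup>+x. ennreal (f Y i x) \<partial>lborel) = (if i \<in> Y then ennreal (1 / (1 - \<beta>)) else ennreal (1 / (g * L)))"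
          unfolding f_def using nn_integral_powr_01[OF assms(1)] nn_integral_exp_0_infinity[of "g * L"] by simp
      qed
      also have "\<dots> = ennreal ((1 / (1 - \<beta>)) ^ card Y * (1 / (g * L)) ^ (CARD('s) - card Y))"
        using assms L by (subst prod.If_cases) (auto simp: ennreal_power ennreal_mult card_Diff_subset Compl_eq_Diff_UNIV)
      finally show "ennreal (L ^ (d - card Y)) * (\<integral>\<^sup>+x. ennreal (\<Prod>i\<in>UNIV. f Y i (x $ i)) \<partial>lborel)
        = ennreal (L ^ (d - card Y) * ((1 / (1 - \<beta>)) ^ card Y * (1 / (g * L)) ^ (CARD('s) - card Y)))"
        using L by (simp add: ennreal_mult'[symmetric])
    qed
    also have "\<dots> = ennreal (\<Sum>Y::'s set | card Y \<le> d. L ^ (d - card Y) * ((1 / (1 - \<beta>)) ^ card Y * (1 / (g * L)) ^ (CARD('s) - card Y)))"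
      using assms L by (intro sum_ennreal) auto
    also have "(\<Sum>Y::'s set | card Y \<le> d. L ^ (d - card Y) * ((1 / (1 - \<beta>)) ^ card Y * (1 / (g * L)) ^ (CARD('s) - card Y)))
       = K * L powr (real d - CARD('s))"
      unfolding K_def sum_distrib_right
    proof (intro sum.cong refl)
      fix Y :: "'s set" assume "Y \<in> {Y. card Y \<le> d}"
      then have Y: "card Y \<le> d" "card Y \<le> CARD('s)" by (auto intro: card_mono)
      have "L ^ (d - card Y) = L powr (real d - card Y)" using L Y by (simp add: powr_realpow flip: of_nat_diff)
      moreover have "(1 / (g * L)) ^ (CARD('s) - card Y) = (1 / g) ^ (CARD('s) - card Y) * L powr (- (real CARD('s) - card Y))"
        using L Y by (simp add: power_divide power_mult_distrib powr_minus_divide powr_realpow flip: of_nat_diff)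
      moreover have "L powr (real d - card Y) * L powr (- (real CARD('s) - card Y)) = L powr (real d - CARD('s))"
        by (simp flip: powr_add)
      ultimately show "L ^ (d - card Y) * ((1 / (1 - \<beta>)) ^ card Y * (1 / (g * L)) ^ (CARD('s) - card Y))
         = (1 / (1 - \<beta>)) ^ card Y * (1 / g) ^ (CARD('s) - card Y) * L powr (real d - CARD('s))"
        by (simp add: mult_ac)
    qed
    finally show "(\<integral>\<^sup>+x. ennreal (indicator (dominant_simplex :: (real ^ 's) set) x *
      (\<Sum>Y | card Y \<le> d. L ^ (d - card Y) *
          (\<Prod>i\<in>UNIV. if i \<in> Y then (x $ i) powr (- \<beta>) else exp (- g * L * x $ i)))) \<partial>lborel)
    \<le> ennreal (K * L powr (real d - CARD('s)))" .
  qed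
qed

text \<open>Caratheodory leaves at most \<open>CARD('s) + 1\<close> vertices, and the one with the
  largest weight is taken as base.\<close>

lemma convex_hull_dominant_simplex_cover:
  fixes V :: "(real ^ 's) set"
  assumes "finite V" "t \<in> convex hull V"
  obtains v0 v x where "v0 \<in> V" "\<And>i. v i \<in> V" "x \<in> (dominant_simplex :: (real ^ 's) set)"
    "t = v0 + (\<Sum>i\<in>UNIV. x $ i *\<^sub>R (v i - v0))"
proof -
  obtain S where S: "finite S" "S \<subseteq> V" "card S \<le> CARD('s) + 1" "t \<in> convex hull S"
    using assms(2) unfolding caratheodory[of V] by auto
  obtain u where u: "\<And>v. v \<in> S \<Longrightarrow> 0 \<le> u v" "sum u S = 1" "(\<Sum>v\<in>S. u v *\<^sub>R v) = t"
    using S(4) unfolding convex_hull_finite[OF S(1)] by auto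
  have "S \<noteq> {}" using u(2) by auto
  have "\<exists>v0\<in>S. \<forall>v\<in>S. u v \<le> u v0"
  proof -
    have "Max (u ` S) \<in> u ` S" using S \<open>S \<noteq> {}\<close> by (intro Max_in) auto
    then show ?thesis using S by (metis (no_types, lifting) Max_ge finite_imageI imageE imageI)
  qed
  then obtain v0 where v0: "v0 \<in> S" "\<And>v. v \<in> S \<Longrightarrow> u v \<le> u v0" by auto
  define S' where "S' = S - {v0}"
  have S': "finite S'" "card S' \<le> CARD('s)" "S = insert v0 S'" "v0 \<notin> S'"
    using S v0 by (auto simp: S'_def)
  obtain f :: "real^'s \<Rightarrow> 's" where f: "inj_on f S'"
    using card_le_inj[of S' "UNIV :: 's set"] S' by auto
  \<comment> \<open>Missing vertices are padded with copies of \<open>v0\<close> of weight 0. The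
    degenerate simplices that arise are null sets in the integral estimate.\<close>
  define v where "v i = (if i \<in> f ` S' then inv_into S' f i else v0)" for i
  define x :: "real^'s" where "x = (\<chi> i. if i \<in> f ` S' then u (inv_into S' f i) else 0)"
  have sum_f: "(\<Sum>i\<in>UNIV. if i \<in> f ` S' then h (inv_into S' f i) else 0) = (\<Sum>w\<in>S'. h w)"
    for h :: "real^'s \<Rightarrow> 'z::comm_monoid_add"
  proof -
    have "(\<Sum>i\<in>UNIV. if i \<in> f ` S' then h (inv_into S' f i) else 0) = (\<Sum>i\<in>f ` S'. h (inv_into S' f i))"
      by (simp add: sum.If_cases)
    also have "\<dots> = (\<Sum>w\<in>S'. h w)" using f by (subst sum.reindex) auto
    finally show ?thesis .
  qed
  have sx: "(\<Sum>i\<in>UNIV. x $ i) = 1 - u v0"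
  proof -
    have "(\<Sum>i\<in>UNIV. x $ i) = (\<Sum>w\<in>S'. u w)" unfolding x_def vec_lambda_beta by (rule sum_f)
    then show ?thesis using u(2) S' by simp
  qed
  have u0: "u v0 \<ge> 0" using u v0 by auto
  show ?thesis
  proof (rule that[of v0 v x])
    show "v0 \<in> V" "v i \<in> V" for i
      using v0 S S' inv_into_into[of i f S'] by (auto simp: v_def)
    show "x \<in> dominant_simplex"
      using sx u0 v0 u S'(3) inv_into_into[of _ f S'] unfolding dominant_simplex_def
      by (auto simp: x_def)
    have "(\<Sum>i\<in>UNIV. x $ i *\<^sub>R (v i - v0)) = (\<Sum>i\<in>UNIV. if i \<in> f ` S' then u (inv_into S' f i) *\<^sub>R (inv_into S' f i - v0) else 0)"
      by (intro sum.cong) (auto simp: x_def v_def)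
    also have "\<dots> = (\<Sum>w\<in>S'. u w *\<^sub>R (w - v0))" by (rule sum_f)
    also have "\<dots> = (\<Sum>w\<in>S. u w *\<^sub>R (w - v0))" using S' by simp
    also have "\<dots> = t - v0"
      using u by (simp add: scaleR_right_diff_distrib sum_subtractf flip: scaleR_sum_left)
    finally show "t = v0 + (\<Sum>i\<in>UNIV. x $ i *\<^sub>R (v i - v0))" by simp
  qed
qed

subsection \<open>Concentration near a face of a polytope\<close>

definition affine_form :: "('a::euclidean_space \<Rightarrow> real) \<Rightarrow> bool" where
  "affine_form f \<longleftrightarrow> (\<exists>c w. f = (\<lambda>t. c + w \<bullet> t))"

lemma affine_form_continuous_on: "affine_form f \<Longrightarrow> continuous_on S f"
  by (auto simp: affine_form_def intro!: continuous_intros)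

lemma affine_form_measurable: "affine_form f \<Longrightarrow> f \<in> borel_measurable borel"
  by (intro borel_measurable_continuous_onI affine_form_continuous_on)

lemma affine_form_barycentric:
  assumes "affine_form f"
  shows "f (v0 + (\<Sum>i\<in>I. x i *\<^sub>R (v i - v0))) = f v0 * (1 - sum x I) + (\<Sum>i\<in>I. f (v i) * x i)"
proof -
  obtain c w where f: "f = (\<lambda>t. c + w \<bullet> t)" using assms by (auto simp: affine_form_def)
  show ?thesis
    unfolding f
    by (simp add: inner_right_distrib inner_sum_right inner_diff_right algebra_simps sum.distrib
      sum_subtractf sum_distrib_left sum_distrib_right)
qed

lemma affine_form_zero_affine_hull:
  assumes "affine_form f" "\<And>t. t \<in> E \<Longrightarrow> f t = 0" "x \<in> affine hull E"
  shows "f x = 0"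
proof -
  obtain c w where f: "f = (\<lambda>t. c + w \<bullet> t)" using assms by (auto simp: affine_form_def)
  have "affine {t. w \<bullet> t = - c}" by (rule affine_hyperplane)
  moreover have "E \<subseteq> {t. w \<bullet> t = - c}"
  proof
    fix t assume "t \<in> E"
    then show "t \<in> {t. w \<bullet> t = - c}" using assms(2)[of t] by (simp add: f)
  qed
  ultimately have "affine hull E \<subseteq> {t. w \<bullet> t = - c}" by (simp add: hull_minimal)
  then show ?thesis using assms(3) by (auto simp: f)
qed

lemma affine_form_bounded:
  assumes "affine_form f" "bounded S"
  obtains K where "K > 0" "\<And>t. t \<in> S \<Longrightarrow> \<bar>f t\<bar> \<le> K"
proof -
  obtain c w where f: "f = (\<lambda>t. c + w \<bullet> t)" using assms by (auto simp: affine_form_def)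
  obtain B where B: "\<And>t. t \<in> S \<Longrightarrow> norm t \<le> B" "B > 0" using assms(2) bounded_pos by blast
  show ?thesis
  proof (rule that[of "\<bar>c\<bar> + norm w * B + 1"])
    show "\<bar>c\<bar> + norm w * B + 1 > 0" using B by (intro add_nonneg_pos add_nonneg_nonneg) auto
    fix t assume "t \<in> S"
    have "\<bar>w \<bullet> t\<bar> \<le> norm w * norm t" by (rule Cauchy_Schwarz_ineq2)
    also have "\<dots> \<le> norm w * B" using B \<open>t \<in> S\<close> by (intro mult_left_mono) auto
    finally show "\<bar>f t\<bar> \<le> \<bar>c\<bar> + norm w * B + 1" by (simp add: f)
  qed
qed

lemma compact_negligible_nn_integral:
  fixes S :: "'a::euclidean_space set"
  assumes "compact S" "negligible S"
  shows "(\<integral>\<^sup>+t\<in>S. f t \<partial>lborel) = 0"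
proof -
  have "S \<in> sets borel" using assms(1) by (simp add: borel_compact)
  moreover have "emeasure lborel S = 0"
    using assms(2) calculation by (simp add: negligible_iff_emeasure0)
  ultimately have "S \<in> null_sets lborel" by auto
  then show ?thesis by (rule nn_integral_null_set)
qed

text \<open>\<open>P\<close> is a polytope cut out by the forms \<open>y j \<ge> 0\<close>, and \<open>F\<close> is the face on which the form
  \<open>\<tau>\<close>, nonnegative on \<open>P\<close>, vanishes. Exponents \<open>l j\<close> matter only for the forms in \<open>J'\<close>. The last
  assumption is the local integrability of \<open>\<Prod>j. y j t powr l j\<close> on \<open>F\<close> along each of its faces.\<close>

locale polytope_face =
  fixes J :: "'j set" and y :: "'j \<Rightarrow> real ^ 's \<Rightarrow> real" and \<tau> :: "real ^ 's \<Rightarrow> real"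
    and l :: "'j \<Rightarrow> real" and d :: nat and P F :: "(real ^ 's) set" and J' :: "'j set"
  assumes finite_J: "finite J" and affine_y: "\<And>j. j \<in> J \<Longrightarrow> affine_form (y j)"
    and affine_tau: "affine_form \<tau>"
    and P_eq: "P = {t. \<forall>j\<in>J. 0 \<le> y j t}" and bounded_P: "bounded P"
    and tau_nonneg: "\<And>t. t \<in> P \<Longrightarrow> 0 \<le> \<tau> t"
    and F_eq: "F = {t \<in> P. \<tau> t = 0}" and F_nonempty: "F \<noteq> {}" and dim_F: "aff_dim F = int d"
    and J'_eq: "J' = {j \<in> J. \<exists>t\<in>F. y j t \<noteq> 0}"
    and local_integrability: "\<And>E. E \<subseteq> F \<Longrightarrow> E \<noteq> {} \<Longrightarrow> \<not> affine_dependent E \<Longrightarrow> card E \<le> d \<Longrightarrow>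
      0 < (\<Sum>j | j \<in> J' \<and> (\<forall>t\<in>E. y j t = 0). l j) + (real d + 1 - card E)"
begin

lemma J'_subset: "J' \<subseteq> J" by (auto simp: J'_eq)

lemma finite_J': "finite J'" using finite_J J'_subset finite_subset by blast

lemma y_nonneg: "t \<in> P \<Longrightarrow> j \<in> J \<Longrightarrow> 0 \<le> y j t" by (simp add: P_eq)

lemma measurable_y: "j \<in> J \<Longrightarrow> y j \<in> borel_measurable borel"
  by (intro affine_form_measurable affine_y)

lemma measurable_tau: "\<tau> \<in> borel_measurable borel"
  by (intro affine_form_measurable affine_tau)

lemma polyhedron_P: "polyhedron P"
proof -
  have "polyhedron {t. 0 \<le> y j t}" if j: "j \<in> J" for j
  proof -
    obtain c w where "y j = (\<lambda>t. c + w \<bullet> t)" using affine_y[OF j] by (auto simp: affine_form_def)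
    then have "{t. 0 \<le> y j t} = {t. w \<bullet> t \<ge> - c}" by (auto simp: algebra_simps)
    then show ?thesis by (simp add: polyhedron_halfspace_ge)
  qed
  then have "polyhedron (\<Inter>j\<in>J. {t. 0 \<le> y j t})"
    using finite_J by (intro polyhedron_Inter) auto
  then show ?thesis by (simp add: P_eq Collect_ball_eq)
qed

lemma polytope_P: "polytope P"
  using polyhedron_P bounded_P by (simp add: polytope_eq_bounded_polyhedron)

lemma compact_P: "compact P"
  using polytope_P by (rule polytope_imp_compact)

lemma borel_P: "P \<in> sets borel"
  using compact_P by (simp add: borel_compact)

text \<open>Three parameters stay free: the shifts \<open>a\<close>, a loss \<epsilon> in every
  exponent and a decay rate \<open>c\<close>. The estimates below trade part of the decay and of the
  exponents for additional factors, passing from loss 0 and rate 1 to loss \<epsilon> and rate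
  1/2.\<close>

definition weight :: "('j \<Rightarrow> real) \<Rightarrow> real \<Rightarrow> real \<Rightarrow> real \<Rightarrow> real ^ 's \<Rightarrow> real" where
  "weight a \<epsilon> c L t = exp (- L * (c * \<tau> t)) * (\<Prod>j\<in>J'. (a j / L + y j t) powr (l j - \<epsilon>))"

lemma measurable_weight: "weight a \<epsilon> c L \<in> borel_measurable borel"
proof -
  have [measurable]: "y j \<in> borel_measurable borel" if "j \<in> J'" for j
    using measurable_y J'_subset that by auto
  note [measurable] = measurable_tau
  show ?thesis unfolding weight_def by measurable
qed

lemma weight_nonneg: "weight a \<epsilon> c L t \<ge> 0"
  by (simp add: weight_def prod_nonneg)

text \<open>Pull back to barycentric coordinates based at \<open>v0\<close>. A degenerate simplex is
  a null set. If \<open>v0\<close> is off \<open>F\<close>, then \<tau> is bounded below on the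
  piece and the weight decays exponentially in \<open>L\<close>. If \<open>v0\<close> lies on
  \<open>F\<close>, the pointwise bound applies with \<beta> = 1 - \<epsilon>, for which
  \<open>C\<close> is exactly the power counting hypothesis.\<close>

lemma simplex_piece_bound:
  fixes v :: "'s \<Rightarrow> real ^ 's"
  assumes V: "V \<subseteq> P" and v0: "v0 \<in> V" and v: "\<And>i. v i \<in> V" and c: "c > 0" and \<epsilon>: "0 < \<epsilon>" "\<epsilon> < 1"
    and C: "\<And>E. E \<subseteq> V \<inter> F \<Longrightarrow> E \<noteq> {} \<Longrightarrow> \<not> affine_dependent E \<Longrightarrow> card E \<le> d \<Longrightarrow>
      0 \<le> (\<Sum>j | j \<in> J' \<and> (\<forall>t\<in>E. y j t = 0). l j - \<epsilon>) + (1 - \<epsilon>) * (real d + 1 - card E)"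
  defines "D \<equiv> (\<lambda>x. v0 + (\<Sum>i\<in>UNIV. x $ i *\<^sub>R (v i - v0))) ` dominant_simplex"
  shows "\<exists>K\<ge>0. \<forall>L\<ge>1. (\<integral>\<^sup>+t\<in>D. ennreal (weight (\<lambda>_. 1) \<epsilon> c L t) \<partial>lborel)
     \<le> ennreal (K * L powr (real d - CARD('s)))"
proof -
  define A :: "real^'s \<Rightarrow> real^'s" where "A x = (\<Sum>i\<in>UNIV. x $ i *\<^sub>R (v i - v0))" for x
  have linA: "linear A"
    unfolding A_def by (intro linearI) (auto simp: sum.distrib scaleR_add_left scaleR_sum_right)
  have D: "D = (\<lambda>x. v0 + A x) ` dominant_simplex" by (simp add: D_def A_def)
  have contA: "continuous_on S A" for S
    using linA by (simp add: linear_continuous_on linear_conv_bounded_linear)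
  have compD: "compact D"
    unfolding D by (intro compact_continuous_image compact_dominant_simplex continuous_intros contA)
  have convP: "convex P" using polytope_P polytope_imp_convex by blast
  have DP: "D \<subseteq> P"
  proof
    fix t assume "t \<in> D"
    then obtain x where x: "x \<in> dominant_simplex" "t = v0 + (\<Sum>i\<in>UNIV. x $ i *\<^sub>R (v i - v0))" by (auto simp: D_def)
    have s: "(\<Sum>i\<in>UNIV. x $ i) \<le> 1"
    proof -
      have "x $ i + (\<Sum>i\<in>UNIV. x $ i) \<le> 1" "0 \<le> x $ i" for i
        using x(1) by (auto simp: dominant_simplex_def)
      from this[of undefined] show ?thesis by linarith
    qed
    show "t \<in> P" unfolding P_eq
    proof (intro CollectI ballI)
      fix j assume j: "j \<in> J"
      have "y j t = y j v0 * (1 - (\<Sum>i\<in>UNIV. x $ i)) + (\<Sum>i\<in>UNIV. y j (v i) * x $ i)"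
        unfolding x(2) by (rule affine_form_barycentric[OF affine_y[OF j]])
      also have "\<dots> \<ge> 0"
        using y_nonneg[OF _ j] v0 v V x(1) s
        by (intro add_nonneg_nonneg mult_nonneg_nonneg sum_nonneg) (auto simp: dominant_simplex_def)
      finally show "0 \<le> y j t" .
    qed
  qed
  show ?thesis
  proof (cases "inj A")
    case False
    then have "negligible (A ` dominant_simplex)" using linA negligible_linear_singular_image by blast
    then have "negligible ((+) v0 ` A ` dominant_simplex)" by (rule negligible_translation)
    then have "negligible D" by (simp add: D image_image)
    then have "(\<integral>\<^sup>+t\<in>D. f t \<partial>lborel) = 0" for f
      using compD compact_negligible_nn_integral by blast
    then show ?thesis by (intro exI[of _ 0]) auto
  next
    case True
    \<comment> \<open>\<open>A\<close> maps unit vectors to the edges at \<open>v0\<close>, so its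
      injectivity says that the vertices are affinely independent, which is the condition on
      \<open>E\<close> in \<open>C\<close>.\<close>
    have indep: "v i \<noteq> v0" "inj v" "independent ((\<lambda>i. v i - v0) ` UNIV)" for i
    proof -
      have Ax: "A (axis i 1) = v i - v0" for i
        unfolding A_def by (subst sum.mono_neutral_cong_right[where S="{i}"]) (auto simp: axis_def)
      have "axis i 1 \<noteq> (0 :: real^'s)" for i by (simp add: axis_eq_0_iff)
      then have "A (axis i 1) \<noteq> 0" for i using True linA by (metis linear_injective_0)
      then show "v i \<noteq> v0" for i using Ax[of i] by auto
      show "inj v"
      proof (rule injI)
        fix i j assume "v i = v j"
        then have "A (axis i 1) = A (axis j 1)" by (simp add: Ax)
        then have "axis i 1 = (axis j 1 :: real^'s)" using True by (auto dest: injD)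
        then show "i = j" by (simp add: axis_eq_axis)
      qed
      have "independent (range (\<lambda>i. axis i 1 :: real^'s))"
        using independent_Basis[where 'a="real^'s"] by (simp add: Basis_vec_def UNION_singleton_eq_range)
      then have "independent (A ` range (\<lambda>i. axis i 1))"
        using linA True by (intro linear_independent_injective_image) (auto intro: inj_on_subset)
      then show "independent ((\<lambda>i. v i - v0) ` UNIV)" by (simp add: image_image Ax)
    qed
    have aff_indep: "\<not> affine_dependent (insert v0 (v ` Y))" "card (insert v0 (v ` Y)) = card Y + 1" for Y
    proof -
      have n: "v0 \<notin> v ` Y" using indep(1) by auto
      have "independent ((\<lambda>x. - v0 + x) ` (v ` Y))"
        using independent_mono[OF indep(3), of "(\<lambda>i. v i - v0) ` Y"] by (auto simp: image_image)
      then show "\<not> affine_dependent (insert v0 (v ` Y))"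
        using affine_dependent_iff_dependent[OF n] by simp
      show "card (insert v0 (v ` Y)) = card Y + 1"
        using n indep(2) by (simp add: card_image inj_on_subset)
    qed
    show ?thesis
    proof (cases "\<tau> v0 = 0")
      case False
      then have \<tau>0: "\<tau> v0 > 0" using tau_nonneg[of v0] v0 V by auto
      \<comment> \<open>On the dominant part \<open>v0\<close> has weight at least
        \<open>1 / s1\<close>, so \<tau> is at least \<open>\<tau> v0 / s1\<close> there.\<close>
      define s1 where "s1 = real CARD('s) + 1"
      define g0 where "g0 = c * (\<tau> v0 / s1)"
      have g0: "g0 > 0" using c \<tau>0 by (simp add: g0_def s1_def)
      have tau_ge: "c * \<tau> t \<ge> g0" if t: "t \<in> D" for t
      proof -
        obtain x where x: "x \<in> dominant_simplex" "t = v0 + (\<Sum>i\<in>UNIV. x $ i *\<^sub>R (v i - v0))"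
          using t by (auto simp: D_def)
        define S where "S = (\<Sum>i\<in>UNIV. x $ i)"
        have "(\<Sum>i\<in>UNIV. x $ i) \<le> (\<Sum>i\<in>(UNIV::'s set). 1 - S)"
          using x(1) by (intro sum_mono) (auto simp: dominant_simplex_def S_def algebra_simps)
        then have "1 / s1 \<le> 1 - S" by (simp add: S_def[symmetric] s1_def field_simps)
        then have "\<tau> v0 * (1 / s1) \<le> \<tau> v0 * (1 - S)" using \<tau>0 by (intro mult_left_mono) auto
        also have "\<dots> \<le> \<tau> v0 * (1 - S) + (\<Sum>i\<in>UNIV. \<tau> (v i) * x $ i)"
          using tau_nonneg v V x(1) by (auto intro!: sum_nonneg mult_nonneg_nonneg simp: dominant_simplex_def)
        also have "\<dots> = \<tau> t"
          unfolding x(2) S_def by (rule affine_form_barycentric[OF affine_tau, symmetric])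
        finally have "\<tau> v0 / s1 \<le> \<tau> t" by simp
        then show ?thesis unfolding g0_def using c by (intro mult_left_mono) auto
      qed
      have "\<forall>j\<in>J'. \<exists>Y>0. \<forall>t\<in>P. \<bar>y j t\<bar> \<le> Y"
        using affine_form_bounded[OF affine_y bounded_P] J'_subset by (metis subsetD)
      then obtain Yb where Yb: "\<And>j. j \<in> J' \<Longrightarrow> Yb j > 0" "\<And>j t. j \<in> J' \<Longrightarrow> t \<in> P \<Longrightarrow> \<bar>y j t\<bar> \<le> Yb j"
        by metis
      define K1 where "K1 = (\<Prod>j\<in>J'. (1 + Yb j) powr \<bar>l j - \<epsilon>\<bar>)"
      have K1: "K1 \<ge> 0" by (simp add: K1_def prod_nonneg)
      define p where "p = (\<Sum>j\<in>J'. \<bar>l j - \<epsilon>\<bar>)"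
      have prod_le: "(\<Prod>j\<in>J'. (1 / L + y j t) powr (l j - \<epsilon>)) \<le> K1 * L powr p" if L: "L \<ge> 1" and t: "t \<in> P" for L t
      proof -
        have "(\<Prod>j\<in>J'. (1 / L + y j t) powr (l j - \<epsilon>)) \<le> (\<Prod>j\<in>J'. ((1 + Yb j) powr \<bar>l j - \<epsilon>\<bar> * L powr \<bar>l j - \<epsilon>\<bar>))"
        proof (intro prod_mono conjI)
          fix j assume j: "j \<in> J'"
          have y: "0 \<le> y j t" "y j t \<le> Yb j" using y_nonneg[OF t] J'_subset j Yb(2)[OF j t] by auto
          have L': "0 < 1 / L" "1 / L \<le> 1" using L by auto
          have "(1 / L + y j t) powr (l j - \<epsilon>) \<le> ((1 + Yb j) * L) powr \<bar>l j - \<epsilon>\<bar> * 1 powr (l j - \<epsilon>)"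
          proof (rule powr_comparable)
            have "1 / L + y j t \<le> (1 + Yb j) * 1" using add_mono[OF L'(2) y(2)] by simp
            also have "\<dots> \<le> (1 + Yb j) * L" using L y by (intro mult_left_mono) auto
            finally show "1 / L + y j t \<le> (1 + Yb j) * L * 1" by simp
            have "1 \<le> (1 + Yb j) * (L * (1 / L))" using y L by simp
            also have "\<dots> \<le> (1 + Yb j) * (L * (1 / L + y j t))" using y L by (intro mult_left_mono) auto
            finally show "1 \<le> (1 + Yb j) * L * (1 / L + y j t)" by (simp only: mult.assoc)
          qed (use L' y in \<open>linarith+\<close>)
          then show "(1 / L + y j t) powr (l j - \<epsilon>) \<le> (1 + Yb j) powr \<bar>l j - \<epsilon>\<bar> * L powr \<bar>l j - \<epsilon>\<bar>"
            using y L by (simp add: powr_mult)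
        qed auto
        also have "\<dots> = K1 * L powr p" using L by (simp add: prod.distrib K1_def p_def powr_sum)
        finally show ?thesis .
      qed
      obtain K3 where K3: "K3 > 0" "\<And>x. x \<ge> 1 \<Longrightarrow> x powr (p + CARD('s) - d) * exp (- g0 * x) \<le> K3 * exp (- (g0 / 2) * x)"
        using powr_times_exp_bound[OF g0] by blast
      have w_le: "weight (\<lambda>_. 1) \<epsilon> c L t \<le> K1 * K3 * L powr (real d - CARD('s))" if L: "L \<ge> 1" and t: "t \<in> D" for L t
      proof -
        have "weight (\<lambda>_. 1) \<epsilon> c L t \<le> exp (- g0 * L) * (K1 * L powr p)"
          unfolding weight_def using tau_ge[OF t] L t DP
          by (intro mult_mono prod_le) (auto intro!: prod_nonneg mult_left_mono simp: mult.commute)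
        also have "L powr p = L powr (real d - CARD('s)) * L powr (p + CARD('s) - d)" by (simp flip: powr_add)
        also have "exp (- g0 * L) * (K1 * (L powr (real d - CARD('s)) * L powr (p + CARD('s) - d)))
          = K1 * L powr (real d - CARD('s)) * (L powr (p + CARD('s) - d) * exp (- g0 * L))" by simp
        also have "\<dots> \<le> K1 * L powr (real d - CARD('s)) * K3"
        proof (intro mult_left_mono)
          have "K3 * exp (- (g0 / 2) * L) \<le> K3 * 1" using K3 g0 L by (intro mult_left_mono) auto
          then show "L powr (p + CARD('s) - d) * exp (- g0 * L) \<le> K3" using K3(2)[OF L] by simp
        qed (use K1 in auto)
        finally show ?thesis by (simp add: mult_ac)
      qed
      have D_fin: "emeasure lborel D < \<infinity>"
        using compD by (intro emeasure_bounded_finite compact_imp_bounded)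
      have D_borel: "D \<in> sets lborel" using compD by (simp add: borel_compact)
      show ?thesis
      proof (intro exI[of _ "K1 * K3 * measure lborel D"] conjI allI impI)
        show "0 \<le> K1 * K3 * measure lborel D" using K1 K3 by simp
        fix L :: real assume L: "L \<ge> 1"
        have "(\<integral>\<^sup>+t\<in>D. ennreal (weight (\<lambda>_. 1) \<epsilon> c L t) \<partial>lborel)
          \<le> (\<integral>\<^sup>+t. ennreal (K1 * K3 * L powr (real d - CARD('s))) * indicator D t \<partial>lborel)"
          using w_le[OF L] by (intro nn_integral_mono) (auto split: split_indicator intro!: ennreal_leI)
        also have "\<dots> = ennreal (K1 * K3 * L powr (real d - CARD('s))) * emeasure lborel D"
          using D_borel by (rule nn_integral_cmult_indicator)
        also have "\<dots> = ennreal (K1 * K3 * measure lborel D * L powr (real d - CARD('s)))"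
          using D_fin K1 K3 by (simp add: emeasure_eq_ennreal_measure ennreal_mult[symmetric] mult_ac)
        finally show "(\<integral>\<^sup>+t\<in>D. ennreal (weight (\<lambda>_. 1) \<epsilon> c L t) \<partial>lborel)
          \<le> ennreal (K1 * K3 * measure lborel D * L powr (real d - CARD('s)))" .
      qed
    next
      case \<tau>0: True
      obtain m where m: "m > 0" "\<And>f. f \<in> borel_measurable borel \<Longrightarrow>
          (\<integral>\<^sup>+x. f (A x) \<partial>lborel) = ennreal m * (\<integral>\<^sup>+x. f x \<partial>lborel)"
        using nn_integral_linear_injective[OF linA True] by auto
      have surj: "\<exists>x. t = v0 + A x" for t
        using linear_injective_imp_surjective[OF linA True] by (metis add_diff_cancel_left' diff_add_cancel add.commute surjD)
      define a where "a j = y j v0" for j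
      define b where "b j i = y j (v i)" for j i
      define cc where "cc i = c * \<tau> (v i)" for i
      have v0F: "v0 \<in> F" using \<tau>0 v0 V by (auto simp: F_eq)
      have dle: "d \<le> CARD('s)"
        using dim_F aff_dim_le_DIM[of F] by simp
      have "\<exists>K g. K > 0 \<and> g > 0 \<and> (\<forall>L\<ge>1. \<forall>x. (\<forall>i. 0 \<le> x i) \<and> (\<forall>i. x i + sum x UNIV \<le> 1) \<longrightarrow>
         exp (- L * (\<Sum>i\<in>UNIV. cc i * x i)) *
           (\<Prod>j\<in>J'. (1 / L + (a j * (1 - sum x UNIV) + (\<Sum>i\<in>UNIV. b j i * x i))) powr (l j - \<epsilon>))
         \<le> K * (\<Sum>Y | card Y \<le> d. L ^ (d - card Y) *
              (\<Prod>i\<in>UNIV. if i \<in> Y then x i powr (- (1 - \<epsilon>)) else exp (- g * L * x i))))"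
      proof (rule simplex_pointwise_bound[OF finite_J'])
        show "a j \<ge> 0" "b j i \<ge> 0" if "j \<in> J'" for j i
          using that J'_subset y_nonneg v0 v V unfolding a_def b_def by blast+
        show "a j > 0 \<or> (\<exists>i. b j i > 0)" if j: "j \<in> J'" for j
        proof (rule ccontr)
          have jJ: "j \<in> J" using j J'_subset by auto
          assume "\<not> (a j > 0 \<or> (\<exists>i. b j i > 0))"
          moreover have "0 \<le> y j v0" "0 \<le> y j (v i)" for i
            using y_nonneg[OF _ jJ] v0 v V by blast+
          ultimately have z: "y j v0 = 0" "y j (v i) = 0" for i
            by (auto simp: a_def b_def not_less intro: antisym)
          have "y j t = 0" for t
          proof -
            obtain x where "t = v0 + A x" using surj by blast
            then show ?thesis unfolding A_def by (simp add: affine_form_barycentric[OF affine_y[OF jJ]] z)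
          qed
          then show False using j by (auto simp: J'_eq)
        qed
        show "cc i \<ge> 0" for i
          unfolding cc_def using c tau_nonneg[of "v i"] v[of i] V by (intro mult_nonneg_nonneg) auto
        fix Y assume Y: "Y \<subseteq> {i. cc i = 0}"
        define E where "E = insert v0 (v ` Y)"
        have "\<tau> (v i) = 0" if "i \<in> Y" for i using Y that c by (auto simp: cc_def)
        then have EF: "E \<subseteq> F" using v0F v V unfolding E_def F_eq by auto
        have EV: "E \<subseteq> V \<inter> F" using EF v0 v by (auto simp: E_def)
        have E: "\<not> affine_dependent E" "card E = card Y + 1" using aff_indep[of Y] by (auto simp: E_def)
        have dimE: "aff_dim E = int (card Y)" using E aff_dim_affine_independent[of E] by simp
        then have "card Y \<le> d" using aff_dim_subset[OF EF] dim_F by simp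
        have set: "{j. j \<in> J' \<and> a j = 0 \<and> (\<forall>i\<in>Y. b j i = 0)} = {j. j \<in> J' \<and> (\<forall>t\<in>E. y j t = 0)}"
          by (auto simp: E_def a_def b_def)
        \<comment> \<open>\<open>C\<close> covers sets of at most \<open>d\<close> points. A set of
          \<open>d + 1\<close> affinely independent points spans the hull of \<open>F\<close>, and a
          form of \<open>J'\<close> cannot vanish on all of it, so the sum is empty and the other
          term is 0.\<close>
        have "0 \<le> (\<Sum>j | j \<in> J' \<and> (\<forall>t\<in>E. y j t = 0). l j - \<epsilon>) + (1 - \<epsilon>) * (real d - card Y)"
        proof (cases "card Y = d")
          case False
          then have "card E \<le> d" using E(2) \<open>card Y \<le> d\<close> by simp
          then show ?thesis using C[OF EV _ E(1)] E(2) by (auto simp: E_def)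
        next
          case True
          have "affine hull E = affine hull F"
          proof (rule affine_dim_equal)
            show "affine hull E \<noteq> {}" by (simp add: E_def)
            show "affine hull E \<subseteq> affine hull F" by (rule hull_mono[OF EF])
            show "aff_dim (affine hull E) = aff_dim (affine hull F)" using dimE dim_F True by simp
          qed auto
          then have "y j t = 0" if "j \<in> J'" "\<forall>t\<in>E. y j t = 0" "t \<in> F" for j t
          proof -
            have "t \<in> affine hull E" using \<open>affine hull E = affine hull F\<close> hull_inc[OF that(3)] by simp
            moreover have "affine_form (y j)" using affine_y that(1) J'_subset by blast
            ultimately show ?thesis using affine_form_zero_affine_hull[of "y j" E t] that(2) by blast
          qed
          then have "{j. j \<in> J' \<and> (\<forall>t\<in>E. y j t = 0)} = {}" by (auto simp: J'_eq)
          then show ?thesis using True by (simp only: sum.empty) simp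
        qed
        then show "card Y \<le> d \<and> 0 \<le> (\<Sum>j | j \<in> J' \<and> a j = 0 \<and> (\<forall>i\<in>Y. b j i = 0). l j - \<epsilon>) + (1 - \<epsilon>) * (real d - card Y)"
          using \<open>card Y \<le> d\<close> unfolding set by simp
      qed (use \<epsilon> in auto)
      then obtain K g where K: "K > 0" "g > 0" and Kg: "\<And>L x. L \<ge> 1 \<Longrightarrow> (\<forall>i. 0 \<le> x i) \<and> (\<forall>i. x i + sum x UNIV \<le> 1) \<Longrightarrow>
         exp (- L * (\<Sum>i\<in>UNIV. cc i * x i)) *
           (\<Prod>j\<in>J'. (1 / L + (a j * (1 - sum x UNIV) + (\<Sum>i\<in>UNIV. b j i * x i))) powr (l j - \<epsilon>))
         \<le> K * (\<Sum>Y | card Y \<le> d. L ^ (d - card Y) *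
              (\<Prod>i\<in>UNIV. if i \<in> Y then x i powr (- (1 - \<epsilon>)) else exp (- g * L * x i)))"
        by blast
      define S where "S L x = (\<Sum>Y | card Y \<le> d. L ^ (d - card Y) *
              (\<Prod>i\<in>UNIV. if i \<in> Y then (x $ i) powr (- (1 - \<epsilon>)) else exp (- g * L * x $ i)))" for L and x :: "real^'s"
      obtain K2 where K2: "K2 \<ge> 0" "\<And>L. L \<ge> 1 \<Longrightarrow> (\<integral>\<^sup>+x. ennreal (indicator (dominant_simplex :: (real ^ 's) set) x * S L x) \<partial>lborel)
          \<le> ennreal (K2 * L powr (real d - CARD('s)))"
        using dominant_simplex_integral_bound[of "1 - \<epsilon>" g d, OF _ K(2) dle] \<epsilon> unfolding S_def by auto
      show ?thesis
      proof (intro exI[of _ "K * K2 / m"] conjI allI impI)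
        show "0 \<le> K * K2 / m" using K K2 m by simp
        fix L :: real assume L: "L \<ge> 1"
        define f where "f t = ennreal (weight (\<lambda>_. 1) \<epsilon> c L t) * indicator D t" for t
        note [measurable] = measurable_weight
        have [measurable]: "D \<in> sets borel" using compD by (simp add: borel_compact)
        have [measurable]: "A \<in> borel_measurable borel" using contA by (intro borel_measurable_continuous_onI)
        have [measurable]: "f \<in> borel_measurable borel" unfolding f_def by measurable
        have "ennreal m * (\<integral>\<^sup>+t. f t \<partial>lborel) = ennreal m * (\<integral>\<^sup>+t. f (v0 + t) \<partial>lborel)"
          by (subst lborel_distr_plus[of v0, symmetric]) (simp add: nn_integral_distr)
        also have "\<dots> = (\<integral>\<^sup>+x. f (v0 + A x) \<partial>lborel)"
          using m(2)[of "\<lambda>t. f (v0 + t)"] by simp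
        also have "\<dots> \<le> (\<integral>\<^sup>+x. ennreal K * ennreal (indicator dominant_simplex x * S L x) \<partial>lborel)"
        proof (intro nn_integral_mono)
          fix x
          show "f (v0 + A x) \<le> ennreal K * ennreal (indicator dominant_simplex x * S L x)"
          proof (cases "x \<in> dominant_simplex")
            case x: True
            have "weight (\<lambda>_. 1) \<epsilon> c L (v0 + A x) \<le> K * S L x"
            proof -
              have "\<tau> (v0 + A x) = (\<Sum>i\<in>UNIV. \<tau> (v i) * x $ i)"
                unfolding A_def using affine_form_barycentric[OF affine_tau, of v0 "\<lambda>i. x $ i" v UNIV] \<tau>0 by simp
              then have "c * \<tau> (v0 + A x) = (\<Sum>i\<in>UNIV. cc i * x $ i)"
                by (simp add: cc_def sum_distrib_left mult_ac)
              moreover have "y j (v0 + A x) = a j * (1 - (\<Sum>i\<in>UNIV. x $ i)) + (\<Sum>i\<in>UNIV. b j i * x $ i)" if "j \<in> J'" for j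
                unfolding A_def a_def b_def using affine_form_barycentric affine_y J'_subset that by blast
              ultimately show ?thesis
                unfolding weight_def S_def using Kg[OF L, of "\<lambda>i. x $ i"] x
                by (simp add: dominant_simplex_def)
            qed
            moreover have "f (v0 + A x) = ennreal (weight (\<lambda>_. 1) \<epsilon> c L (v0 + A x))"
              using x by (auto simp: f_def D)
            moreover have "S L x \<ge> 0" unfolding S_def using L by (intro sum_nonneg mult_nonneg_nonneg prod_nonneg) auto
            ultimately show ?thesis using K x by (simp add: ennreal_mult'[symmetric] ennreal_leI)
          next
            case False
            then have "v0 + A x \<notin> D" by (auto simp: D inj_eq[OF True])
            then show ?thesis by (simp add: f_def)
          qed
        qed
        also have "\<dots> = ennreal K * (\<integral>\<^sup>+x. ennreal (indicator dominant_simplex x * S L x) \<partial>lborel)"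
        proof (intro nn_integral_cmult)
          have [measurable]: "dominant_simplex \<in> sets (borel :: (real^'s) measure)"
            by (rule borel_compact[OF compact_dominant_simplex])
          show "(\<lambda>x. ennreal (indicator dominant_simplex x * S L x)) \<in> borel_measurable lborel"
            unfolding S_def by measurable
        qed
        also have "\<dots> \<le> ennreal K * ennreal (K2 * L powr (real d - CARD('s)))"
          by (intro mult_left_mono K2 L) auto
        finally have "ennreal (1 / m) * (ennreal m * (\<integral>\<^sup>+t. f t \<partial>lborel)) \<le> ennreal (1 / m) * (ennreal K * ennreal (K2 * L powr (real d - CARD('s))))"
          by (intro mult_left_mono) auto
        also have "ennreal (1 / m) * (ennreal m * (\<integral>\<^sup>+t. f t \<partial>lborel)) = (\<integral>\<^sup>+t. f t \<partial>lborel)"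
          using m(1) by (simp add: mult.assoc[symmetric] ennreal_mult[symmetric])
        also have "ennreal (1 / m) * (ennreal K * ennreal (K2 * L powr (real d - CARD('s)))) = ennreal (K * K2 / m * L powr (real d - CARD('s)))"
          using m(1) K K2 by (simp add: ennreal_mult[symmetric])
        finally show "(\<integral>\<^sup>+t\<in>D. ennreal (weight (\<lambda>_. 1) \<epsilon> c L t) \<partial>lborel) \<le> ennreal (K * K2 / m * L powr (real d - CARD('s)))"
          by (simp add: f_def)
      qed
    qed
  qed
qed

end

section \<open>Uniform bound for the weight integral\<close>

context polytope_face
begin

text \<open>Only finitely many sets of vertices occur, so the strict inequalities share a positive
  margin, which is then distributed over the exponents.\<close>

lemma uniform_exponent_loss:
  assumes "finite V"
  obtains \<epsilon> :: real where "0 < \<epsilon>" "\<epsilon> < 1"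
    "\<And>E. E \<subseteq> V \<inter> F \<Longrightarrow> E \<noteq> {} \<Longrightarrow> \<not> affine_dependent E \<Longrightarrow> card E \<le> d \<Longrightarrow>
      0 \<le> (\<Sum>j | j \<in> J' \<and> (\<forall>t\<in>E. y j t = 0). l j - \<epsilon>) + (1 - \<epsilon>) * (real d + 1 - card E)"
proof -
  define \<E> where "\<E> = {E. E \<subseteq> V \<inter> F \<and> E \<noteq> {} \<and> \<not> affine_dependent E \<and> card E \<le> d}"
  have fin: "finite \<E>" unfolding \<E>_def by (rule finite_subset[of _ "Pow V"]) (use assms in \<open>blast, simp\<close>)
  define g where "g E = (\<Sum>j | j \<in> J' \<and> (\<forall>t\<in>E. y j t = 0). l j) + (real d + 1 - card E)" for E
  define m where "m = Min (insert 1 (g ` \<E>))"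
  have m0: "m > 0"
    unfolding m_def using fin local_integrability by (auto simp: g_def \<E>_def)
  have m_le: "m \<le> g E" if "E \<in> \<E>" for E using fin that by (simp add: m_def)
  have m1: "m \<le> 1" using fin by (simp add: m_def)
  \<comment> \<open>Exceeds the total coefficient \<open>card A + (d + 1 - card E)\<close> of the
    loss; being at least 2, it also keeps \<open>m / N\<close> below 1.\<close>
  define N where "N = real (card J') + real d + 2"
  have N: "N \<ge> 2" by (simp add: N_def)
  show ?thesis
  proof (rule that[of "m / N"])
    show "0 < m / N" using m0 N by simp
    show "m / N < 1" using m1 N by (simp add: field_simps)
    fix E assume E: "E \<subseteq> V \<inter> F" "E \<noteq> {}" "\<not> affine_dependent E" "card E \<le> d"
    define A where "A = {j. j \<in> J' \<and> (\<forall>t\<in>E. y j t = 0)}"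
    have "E \<in> \<E>" using E by (simp add: \<E>_def)
    then have "m \<le> g E" by (rule m_le)
    have "real (card A) \<le> real (card J')" using finite_J' by (auto simp: A_def intro!: card_mono)
    then have "m / N * (real (card A) + (real d + 1 - card E)) \<le> m / N * N"
      using m0 N by (intro mult_left_mono) (auto simp: N_def)
    also have "\<dots> = m" using N by simp
    finally have "m / N * (real (card A) + (real d + 1 - card E)) \<le> g E" using \<open>m \<le> g E\<close> by linarith
    then show "0 \<le> (\<Sum>j | j \<in> J' \<and> (\<forall>t\<in>E. y j t = 0). l j - m / N) + (1 - m / N) * (real d + 1 - card E)"
      unfolding A_def[symmetric] g_def by (simp add: sum_subtractf algebra_simps)
  qed
qed

text \<open>The loss \<epsilon> is determined by the vertices alone, before the rate
  \<open>c\<close>. The order \<open>L powr (d - CARD('s))\<close> is the one expected from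
  concentration within \<open>1 / L\<close> of a face of dimension \<open>d\<close>.\<close>

theorem weight_integral_bound:
  obtains \<epsilon> :: real where "0 < \<epsilon>" "\<epsilon> < 1"
    "\<And>c. c > 0 \<Longrightarrow> \<exists>K\<ge>0. \<forall>L\<ge>1. (\<integral>\<^sup>+t\<in>P. ennreal (weight (\<lambda>_. 1) \<epsilon> c L t) \<partial>lborel)
       \<le> ennreal (K * L powr (real d - CARD('s)))"
proof -
  obtain V where V: "finite V" "P = convex hull V" using polytope_P by (auto simp: polytope_def)
  obtain \<epsilon> where \<epsilon>: "0 < \<epsilon>" "\<epsilon> < 1"
    "\<And>E. E \<subseteq> V \<inter> F \<Longrightarrow> E \<noteq> {} \<Longrightarrow> \<not> affine_dependent E \<Longrightarrow> card E \<le> d \<Longrightarrow>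
      0 \<le> (\<Sum>j | j \<in> J' \<and> (\<forall>t\<in>E. y j t = 0). l j - \<epsilon>) + (1 - \<epsilon>) * (real d + 1 - card E)"
    by (rule uniform_exponent_loss[OF V(1)]) (rule that; assumption)
  have VP: "V \<subseteq> P" unfolding V(2) by (rule hull_subset)
  show ?thesis
  proof (rule that[OF \<epsilon>(1,2)])
    fix c :: real assume c: "c > 0"
    \<comment> \<open>All choices of a base vertex and \<open>CARD('s)\<close> further vertices,
      with repetition: a finite family whose dominant parts cover \<open>P\<close>.\<close>
    define I where "I = V \<times> {v :: 's \<Rightarrow> real^'s. \<forall>i. v i \<in> V}"
    have "{v :: 's \<Rightarrow> real^'s. \<forall>i. v i \<in> V} = PiE UNIV (\<lambda>_. V)" by auto
    then have finI: "finite I" unfolding I_def using V by (auto intro!: finite_cartesian_product finite_PiE)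
    define D where "D w = (\<lambda>x. fst w + (\<Sum>i\<in>UNIV. x $ i *\<^sub>R (snd w i - fst w))) ` (dominant_simplex :: (real^'s) set)"
      for w :: "(real^'s) \<times> ('s \<Rightarrow> real^'s)"
    have "\<forall>w\<in>I. \<exists>K\<ge>0. \<forall>L\<ge>1. (\<integral>\<^sup>+t\<in>D w. ennreal (weight (\<lambda>_. 1) \<epsilon> c L t) \<partial>lborel)
       \<le> ennreal (K * L powr (real d - CARD('s)))"
      unfolding D_def by (intro ballI simplex_piece_bound[OF VP _ _ c \<epsilon>]) (auto simp: I_def)
    from bchoice[OF this] obtain K where "\<forall>w\<in>I. K w \<ge> 0 \<and> (\<forall>L\<ge>1.
      (\<integral>\<^sup>+t\<in>D w. ennreal (weight (\<lambda>_. 1) \<epsilon> c L t) \<partial>lborel) \<le> ennreal (K w * L powr (real d - CARD('s))))" ..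
    then have K: "\<And>w. w \<in> I \<Longrightarrow> K w \<ge> 0" "\<And>w L. w \<in> I \<Longrightarrow> L \<ge> 1 \<Longrightarrow>
      (\<integral>\<^sup>+t\<in>D w. ennreal (weight (\<lambda>_. 1) \<epsilon> c L t) \<partial>lborel) \<le> ennreal (K w * L powr (real d - CARD('s)))"
      by blast+
    have D_borel: "D w \<in> sets borel" for w
      unfolding D_def
      by (intro borel_compact compact_continuous_image compact_dominant_simplex continuous_intros)
    show "\<exists>K\<ge>0. \<forall>L\<ge>1. (\<integral>\<^sup>+t\<in>P. ennreal (weight (\<lambda>_. 1) \<epsilon> c L t) \<partial>lborel)
       \<le> ennreal (K * L powr (real d - CARD('s)))"
    proof (intro exI[of _ "sum K I"] conjI allI impI)
      show "0 \<le> sum K I" using K by (intro sum_nonneg) auto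
      fix L :: real assume L: "L \<ge> 1"
      have "(\<integral>\<^sup>+t\<in>P. ennreal (weight (\<lambda>_. 1) \<epsilon> c L t) \<partial>lborel)
         \<le> (\<integral>\<^sup>+t. (\<Sum>w\<in>I. ennreal (weight (\<lambda>_. 1) \<epsilon> c L t) * indicator (D w) t) \<partial>lborel)"
      proof (intro nn_integral_mono)
        fix t
        show "ennreal (weight (\<lambda>_. 1) \<epsilon> c L t) * indicator P t \<le> (\<Sum>w\<in>I. ennreal (weight (\<lambda>_. 1) \<epsilon> c L t) * indicator (D w) t)"
        proof (cases "t \<in> P")
          case True
          then obtain v0 v x where "v0 \<in> V" "\<And>i. v i \<in> V" "x \<in> (dominant_simplex :: (real ^ 's) set)"
            "t = v0 + (\<Sum>i\<in>UNIV. x $ i *\<^sub>R (v i - v0))"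
            using convex_hull_dominant_simplex_cover[OF V(1), of t] V(2) by blast
          then have w: "(v0, v) \<in> I" "t \<in> D (v0, v)" by (auto simp: I_def D_def)
          have "ennreal (weight (\<lambda>_. 1) \<epsilon> c L t) * indicator P t
             = ennreal (weight (\<lambda>_. 1) \<epsilon> c L t) * indicator (D (v0, v)) t"
            using True w by simp
          also have "\<dots> \<le> (\<Sum>w\<in>I. ennreal (weight (\<lambda>_. 1) \<epsilon> c L t) * indicator (D w) t)"
            by (rule member_le_sum) (use w finI in auto)
          finally show ?thesis .
        qed simp
      qed
      also have "\<dots> = (\<Sum>w\<in>I. \<integral>\<^sup>+t\<in>D w. ennreal (weight (\<lambda>_. 1) \<epsilon> c L t) \<partial>lborel)"
        using D_borel measurable_weight by (intro nn_integral_sum) auto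
      also have "\<dots> \<le> (\<Sum>w\<in>I. ennreal (K w * L powr (real d - CARD('s))))"
        by (intro sum_mono K L)
      also have "\<dots> = ennreal (\<Sum>w\<in>I. K w * L powr (real d - CARD('s)))"
        using K by (intro sum_ennreal) auto
      also have "(\<Sum>w\<in>I. K w * L powr (real d - CARD('s))) = sum K I * L powr (real d - CARD('s))"
        by (simp add: sum_distrib_right)
      finally show "(\<integral>\<^sup>+t\<in>P. ennreal (weight (\<lambda>_. 1) \<epsilon> c L t) \<partial>lborel)
         \<le> ennreal (sum K I * L powr (real d - CARD('s)))" .
    qed
  qed
qed

end

subsection \<open>Comparison of different scales\<close>

lemma powr_diff_one_bound:
  fixes r R l :: real
  assumes "R \<ge> 1" "1 / R \<le> r" "r \<le> R"
  shows "\<bar>r powr l - 1\<bar> \<le> \<bar>l\<bar> * R powr (\<bar>l\<bar> + 1) * \<bar>r - 1\<bar>"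
proof -
  have R0: "1 / R > 0" using assms by simp
  have r: "r > 0" using R0 assms(2) by linarith
  have mvt: "\<exists>\<xi>. 1 / R \<le> \<xi> \<and> \<xi> \<le> R \<and> r powr l - 1 = (r - 1) * (l * \<xi> powr (l - 1))"
  proof (cases r "1 :: real" rule: linorder_cases)
    case less
    have "\<exists>\<xi>>r. \<xi> < 1 \<and> 1 powr l - r powr l = (1 - r) * (l * \<xi> powr (l - 1))"
      using less r by (intro MVT2) (auto intro!: derivative_eq_intros)
    then obtain \<xi> where "r < \<xi>" "\<xi> < 1" "1 powr l - r powr l = (1 - r) * (l * \<xi> powr (l - 1))" by blast
    then show ?thesis using assms by (intro exI[of _ \<xi>]) (auto simp: algebra_simps)
  next
    case equal
    then show ?thesis using assms by (intro exI[of _ 1]) auto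
  next
    case greater
    have "\<exists>\<xi>>1. \<xi> < r \<and> r powr l - 1 powr l = (r - 1) * (l * \<xi> powr (l - 1))"
      using greater by (intro MVT2) (auto intro!: derivative_eq_intros)
    then obtain \<xi> where \<xi>: "1 < \<xi>" "\<xi> < r" "r powr l - 1 powr l = (r - 1) * (l * \<xi> powr (l - 1))" by blast
    have "1 / R \<le> 1" using assms by simp
    then have "1 / R \<le> \<xi>" using \<xi> by linarith
    then show ?thesis using \<xi> assms by (intro exI[of _ \<xi>]) auto
  qed
  then obtain \<xi> where \<xi>: "1 / R \<le> \<xi>" "\<xi> \<le> R" "r powr l - 1 = (r - 1) * (l * \<xi> powr (l - 1))" by blast
  have \<xi>0: "\<xi> > 0" using R0 \<xi>(1) by linarith
  have "\<xi> powr (l - 1) \<le> R powr \<bar>l - 1\<bar> * 1 powr (l - 1)"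
    using \<xi> \<xi>0 assms by (intro powr_comparable) (auto simp: field_simps)
  also have "\<dots> \<le> R powr (\<bar>l\<bar> + 1)" using assms by (auto intro!: powr_mono)
  finally have "\<bar>r - 1\<bar> * (\<bar>l\<bar> * \<xi> powr (l - 1)) \<le> \<bar>r - 1\<bar> * (\<bar>l\<bar> * R powr (\<bar>l\<bar> + 1))"
    by (intro mult_left_mono) auto
  then show ?thesis by (simp add: \<xi>(3) abs_mult mult_ac)
qed

text \<open>Telescoping by \<open>a * b - 1 = a * (b - 1) + (a - 1)\<close>. The dependence on
  \<open>R\<close> has to be polynomial, because \<open>R\<close> will grow like
  \<open>1 + L * \<tau> t\<close>.\<close>

lemma prod_powr_diff_one_bound:
  fixes r l :: "'j \<Rightarrow> real" and R :: real
  assumes "finite J" "R \<ge> 1" "\<And>j. j \<in> J \<Longrightarrow> 1 / R \<le> r j" "\<And>j. j \<in> J \<Longrightarrow> r j \<le> R"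
  shows "\<bar>(\<Prod>j\<in>J. r j powr l j) - 1\<bar> \<le> R powr (\<Sum>j\<in>J. \<bar>l j\<bar> + 1) * (\<Sum>j\<in>J. \<bar>l j\<bar> * \<bar>r j - 1\<bar>)"
  using assms(1,3,4)
proof (induction J rule: finite_induct)
  case empty
  then show ?case by simp
next
  case (insert k J)
  define a where "a = r k powr l k"
  define b where "b = (\<Prod>j\<in>J. r j powr l j)"
  define s where "s = (\<Sum>j\<in>J. \<bar>l j\<bar> + 1)"
  define S where "S = (\<Sum>j\<in>J. \<bar>l j\<bar> * \<bar>r j - 1\<bar>)"
  have S0: "S \<ge> 0" by (simp add: S_def sum_nonneg)
  have s0: "s \<ge> 0" by (simp add: s_def sum_nonneg)
  have IH: "\<bar>b - 1\<bar> \<le> R powr s * S" unfolding b_def s_def S_def using insert by auto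
  have R0: "1 / R > 0" using assms by simp
  have rk: "1 / R \<le> r k" "r k \<le> R" "r k > 0" using insert.prems(1)[of k] insert.prems(2)[of k] R0 by (simp_all, linarith)
  have "a \<le> R powr \<bar>l k\<bar> * 1 powr l k"
    unfolding a_def using rk assms(2) by (intro powr_comparable) (auto simp: field_simps)
  also have "\<dots> \<le> R powr (\<bar>l k\<bar> + 1)" using assms by (auto intro!: powr_mono)
  finally have a: "a \<le> R powr (\<bar>l k\<bar> + 1)" .
  have a1: "\<bar>a - 1\<bar> \<le> R powr (\<bar>l k\<bar> + 1) * (\<bar>l k\<bar> * \<bar>r k - 1\<bar>)"
    unfolding a_def using powr_diff_one_bound[OF assms(2) rk(1,2), of "l k"] by (simp add: mult_ac)
  have "\<bar>a * b - 1\<bar> = \<bar>a * (b - 1) + (a - 1)\<bar>" by (simp add: algebra_simps)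
  also have "\<dots> \<le> \<bar>a * (b - 1)\<bar> + \<bar>a - 1\<bar>" by (rule abs_triangle_ineq)
  also have "\<bar>a * (b - 1)\<bar> \<le> R powr (\<bar>l k\<bar> + 1) * (R powr s * S)"
    unfolding abs_mult using a IH by (intro mult_mono) (auto simp: a_def)
  also have "\<bar>a - 1\<bar> \<le> R powr (\<bar>l k\<bar> + 1) * (R powr s * (\<bar>l k\<bar> * \<bar>r k - 1\<bar>))"
  proof (rule order_trans[OF a1], rule mult_left_mono)
    have "1 \<le> R powr s" using assms(2) s0 by (simp add: ge_one_powr_ge_zero)
    then show "\<bar>l k\<bar> * \<bar>r k - 1\<bar> \<le> R powr s * (\<bar>l k\<bar> * \<bar>r k - 1\<bar>)"
      using mult_right_mono[of 1 "R powr s" "\<bar>l k\<bar> * \<bar>r k - 1\<bar>"] by simp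
  qed simp
  also have "R powr (\<bar>l k\<bar> + 1) * (R powr s * S) + R powr (\<bar>l k\<bar> + 1) * (R powr s * (\<bar>l k\<bar> * \<bar>r k - 1\<bar>))
     = R powr ((\<bar>l k\<bar> + 1) + s) * (\<bar>l k\<bar> * \<bar>r k - 1\<bar> + S)"
    by (simp add: powr_add algebra_simps)
  finally show ?case using insert.hyps by (simp add: a_def b_def s_def S_def)
qed

lemma nn_integral_diagonal:
  fixes c :: "'s::finite \<Rightarrow> real" and f :: "real ^ 's \<Rightarrow> ennreal"
  assumes c: "\<And>i. c i > 0" and [measurable]: "f \<in> borel_measurable borel"
  shows "(\<integral>\<^sup>+x. f x \<partial>lborel) = ennreal (\<Prod>i\<in>UNIV. c i) * (\<integral>\<^sup>+x. f (\<chi> i. c i * x $ i) \<partial>lborel)"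
proof -
  have Basis: "(Basis :: (real^'s) set) = range (\<lambda>i. axis i 1)" by (auto simp: Basis_vec_def)
  have inj: "inj (\<lambda>i. axis i 1 :: real^'s)" by (auto simp: inj_on_def axis_eq_axis)
  define h where "h b = c (inv (\<lambda>i. axis i 1 :: real^'s) b)" for b
  have h: "h (axis i 1) = c i" for i unfolding h_def using inv_f_f[OF inj, of i] by simp
  have T: "(0 :: real^'s) + (\<Sum>j\<in>Basis. (h j * (x \<bullet> j)) *\<^sub>R j) = (\<chi> i. c i * x $ i)" for x
  proof -
    have "(\<Sum>j\<in>Basis. (h j * (x \<bullet> j)) *\<^sub>R j) = (\<Sum>i\<in>UNIV. (c i * x $ i) *\<^sub>R axis i 1)"
      unfolding Basis by (subst sum.reindex[OF inj]) (simp add: h o_def inner_axis)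
    also have "\<dots> = (\<chi> i. c i * x $ i)"
      by (simp add: vec_eq_iff axis_def if_distrib[of "\<lambda>x. _ * x"] cong: if_cong)
    finally show ?thesis by simp
  qed
  have P: "(\<Prod>j\<in>Basis. \<bar>h j\<bar>) = (\<Prod>i\<in>UNIV. c i)"
    unfolding Basis using c by (subst prod.reindex[OF inj]) (simp add: h o_def less_imp_le)
  have "(lborel :: (real^'s) measure) = density (distr lborel borel (\<lambda>x. \<chi> i. c i * x $ i)) (\<lambda>_. \<Prod>i\<in>UNIV. c i)"
  proof -
    have "h j \<noteq> 0" if j: "j \<in> Basis" for j
    proof -
      obtain i where "j = axis i 1" using j Basis by auto
      then show ?thesis using c[of i] h[of i] by simp
    qed
    from lborel_affine_euclidean[of h "0 :: real^'s", OF this] show ?thesis unfolding T P .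
  qed
  then have "(\<integral>\<^sup>+x. f x \<partial>lborel) = (\<integral>\<^sup>+x. f x \<partial>density (distr lborel borel (\<lambda>x. \<chi> i. c i * x $ i)) (\<lambda>_. \<Prod>i\<in>UNIV. c i))"
    by simp
  also have "\<dots> = ennreal (\<Prod>i\<in>UNIV. c i) * (\<integral>\<^sup>+x. f (\<chi> i. c i * x $ i) \<partial>lborel)"
  proof -
    have [measurable]: "(\<lambda>x::real^'s. \<chi> i. c i * x $ i) \<in> borel_measurable borel"
      by (intro borel_measurable_continuous_onI continuous_intros)
    show ?thesis
      by (simp add: nn_integral_density nn_integral_distr nn_integral_cmult)
  qed
  finally show ?thesis .
qed

text \<open>\<open>Pi\<close> is an affine map onto a complement of the directions of \<open>F\<close>, so that
  \<open>t \<mapsto> t + (\<kappa> - 1) *\<^sub>R Pi t\<close> fixes \<open>F\<close> and scales by \<open>\<kappa>\<close> transversally to it.\<close>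

lemma transversal_scaling:
  fixes F :: "(real ^ 's) set"
  assumes "F \<noteq> {}" "aff_dim F = int d"
  obtains Pi :: "real ^ 's \<Rightarrow> real ^ 's" where
    "\<And>t. t \<in> F \<Longrightarrow> Pi t = 0"
    "\<And>t r. Pi (t + r *\<^sub>R Pi t) = (1 + r) *\<^sub>R Pi t"
    "\<And>f t r. affine_form f \<Longrightarrow> (\<And>t. t \<in> F \<Longrightarrow> f t = 0) \<Longrightarrow> f (t + r *\<^sub>R Pi t) = (1 + r) * f t"
    "\<And>V u. finite V \<Longrightarrow> sum u V = 1 \<Longrightarrow> Pi (\<Sum>v\<in>V. u v *\<^sub>R v) = (\<Sum>v\<in>V. u v *\<^sub>R Pi v)"
    "\<And>\<kappa> f. \<kappa> > 0 \<Longrightarrow> f \<in> borel_measurable borel \<Longrightarrow>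
      ennreal (\<kappa> powr (CARD('s) - real d)) * (\<integral>\<^sup>+t. f (t + (\<kappa> - 1) *\<^sub>R Pi t) \<partial>lborel) = (\<integral>\<^sup>+t. f t \<partial>lborel)"
    "continuous_on UNIV Pi"
proof -
  obtain p where p: "p \<in> F" using assms(1) by auto
  define V0 where "V0 = (+) (- p) ` F"
  have dimV0: "dim V0 = d"
    using aff_dim_eq_dim[of p F] p hull_inc[of p F] assms(2) by (simp add: V0_def)
  obtain B0 where B0: "B0 \<subseteq> V0" "independent B0" "V0 \<subseteq> span B0" "card B0 = d"
    using basis_exists[of V0] dimV0 by metis
  \<comment> \<open>A basis of the directions of \<open>F\<close> completed to a basis of the space;
    \<open>S0\<close> below marks the indices of the vectors along \<open>F\<close>.\<close>
  obtain W where W: "B0 \<subseteq> W" "independent W" "UNIV \<subseteq> span W"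
    using maximal_independent_subset_extend[of B0 UNIV] B0(2) by auto
  have finW: "finite W" using W(2) independent_imp_finite by blast
  have cardW: "card W = CARD('s)"
    using W by (metis DIM_cart DIM_real basis_card_eq_dim dim_UNIV mult.right_neutral subset_UNIV)
  obtain w where w: "bij_betw w (UNIV :: 's set) W"
    using finite_same_card_bij[of "UNIV :: 's set" W] finW cardW by auto
  define S0 where "S0 = {i. w i \<in> B0}"
  have injw: "inj w" and rw: "range w = W" using w by (auto simp: bij_betw_def)
  have wS0: "w ` S0 = B0" using rw W(1) by (auto simp: S0_def image_iff)
  have cardS0: "card S0 = d"
    using B0(4) wS0 injw by (metis card_image inj_on_subset subset_UNIV)
  define A :: "real^'s \<Rightarrow> real^'s" where "A x = (\<Sum>i\<in>UNIV. x $ i *\<^sub>R w i)" for x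
  have linA: "linear A"
    unfolding A_def by (intro linearI) (auto simp: sum.distrib scaleR_add_left scaleR_sum_right)
  have surjA: "surj A"
  proof -
    have "x \<in> range A" for x
    proof -
      have "x \<in> span W" using W by auto
      then obtain u where u: "(\<Sum>v\<in>W. u v *\<^sub>R v) = x" using span_finite[OF finW] by auto
      have "x = A (\<chi> i. u (w i))"
        unfolding A_def u[symmetric] rw[symmetric] using injw by (subst sum.reindex) (auto simp: o_def)
      then show ?thesis by blast
    qed
    then show ?thesis by auto
  qed
  have injA: "inj A" using linA surjA linear_surjective_imp_injective by blast
  obtain B where B: "linear B" "\<And>x. B (A x) = x" "\<And>x. A (B x) = x"
    by (metis linA linear_injective_isomorphism injA)
  define N :: "real^'s \<Rightarrow> real^'s" where "N x = (\<chi> i. if i \<in> S0 then 0 else x $ i)" for x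
  have linN: "linear N" by (intro linearI) (auto simp: N_def vec_eq_iff)
  \<comment> \<open>The projection along \<open>span B0\<close> onto the span of the remaining basis
    vectors.\<close>
  define Q where "Q x = A (N (B x))" for x
  have linQ: "linear Q"
    unfolding Q_def using linear_compose[OF linear_compose[OF B(1) linN] linA] by (simp add: o_def)
  have QQ: "Q (Q x) = Q x" for x
    unfolding Q_def B(2) by (simp add: N_def cong: if_cong)
  define Pi where "Pi t = Q (t - p)" for t
  have V0z: "Q x = 0" if x: "x \<in> V0" for x
  proof -
    have "finite B0" using B0(2) independent_imp_finite by blast
    obtain u where u: "(\<Sum>v\<in>B0. u v *\<^sub>R v) = x" using x B0(3) unfolding span_finite[OF \<open>finite B0\<close>] by blast
    have "x = A (\<chi> i. if i \<in> S0 then u (w i) else 0)"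
    proof -
      have "x = (\<Sum>i\<in>S0. u (w i) *\<^sub>R w i)"
        unfolding u[symmetric] wS0[symmetric] using injw by (subst sum.reindex) (auto simp: o_def intro: inj_on_subset)
      also have "\<dots> = (\<Sum>i\<in>UNIV. (if i \<in> S0 then u (w i) else 0) *\<^sub>R w i)"
        by (intro sum.mono_neutral_cong_left) auto
      finally show ?thesis by (simp add: A_def)
    qed
    then have "N (B x) = N (\<chi> i. if i \<in> S0 then u (w i) else 0)" using B(2) by metis
    then have "N (B x) = 0" by (simp add: N_def vec_eq_iff)
    then show ?thesis unfolding Q_def using linear_0[OF linA] by simp
  qed
  have Pi_shift: "Pi (t + r *\<^sub>R Pi t) = (1 + r) *\<^sub>R Pi t" for t r
  proof -
    have "Pi (t + r *\<^sub>R Pi t) = Q ((t - p) + r *\<^sub>R Q (t - p))" by (simp add: Pi_def algebra_simps)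
    also have "\<dots> = Q (t - p) + r *\<^sub>R Q (Q (t - p))"
      by (simp add: linear_add[OF linQ] linear_cmul[OF linQ])
    finally show ?thesis by (simp add: QQ Pi_def scaleR_add_left)
  qed
  have Pi_F: "Pi t = 0" if "t \<in> F" for t
    unfolding Pi_def by (rule V0z) (use that in \<open>auto simp: V0_def image_iff\<close>)
  have Pi_form: "f (t + r *\<^sub>R Pi t) = (1 + r) * f t" if f: "affine_form f" "\<And>t. t \<in> F \<Longrightarrow> f t = 0" for f t r
  proof -
    obtain c e where ce: "f = (\<lambda>t. c + e \<bullet> t)" using f(1) by (auto simp: affine_form_def)
    have cp: "c = - (e \<bullet> p)" using f(2)[OF p] by (simp add: ce)
    \<comment> \<open>The linear part of a form vanishing on \<open>F\<close> kills the directions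
      of \<open>F\<close>, so it does not notice the projection.\<close>
    have eV0: "e \<bullet> b = 0" if b: "b \<in> B0" for b
    proof -
      obtain t where "t \<in> F" "b = - p + t" using B0(1) b unfolding V0_def by blast
      then show ?thesis using f(2)[of t] cp by (simp add: ce inner_diff_right)
    qed
    have "e \<bullet> x = e \<bullet> Q x" for x
    proof -
      have "e \<bullet> A z = e \<bullet> A (N z)" for z
        unfolding A_def inner_sum_right
      proof (intro sum.cong refl)
        fix i show "e \<bullet> z $ i *\<^sub>R w i = e \<bullet> N z $ i *\<^sub>R w i"
          using eV0[of "w i"] by (auto simp: N_def S0_def)
      qed
      from this[of "B x"] show ?thesis by (simp add: B(3) Q_def)
    qed
    then have "e \<bullet> Pi t = f t" by (simp add: Pi_def ce cp inner_diff_right flip: \<open>\<And>x. e \<bullet> x = e \<bullet> Q x\<close>)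
    then show ?thesis by (simp add: ce inner_add_right algebra_simps)
  qed
  have Pi_sum: "Pi (\<Sum>v\<in>V. u v *\<^sub>R v) = (\<Sum>v\<in>V. u v *\<^sub>R Pi v)" if V: "finite V" "sum u V = 1" for V u
  proof -
    have "(\<Sum>v\<in>V. u v *\<^sub>R v) - p = (\<Sum>v\<in>V. u v *\<^sub>R (v - p))"
      using V by (simp add: scaleR_right_diff_distrib sum_subtractf flip: scaleR_sum_left)
    then show ?thesis unfolding Pi_def by (simp add: linear_sum[OF linQ] linear_cmul[OF linQ])
  qed
  have contQ: "continuous_on UNIV Q"
    using linQ by (simp add: linear_continuous_on linear_conv_bounded_linear)
  have contPi: "continuous_on UNIV Pi"
    unfolding Pi_def by (intro continuous_on_compose2[OF contQ] continuous_intros) auto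
  obtain m where m: "m > 0" "\<And>f. f \<in> borel_measurable borel \<Longrightarrow>
      (\<integral>\<^sup>+x. f (A x) \<partial>lborel) = ennreal m * (\<integral>\<^sup>+x. f x \<partial>lborel)"
    using nn_integral_linear_injective[OF linA injA] by auto
  have [measurable]: "Pi \<in> borel_measurable borel" using contPi by (rule borel_measurable_continuous_onI)
  have [measurable]: "A \<in> borel_measurable borel"
    using linA by (intro borel_measurable_continuous_onI) (simp add: linear_continuous_on linear_conv_bounded_linear)
  \<comment> \<open>In the basis \<open>W\<close> the scaling is diagonal, with entry 1 in the
    \<open>d\<close> directions of \<open>F\<close> and \<kappa> in the others. The factor
    \<open>m\<close> of the change of basis appears on both sides and cancels.\<close>
  have Pi_int: "ennreal (\<kappa> powr (CARD('s) - real d)) * (\<integral>\<^sup>+t. f (t + (\<kappa> - 1) *\<^sub>R Pi t) \<partial>lborel) = (\<integral>\<^sup>+t. f t \<partial>lborel)"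
    if \<kappa>: "\<kappa> > 0" and [measurable]: "f \<in> borel_measurable borel" for \<kappa> and f :: "real^'s \<Rightarrow> ennreal"
  proof -
    define c where "c i = (if i \<in> S0 then 1 else \<kappa>)" for i
    have c0: "c i > 0" for i using \<kappa> by (simp add: c_def)
    have trans: "(\<integral>\<^sup>+t. g t \<partial>lborel) = (\<integral>\<^sup>+t. g (p + t) \<partial>lborel)" if [measurable]: "g \<in> borel_measurable borel"
      for g :: "real^'s \<Rightarrow> ennreal"
      by (subst lborel_distr_plus[of p, symmetric]) (simp add: nn_integral_distr)
    have prod_c: "(\<Prod>i\<in>UNIV. c i) = \<kappa> powr (CARD('s) - real d)"
    proof -
      have "(\<Prod>i\<in>UNIV. c i) = \<kappa> ^ card (- S0)" unfolding c_def by (subst prod.If_cases) auto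
      also have "card (- S0) = CARD('s) - d" using cardS0 by (simp add: card_Diff_subset Compl_eq_Diff_UNIV)
      also have "d \<le> CARD('s)" unfolding cardS0[symmetric] by (intro card_mono) auto
      then have "\<kappa> ^ (CARD('s) - d) = \<kappa> powr (CARD('s) - real d)"
        using \<kappa> by (simp add: powr_realpow flip: of_nat_diff)
      finally show ?thesis .
    qed
    have T: "p + A x + (\<kappa> - 1) *\<^sub>R Pi (p + A x) = p + A (\<chi> i. c i * x $ i)" for x
    proof -
      have "(\<kappa> - 1) *\<^sub>R Pi (p + A x) = A ((\<kappa> - 1) *\<^sub>R N x)"
        by (simp add: Pi_def Q_def B(2) linear_cmul[OF linA])
      then have "A x + (\<kappa> - 1) *\<^sub>R Pi (p + A x) = A (x + (\<kappa> - 1) *\<^sub>R N x)" by (simp add: linear_add[OF linA])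
      also have "x + (\<kappa> - 1) *\<^sub>R N x = (\<chi> i. c i * x $ i)"
        by (simp add: vec_eq_iff c_def N_def algebra_simps)
      finally show ?thesis by (simp add: add.assoc)
    qed
    have "ennreal m * (ennreal (\<kappa> powr (CARD('s) - real d)) * (\<integral>\<^sup>+t. f (t + (\<kappa> - 1) *\<^sub>R Pi t) \<partial>lborel))
        = ennreal (\<kappa> powr (CARD('s) - real d)) * (ennreal m * (\<integral>\<^sup>+t. f (p + t + (\<kappa> - 1) *\<^sub>R Pi (p + t)) \<partial>lborel))"
      by (subst trans) (measurable, simp add: mult_ac)
    also have "ennreal m * (\<integral>\<^sup>+t. f (p + t + (\<kappa> - 1) *\<^sub>R Pi (p + t)) \<partial>lborel)
        = (\<integral>\<^sup>+x. f (p + A x + (\<kappa> - 1) *\<^sub>R Pi (p + A x)) \<partial>lborel)"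
      by (rule m(2)[of "\<lambda>t. f (p + t + (\<kappa> - 1) *\<^sub>R Pi (p + t))", symmetric]) measurable
    also have "\<dots> = (\<integral>\<^sup>+x. f (p + A (\<chi> i. c i * x $ i)) \<partial>lborel)" by (simp only: T)
    also have "ennreal (\<kappa> powr (CARD('s) - real d)) * \<dots> = (\<integral>\<^sup>+x. f (p + A x) \<partial>lborel)"
      using nn_integral_diagonal[of c "\<lambda>x. f (p + A x)", OF c0] by (simp add: prod_c)
    also have "\<dots> = ennreal m * (\<integral>\<^sup>+t. f (p + t) \<partial>lborel)"
      by (rule m(2)[of "\<lambda>t. f (p + t)"]) measurable
    also have "\<dots> = ennreal m * (\<integral>\<^sup>+t. f t \<partial>lborel)" by (subst trans[of f]) auto
    finally show ?thesis using m(1) by (simp add: ennreal_mult_cancel_left)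
  qed
  show ?thesis
    by (rule that[of Pi, OF Pi_F Pi_shift Pi_form Pi_sum Pi_int contPi])
qed

text \<open>Successive doublings contribute a geometric series, so any two scales above
  \<open>L\<close> differ by \<open>O(L powr (- \<epsilon>))\<close>. This gives the limit and the
  rate at once.\<close>

lemma doubling_cauchy_limit:
  fixes f :: "real \<Rightarrow> real"
  assumes K: "K \<ge> 0" and \<epsilon>: "\<epsilon> > 0"
    and f: "\<And>L L'. 1 \<le> L \<Longrightarrow> L \<le> L' \<Longrightarrow> L' \<le> 2 * L \<Longrightarrow> \<bar>f L' - f L\<bar> \<le> K * L powr (- \<epsilon>)"
  shows "\<exists>c K'. K' \<ge> 0 \<and> (\<forall>L\<ge>1. \<bar>f L - c\<bar> \<le> K' * L powr (- \<epsilon>))"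
proof -
  define q where "q = 2 powr (- \<epsilon>)"
  have q: "0 < q" "q < 1" using \<epsilon> by (auto simp: q_def powr_less_one)
  \<comment> \<open>The solution of \<open>K' = K + K' * q\<close>, which makes the induction over
    doublings close.\<close>
  define K' where "K' = K / (1 - q)"
  have K': "K' \<ge> 0" "K + K' * q = K'" using K q by (auto simp: K'_def field_simps)
  have step: "\<bar>f L' - f L\<bar> \<le> K' * L powr (- \<epsilon>)" if "1 \<le> L" "L \<le> L'" "L' \<le> 2 ^ n * L" for n L L'
    using that
  proof (induction n arbitrary: L)
    case 0
    then have "L' = L" by simp
    then show ?case using K' by simp
  next
    case (Suc n)
    have KK': "K * L powr (- \<epsilon>) \<le> K' * L powr (- \<epsilon>)"
    proof (rule mult_right_mono)
      have "K' * q \<ge> 0" using K' q by simp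
      then show "K \<le> K'" using K'(2) by linarith
    qed simp
    show ?case
    proof (cases "L' \<le> 2 * L")
      case True
      then show ?thesis using f[of L L'] Suc.prems KK' by linarith
    next
      case False
      have "\<bar>f L' - f (2 * L)\<bar> \<le> K' * (2 * L) powr (- \<epsilon>)"
        using Suc.prems False by (intro Suc.IH) auto
      also have "(2 * L) powr (- \<epsilon>) = q * L powr (- \<epsilon>)" using Suc.prems by (simp add: powr_mult q_def)
      finally have "\<bar>f L' - f L\<bar> \<le> K' * (q * L powr (- \<epsilon>)) + K * L powr (- \<epsilon>)"
        using f[of L "2 * L"] Suc.prems by linarith
      also have "\<dots> = (K + K' * q) * L powr (- \<epsilon>)" by (simp add: algebra_simps)
      finally show ?thesis by (simp only: K'(2))
    qed
  qed
  have far: "\<bar>f L' - f L\<bar> \<le> K' * L powr (- \<epsilon>)" if "1 \<le> L" "L \<le> L'" for L L'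
  proof -
    obtain n where "L' / L < 2 ^ n" using real_arch_pow[of 2 "L' / L"] by auto
    then have "L' \<le> 2 ^ n * L" using that by (simp add: field_simps)
    then show ?thesis using step that by blast
  qed
  have lim0: "(\<lambda>n. K' * (real n) powr (- \<epsilon>)) \<longlonglongrightarrow> K' * 0"
    using \<epsilon> by (intro tendsto_mult tendsto_const tendsto_neg_powr filterlim_real_sequentially) auto
  have "Cauchy (\<lambda>n. f (real n))"
  proof (rule CauchyI)
    fix e :: real assume "e > 0"
    then have "\<forall>\<^sub>F n in sequentially. K' * real n powr (- \<epsilon>) < e / 2"
      using order_tendstoD(2)[OF lim0, of "e / 2"] by simp
    then obtain N where N: "\<And>n. n \<ge> N \<Longrightarrow> K' * real n powr (- \<epsilon>) < e / 2"
      by (auto simp: eventually_sequentially)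
    show "\<exists>M. \<forall>m\<ge>M. \<forall>n\<ge>M. norm (f (real m) - f (real n)) < e"
    proof (intro exI[of _ "max 1 N"] allI impI)
      fix m n assume mn: "m \<ge> max 1 N" "n \<ge> max 1 N"
      have M: "1 \<le> real (max 1 N)" "real (max 1 N) \<le> real m" "real (max 1 N) \<le> real n"
        using mn by linarith+
      have "K' * real (max 1 N) powr (- \<epsilon>) < e / 2" by (rule N) simp
      then show "norm (f (real m) - f (real n)) < e"
        using far[OF M(1,2)] far[OF M(1,3)] unfolding real_norm_def by linarith
    qed
  qed
  then obtain c where c: "(\<lambda>n. f (real n)) \<longlonglongrightarrow> c" using Cauchy_convergent convergent_def by blast
  show ?thesis
  proof (rule exI[of _ c], rule exI[of _ K'], intro conjI K' allI impI)
    fix L :: real assume L: "L \<ge> 1"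
    have "(\<lambda>n. \<bar>f L - f (real n)\<bar>) \<longlonglongrightarrow> \<bar>f L - c\<bar>" by (intro tendsto_intros c)
    moreover have "\<forall>\<^sub>F n in sequentially. \<bar>f L - f (real n)\<bar> \<le> K' * L powr (- \<epsilon>)"
      using eventually_ge_at_top[of "nat \<lceil>L\<rceil>"]
    proof eventually_elim
      case (elim n)
      then have "L \<le> real n" by linarith
      from far[OF L this] show ?case by linarith
    qed
    ultimately show "\<bar>f L - c\<bar> \<le> K' * L powr (- \<epsilon>)" by (rule tendsto_upperbound) simp
  qed
qed

section \<open>Absorbing additional factors into the weight\<close>

context polytope_face
begin

lemma y_bound:
  obtains Y where "\<And>j. j \<in> J' \<Longrightarrow> Y j > 0" "\<And>j t. j \<in> J' \<Longrightarrow> t \<in> P \<Longrightarrow> y j t \<le> Y j"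
proof -
  have "\<forall>j\<in>J'. \<exists>Y>0. \<forall>t\<in>P. y j t \<le> Y"
  proof
    fix j assume "j \<in> J'"
    then have "affine_form (y j)" using affine_y J'_subset by blast
    then obtain K where "K > 0" "\<And>t. t \<in> P \<Longrightarrow> \<bar>y j t\<bar> \<le> K"
      using affine_form_bounded[OF _ bounded_P] by blast
    then show "\<exists>Y>0. \<forall>t\<in>P. y j t \<le> Y" by (intro exI[of _ K]) (auto dest: abs_le_D1)
  qed
  from bchoice[OF this] obtain Y where "\<forall>j\<in>J'. Y j > 0 \<and> (\<forall>t\<in>P. y j t \<le> Y j)" ..
  then show ?thesis using that[of Y] by blast
qed

text \<open>Half of the decay pays for the power of \<open>1 + L * \<tau> t\<close>, and one
  \<epsilon> from each exponent is released as the bounded product of the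
  \<open>(1 / L + y j t) powr \<epsilon>\<close>. Dropping the product gives finiteness of the mass;
  keeping the factor for one \<open>k\<close> makes the weight small where \<open>y k\<close> is
  small. Changing the shifts \<open>a j\<close> to 1 costs a constant.\<close>

lemma weight_gain:
  fixes p :: real
  assumes a: "\<And>j. a j > 0" and \<epsilon>: "0 < \<epsilon>"
  shows "\<exists>K>0. \<forall>L\<ge>1. \<forall>t\<in>P.
      weight a 0 1 L t * (1 + L * \<tau> t) powr p \<le> K * weight (\<lambda>_. 1) \<epsilon> (1/2) L t \<and>
      (\<forall>k\<in>J'. weight a 0 1 L t * (1 + L * \<tau> t) powr p \<le> K * weight (\<lambda>_. 1) \<epsilon> (1/2) L t * (1 / L + y k t) powr \<epsilon>)"
proof -
  obtain Y where Y: "\<And>j. j \<in> J' \<Longrightarrow> Y j > 0" "\<And>j t. j \<in> J' \<Longrightarrow> t \<in> P \<Longrightarrow> y j t \<le> Y j"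
    using y_bound by metis
  obtain K1 where K1: "K1 > 0" "\<And>x. x \<ge> 1 \<Longrightarrow> x powr p * exp (- 1 * x) \<le> K1 * exp (- (1 / 2) * x)"
    using powr_times_exp_bound[of 1 p] by auto
  define R where "R j = max (a j) (1 / a j)" for j
  have R: "a j \<le> R j" "1 \<le> R j * a j" "R j \<ge> 1" for j
  proof -
    show "a j \<le> R j" by (simp add: R_def)
    have "1 = 1 / a j * a j" using a[of j] by simp
    also have "\<dots> \<le> R j * a j" using a[of j] by (intro mult_right_mono) (auto simp: R_def)
    finally show "1 \<le> R j * a j" .
    show "R j \<ge> 1" using a[of j] by (cases "a j \<ge> 1") (auto simp: R_def le_max_iff_disj)
  qed
  define K2 where "K2 = (\<Prod>j\<in>J'. (1 + Y j) powr \<epsilon>)"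
  define K3 where "K3 = (\<Prod>j\<in>J'. R j powr \<bar>l j\<bar>)"
  have K2: "K2 > 0" unfolding K2_def by (intro prod_pos) (use Y(1) in fastforce)
  have K3: "K3 > 0" unfolding K3_def
  proof (intro prod_pos)
    fix j show "0 < R j powr \<bar>l j\<bar>" using R(3)[of j] by simp
  qed
  define K where "K = exp 1 * K1 * K2 * K3"
  show ?thesis
  proof (intro exI[of _ K] conjI allI impI ballI)
    show "K > 0" using K1 K2 K3 by (simp add: K_def)
    fix L :: real and t assume L: "L \<ge> 1" and t: "t \<in> P"
    define x where "x = 1 + L * \<tau> t"
    have \<tau>: "\<tau> t \<ge> 0" using tau_nonneg t by auto
    have x: "x \<ge> 1" using L \<tau> by (simp add: x_def)
    define u where "u j = 1 / L + y j t" for j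
    have u: "u j > 0" "u j \<le> 1 + Y j" "u j \<ge> 1 / L" if "j \<in> J'" for j
    proof -
      have "1 / L > 0" "1 / L \<le> 1" "y j t \<ge> 0" "y j t \<le> Y j"
        using L Y that y_nonneg[OF t] J'_subset t by auto
      then show "u j > 0" "u j \<le> 1 + Y j" "u j \<ge> 1 / L" unfolding u_def by linarith+
    qed
    have e: "exp (- L * (1 * \<tau> t)) * x powr p \<le> exp 1 * K1 * exp (- L * (1 / 2 * \<tau> t))"
    proof -
      have "exp (- L * (1 * \<tau> t)) * x powr p = exp 1 * (x powr p * exp (- 1 * x))"
      proof -
        have "exp (- L * (1 * \<tau> t)) = exp 1 * exp (- 1 * x)" by (simp add: x_def flip: exp_add)
        then show ?thesis by simp
      qed
      also have "\<dots> \<le> exp 1 * (K1 * exp (- (1 / 2) * x))" by (intro mult_left_mono K1(2) x) auto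
      also have "\<dots> \<le> exp 1 * (K1 * exp (- L * (1 / 2 * \<tau> t)))"
        using K1 by (intro mult_left_mono) (auto simp: x_def field_simps)
      finally show ?thesis by (simp add: mult_ac)
    qed
    have pr: "(\<Prod>j\<in>J'. (a j / L + y j t) powr (l j - 0)) \<le> K3 * ((\<Prod>j\<in>J'. u j powr (l j - \<epsilon>)) * (\<Prod>j\<in>J'. u j powr \<epsilon>))"
    proof -
      have "(\<Prod>j\<in>J'. (a j / L + y j t) powr (l j - 0)) \<le> (\<Prod>j\<in>J'. R j powr \<bar>l j\<bar> * (u j powr (l j - \<epsilon>) * u j powr \<epsilon>))"
      proof (intro prod_mono conjI)
        fix j assume j: "j \<in> J'"
        have y0: "y j t \<ge> 0" using j y_nonneg[OF t] J'_subset by auto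
        have yR: "y j t \<le> R j * y j t" using mult_right_mono[OF R(3)[of j] y0] by simp
        have aL: "a j / L > 0" using a[of j] L by simp
        have "(a j / L + y j t) powr l j \<le> R j powr \<bar>l j\<bar> * u j powr l j"
        proof (rule powr_comparable)
          show "0 < a j / L + y j t" using aL y0 by linarith
          show "0 < u j" using u j by auto
          have "a j / L \<le> R j / L" using R(1)[of j] L by (intro divide_right_mono) auto
          then show "a j / L + y j t \<le> R j * u j" using yR by (simp add: u_def distrib_left)
          have "1 / L \<le> (R j * a j) / L" using R(2)[of j] L by (intro divide_right_mono) auto
          then show "u j \<le> R j * (a j / L + y j t)" using yR by (simp add: u_def distrib_left)
        qed
        also have "u j powr l j = u j powr (l j - \<epsilon>) * u j powr \<epsilon>" by (simp flip: powr_add)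
        finally show "(a j / L + y j t) powr (l j - 0) \<le> R j powr \<bar>l j\<bar> * (u j powr (l j - \<epsilon>) * u j powr \<epsilon>)" by simp
      qed auto
      then show ?thesis by (simp add: prod.distrib K3_def)
    qed
    define U where "U = (\<Prod>j\<in>J'. u j powr (l j - \<epsilon>))"
    have U0: "U \<ge> 0" by (simp add: U_def prod_nonneg)
    have main: "weight a 0 1 L t * x powr p \<le> K * weight (\<lambda>_. 1) \<epsilon> (1/2) L t * B"
      if B: "(\<Prod>j\<in>J'. u j powr \<epsilon>) \<le> K2 * B" "B \<ge> 0" for B
    proof -
      have "weight a 0 1 L t * x powr p = (exp (- L * (1 * \<tau> t)) * x powr p) * (\<Prod>j\<in>J'. (a j / L + y j t) powr (l j - 0))"
        by (simp add: weight_def)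
      also have "\<dots> \<le> (exp 1 * K1 * exp (- L * (1 / 2 * \<tau> t))) * (K3 * (U * (K2 * B)))"
      proof (rule mult_mono[OF e])
        have "K3 * (U * (\<Prod>j\<in>J'. u j powr \<epsilon>)) \<le> K3 * (U * (K2 * B))"
          using B K3 U0 by (intro mult_left_mono) auto
        then show "(\<Prod>j\<in>J'. (a j / L + y j t) powr (l j - 0)) \<le> K3 * (U * (K2 * B))"
          using pr unfolding U_def by linarith
      qed (use K1 in \<open>auto intro!: prod_nonneg\<close>)
      also have "\<dots> = K * weight (\<lambda>_. 1) \<epsilon> (1/2) L t * B"
        by (simp add: K_def weight_def U_def u_def mult_ac)
      finally show ?thesis .
    qed
    have le1: "u j powr \<epsilon> \<le> (1 + Y j) powr \<epsilon>" if "j \<in> J'" for j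
      using u[OF that] \<epsilon> by (intro powr_mono2) auto
    have "(\<Prod>j\<in>J'. u j powr \<epsilon>) \<le> K2" unfolding K2_def using le1 by (intro prod_mono) auto
    then show "weight a 0 1 L t * (1 + L * \<tau> t) powr p \<le> K * weight (\<lambda>_. 1) \<epsilon> (1/2) L t"
      using main[of 1] by (simp add: x_def)
    fix k assume k: "k \<in> J'"
    have "(\<Prod>j\<in>J'. u j powr \<epsilon>) \<le> K2 * u k powr \<epsilon>"
    proof -
      have "(\<Prod>j\<in>J' - {k}. u j powr \<epsilon>) \<le> (\<Prod>j\<in>J' - {k}. (1 + Y j) powr \<epsilon>)"
        using le1 by (intro prod_mono) auto
      also have "\<dots> \<le> (1 + Y k) powr \<epsilon> * (\<Prod>j\<in>J' - {k}. (1 + Y j) powr \<epsilon>)"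
      proof -
        have "1 \<le> (1 + Y k) powr \<epsilon>" using Y(1)[OF k] \<epsilon> by (intro ge_one_powr_ge_zero) auto
        then show ?thesis
          using mult_right_mono[of 1 "(1 + Y k) powr \<epsilon>" "\<Prod>j\<in>J' - {k}. (1 + Y j) powr \<epsilon>"] by (simp add: prod_nonneg)
      qed
      also have "\<dots> = K2" unfolding K2_def by (rule prod.remove[OF finite_J' k, symmetric])
      finally have "u k powr \<epsilon> * (\<Prod>j\<in>J' - {k}. u j powr \<epsilon>) \<le> u k powr \<epsilon> * K2"
        by (intro mult_left_mono) auto
      then show ?thesis by (simp add: prod.remove[OF finite_J' k] mult.commute)
    qed
    then show "weight a 0 1 L t * (1 + L * \<tau> t) powr p \<le> K * weight (\<lambda>_. 1) \<epsilon> (1/2) L t * (1 / L + y k t) powr \<epsilon>"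
      using main[of "u k powr \<epsilon>"] by (simp add: x_def u_def)
  qed
qed

text \<open>For \<open>v = L * (1 / L + y k t)\<close> the released factor divided by
  \<open>v\<close> equals \<open>L powr (- \<epsilon>) * v powr (\<epsilon> - 1)\<close>, and the
  last power is at most 1 because \<open>v \<ge> 1\<close> and \<epsilon> < 1. Denominators
  \<open>1 + L * y k t\<close> arise as relative perturbations of the forms.\<close>

lemma weight_gain':
  fixes p :: real
  assumes a: "\<And>j. a j > 0" and \<epsilon>: "0 < \<epsilon>" "\<epsilon> < 1"
  obtains K where "K > 0" "\<And>L t k. L \<ge> 1 \<Longrightarrow> t \<in> P \<Longrightarrow> k \<in> J' \<Longrightarrow>
      weight a 0 1 L t * (1 + L * \<tau> t) powr p / (1 + L * y k t) \<le> K * (L powr (- \<epsilon>) * weight (\<lambda>_. 1) \<epsilon> (1/2) L t)"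
proof -
  obtain K where K: "K > 0" "\<And>L t k. L \<ge> 1 \<Longrightarrow> t \<in> P \<Longrightarrow> k \<in> J' \<Longrightarrow>
      weight a 0 1 L t * (1 + L * \<tau> t) powr p \<le> K * weight (\<lambda>_. 1) \<epsilon> (1/2) L t * (1 / L + y k t) powr \<epsilon>"
    using weight_gain[of a \<epsilon> p, OF a \<epsilon>(1)] by blast
  show ?thesis
  proof (rule that[OF K(1)])
    fix L t k assume L: "L \<ge> (1::real)" and t: "t \<in> P" and k: "k \<in> J'"
    define u where "u = 1 / L + y k t"
    have y0: "y k t \<ge> 0" using y_nonneg[OF t] J'_subset k by auto
    have L0: "1 / L > 0" using L by simp
    have u0: "u > 0" using y0 L0 unfolding u_def by linarith
    have Lu: "1 + L * y k t = L * u" using L by (simp add: u_def distrib_left)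
    have Lu1: "L * u \<ge> 1" using y0 L unfolding Lu[symmetric] by simp
    have "u powr \<epsilon> / (L * u) = L powr (- \<epsilon>) * ((L * u) powr \<epsilon> / (L * u) powr 1)"
      using L u0 by (simp add: powr_mult powr_minus field_simps)
    also have "\<dots> = L powr (- \<epsilon>) * (L * u) powr (\<epsilon> - 1)" by (simp only: powr_diff)
    also have "\<dots> \<le> L powr (- \<epsilon>) * 1"
    proof (intro mult_left_mono)
      have "(L * u) powr (\<epsilon> - 1) \<le> (L * u) powr 0" using Lu1 \<epsilon> by (intro powr_mono) auto
      then show "(L * u) powr (\<epsilon> - 1) \<le> 1" using Lu1 by (auto split: if_splits)
    qed simp
    finally have *: "u powr \<epsilon> / (L * u) \<le> L powr (- \<epsilon>)" by simp
    have "weight a 0 1 L t * (1 + L * \<tau> t) powr p / (1 + L * y k t)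
       \<le> K * weight (\<lambda>_. 1) \<epsilon> (1/2) L t * u powr \<epsilon> / (L * u)"
      unfolding Lu using K(2)[OF L t k] L u0 unfolding u_def by (intro divide_right_mono) auto
    also have "\<dots> = K * weight (\<lambda>_. 1) \<epsilon> (1/2) L t * (u powr \<epsilon> / (L * u))" by simp
    also have "\<dots> \<le> K * weight (\<lambda>_. 1) \<epsilon> (1/2) L t * L powr (- \<epsilon>)"
      using K weight_nonneg by (intro mult_left_mono *) auto
    finally show "weight a 0 1 L t * (1 + L * \<tau> t) powr p / (1 + L * y k t) \<le> K * (L powr (- \<epsilon>) * weight (\<lambda>_. 1) \<epsilon> (1/2) L t)"
      by (simp add: mult_ac)
  qed
qed

section \<open>Effect of a transversal scaling on the weight\<close>

context
  fixes Pi :: "real ^ 's \<Rightarrow> real ^ 's"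
  assumes Pi_F: "\<And>t. t \<in> F \<Longrightarrow> Pi t = 0"
    and Pi_shift: "\<And>t r. Pi (t + r *\<^sub>R Pi t) = (1 + r) *\<^sub>R Pi t"
    and Pi_form: "\<And>f t r. affine_form f \<Longrightarrow> (\<And>t. t \<in> F \<Longrightarrow> f t = 0) \<Longrightarrow> f (t + r *\<^sub>R Pi t) = (1 + r) * f t"
    and Pi_sum: "\<And>V u. finite V \<Longrightarrow> sum u V = 1 \<Longrightarrow> Pi (\<Sum>v\<in>V. u v *\<^sub>R v) = (\<Sum>v\<in>V. u v *\<^sub>R Pi v)"
begin

text \<open>\<open>Pi\<close> and \<tau> respect convex combinations, so the bound passes from the
  vertices to \<open>P\<close>. At vertices with \<tau> = 0 both sides vanish.\<close>

lemma Pi_bound: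
  obtains C where "C > 0" "\<And>t. t \<in> P \<Longrightarrow> norm (Pi t) \<le> C * \<tau> t"
proof -
  obtain V where V: "finite V" "P = convex hull V" using polytope_P by (auto simp: polytope_def)
  have VP: "V \<subseteq> P" unfolding V(2) by (rule hull_subset)
  \<comment> \<open>Vertices on \<open>F\<close> contribute 0 to the sum, since division by 0 yields
    0.\<close>
  define C where "C = 1 + (\<Sum>v\<in>V. norm (Pi v) / \<tau> v)"
  have C: "C > 0" unfolding C_def using VP tau_nonneg
    by (intro add_pos_nonneg sum_nonneg divide_nonneg_nonneg) auto
  have Cv: "norm (Pi v) \<le> C * \<tau> v" if v: "v \<in> V" for v
  proof (cases "\<tau> v = 0")
    case True
    then have "v \<in> F" using v VP by (auto simp: F_eq)
    then show ?thesis using True by (simp add: Pi_F)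
  next
    case False
    then have \<tau>: "\<tau> v > 0" using v VP tau_nonneg[of v] by auto
    have "norm (Pi v) / \<tau> v \<le> (\<Sum>v\<in>V. norm (Pi v) / \<tau> v)"
      by (rule member_le_sum) (use v V VP tau_nonneg in auto)
    then have "norm (Pi v) / \<tau> v \<le> C" by (simp add: C_def)
    then show ?thesis using \<tau> by (simp add: field_simps)
  qed
  show ?thesis
  proof (rule that[OF C])
    fix t assume "t \<in> P"
    then obtain u where u: "\<And>v. v \<in> V \<Longrightarrow> 0 \<le> u v" "sum u V = 1" "(\<Sum>v\<in>V. u v *\<^sub>R v) = t"
      unfolding V(2) convex_hull_finite[OF V(1)] by auto
    have "norm (Pi t) \<le> (\<Sum>v\<in>V. norm (u v *\<^sub>R Pi v))"
      unfolding u(3)[symmetric] Pi_sum[OF V(1) u(2)] by (rule norm_sum)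
    also have "\<dots> = (\<Sum>v\<in>V. u v * norm (Pi v))" using u by (intro sum.cong) auto
    also have "\<dots> \<le> (\<Sum>v\<in>V. u v * (C * \<tau> v))" using u Cv by (intro sum_mono mult_left_mono) auto
    also have "\<dots> = C * (\<Sum>v\<in>V. u v * \<tau> v)" by (simp add: sum_distrib_left mult_ac)
    also have "(\<Sum>v\<in>V. u v * \<tau> v) = \<tau> t"
    proof -
      obtain c w where ce: "\<tau> = (\<lambda>t. c + w \<bullet> t)" using affine_tau by (auto simp: affine_form_def)
      have "(\<Sum>v\<in>V. u v * \<tau> v) = c * sum u V + w \<bullet> (\<Sum>v\<in>V. u v *\<^sub>R v)"
        by (simp add: ce distrib_left sum.distrib inner_sum_right sum_distrib_left mult_ac)
      then show ?thesis using u by (simp add: ce)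
    qed
    finally show "norm (Pi t) \<le> C * \<tau> t" .
  qed
qed

lemma y_shift_bound:
  obtains C where "C \<ge> 1"
    "\<And>t r j. t \<in> P \<Longrightarrow> \<bar>r\<bar> \<le> 1 \<Longrightarrow> j \<in> J \<Longrightarrow> \<bar>y j (t + r *\<^sub>R Pi t) - y j t\<bar> \<le> C * \<tau> t"
proof -
  obtain C0 where C0: "C0 > 0" "\<And>t. t \<in> P \<Longrightarrow> norm (Pi t) \<le> C0 * \<tau> t" using Pi_bound by metis
  have "\<forall>j\<in>J. \<exists>w. \<forall>s t. y j s - y j t = w \<bullet> (s - t)"
  proof
    fix j assume j: "j \<in> J"
    obtain c w where "y j = (\<lambda>t. c + w \<bullet> t)" using affine_y[OF j] by (auto simp: affine_form_def)
    then show "\<exists>w. \<forall>s t. y j s - y j t = w \<bullet> (s - t)"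
      by (intro exI[of _ w]) (simp add: inner_diff_right)
  qed
  from bchoice[OF this] obtain w where w: "\<And>j s t. j \<in> J \<Longrightarrow> y j s - y j t = w j \<bullet> (s - t)" by blast
  define C where "C = 1 + (\<Sum>j\<in>J. norm (w j)) * C0"
  have C: "C \<ge> 1" using C0 by (simp add: C_def sum_nonneg)
  show ?thesis
  proof (rule that[OF C])
    fix t r j assume t: "t \<in> P" and r: "\<bar>r\<bar> \<le> (1::real)" and j: "j \<in> J"
    have "\<bar>y j (t + r *\<^sub>R Pi t) - y j t\<bar> = \<bar>r\<bar> * \<bar>w j \<bullet> Pi t\<bar>"
      using w[OF j] by (simp add: abs_mult)
    also have "\<dots> \<le> 1 * (norm (w j) * norm (Pi t))"
      using r by (intro mult_mono Cauchy_Schwarz_ineq2) auto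
    also have "\<dots> \<le> (\<Sum>j\<in>J. norm (w j)) * (C0 * \<tau> t)"
      using C0(2)[OF t] finite_J j by (auto intro!: mult_mono member_le_sum sum_nonneg)
    also have "\<dots> \<le> C * \<tau> t" using tau_nonneg[OF t] by (simp add: C_def algebra_simps)
    finally show "\<bar>y j (t + r *\<^sub>R Pi t) - y j t\<bar> \<le> C * \<tau> t" .
  qed
qed

lemma tau_shift: "\<tau> (t + r *\<^sub>R Pi t) = (1 + r) * \<tau> t"
  by (rule Pi_form[OF affine_tau]) (auto simp: F_eq)

text \<open>A point can leave \<open>P\<close> only through a form of \<open>J'\<close>, as a form
  vanishing on \<open>F\<close> is merely multiplied by \<open>1 + r \<ge> 0\<close>. Displacements
  change a form by \<open>O(\<tau> t)\<close>, so such a point has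
  \<open>y j t = O(\<tau> t)\<close>. Then \<open>1 + L * \<tau> t\<close> dominates
  \<open>1 + L * y j t\<close>, and inserting their quotient produces the factor
  \<open>L powr (- \<epsilon>)\<close>.\<close>

lemma weight_exit_bound:
  assumes a: "\<And>j. a j > 0" and \<epsilon>: "0 < \<epsilon>" "\<epsilon> < 1"
  obtains K where "K > 0" "\<And>L t r. L \<ge> 1 \<Longrightarrow> t \<in> P \<Longrightarrow> - 1 \<le> r \<Longrightarrow> r \<le> 1 \<Longrightarrow> t + r *\<^sub>R Pi t \<notin> P \<Longrightarrow>
      weight a 0 1 L t \<le> K * (L powr (- \<epsilon>) * weight (\<lambda>_. 1) \<epsilon> (1/2) L t)"
proof -
  obtain K where K: "K > 0" "\<And>L t k. L \<ge> 1 \<Longrightarrow> t \<in> P \<Longrightarrow> k \<in> J' \<Longrightarrow>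
      weight a 0 1 L t * (1 + L * \<tau> t) powr 1 / (1 + L * y k t) \<le> K * (L powr (- \<epsilon>) * weight (\<lambda>_. 1) \<epsilon> (1/2) L t)"
    using weight_gain'[of a \<epsilon> 1] a \<epsilon> by metis
  obtain C where C: "C \<ge> 1"
    "\<And>t r j. t \<in> P \<Longrightarrow> \<bar>r\<bar> \<le> 1 \<Longrightarrow> j \<in> J \<Longrightarrow> \<bar>y j (t + r *\<^sub>R Pi t) - y j t\<bar> \<le> C * \<tau> t"
    using y_shift_bound by metis
  show ?thesis
  proof (rule that[of "C * K"])
    show "C * K > 0" using C K by simp
    fix L t r assume L: "L \<ge> (1::real)" and t: "t \<in> P" and r: "-1 \<le> r" "r \<le> (1::real)" and ex: "t + r *\<^sub>R Pi t \<notin> P"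
    obtain j where j: "j \<in> J" "y j (t + r *\<^sub>R Pi t) < 0" using ex by (auto simp: P_eq not_le)
    have y0: "y j t \<ge> 0" using y_nonneg[OF t j(1)] .
    have j': "j \<in> J'"
    proof (rule ccontr)
      assume "j \<notin> J'"
      then have "y j (t + r *\<^sub>R Pi t) = (1 + r) * y j t"
        using j by (intro Pi_form affine_y) (auto simp: J'_eq)
      moreover have "\<dots> \<ge> 0" using r y0 by (intro mult_nonneg_nonneg) auto
      ultimately show False using j by simp
    qed
    have "y j t \<le> C * \<tau> t" using C(2)[OF t _ j(1), of r] j(2) r by (simp add: abs_le_iff)
    then have "L * y j t \<le> L * (C * \<tau> t)" using L by (intro mult_left_mono) auto
    then have le: "1 + L * y j t \<le> C * (1 + L * \<tau> t)" using C(1) by (simp add: algebra_simps)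
    have pos: "1 + L * y j t > 0" using y0 L by (simp add: add_pos_nonneg)
    have "1 + L * \<tau> t > 0" using tau_nonneg[OF t] L by (simp add: add_pos_nonneg)
    then have "1 \<le> C * ((1 + L * \<tau> t) powr 1 / (1 + L * y j t))" using le pos by (simp add: field_simps)
    then have "weight a 0 1 L t * 1 \<le> weight a 0 1 L t * (C * ((1 + L * \<tau> t) powr 1 / (1 + L * y j t)))"
      by (intro mult_left_mono weight_nonneg)
    also have "\<dots> = C * (weight a 0 1 L t * (1 + L * \<tau> t) powr 1 / (1 + L * y j t))" by simp
    also have "\<dots> \<le> C * (K * (L powr (- \<epsilon>) * weight (\<lambda>_. 1) \<epsilon> (1/2) L t))"
      using C(1) by (intro mult_left_mono K(2)[OF L t j']) auto
    finally show "weight a 0 1 L t \<le> C * K * (L powr (- \<epsilon>) * weight (\<lambda>_. 1) \<epsilon> (1/2) L t)" by simp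
  qed
qed

lemma weight_diff_bound:
  assumes a: "\<And>j. a j > 0" "\<And>j. a' j > 0" and \<epsilon>: "0 < \<epsilon>" "\<epsilon> < 1"
  obtains K where "K > 0" "\<And>L L' t. L \<ge> 1 \<Longrightarrow> L \<le> L' \<Longrightarrow> L' \<le> 2 * L \<Longrightarrow> t \<in> P \<Longrightarrow> t + (L / L' - 1) *\<^sub>R Pi t \<in> P \<Longrightarrow>
      \<bar>weight a' 0 1 L' (t + (L / L' - 1) *\<^sub>R Pi t) - weight a 0 1 L t\<bar>
        \<le> K * (L powr (- \<epsilon>) * weight (\<lambda>_. 1) \<epsilon> (1/2) L t)"
proof -
  obtain C where C: "C \<ge> 1"
    "\<And>t r j. t \<in> P \<Longrightarrow> \<bar>r\<bar> \<le> 1 \<Longrightarrow> j \<in> J \<Longrightarrow> \<bar>y j (t + r *\<^sub>R Pi t) - y j t\<bar> \<le> C * \<tau> t"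
    using y_shift_bound by metis
  \<comment> \<open>The first factor keeps the shifted forms at both scales above a multiple of
    \<open>1 / L\<close>, the 2 coming from \<open>L' \<le> 2 * L\<close>. The second bounds the
    change of a form together with its shift.\<close>
  define C1 where "C1 = 1 + (\<Sum>j\<in>J'. (1 + 1 / a j + 2 / a' j) * (C + a j + a' j))"
  have C1_ge: "(1 + 1 / a j + 2 / a' j) * (C + a j + a' j) \<le> C1 - 1" if "j \<in> J'" for j
  proof -
    have "0 \<le> (1 + 1 / a j + 2 / a' j) * (C + a j + a' j)" for j
      using a(1)[of j] a(2)[of j] C(1) by (intro mult_nonneg_nonneg add_nonneg_nonneg) auto
    then show ?thesis unfolding C1_def using finite_J' that by (auto intro!: member_le_sum)
  qed
  have C1: "C1 \<ge> 1"
    unfolding C1_def using a[THEN less_imp_le] C(1)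
    by (auto intro!: sum_nonneg mult_nonneg_nonneg add_nonneg_nonneg)
  \<comment> \<open>Exponent produced by the product estimate. The numerator of the ratio error adds
    one more power, hence \<open>s + 1\<close> in the gain.\<close>
  define s where "s = (\<Sum>j\<in>J'. \<bar>l j\<bar> + 1)"
  have s0: "s \<ge> 0" by (simp add: s_def sum_nonneg)
  obtain K where K: "K > 0" "\<And>L t k. L \<ge> 1 \<Longrightarrow> t \<in> P \<Longrightarrow> k \<in> J' \<Longrightarrow>
      weight a 0 1 L t * (1 + L * \<tau> t) powr (s + 1) / (1 + L * y k t) \<le> K * (L powr (- \<epsilon>) * weight (\<lambda>_. 1) \<epsilon> (1/2) L t)"
    using weight_gain'[of a \<epsilon> "s + 1"] a \<epsilon> by metis
  define lsum where "lsum = (\<Sum>j\<in>J'. \<bar>l j\<bar>)"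
  have ls: "lsum \<ge> 0" by (simp add: lsum_def sum_nonneg)
  define K' where "K' = C1 powr (s + 1) * lsum * K + 1"
  have K': "K' > 0" using ls K by (simp add: K'_def add_nonneg_pos)
  show ?thesis
  proof (rule that[OF K'])
    fix L L' t assume L: "L \<ge> (1::real)" "L \<le> L'" "L' \<le> 2 * L" and t: "t \<in> P" and tP: "t + (L / L' - 1) *\<^sub>R Pi t \<in> P"
    define \<kappa> where "\<kappa> = L / L'"
    have \<kappa>: "0 < \<kappa>" "\<kappa> \<le> 1" "L' * \<kappa> = L" using L by (auto simp: \<kappa>_def)
    define T where "T = t + (\<kappa> - 1) *\<^sub>R Pi t"
    have TP: "T \<in> P" using tP by (simp add: T_def \<kappa>_def)
    define q where "q = 1 + L * \<tau> t"
    have \<tau>: "\<tau> t \<ge> 0" using tau_nonneg[OF t] .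
    have q1: "q \<ge> 1" using L \<tau> by (simp add: q_def)
    define r where "r j = (a' j / L' + y j T) / (a j / L + y j t)" for j
    have rj: "\<bar>r j - 1\<bar> \<le> C1 * (q / (1 + L * y j t))" "1 / (C1 * q) \<le> r j" "r j \<le> C1 * q"
       "a j / L + y j t > 0" "a' j / L' + y j T > 0" if j: "j \<in> J'" for j
    proof -
      have jJ: "j \<in> J" using j J'_subset by auto
      define D where "D = (C + a j + a' j)"
      have D0: "D \<ge> 1" using C(1) a(1)[of j] a(2)[of j] by (simp add: D_def)
      define E where "E = 1 + 1 / a j + 2 / a' j"
      have E0: "E \<ge> 1" "E \<ge> 1 / a j" "E \<ge> 2 / a' j" using a(1)[of j] a(2)[of j] by (auto simp: E_def)
      have DE: "E * D \<le> C1 - 1" using C1_ge[OF j] by (simp add: E_def D_def)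
      have y0: "y j t \<ge> 0" "y j T \<ge> 0" using y_nonneg jJ t TP by auto
      have aL: "a j / L > 0" "a' j / L' > 0" using a L by auto
      show pos: "a j / L + y j t > 0" "a' j / L' + y j T > 0" using aL y0 by linarith+
      have d1: "\<bar>y j T - y j t\<bar> \<le> C * \<tau> t" unfolding T_def using \<kappa> by (intro C(2)[OF t _ jJ]) auto
      have "a' j / L' \<le> a' j / L" using L a(2)[of j] by (intro divide_left_mono) auto
      then have "\<bar>(a' j / L' + y j T) - (a j / L + y j t)\<bar> \<le> a' j / L + a j / L + C * \<tau> t"
        using d1 aL by linarith
      also have "\<dots> \<le> D * (q / L)"
      proof -
        have "D * (q / L) = (C + a j + a' j) / L + (C + a j + a' j) * \<tau> t"
          using L by (simp add: D_def q_def field_simps)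
        moreover have "(a j + a' j) * \<tau> t \<ge> 0" "C / L \<ge> 0" using \<tau> a(1)[of j] a(2)[of j] C L by auto
        ultimately show ?thesis by (simp add: add_divide_distrib algebra_simps)
      qed
      finally have diff: "\<bar>(a' j / L' + y j T) - (a j / L + y j t)\<bar> \<le> D * (q / L)" .
      have den: "1 / L + y j t \<le> E * (a j / L + y j t)"
      proof -
        have "1 / L = 1 / a j * (a j / L)" using a(1)[of j] by simp
        also have "\<dots> \<le> E * (a j / L)" using E0 aL by (intro mult_right_mono) auto
        finally have "1 / L \<le> E * (a j / L)" .
        moreover have "y j t \<le> E * y j t" using mult_right_mono[OF E0(1) y0(1)] by simp
        ultimately show ?thesis by (simp add: distrib_left)
      qed
      have num: "1 / L \<le> E * (a' j / L' + y j T)"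
      proof -
        have "1 / L \<le> 2 / L'" using L by (simp add: field_simps)
        also have "\<dots> = 2 / a' j * (a' j / L')" using a(2)[of j] by simp
        also have "\<dots> \<le> E * (a' j / L' + y j T)" using E0 aL y0 by (intro mult_mono) auto
        finally show ?thesis .
      qed
      have Lp: "1 / L > 0" using L by simp
      have u0: "1 / L + y j t > 0" using y0 Lp by linarith
      have r1: "r j - 1 = ((a' j / L' + y j T) - (a j / L + y j t)) / (a j / L + y j t)"
        using pos by (simp add: r_def field_simps)
      have "\<bar>r j - 1\<bar> = \<bar>(a' j / L' + y j T) - (a j / L + y j t)\<bar> / (a j / L + y j t)"
        unfolding r1 abs_divide using pos by simp
      also have "\<dots> \<le> (D * (q / L)) / (a j / L + y j t)" using diff pos by (intro divide_right_mono) auto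
      also have "\<dots> \<le> (D * (q / L)) * (E / (1 / L + y j t))"
      proof -
        have "1 / (a j / L + y j t) \<le> E / (1 / L + y j t)" using den pos u0 by (simp add: field_simps)
        then have "(D * (q / L)) * (1 / (a j / L + y j t)) \<le> (D * (q / L)) * (E / (1 / L + y j t))"
          using D0 q1 L by (intro mult_left_mono) auto
        then show ?thesis by simp
      qed
      also have "\<dots> = (E * D) * (q / (L * (1 / L + y j t)))"
        by (simp only: times_divide_eq_left times_divide_eq_right divide_divide_eq_left mult_ac)
      also have "L * (1 / L + y j t) = 1 + L * y j t" using L by (simp add: distrib_left)
      finally have r2: "\<bar>r j - 1\<bar> \<le> (E * D) * (q / (1 + L * y j t))" .
      have Ly: "1 + L * y j t \<ge> 1" using y0 L by simp
      have qd0: "q / (1 + L * y j t) \<ge> 0" using q1 Ly by auto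
      have "(E * D) * (q / (1 + L * y j t)) \<le> (C1 - 1) * (q / (1 + L * y j t))"
        using DE qd0 by (rule mult_right_mono)
      also have "\<dots> \<le> C1 * (q / (1 + L * y j t))" using qd0 by (intro mult_right_mono) auto
      finally show "\<bar>r j - 1\<bar> \<le> C1 * (q / (1 + L * y j t))" using r2 by linarith
      have "q / (1 + L * y j t) \<le> q" using q1 Ly by (simp add: divide_le_eq mult_le_cancel_left1)
      then have "(E * D) * (q / (1 + L * y j t)) \<le> (C1 - 1) * q"
        using DE qd0 C1 by (intro mult_mono) auto
      then have "r j \<le> 1 + (C1 - 1) * q" using r2 by linarith
      also have "\<dots> \<le> C1 * q" using q1 by (simp add: algebra_simps)
      finally show "r j \<le> C1 * q" .
      have "D * (q / L) = (D * q) * (1 / L)" by simp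
      also have "\<dots> \<le> (D * q) * (E * (a' j / L' + y j T))" using num D0 q1 by (intro mult_left_mono) auto
      finally have "a j / L + y j t \<le> (a' j / L' + y j T) + (D * q) * (E * (a' j / L' + y j T))"
        using diff by linarith
      also have "\<dots> = (1 + (E * D) * q) * (a' j / L' + y j T)" by (simp add: algebra_simps)
      also have "\<dots> \<le> (C1 * q) * (a' j / L' + y j T)"
      proof (rule mult_right_mono)
        have "(E * D) * q \<le> (C1 - 1) * q" using DE q1 by (intro mult_right_mono) auto
        then show "1 + (E * D) * q \<le> C1 * q" using q1 by (simp add: algebra_simps)
      qed (use pos in auto)
      finally have "a j / L + y j t \<le> (C1 * q) * (a' j / L' + y j T)" .
      then show "1 / (C1 * q) \<le> r j" using pos C1 q1 by (simp add: r_def field_simps)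
    qed
    have Cq: "C1 * q \<ge> 1" using mult_mono[OF C1 q1] C1 by simp
    define W where "W = weight a 0 1 L t"
    have W0: "W \<ge> 0" by (simp add: W_def weight_nonneg)
    have "weight a' 0 1 L' T = W * (\<Prod>j\<in>J'. r j powr l j)"
    proof -
      have "\<tau> T = \<kappa> * \<tau> t" unfolding T_def tau_shift by simp
      then have "L' * \<tau> T = L * \<tau> t" using \<kappa>(3) by (metis mult.assoc)
      moreover have "(\<Prod>j\<in>J'. (a' j / L' + y j T) powr l j) = (\<Prod>j\<in>J'. (a j / L + y j t) powr l j) * (\<Prod>j\<in>J'. r j powr l j)"
        unfolding prod.distrib[symmetric]
      proof (intro prod.cong refl)
        fix j assume j: "j \<in> J'"
        have "a' j / L' + y j T = (a j / L + y j t) * r j" using rj(4)[OF j] by (simp add: r_def)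
        then show "(a' j / L' + y j T) powr l j = (a j / L + y j t) powr l j * r j powr l j"
          using rj(4,5)[OF j] by (simp add: powr_mult)
      qed
      ultimately show ?thesis by (simp add: W_def weight_def)
    qed
    then have "\<bar>weight a' 0 1 L' T - W\<bar> = W * \<bar>(\<Prod>j\<in>J'. r j powr l j) - 1\<bar>"
    proof -
      have "W * (\<Prod>j\<in>J'. r j powr l j) - W = W * ((\<Prod>j\<in>J'. r j powr l j) - 1)" by (simp add: algebra_simps)
      then show ?thesis using \<open>weight a' 0 1 L' T = _\<close> W0 by (simp only: abs_mult abs_of_nonneg)
    qed
    also have "\<dots> \<le> W * ((C1 * q) powr s * (\<Sum>j\<in>J'. \<bar>l j\<bar> * \<bar>r j - 1\<bar>))"
      unfolding s_def using W0 rj finite_J' Cq by (intro mult_left_mono prod_powr_diff_one_bound) auto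
    also have "\<dots> \<le> W * ((C1 * q) powr s * (\<Sum>j\<in>J'. \<bar>l j\<bar> * (C1 * (q / (1 + L * y j t)))))"
      using W0 rj(1) by (intro mult_left_mono sum_mono) auto
    also have "\<dots> = (\<Sum>j\<in>J'. \<bar>l j\<bar> * (C1 powr (s + 1) * (W * q powr (s + 1) / (1 + L * y j t))))"
      using C1 q1 by (simp add: powr_mult powr_add sum_distrib_left mult_ac)
    also have "\<dots> \<le> (\<Sum>j\<in>J'. \<bar>l j\<bar> * (C1 powr (s + 1) * (K * (L powr (- \<epsilon>) * weight (\<lambda>_. 1) \<epsilon> (1/2) L t))))"
      unfolding W_def q_def by (intro sum_mono mult_left_mono K(2) L t) auto
    also have "\<dots> = (C1 powr (s + 1) * lsum * K) * (L powr (- \<epsilon>) * weight (\<lambda>_. 1) \<epsilon> (1/2) L t)"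
      by (simp add: lsum_def sum_distrib_right sum_distrib_left mult_ac)
    also have "\<dots> \<le> K' * (L powr (- \<epsilon>) * weight (\<lambda>_. 1) \<epsilon> (1/2) L t)"
      using weight_nonneg by (intro mult_right_mono mult_nonneg_nonneg) (auto simp: K'_def)
    finally show "\<bar>weight a' 0 1 L' (t + (L / L' - 1) *\<^sub>R Pi t) - weight a 0 1 L t\<bar>
        \<le> K' * (L powr (- \<epsilon>) * weight (\<lambda>_. 1) \<epsilon> (1/2) L t)"
      by (simp add: T_def \<kappa>_def W_def)
  qed
qed

end

end

section \<open>Convergence of the normalized mass\<close>

context polytope_face
begin

definition mass :: "('j \<Rightarrow> real) \<Rightarrow> real \<Rightarrow> ennreal" where
  "mass a L = (\<integral>\<^sup>+t\<in>P. ennreal (weight a 0 1 L t) \<partial>lborel)"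

definition normalized_mass :: "('j \<Rightarrow> real) \<Rightarrow> real \<Rightarrow> real" where
  "normalized_mass a L = L powr (CARD('s) - real d) * enn2real (mass a L)"

text \<open>The substitution \<open>T\<close> turns the mass at \<open>L'\<close> into an integral
  whose integrand differs pointwise from that at \<open>L\<close> by an error controlled through
  \<open>U\<close>. Working in \<open>ennreal\<close> with two one-sided inequalities avoids
  subtracting masses whose finiteness is shown only afterwards.\<close>

lemma mass_comparison:
  assumes \<epsilon>: "0 < \<epsilon>" "\<epsilon> < 1"
    and U: "\<exists>K\<ge>0. \<forall>L\<ge>1. (\<integral>\<^sup>+t\<in>P. ennreal (weight (\<lambda>_. 1) \<epsilon> (1/2) L t) \<partial>lborel)
       \<le> ennreal (K * L powr (real d - CARD('s)))"
    and a: "\<And>j. a j > 0" "\<And>j. a' j > 0"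
  shows "\<exists>K\<ge>0. \<forall>L\<ge>1. \<forall>L'. L \<le> L' \<and> L' \<le> 2 * L \<longrightarrow>
      ennreal (L' powr (CARD('s) - real d)) * mass a' L' \<le> ennreal (L powr (CARD('s) - real d)) * mass a L + ennreal (K * L powr (- \<epsilon>)) \<and>
      ennreal (L powr (CARD('s) - real d)) * mass a L \<le> ennreal (L' powr (CARD('s) - real d)) * mass a' L' + ennreal (K * L powr (- \<epsilon>))"
proof -
  define m where "m = CARD('s) - real d"
  obtain K0 where K0: "K0 \<ge> 0" "\<And>L. L \<ge> 1 \<Longrightarrow> (\<integral>\<^sup>+t\<in>P. ennreal (weight (\<lambda>_. 1) \<epsilon> (1/2) L t) \<partial>lborel)
       \<le> ennreal (K0 * L powr (- m))"
    using U by (auto simp: m_def)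
  obtain Pi where Pi: "\<And>t. t \<in> F \<Longrightarrow> Pi t = 0"
    "\<And>t r. Pi (t + r *\<^sub>R Pi t) = (1 + r) *\<^sub>R Pi t"
    "\<And>f t r. affine_form f \<Longrightarrow> (\<And>t. t \<in> F \<Longrightarrow> f t = 0) \<Longrightarrow> f (t + r *\<^sub>R Pi t) = (1 + r) * f t"
    "\<And>V u. finite V \<Longrightarrow> sum u V = 1 \<Longrightarrow> Pi (\<Sum>v\<in>V. u v *\<^sub>R v) = (\<Sum>v\<in>V. u v *\<^sub>R Pi v)"
    "\<And>\<kappa> f. \<kappa> > 0 \<Longrightarrow> f \<in> borel_measurable borel \<Longrightarrow>
      ennreal (\<kappa> powr (CARD('s) - real d)) * (\<integral>\<^sup>+t. f (t + (\<kappa> - 1) *\<^sub>R Pi t) \<partial>lborel) = (\<integral>\<^sup>+t. f t \<partial>lborel)"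
    "continuous_on UNIV Pi"
  proof -
    show thesis by (rule transversal_scaling[OF F_nonempty dim_F]) (fact that)
  qed
  note Pi5 = Pi(5)[folded m_def]
  have [measurable]: "Pi \<in> borel_measurable borel" using Pi(6) by (rule borel_measurable_continuous_onI)
  obtain K1 where K1: "K1 > 0" "\<And>L t r. L \<ge> 1 \<Longrightarrow> t \<in> P \<Longrightarrow> - 1 \<le> r \<Longrightarrow> r \<le> 1 \<Longrightarrow> t + r *\<^sub>R Pi t \<notin> P \<Longrightarrow>
      weight a 0 1 L t \<le> K1 * (L powr (- \<epsilon>) * weight (\<lambda>_. 1) \<epsilon> (1/2) L t)"
  proof -
    show thesis by (rule weight_exit_bound[of Pi a \<epsilon>]) (fact Pi a \<epsilon> that)+
  qed
  obtain K2 where K2: "K2 > 0" "\<And>L t r. L \<ge> 1 \<Longrightarrow> t \<in> P \<Longrightarrow> - 1 \<le> r \<Longrightarrow> r \<le> 1 \<Longrightarrow> t + r *\<^sub>R Pi t \<notin> P \<Longrightarrow>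
      weight a' 0 1 L t \<le> K2 * (L powr (- \<epsilon>) * weight (\<lambda>_. 1) \<epsilon> (1/2) L t)"
  proof -
    show thesis by (rule weight_exit_bound[of Pi a' \<epsilon>]) (fact Pi a \<epsilon> that)+
  qed
  obtain K3 where K3: "K3 > 0" "\<And>L L' t. L \<ge> 1 \<Longrightarrow> L \<le> L' \<Longrightarrow> L' \<le> 2 * L \<Longrightarrow> t \<in> P \<Longrightarrow> t + (L / L' - 1) *\<^sub>R Pi t \<in> P \<Longrightarrow>
      \<bar>weight a' 0 1 L' (t + (L / L' - 1) *\<^sub>R Pi t) - weight a 0 1 L t\<bar>
        \<le> K3 * (L powr (- \<epsilon>) * weight (\<lambda>_. 1) \<epsilon> (1/2) L t)"
  proof -
    show thesis by (rule weight_diff_bound[of Pi a a' \<epsilon>]) (fact Pi a \<epsilon> that)+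
  qed
  define K where "K = K1 + K2 + K3"
  have K: "K > 0" "K1 \<le> K" "K2 \<le> K" "K3 \<le> K" using K1 K2 K3 by (auto simp: K_def)
  define \<psi> where "\<psi> L t = ennreal (weight (\<lambda>_. 1) \<epsilon> (1/2) L t) * indicator P t" for L t
  have [measurable]: "weight a e c L \<in> borel_measurable borel" "P \<in> sets borel" for a e c L
    by (rule measurable_weight, rule borel_P)
  have [measurable]: "\<psi> L \<in> borel_measurable borel" for L
    unfolding \<psi>_def[abs_def] by measurable
  show ?thesis
  proof (intro exI[of _ "2 * K * K0"] conjI allI impI)
    show "0 \<le> 2 * K * K0" using K K0 by simp
    fix L L' :: real assume L1: "L \<ge> 1" and L': "L \<le> L' \<and> L' \<le> 2 * L"
    define \<kappa> where "\<kappa> = L / L'"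
    have \<kappa>: "0 < \<kappa>" "\<kappa> \<le> 1" "1 / \<kappa> \<le> 2" "L' * \<kappa> = L" using L1 L' by (auto simp: \<kappa>_def field_simps)
    define T where "T t = t + (\<kappa> - 1) *\<^sub>R Pi t" for t
    have [measurable]: "T \<in> borel_measurable borel" unfolding T_def by measurable
    \<comment> \<open>The inverse of \<open>T\<close> scales by \<open>1 / \<kappa> \<le> 2\<close>.
      A point outside \<open>P\<close> that \<open>T\<close> carries into \<open>P\<close> is thus
      the image of a point of \<open>P\<close> that exits under a scaling by at most 2.\<close>
    have Tinv: "T t + (1 / \<kappa> - 1) *\<^sub>R Pi (T t) = t" for t
    proof -
      have "Pi (T t) = \<kappa> *\<^sub>R Pi t" unfolding T_def Pi(2) by simp
      moreover have "(1 / \<kappa> - 1) * \<kappa> = 1 - \<kappa>" using \<kappa> by (simp add: field_simps)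
      ultimately show ?thesis by (simp add: T_def algebra_simps)
    qed
    define f where "f t = ennreal (weight a 0 1 L t) * indicator P t" for t
    define f' where "f' t = ennreal (weight a' 0 1 L' t) * indicator P t" for t
    have [measurable]: "f \<in> borel_measurable borel" "f' \<in> borel_measurable borel"
      unfolding f_def[abs_def] f'_def[abs_def] by measurable
    \<comment> \<open>The first summand is the error at the original point; the second serves points
      that lie in \<open>P\<close> only after scaling and is evaluated there.\<close>
    define E where "E t = ennreal (K * L powr (- \<epsilon>)) * (\<psi> L t + \<psi> L' (T t))" for t
    have Lpow: "L' powr (- \<epsilon>) \<le> L powr (- \<epsilon>)" using L1 L' \<epsilon> by (intro powr_mono2') auto
    have Ebound: "ennreal w \<le> E t" if "w \<le> k * (L powr (- \<epsilon>) * weight (\<lambda>_. 1) \<epsilon> (1/2) L t)" "k \<le> K" "t \<in> P" for w k t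
    proof -
      have "w \<le> K * (L powr (- \<epsilon>) * weight (\<lambda>_. 1) \<epsilon> (1/2) L t)"
        using that weight_nonneg by (intro order_trans[OF that(1)] mult_right_mono mult_nonneg_nonneg) auto
      then have "ennreal w \<le> ennreal (K * L powr (- \<epsilon>)) * \<psi> L t"
        using K that(3) by (simp add: \<psi>_def ennreal_mult'[symmetric] mult.assoc ennreal_leI)
      then show ?thesis by (simp add: E_def distrib_left add_increasing2)
    qed
    have pw: "f' (T t) \<le> f t + E t \<and> f t \<le> f' (T t) + E t" for t
    proof -
      have TL: "T t = t + (L / L' - 1) *\<^sub>R Pi t" by (simp add: T_def \<kappa>_def)
      consider "t \<in> P" "T t \<in> P" | "t \<in> P" "T t \<notin> P" | "t \<notin> P" "T t \<in> P" | "t \<notin> P" "T t \<notin> P" by blast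
      then show ?thesis
      proof cases
        case 1
        define w where "w = weight a 0 1 L t"
        define w' where "w' = weight a' 0 1 L' (T t)"
        have ww: "w \<ge> 0" "w' \<ge> 0" by (auto simp: w_def w'_def weight_nonneg)
        have "\<bar>w' - w\<bar> \<le> K3 * (L powr (- \<epsilon>) * weight (\<lambda>_. 1) \<epsilon> (1/2) L t)"
          using K3(2)[of L L' t] L1 L' 1 unfolding w_def w'_def TL by blast
        then have e: "ennreal \<bar>w' - w\<bar> \<le> E t" by (rule Ebound) (use K 1 in auto)
        have "ennreal w' \<le> ennreal w + ennreal \<bar>w' - w\<bar>" "ennreal w \<le> ennreal w' + ennreal \<bar>w' - w\<bar>"
          using ww by (auto simp: ennreal_plus[symmetric] simp del: ennreal_plus intro!: ennreal_leI)
        then have "ennreal w' \<le> ennreal w + E t" "ennreal w \<le> ennreal w' + E t"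
          using e by (meson add_left_mono order_trans)+
        then show ?thesis using 1 by (simp add: f_def f'_def w_def w'_def)
      next
        case 2
        have "weight a 0 1 L t \<le> K1 * (L powr (- \<epsilon>) * weight (\<lambda>_. 1) \<epsilon> (1/2) L t)"
          using 2 \<kappa> L1 by (intro K1(2)[of L t "\<kappa> - 1"]) (auto simp: T_def)
        then have "ennreal (weight a 0 1 L t) \<le> E t" by (rule Ebound) (use K 2 in auto)
        then show ?thesis using 2 by (simp add: f_def f'_def)
      next
        case 3
        have "weight a' 0 1 L' (T t) \<le> K2 * (L' powr (- \<epsilon>) * weight (\<lambda>_. 1) \<epsilon> (1/2) L' (T t))"
        proof (rule K2(2)[of L' "T t" "1 / \<kappa> - 1"])
          have "1 / \<kappa> > 0" using \<kappa> by simp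
          then show "- 1 \<le> 1 / \<kappa> - 1" "1 / \<kappa> - 1 \<le> 1" using \<kappa> by linarith+
          show "T t + (1 / \<kappa> - 1) *\<^sub>R Pi (T t) \<notin> P" unfolding Tinv by (rule 3)
        qed (use L1 L' 3 in auto)
        also have "\<dots> \<le> K * (L powr (- \<epsilon>) * weight (\<lambda>_. 1) \<epsilon> (1/2) L' (T t))"
          using K Lpow weight_nonneg by (intro mult_mono mult_right_mono mult_nonneg_nonneg) auto
        finally have "ennreal (weight a' 0 1 L' (T t)) \<le> ennreal (K * L powr (- \<epsilon>)) * \<psi> L' (T t)"
          using K 3 by (simp add: \<psi>_def ennreal_mult'[symmetric] mult.assoc ennreal_leI)
        then have "ennreal (weight a' 0 1 L' (T t)) \<le> E t" by (simp add: E_def distrib_left add_increasing)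
        then show ?thesis using 3 by (simp add: f_def f'_def)
      next
        case 4
        then show ?thesis by (simp add: f_def f'_def)
      qed
    qed
    define N where "N = (\<integral>\<^sup>+t. f t \<partial>lborel)"
    define N' where "N' = (\<integral>\<^sup>+t. f' (T t) \<partial>lborel)"
    have N_mass: "N = mass a L" by (simp add: N_def f_def mass_def)
    have Lm: "L powr m = L' powr m * \<kappa> powr m" using \<kappa> L1 L' by (simp flip: powr_mult)
    have N'_mass: "ennreal (L' powr m) * mass a' L' = ennreal (L powr m) * N'"
    proof -
      have "ennreal (\<kappa> powr m) * N' = mass a' L'"
        using Pi5[OF \<kappa>(1), of f'] by (simp add: N'_def T_def mass_def f'_def)
      then show ?thesis unfolding Lm by (simp add: ennreal_mult' mult.assoc)
    qed
    have \<psi>L: "ennreal (L powr m) * (\<integral>\<^sup>+t. \<psi> L t \<partial>lborel) \<le> ennreal K0"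
    proof -
      have "ennreal (L powr m) * (\<integral>\<^sup>+t. \<psi> L t \<partial>lborel) \<le> ennreal (L powr m) * ennreal (K0 * L powr (- m))"
        using K0(2)[OF L1] by (intro mult_left_mono) (auto simp: \<psi>_def)
      also have "\<dots> = ennreal (K0 * (L powr m * L powr (- m)))" using K0 by (simp add: ennreal_mult'[symmetric] mult_ac)
      also have "L powr m * L powr (- m) = 1" using L1 by (simp flip: powr_add)
      finally show ?thesis by simp
    qed
    have \<psi>L': "ennreal (L powr m) * (\<integral>\<^sup>+t. \<psi> L' (T t) \<partial>lborel) \<le> ennreal K0"
    proof -
      have "ennreal (L powr m) * (\<integral>\<^sup>+t. \<psi> L' (T t) \<partial>lborel)
         = ennreal (L' powr m) * (ennreal (\<kappa> powr m) * (\<integral>\<^sup>+t. \<psi> L' (T t) \<partial>lborel))"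
        unfolding Lm by (simp add: ennreal_mult' mult.assoc)
      also have "ennreal (\<kappa> powr m) * (\<integral>\<^sup>+t. \<psi> L' (T t) \<partial>lborel) = (\<integral>\<^sup>+t. \<psi> L' t \<partial>lborel)"
        using Pi5[OF \<kappa>(1), of "\<psi> L'"] by (simp add: T_def)
      also have "ennreal (L' powr m) * \<dots> \<le> ennreal (L' powr m) * ennreal (K0 * L' powr (- m))"
        using K0(2)[of L'] L1 L' by (intro mult_left_mono) (auto simp: \<psi>_def)
      also have "\<dots> = ennreal (K0 * (L' powr m * L' powr (- m)))" using K0 by (simp add: ennreal_mult'[symmetric] mult_ac)
      also have "L' powr m * L' powr (- m) = 1" using L1 L' by (simp flip: powr_add)
      finally show ?thesis by simp
    qed
    have E_int: "ennreal (L powr m) * (\<integral>\<^sup>+t. E t \<partial>lborel) \<le> ennreal (2 * K * K0 * L powr (- \<epsilon>))"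
    proof -
      have "ennreal (L powr m) * (\<integral>\<^sup>+t. E t \<partial>lborel) = ennreal (K * L powr (- \<epsilon>)) *
        (ennreal (L powr m) * (\<integral>\<^sup>+t. \<psi> L t \<partial>lborel) + ennreal (L powr m) * (\<integral>\<^sup>+t. \<psi> L' (T t) \<partial>lborel))"
        unfolding E_def by (subst nn_integral_cmult) (measurable, simp add: nn_integral_add distrib_left mult_ac)
      also have "\<dots> \<le> ennreal (K * L powr (- \<epsilon>)) * (ennreal K0 + ennreal K0)"
        by (intro mult_left_mono add_mono \<psi>L \<psi>L') auto
      also have "\<dots> = ennreal (2 * K * K0 * L powr (- \<epsilon>))"
        using K K0 by (simp add: ennreal_plus[symmetric] ennreal_mult'[symmetric] mult_ac del: ennreal_plus)
      finally show ?thesis .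
    qed
    have [measurable]: "E \<in> borel_measurable borel" unfolding E_def by measurable
    have "N' \<le> N + (\<integral>\<^sup>+t. E t \<partial>lborel)"
      unfolding N'_def N_def using pw by (subst nn_integral_add[symmetric]) (auto intro: nn_integral_mono)
    then have "ennreal (L powr m) * N' \<le> ennreal (L powr m) * N + ennreal (L powr m) * (\<integral>\<^sup>+t. E t \<partial>lborel)"
      unfolding distrib_left[symmetric] by (rule mult_left_mono) simp
    also have "\<dots> \<le> ennreal (L powr m) * N + ennreal (2 * K * K0 * L powr (- \<epsilon>))"
      by (intro add_left_mono E_int)
    finally show "ennreal (L' powr (CARD('s) - real d)) * mass a' L'
      \<le> ennreal (L powr (CARD('s) - real d)) * mass a L + ennreal (2 * K * K0 * L powr (- \<epsilon>))"
      unfolding m_def[symmetric] N'_mass N_mass .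
    have "N \<le> N' + (\<integral>\<^sup>+t. E t \<partial>lborel)"
      unfolding N'_def N_def using pw by (subst nn_integral_add[symmetric]) (auto intro: nn_integral_mono)
    then have "ennreal (L powr m) * N \<le> ennreal (L powr m) * N' + ennreal (L powr m) * (\<integral>\<^sup>+t. E t \<partial>lborel)"
      unfolding distrib_left[symmetric] by (rule mult_left_mono) simp
    also have "\<dots> \<le> ennreal (L powr m) * N' + ennreal (2 * K * K0 * L powr (- \<epsilon>))"
      by (intro add_left_mono E_int)
    finally show "ennreal (L powr (CARD('s) - real d)) * mass a L
      \<le> ennreal (L' powr (CARD('s) - real d)) * mass a' L' + ennreal (2 * K * K0 * L powr (- \<epsilon>))"
      unfolding m_def[symmetric] N'_mass N_mass .
  qed
qed

text \<open>The limit is constructed for shift 1. Comparing it with any other shift at equal scales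
  gives a difference \<open>O(L powr (- \<epsilon>))\<close>, so one \<open>c\<close> serves all
  shifts. In the last bound the saving is the released factor, which is at most
  \<open>(2 * M / L) powr \<epsilon>\<close> on the slice.\<close>

theorem normalized_mass_asymptotics:
  obtains \<epsilon> c :: real where "\<epsilon> > 0"
    "\<And>a. (\<And>j. a j > 0) \<Longrightarrow> \<exists>K\<ge>0. \<forall>L\<ge>1. mass a L < \<infinity> \<and> \<bar>normalized_mass a L - c\<bar> \<le> K * L powr (- \<epsilon>)"
    "\<And>a. (\<And>j. a j > 0) \<Longrightarrow> \<exists>K\<ge>0. \<forall>L\<ge>1. \<forall>M\<ge>1. \<forall>k\<in>J'.
        (\<integral>\<^sup>+t\<in>P \<inter> {t. L * y k t \<le> M}. ennreal (weight a 0 1 L t) \<partial>lborel)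
          \<le> ennreal (K * (M / L) powr \<epsilon> * L powr (real d - CARD('s)))"
proof -
  obtain \<epsilon> :: real where \<epsilon>: "0 < \<epsilon>" "\<epsilon> < 1" and U0:
    "\<And>c. c > 0 \<Longrightarrow> \<exists>K\<ge>0. \<forall>L\<ge>1. (\<integral>\<^sup>+t\<in>P. ennreal (weight (\<lambda>_. 1) \<epsilon> c L t) \<partial>lborel)
       \<le> ennreal (K * L powr (real d - CARD('s)))"
    by (rule weight_integral_bound) (rule that; assumption)
  have "1 / 2 > (0::real)" by simp
  note U = U0[OF this]
  obtain K0 where K0: "K0 \<ge> 0" "\<And>L. L \<ge> 1 \<Longrightarrow> (\<integral>\<^sup>+t\<in>P. ennreal (weight (\<lambda>_. 1) \<epsilon> (1/2) L t) \<partial>lborel)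
       \<le> ennreal (K0 * L powr (real d - CARD('s)))"
    using U by auto
  have [measurable]: "weight a e c L \<in> borel_measurable borel" "P \<in> sets borel" for a e c L
    by (rule measurable_weight, rule borel_P)
  \<comment> \<open>Finiteness is what permits the passage from \<open>ennreal\<close> to the
    real-valued normalized mass.\<close>
  have fin: "mass a L < \<infinity>" if a: "\<And>j. a j > 0" and L: "L \<ge> 1" for a L
  proof -
    obtain K where K: "K > 0" "\<And>L t. L \<ge> 1 \<Longrightarrow> t \<in> P \<Longrightarrow> weight a 0 1 L t * (1 + L * \<tau> t) powr 0 \<le> K * weight (\<lambda>_. 1) \<epsilon> (1/2) L t"
      using weight_gain[of a \<epsilon> 0, OF a \<epsilon>(1)] by blast
    have "mass a L \<le> (\<integral>\<^sup>+t. ennreal K * (ennreal (weight (\<lambda>_. 1) \<epsilon> (1/2) L t) * indicator P t) \<partial>lborel)"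
      unfolding mass_def
    proof (intro nn_integral_mono)
      fix t
      show "ennreal (weight a 0 1 L t) * indicator P t \<le> ennreal K * (ennreal (weight (\<lambda>_. 1) \<epsilon> (1/2) L t) * indicator P t)"
      proof (cases "t \<in> P")
        case True
        have "1 + L * \<tau> t > 0" using tau_nonneg[OF True] L by (simp add: add_pos_nonneg)
        then have "weight a 0 1 L t \<le> K * weight (\<lambda>_. 1) \<epsilon> (1/2) L t" using K(2)[OF L True] by simp
        then show ?thesis using True K(1) by (simp add: ennreal_mult'[symmetric] ennreal_leI)
      qed simp
    qed
    also have "\<dots> = ennreal K * (\<integral>\<^sup>+t\<in>P. ennreal (weight (\<lambda>_. 1) \<epsilon> (1/2) L t) \<partial>lborel)"
      by (rule nn_integral_cmult) measurable
    also have "\<dots> \<le> ennreal K * ennreal (K0 * L powr (real d - CARD('s)))" by (intro mult_left_mono K0 L) auto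
    also have "\<dots> < \<infinity>" by (simp add: ennreal_mult_less_top)
    finally show ?thesis .
  qed
  have cmp: "\<exists>K\<ge>0. \<forall>L\<ge>1. \<forall>L'. L \<le> L' \<and> L' \<le> 2 * L \<longrightarrow> \<bar>normalized_mass a' L' - normalized_mass a L\<bar> \<le> K * L powr (- \<epsilon>)"
    if a: "\<And>j. a j > 0" "\<And>j. a' j > 0" for a a'
  proof -
    obtain K where K: "K \<ge> 0" "\<And>L L'. L \<ge> 1 \<Longrightarrow> L \<le> L' \<Longrightarrow> L' \<le> 2 * L \<Longrightarrow>
      ennreal (L' powr (CARD('s) - real d)) * mass a' L' \<le> ennreal (L powr (CARD('s) - real d)) * mass a L + ennreal (K * L powr (- \<epsilon>)) \<and>
      ennreal (L powr (CARD('s) - real d)) * mass a L \<le> ennreal (L' powr (CARD('s) - real d)) * mass a' L' + ennreal (K * L powr (- \<epsilon>))"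
      using mass_comparison[of \<epsilon> a a', OF \<epsilon> U a] by (elim exE conjE) (rule that; blast)
    have conv: "ennreal (L powr (CARD('s) - real d)) * mass b L = ennreal (normalized_mass b L)" "normalized_mass b L \<ge> 0"
      if "\<And>j. b j > 0" "L \<ge> 1" for b L
      using fin[OF that] by (simp_all add: normalized_mass_def ennreal_mult')
    show ?thesis
    proof (intro exI[of _ K] conjI K allI impI)
      fix L L' :: real assume L: "L \<ge> 1" "L \<le> L' \<and> L' \<le> 2 * L"
      have k: "K * L powr (- \<epsilon>) \<ge> 0" using K by simp
      have L': "L' \<ge> 1" using L by auto
      have "ennreal (normalized_mass a' L') \<le> ennreal (normalized_mass a L + K * L powr (- \<epsilon>))"
        "ennreal (normalized_mass a L) \<le> ennreal (normalized_mass a' L' + K * L powr (- \<epsilon>))"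
        using K(2)[of L L'] L conv(2)[of a L, OF a(1)] conv(2)[of a' L', OF a(2) L'] k
        unfolding conv(1)[of a L, OF a(1) L(1)] conv(1)[of a' L', OF a(2) L'] by simp_all
      then show "\<bar>normalized_mass a' L' - normalized_mass a L\<bar> \<le> K * L powr (- \<epsilon>)"
        using conv(2)[of a L, OF a(1) L(1)] conv(2)[of a' L', OF a(2) L'] k
        by (simp add: ennreal_plus[symmetric] ennreal_le_iff abs_le_iff del: ennreal_plus)
    qed
  qed
  have one: "\<And>j::'j. (\<lambda>_. 1) j > (0::real)" by simp
  obtain K1 where K1: "K1 \<ge> 0" "\<And>L L'. L \<ge> 1 \<Longrightarrow> L \<le> L' \<Longrightarrow> L' \<le> 2 * L \<Longrightarrow>
      \<bar>normalized_mass (\<lambda>_. 1) L' - normalized_mass (\<lambda>_. 1) L\<bar> \<le> K1 * L powr (- \<epsilon>)"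
    using cmp[of "\<lambda>_. 1" "\<lambda>_. 1"] by auto
  obtain c K2 where c: "K2 \<ge> 0" "\<And>L. L \<ge> 1 \<Longrightarrow> \<bar>normalized_mass (\<lambda>_. 1) L - c\<bar> \<le> K2 * L powr (- \<epsilon>)"
    using doubling_cauchy_limit[of K1 \<epsilon> "normalized_mass (\<lambda>_. 1)"] K1 \<epsilon> by blast
  show ?thesis
  proof (rule that[OF \<epsilon>(1), of c])
    fix a :: "'j \<Rightarrow> real" assume a: "\<And>j. a j > 0"
    obtain K3 where K3: "K3 \<ge> 0" "\<And>L L'. L \<ge> 1 \<Longrightarrow> L \<le> L' \<Longrightarrow> L' \<le> 2 * L \<Longrightarrow>
      \<bar>normalized_mass a L' - normalized_mass (\<lambda>_. 1) L\<bar> \<le> K3 * L powr (- \<epsilon>)"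
      using cmp[of "\<lambda>_. 1" a] a by auto
    show "\<exists>K\<ge>0. \<forall>L\<ge>1. mass a L < \<infinity> \<and> \<bar>normalized_mass a L - c\<bar> \<le> K * L powr (- \<epsilon>)"
    proof (intro exI[of _ "K2 + K3"] conjI allI impI)
      show "0 \<le> K2 + K3" using c K3 by simp
      fix L :: real assume L: "L \<ge> 1"
      show "mass a L < \<infinity>" by (rule fin[OF a L])
      have "\<bar>normalized_mass a L - normalized_mass (\<lambda>_. 1) L\<bar> \<le> K3 * L powr (- \<epsilon>)" using L by (intro K3) auto
      then show "\<bar>normalized_mass a L - c\<bar> \<le> (K2 + K3) * L powr (- \<epsilon>)"
        using c(2)[OF L] by (simp add: distrib_right)
    qed
  next
    fix a :: "'j \<Rightarrow> real" assume a: "\<And>j. a j > 0"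
    obtain K where K: "K > 0" "\<And>L t k. L \<ge> 1 \<Longrightarrow> t \<in> P \<Longrightarrow> k \<in> J' \<Longrightarrow>
        weight a 0 1 L t * (1 + L * \<tau> t) powr 0 \<le> K * weight (\<lambda>_. 1) \<epsilon> (1/2) L t * (1 / L + y k t) powr \<epsilon>"
      using weight_gain[of a \<epsilon> 0, OF a \<epsilon>(1)] by blast
    show "\<exists>K\<ge>0. \<forall>L\<ge>1. \<forall>M\<ge>1. \<forall>k\<in>J'.
        (\<integral>\<^sup>+t\<in>P \<inter> {t. L * y k t \<le> M}. ennreal (weight a 0 1 L t) \<partial>lborel)
          \<le> ennreal (K * (M / L) powr \<epsilon> * L powr (real d - CARD('s)))"
    proof (intro exI[of _ "K * 2 powr \<epsilon> * K0"] conjI allI impI ballI)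
      show "0 \<le> K * 2 powr \<epsilon> * K0" using K K0 by simp
      fix L M :: real and k assume L: "L \<ge> 1" and M: "M \<ge> 1" and k: "k \<in> J'"
      have "(\<integral>\<^sup>+t\<in>P \<inter> {t. L * y k t \<le> M}. ennreal (weight a 0 1 L t) \<partial>lborel)
        \<le> (\<integral>\<^sup>+t. ennreal (K * (2 powr \<epsilon> * (M / L) powr \<epsilon>)) * (ennreal (weight (\<lambda>_. 1) \<epsilon> (1/2) L t) * indicator P t) \<partial>lborel)"
      proof (intro nn_integral_mono)
        fix t
        show "ennreal (weight a 0 1 L t) * indicator (P \<inter> {t. L * y k t \<le> M}) t
          \<le> ennreal (K * (2 powr \<epsilon> * (M / L) powr \<epsilon>)) * (ennreal (weight (\<lambda>_. 1) \<epsilon> (1/2) L t) * indicator P t)"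
        proof (cases "t \<in> P \<inter> {t. L * y k t \<le> M}")
          case True
          then have t: "t \<in> P" "L * y k t \<le> M" by auto
          have x: "1 + L * \<tau> t > 0" using tau_nonneg[OF t(1)] L by (simp add: add_pos_nonneg)
          have y0: "y k t \<ge> 0" using y_nonneg[OF t(1)] k J'_subset by auto
          have "y k t \<le> M / L" using t(2) L by (simp add: field_simps)
          moreover have "1 / L \<le> M / L" using L M by (intro divide_right_mono) auto
          ultimately have "1 / L + y k t \<le> 2 * (M / L)" by linarith
          then have "(1 / L + y k t) powr \<epsilon> \<le> (2 * (M / L)) powr \<epsilon>"
            using \<epsilon> L y0 by (intro powr_mono2) auto
          also have "\<dots> = 2 powr \<epsilon> * (M / L) powr \<epsilon>" by (rule powr_mult)
          finally have "K * weight (\<lambda>_. 1) \<epsilon> (1/2) L t * (1 / L + y k t) powr \<epsilon>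
             \<le> K * weight (\<lambda>_. 1) \<epsilon> (1/2) L t * (2 powr \<epsilon> * (M / L) powr \<epsilon>)"
            using K weight_nonneg by (intro mult_left_mono) auto
          then have "weight a 0 1 L t \<le> (K * (2 powr \<epsilon> * (M / L) powr \<epsilon>)) * weight (\<lambda>_. 1) \<epsilon> (1/2) L t"
            using K(2)[OF L t(1) k] x by (simp add: mult_ac)
          moreover have "K * (2 powr \<epsilon> * (M / L) powr \<epsilon>) \<ge> 0" using K by simp
          ultimately show ?thesis using t by (simp add: ennreal_mult'[symmetric] ennreal_leI)
        qed simp
      qed
      also have "\<dots> = ennreal (K * (2 powr \<epsilon> * (M / L) powr \<epsilon>)) * (\<integral>\<^sup>+t\<in>P. ennreal (weight (\<lambda>_. 1) \<epsilon> (1/2) L t) \<partial>lborel)"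
        by (rule nn_integral_cmult) measurable
      also have "\<dots> \<le> ennreal (K * (2 powr \<epsilon> * (M / L) powr \<epsilon>)) * ennreal (K0 * L powr (real d - CARD('s)))"
        by (intro mult_left_mono K0 L) auto
      also have "\<dots> = ennreal (K * 2 powr \<epsilon> * K0 * (M / L) powr \<epsilon> * L powr (real d - CARD('s)))"
        using K K0 by (simp add: ennreal_mult'[symmetric] mult_ac)
      finally show "(\<integral>\<^sup>+t\<in>P \<inter> {t. L * y k t \<le> M}. ennreal (weight a 0 1 L t) \<partial>lborel)
          \<le> ennreal (K * 2 powr \<epsilon> * K0 * (M / L) powr \<epsilon> * L powr (real d - CARD('s)))" .
    qed
  qed
qed

end

subsection \<open>Lebesgue measure on affine hulls\<close>

lemma PiM_lborel_translation:
  fixes a :: "'i \<Rightarrow> real"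
  assumes "finite I"
  shows "distr (PiM I (\<lambda>_. lborel)) (PiM I (\<lambda>_. lborel)) (\<lambda>y. \<lambda>i\<in>I. y i + a i) = PiM I (\<lambda>_. lborel :: real measure)"
proof -
  interpret product_sigma_finite "\<lambda>_::'i. lborel :: real measure" ..
  show ?thesis
  proof (rule PiM_eqI[OF assms])
    fix A :: "'i \<Rightarrow> real set" assume A: "\<And>i. i \<in> I \<Longrightarrow> A i \<in> sets lborel"
    have A': "(\<lambda>x. x + a i) -` A i \<in> sets lborel" if "i \<in> I" for i
      using measurable_sets[of "\<lambda>x. x + a i" borel borel "A i"] A[OF that] by simp
    have "emeasure (distr (PiM I (\<lambda>_. lborel)) (PiM I (\<lambda>_. lborel)) (\<lambda>y. \<lambda>i\<in>I. y i + a i)) (Pi\<^sub>E I A)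
      = emeasure (PiM I (\<lambda>_. lborel)) ((\<lambda>y. \<lambda>i\<in>I. y i + a i) -` Pi\<^sub>E I A \<inter> space (PiM I (\<lambda>_. lborel)))"
      using A assms by (intro emeasure_distr sets_PiM_I_finite) auto
    also have "(\<lambda>y. \<lambda>i\<in>I. y i + a i) -` Pi\<^sub>E I A \<inter> space (PiM I (\<lambda>_. lborel)) = Pi\<^sub>E I (\<lambda>i. (\<lambda>x. x + a i) -` A i)"
      by (auto simp: space_PiM PiE_iff)
    also have "emeasure (PiM I (\<lambda>_. lborel)) \<dots> = (\<Prod>i\<in>I. emeasure lborel ((\<lambda>x. x + a i) -` A i))"
      using A' by (intro emeasure_PiM assms) auto
    also have "\<dots> = (\<Prod>i\<in>I. emeasure lborel (A i))"
    proof (intro prod.cong refl)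
      fix i assume i: "i \<in> I"
      have "emeasure lborel (A i) = emeasure (distr lborel borel ((+) (a i))) (A i)" by (simp add: lborel_distr_plus)
      also have "\<dots> = emeasure lborel ((+) (a i) -` A i)" using A[OF i] by (subst emeasure_distr) auto
      also have "(+) (a i) -` A i = (\<lambda>x. x + a i) -` A i" by (auto simp: add.commute)
      finally show "emeasure lborel ((\<lambda>x. x + a i) -` A i) = emeasure lborel (A i)" by simp
    qed
    finally show "emeasure (distr (PiM I (\<lambda>_. lborel)) (PiM I (\<lambda>_. lborel)) (\<lambda>y. \<lambda>i\<in>I. y i + a i)) (Pi\<^sub>E I A)
      = (\<Prod>i\<in>I. emeasure lborel (A i))" .
  qed simp
qed

lemma borel_translation:
  fixes v :: "'a::real_normed_vector"
  assumes "S \<in> sets borel"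
  shows "(+) v ` S \<in> sets borel"
proof -
  have "(+) v ` S = (+) (- v) -` S"
  proof (intro set_eqI iffI)
    fix x assume "x \<in> (+) (- v) -` S"
    then have "v + (- v + x) \<in> (+) v ` S" by (intro imageI) simp
    then show "x \<in> (+) v ` S" by simp
  qed auto
  moreover have "(+) (- v) \<in> borel_measurable borel"
    by (intro borel_measurable_continuous_onI continuous_intros)
  ultimately show ?thesis using measurable_sets[of "(+) (- v)" borel borel S] assms by simp
qed

text \<open>An orthonormal basis of the direction space exists, so the choice in
  \<open>affine_lebesgue\<close> has a candidate and its value comes from some frame. Which one is
  immaterial: later only translation invariance along the hull and positivity on boxes are drawn
  from it.\<close>

lemma affine_lebesgue_frame:
  fixes S :: "'a::euclidean_space set"
  assumes "aff_dim S = int d"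
  obtains p e where "p \<in> S" "\<And>i. i < d \<Longrightarrow> p + e i \<in> affine hull S"
    "\<And>i j. i < d \<Longrightarrow> j < d \<Longrightarrow> e i \<bullet> e j = (if i = j then 1 else 0)"
    "affine_lebesgue S = distr (\<Pi>\<^sub>M i\<in>{..<d}. lborel) borel (\<lambda>y. p + (\<Sum>i<d. y i *\<^sub>R e i))"
proof -
  have "S \<noteq> {}" using assms by auto
  then obtain p where p: "p \<in> S" by auto
  define V where "V = (\<lambda>x. - p + x) ` (affine hull S)"
  have pS: "p \<in> affine hull S" using p by (rule hull_inc)
  have subV: "subspace V"
    unfolding V_def using pS affine_affine_hull by (intro affine_diffs_subspace)
  have dimV: "dim V = d"
    using aff_dim_eq_dim[of p "affine hull S"] pS assms by (simp add: V_def hull_hull)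
  obtain B where B: "B \<subseteq> V" "pairwise orthogonal B" "\<And>x. x \<in> B \<Longrightarrow> norm x = 1" "independent B" "card B = dim V" "span B = V"
    using orthonormal_basis_subspace[OF subV] by metis
  have "finite B" using B(4) independent_imp_finite by blast
  then obtain e where e: "bij_betw e {0..<d} B"
    using ex_bij_betw_nat_finite[of B] B(5) dimV by auto
  have eB: "e i \<in> B" if "i < d" for i using e that by (auto simp: bij_betw_def)
  have ein: "p + e i \<in> affine hull S" if "i < d" for i
    using eB[OF that] B(1) by (auto simp: V_def)
  have eo: "e i \<bullet> e j = (if i = j then 1 else 0)" if "i < d" "j < d" for i j
  proof (cases "i = j")
    case True
    then show ?thesis using B(3)[OF eB[OF that(1)]] by (simp add: norm_eq_1)
  next
    case False
    then have "e i \<noteq> e j" using e that by (auto simp: bij_betw_def inj_on_def)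
    then show ?thesis using B(2) eB that False by (auto simp: pairwise_def orthogonal_def)
  qed
  define Q where "Q M \<longleftrightarrow> (\<exists>p e. p \<in> S \<and> (\<forall>i<d. p + e i \<in> affine hull S) \<and>
       (\<forall>i<d. \<forall>j<d. e i \<bullet> e j = (if i = j then 1 else 0)) \<and>
       M = distr (\<Pi>\<^sub>M i\<in>{..<d}. lborel) borel (\<lambda>y. p + (\<Sum>i<d. y i *\<^sub>R e i)))" for M
  have "Q (distr (\<Pi>\<^sub>M i\<in>{..<d}. lborel) borel (\<lambda>y. p + (\<Sum>i<d. y i *\<^sub>R e i)))"
    unfolding Q_def using p ein eo by blast
  then have "Q (SOME M. Q M)" by (rule someI)
  moreover have "affine_lebesgue S = (SOME M. Q M)"
    unfolding affine_lebesgue_def Q_def assms by simp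
  ultimately have "Q (affine_lebesgue S)" by simp
  then show ?thesis unfolding Q_def using that by blast
qed

text \<open>The dyadic pieces of \<open>F\<close> at distance about \<open>2 ^ (- k)\<close> from the face spanned by \<open>E\<close> are disjoint.
  The piece for \<open>k = 0\<close> is covered by \<open>2 ^ (k * (d + 1 - card E))\<close> translates of the \<open>k\<close>-th one; this bounds the measure of the latter from below, and convergence of the integral forces the
  exponent sum to be positive.\<close>

lemma convergent_type_local_integrability:
  fixes F :: "(real ^ 's) set"
  assumes "convex F" and F_borel: "F \<in> sets borel" and F_nonneg: "\<And>t j. t \<in> F \<Longrightarrow> 0 \<le> t $ j" and dim_F: "aff_dim F = int d"
    and F_coord: "\<And>j. \<not> F \<subseteq> {t. t $ j = 0}" and conv: "convergent_type \<l> F"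
    and E: "E \<subseteq> F" "E \<noteq> {}" "\<not> affine_dependent E" "card E \<le> d"
  shows "0 < (\<Sum>j | \<forall>t\<in>E. t $ j = 0. \<l> $ j) + (real d + 1 - card E)"
proof -
  obtain p e where p: "p \<in> F" and ein: "\<And>i. i < d \<Longrightarrow> p + e i \<in> affine hull F"
    and eo: "\<And>i j. i < d \<Longrightarrow> j < d \<Longrightarrow> e i \<bullet> e j = (if i = j then 1 else 0)"
    and M: "affine_lebesgue F = distr (\<Pi>\<^sub>M i\<in>{..<d}. lborel) borel (\<lambda>y. p + (\<Sum>i<d. y i *\<^sub>R e i))"
  proof -
    show thesis by (rule affine_lebesgue_frame[OF dim_F]) (fact that)
  qed
  define M where "M = affine_lebesgue F"
  define \<Theta> where "\<Theta> y = p + (\<Sum>i<d. y i *\<^sub>R e i)" for y :: "nat \<Rightarrow> real"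
  have M_eq: "M = distr (\<Pi>\<^sub>M i\<in>{..<d}. lborel) borel \<Theta>" unfolding M_def M \<Theta>_def ..
  have [measurable_cong]: "sets M = sets borel" by (simp add: M_eq)
  have [measurable]: "\<Theta> \<in> measurable (\<Pi>\<^sub>M i\<in>{..<d}. lborel) borel"
    unfolding \<Theta>_def by measurable
  define H where "H = affine hull F"
  have pH: "p \<in> H" using p by (simp add: H_def hull_inc)
  define V where "V = (\<lambda>x. - p + x) ` H"
  have subV: "subspace V"
    unfolding V_def using pH by (intro affine_diffs_subspace) (simp_all add: H_def)
  have dimV: "dim V = d"
    using aff_dim_eq_dim[of p H] pH dim_F by (simp add: V_def H_def hull_hull)
  have VH: "x - z \<in> V" if "x \<in> H" "z \<in> H" for x z
  proof -
    have "(- p + x) - (- p + z) \<in> V" using that by (intro subspace_diff subV) (auto simp: V_def)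
    then show ?thesis by simp
  qed
  have HV: "z + v \<in> H" if "z \<in> H" "v \<in> V" for z v
  proof -
    have "- p + z \<in> V" using that(1) by (auto simp: V_def)
    from subspace_add[OF subV this that(2)] have "(- p + z) + v \<in> V" .
    then obtain y where "y \<in> H" "(- p + z) + v = - p + y" unfolding V_def by blast
    then show ?thesis by (simp add: add.assoc)
  qed
  have eV: "e i \<in> V" if "i < d" for i
    using VH[OF ein[OF that, folded H_def] pH] by simp
  have spanV: "\<exists>a. v = (\<Sum>i<d. a i *\<^sub>R e i)" if "v \<in> V" for v
  proof -
    have inj: "inj_on e {..<d}"
    proof (rule inj_onI)
      fix i j assume ij: "i \<in> {..<d}" "j \<in> {..<d}" "e i = e j"
      then have "e i \<bullet> e j = 1" using eo[of j j] by simp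
      then show "i = j" using eo[of i j] ij by (auto split: if_splits)
    qed
    have ind: "independent (e ` {..<d})"
    proof (rule pairwise_orthogonal_independent)
      show "pairwise orthogonal (e ` {..<d})" using eo by (auto simp: pairwise_def orthogonal_def)
      show "0 \<notin> e ` {..<d}"
      proof
        assume "0 \<in> e ` {..<d}"
        then obtain i where "i < d" "e i = 0" by auto
        then show False using eo[of i i] by simp
      qed
    qed
    have "V \<subseteq> span (e ` {..<d})"
      using eV ind dimV card_image[OF inj] by (intro card_ge_dim_independent) auto
    then have "v \<in> span (e ` {..<d})" using that by auto
    then obtain u where "v = (\<Sum>x\<in>e ` {..<d}. u x *\<^sub>R x)" by (auto simp: span_finite)
    then have "v = (\<Sum>i<d. u (e i) *\<^sub>R e i)" using inj by (simp add: sum.reindex)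
    then show ?thesis by (intro exI[of _ "\<lambda>i. u (e i)"])
  qed
  \<comment> \<open>A translation along the hull becomes a translation of the frame
    coordinates.\<close>
  have transl: "emeasure M ((+) v ` S) = emeasure M S" if v: "v \<in> V" and S: "S \<in> sets borel" for v S
  proof -
    obtain a where a: "v = (\<Sum>i<d. a i *\<^sub>R e i)" using spanV[OF v] by blast
    let ?N = "\<Pi>\<^sub>M i\<in>{..<d}. (lborel :: real measure)"
    have [measurable]: "(\<lambda>y. \<lambda>i\<in>{..<d}. y i + a i) \<in> measurable ?N ?N" by measurable
    have "distr M borel ((+) v) = distr ?N borel (\<lambda>y. v + \<Theta> y)"
      unfolding M_eq by (subst distr_distr) (auto simp: o_def)
    also have "\<dots> = distr ?N borel (\<lambda>y. \<Theta> (\<lambda>i\<in>{..<d}. y i + a i))"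
      by (intro distr_cong) (auto simp: \<Theta>_def a scaleR_add_left sum.distrib algebra_simps)
    also have "\<dots> = distr (distr ?N ?N (\<lambda>y. \<lambda>i\<in>{..<d}. y i + a i)) borel \<Theta>"
      by (subst distr_distr) (auto simp: o_def)
    also have "\<dots> = M" by (simp add: PiM_lborel_translation M_eq)
    finally have *: "distr M borel ((+) v) = M" .
    have "(+) v -` ((+) v ` S) = S" by auto
    moreover have "(+) v ` S \<in> sets borel" by (rule borel_translation[OF S])
    ultimately have "emeasure (distr M borel ((+) v)) ((+) v ` S) = emeasure M S"
      by (subst emeasure_distr) (auto simp: M_eq)
    then show ?thesis by (simp add: *)
  qed
  \<comment> \<open>\<open>E\<close> is completed to an affine basis within \<open>F\<close>. By
    convexity \<open>F\<close> contains the simplex on \<open>T\<close>, from which the dyadic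
    pieces are cut by barycentric coordinates.\<close>
  obtain T where T: "\<not> affine_dependent T" "E \<subseteq> T" "T \<subseteq> F" "affine hull T = affine hull F"
    using extend_to_affine_basis_nonempty[OF E(3,1,2)] by auto
  have finT: "finite T" using T(1) aff_independent_finite by blast
  have cardT: "card T = d + 1"
    using aff_dim_affine_independent[OF T(1)] aff_dim_affine_hull[of T] aff_dim_affine_hull[of F] T(4) dim_F by simp
  obtain e0 where e0: "e0 \<in> E" using E(2) by auto
  define X where "X = T - {e0}"
  have finX: "finite X" using finT by (simp add: X_def)
  have cardX: "card X = d" using cardT finT e0 T(2) by (auto simp: X_def)
  have e0H: "e0 \<in> H" and XH: "x \<in> X \<Longrightarrow> x \<in> H" for x
    using e0 E(1) T(3) by (auto simp: H_def X_def intro: hull_inc)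
  have indX: "independent ((\<lambda>x. - e0 + x) ` X)"
  proof -
    have "T = insert e0 X" "e0 \<notin> X" using e0 T(2) by (auto simp: X_def)
    then show ?thesis using T(1) affine_dependent_iff_dependent[of e0 X] by auto
  qed
  have injX: "inj_on (\<lambda>x. - e0 + x) X" by auto
  have spanX: "V = span ((\<lambda>x. - e0 + x) ` X)"
  proof (rule antisym)
    show "V \<subseteq> span ((\<lambda>x. - e0 + x) ` X)"
      using indX dimV cardX card_image[OF injX] VH[OF XH e0H]
      by (intro card_ge_dim_independent) auto
    show "span ((\<lambda>x. - e0 + x) ` X) \<subseteq> V"
      using VH[OF XH e0H] by (intro span_minimal subV) auto
  qed
  \<comment> \<open>Dual functionals: on the hull, \<open>g x (t - e0)\<close> is the barycentric
    coordinate of \<open>t\<close> at \<open>x\<close>.\<close>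
  have "\<forall>x\<in>X. \<exists>g. linear g \<and> (\<forall>x'\<in>X. g (x' - e0) = (if x' = x then 1 else 0 :: real))"
  proof
    fix x assume "x \<in> X"
    obtain g where g: "linear g" "\<forall>z\<in>(\<lambda>x. - e0 + x) ` X. g z = (if z = x - e0 then 1 else 0 :: real)"
      using linear_independent_extend[OF indX, of "\<lambda>z. if z = x - e0 then 1 else 0 :: real"] by auto
    then show "\<exists>g. linear g \<and> (\<forall>x'\<in>X. g (x' - e0) = (if x' = x then 1 else 0 :: real))"
      by (intro exI[of _ g]) auto
  qed
  from bchoice[OF this] obtain g where "\<forall>x\<in>X. linear (g x) \<and> (\<forall>x'\<in>X. g x (x' - e0) = (if x' = x then 1 else 0 :: real))" ..
  then have g: "\<And>x. x \<in> X \<Longrightarrow> linear (g x)"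
    "\<And>x x'. x \<in> X \<Longrightarrow> x' \<in> X \<Longrightarrow> g x (x' - e0) = (if x' = x then 1 else 0)" by auto
  have g_sum: "g x (\<Sum>x'\<in>X. c x' *\<^sub>R (x' - e0)) = c x" if "x \<in> X" for x c
    using that finX by (simp add: linear_sum[OF g(1)] linear_cmul[OF g(1)] g(2) if_distrib[of "\<lambda>z. _ * z"] sum.delta' cong: if_cong)
  have rep: "t = e0 + (\<Sum>x\<in>X. g x (t - e0) *\<^sub>R (x - e0))" if "t \<in> H" for t
  proof -
    have "t - e0 \<in> span ((\<lambda>x. - e0 + x) ` X)" using VH[OF that e0H] spanX by simp
    then obtain u where "t - e0 = (\<Sum>z\<in>(\<lambda>x. - e0 + x) ` X. u z *\<^sub>R z)" using finX by (auto simp: span_finite)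
    then have u: "t - e0 = (\<Sum>x\<in>X. u (- e0 + x) *\<^sub>R (x - e0))" by (simp add: sum.reindex)
    have gu: "g x (t - e0) = u (- e0 + x)" if "x \<in> X" for x unfolding u by (rule g_sum[OF that])
    have "(\<Sum>x\<in>X. g x (t - e0) *\<^sub>R (x - e0)) = (\<Sum>x\<in>X. u (- e0 + x) *\<^sub>R (x - e0))"
      by (intro sum.cong) (auto simp: gu)
    also have "\<dots> = t - e0" by (rule u[symmetric])
    finally show ?thesis by (metis add.commute diff_add_cancel)
  qed
  have gm: "(\<lambda>t. g x (t - e0)) \<in> borel_measurable borel" "continuous_on UNIV (\<lambda>t. g x (t - e0))" if "x \<in> X" for x
  proof -
    have "continuous_on UNIV (g x)"
      using g(1)[OF that] by (simp add: linear_continuous_on linear_conv_bounded_linear)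
    then show "continuous_on UNIV (\<lambda>t. g x (t - e0))"
      by (rule continuous_on_compose2) (auto intro!: continuous_intros)
    then show "(\<lambda>t. g x (t - e0)) \<in> borel_measurable borel" by (rule borel_measurable_continuous_onI)
  qed
  define Z where "Z = T - E"
  have ZX: "Z \<subseteq> X" and finZ: "finite Z" using e0 finT by (auto simp: Z_def X_def)
  have cardZ: "real (card Z) = real d + 1 - card E"
    using T(2) cardT finT E(4) by (simp add: Z_def card_Diff_subset finite_subset of_nat_diff)
  have Zne: "Z \<noteq> {}" using cardZ E(4) by (intro notI) simp
  \<comment> \<open>So small that the \<open>d\<close> coordinates, each at most
    \<open>2 * \<rho>\<close>, leave weight at least 1/2 at \<open>e0\<close>.\<close>
  define \<rho> where "\<rho> = 1 / (4 * (real d + 1))"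
  have \<rho>: "\<rho> > 0" "2 * \<rho> * d \<le> 1 / 2" "\<rho> \<le> 1 / 2" by (auto simp: \<rho>_def field_simps)
  define h where "h k = (1 / 2 :: real) ^ k" for k :: nat
  have h: "h k > 0" "h k \<le> 1" for k by (auto simp: h_def power_le_one)
  \<comment> \<open>The coordinates at \<open>Z\<close> measure the distance from the face spanned
    by \<open>E\<close> and are of size \<open>h k\<close>; all others stay of size \<rho>.
    Half-open ranges make the pieces disjoint and allow an exact tiling.\<close>
  define G where "G k = {t \<in> H. (\<forall>x\<in>X - Z. \<rho> < g x (t - e0) \<and> g x (t - e0) \<le> 2 * \<rho>) \<and>
      (\<forall>x\<in>Z. \<rho> * h k < g x (t - e0) \<and> g x (t - e0) \<le> 2 * (\<rho> * h k))}" for k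
  have G_borel: "G k \<in> sets borel" for k
  proof -
    have "closed H" by (simp add: H_def closed_affine_hull)
    then have [measurable]: "H \<in> sets borel" by simp
    have [measurable]: "{t. a < g x (t - e0) \<and> g x (t - e0) \<le> b} \<in> sets borel" if "x \<in> X" for x a b
    proof -
      note [measurable] = gm(1)[OF that]
      show ?thesis by measurable
    qed
    have "G k = H \<inter> ((\<Inter>x\<in>X - Z. {t. \<rho> < g x (t - e0) \<and> g x (t - e0) \<le> 2 * \<rho>}) \<inter>
       (\<Inter>x\<in>Z. {t. \<rho> * h k < g x (t - e0) \<and> g x (t - e0) \<le> 2 * (\<rho> * h k)}))"
      by (auto simp: G_def)
    also have "\<dots> \<in> sets borel"
    proof -
      have "(\<Inter>x\<in>Z. {t. \<rho> * h k < g x (t - e0) \<and> g x (t - e0) \<le> 2 * (\<rho> * h k)}) \<in> sets borel"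
        using ZX finZ Zne by (intro sets.finite_INT) auto
      moreover have "(\<Inter>x\<in>X - Z. {t. \<rho> < g x (t - e0) \<and> g x (t - e0) \<le> 2 * \<rho>}) \<in> sets borel"
      proof (cases "X - Z = {}")
        case True
        show ?thesis unfolding True by simp
      next
        case False
        then show ?thesis using finX by (intro sets.finite_INT) auto
      qed
      ultimately show ?thesis by (intro sets.Int) auto
    qed
    finally show ?thesis .
  qed
  have coef: "0 < g x (t - e0)" "g x (t - e0) \<le> 2 * \<rho>" if "t \<in> G k" "x \<in> X" for t k x
  proof -
    have "\<rho> * h k > 0" "\<rho> * h k \<le> \<rho>" using h[of k] \<rho> by (auto intro: mult_left_le)
    moreover have "\<rho> * h k < g x (t - e0) \<and> g x (t - e0) \<le> 2 * (\<rho> * h k)" if "x \<in> Z"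
      using \<open>t \<in> G k\<close> that by (simp add: G_def)
    moreover have "\<rho> < g x (t - e0) \<and> g x (t - e0) \<le> 2 * \<rho>" if "x \<notin> Z"
      using \<open>t \<in> G k\<close> \<open>x \<in> X\<close> that by (simp add: G_def)
    ultimately show "0 < g x (t - e0)" "g x (t - e0) \<le> 2 * \<rho>"
      using \<rho>(1) by (cases "x \<in> Z"; linarith)+
  qed
  have coef0: "1 - (\<Sum>x\<in>X. g x (t - e0)) \<ge> 1 / 2" if "t \<in> G k" for t k
  proof -
    have "(\<Sum>x\<in>X. g x (t - e0)) \<le> (\<Sum>x\<in>X. 2 * \<rho>)" using coef(2)[OF that] by (intro sum_mono) auto
    also have "\<dots> = 2 * \<rho> * d" by (simp add: cardX)
    finally show ?thesis using \<rho>(2) by linarith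
  qed
  define lam where "lam t x = (if x = e0 then 1 - (\<Sum>x\<in>X. g x (t - e0)) else g x (t - e0))" for t x
  have T_ins: "T = insert e0 X" "e0 \<notin> X" using e0 T(2) by (auto simp: X_def)
  have lam_sum: "(\<Sum>x\<in>T. lam t x) = 1" for t
  proof -
    have "(\<Sum>x\<in>X. lam t x) = (\<Sum>x\<in>X. g x (t - e0))" using T_ins(2) by (intro sum.cong) (auto simp: lam_def)
    then show ?thesis using finX T_ins by (simp add: lam_def)
  qed
  have lam_rep: "t = (\<Sum>x\<in>T. lam t x *\<^sub>R x)" if "t \<in> H" for t
  proof -
    have "(\<Sum>x\<in>X. lam t x *\<^sub>R x) = (\<Sum>x\<in>X. g x (t - e0) *\<^sub>R x)" using T_ins(2) by (intro sum.cong) (auto simp: lam_def)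
    then have "(\<Sum>x\<in>T. lam t x *\<^sub>R x) = (1 - (\<Sum>x\<in>X. g x (t - e0))) *\<^sub>R e0 + (\<Sum>x\<in>X. g x (t - e0) *\<^sub>R x)"
      using finX T_ins by (simp add: lam_def)
    also have "\<dots> = e0 + (\<Sum>x\<in>X. g x (t - e0) *\<^sub>R (x - e0))"
      by (simp add: scaleR_diff_left scaleR_diff_right sum_subtractf scaleR_sum_left)
    finally show ?thesis using rep[OF that] by simp
  qed
  have lam_pos: "lam t x > 0" if "t \<in> G k" "x \<in> T" for t k x
    using coef(1)[OF that(1), of x] coef0[OF that(1)] that(2) T_ins by (auto simp: lam_def)
  have lam_E: "lam t x \<ge> \<rho>" if "t \<in> G k" "x \<in> E" for t k x
    using coef0[OF that(1)] that \<rho>(3) T(2) unfolding lam_def G_def Z_def X_def by (auto simp: less_imp_le)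
  have lam_Z: "\<rho> * h k \<le> lam t x" "lam t x \<le> 2 * (\<rho> * h k)" if "t \<in> G k" "x \<in> Z" for t k x
    using that ZX T_ins unfolding lam_def G_def by (auto simp: less_imp_le)
  have GH: "G k \<subseteq> H" for k by (auto simp: G_def)
  have GF: "G k \<subseteq> F" for k
  proof
    fix t assume t: "t \<in> G k"
    have "(\<Sum>x\<in>T. lam t x *\<^sub>R x) \<in> convex hull T"
      using lam_pos[OF t] lam_sum[of t] unfolding convex_hull_finite[OF finT]
      by (intro CollectI exI[of _ "lam t"]) (auto simp: less_imp_le)
    moreover have "convex hull T \<subseteq> F" using T(3) \<open>convex F\<close> by (rule hull_minimal)
    moreover have "t \<in> H" using t GH by blast
    ultimately show "t \<in> F" using lam_rep by (metis subsetD)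
  qed
  have disj: "k = k'" if "t \<in> G k" "t \<in> G k'" for t k k'
  proof -
    obtain z where z: "z \<in> Z" using Zne by auto
    have *: False if "t \<in> G k" "t \<in> G k'" "k < k'" for k k'
    proof -
      have "h k' \<le> h (Suc k)" using that(3) unfolding h_def by (intro power_decreasing) auto
      then have "2 * h k' \<le> h k" by (simp add: h_def)
      then have "2 * (\<rho> * h k') \<le> \<rho> * h k" using \<rho>(1) by simp
      then show False using that(1,2) z unfolding G_def by fastforce
    qed
    show ?thesis using *[OF that] *[OF that(2,1)] by (cases k k' rule: linorder_cases) auto
  qed
  have cover: "emeasure M (G 0) \<le> ennreal (2 ^ (k * card Z)) * emeasure M (G k)" for k
  proof -
    define N where "N = Pi\<^sub>E Z (\<lambda>_. {..<(2::nat) ^ k})"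
    have finN: "finite N" unfolding N_def using finZ by (intro finite_PiE) auto
    have cardN: "card N = 2 ^ (k * card Z)" unfolding N_def using finZ by (simp add: card_PiE power_mult)
    \<comment> \<open>At each vertex of \<open>Z\<close> the range of length \<rho> is cut into
      \<open>2 ^ k\<close> intervals of length \<open>\<rho> * h k\<close>. Subtracting
      \<open>v n\<close> moves interval number \<open>n x\<close> onto the range of the
      \<open>k\<close>-th piece, which begins at \<open>\<rho> * h k\<close> and not at 0; hence
      \<open>n x - 1\<close>.\<close>
    define v where "v n = (\<Sum>x\<in>X. (if x \<in> Z then \<rho> + (real (n x) - 1) * (\<rho> * h k) else 0) *\<^sub>R (x - e0))" for n :: "real^'s \<Rightarrow> nat"
    have vV: "v n \<in> V" for n
      unfolding v_def by (intro subspace_sum subspace_scale subV VH XH e0H)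
    have G0_sub: "G 0 \<subseteq> (\<Union>n\<in>N. (+) (v n) ` G k)"
    proof
      fix t assume t: "t \<in> G 0"
      define n where "n = (\<lambda>x\<in>Z. nat (\<lceil>(g x (t - e0) - \<rho>) / (\<rho> * h k)\<rceil> - 1))"
      have rh: "\<rho> * h k > 0" using \<rho> h by simp
      have nx: "real (n x) * (\<rho> * h k) < g x (t - e0) - \<rho>" "g x (t - e0) - \<rho> \<le> (real (n x) + 1) * (\<rho> * h k)" "n x < 2 ^ k"
        if x: "x \<in> Z" for x
      proof -
        define w where "w = (g x (t - e0) - \<rho>) / (\<rho> * h k)"
        have b: "\<rho> < g x (t - e0)" "g x (t - e0) \<le> 2 * \<rho>" using t x by (auto simp: G_def h_def)
        have w0: "w > 0" using b rh by (simp add: w_def)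
        have "w \<le> \<rho> / (\<rho> * h k)" unfolding w_def using b rh by (intro divide_right_mono) auto
        also have "\<dots> = 2 ^ k" using \<rho> by (simp add: h_def power_divide)
        finally have w1: "w \<le> 2 ^ k" .
        have nn: "int (n x) = \<lceil>w\<rceil> - 1" using x w0 by (simp add: n_def w_def[symmetric])
        then have rn: "real (n x) = of_int \<lceil>w\<rceil> - 1" by (metis of_int_1 of_int_diff of_int_of_nat_eq)
        have "real (n x) < w" "w \<le> real (n x) + 1" unfolding rn by linarith+
        moreover have gw: "g x (t - e0) - \<rho> = w * (\<rho> * h k)"
          by (metis w_def nonzero_eq_divide_eq less_irrefl rh)
        ultimately show "real (n x) * (\<rho> * h k) < g x (t - e0) - \<rho>" "g x (t - e0) - \<rho> \<le> (real (n x) + 1) * (\<rho> * h k)"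
          unfolding gw using rh by (auto intro!: mult_strict_right_mono mult_right_mono)
        have "real (n x) < 2 ^ k" using \<open>real (n x) < w\<close> w1 by linarith
        then show "n x < 2 ^ k" by (metis of_nat_less_iff of_nat_numeral of_nat_power)
      qed
      have nN: "n \<in> N" using nx(3) by (auto simp: N_def n_def PiE_iff)
      have tH: "t \<in> H" using t GH by auto
      have sub: "- v n \<in> V" using vV subV by (simp add: subspace_neg)
      have "t - v n \<in> H" using HV[OF tH sub] by simp
      have gx: "g x (t - v n - e0) = g x (t - e0) - (if x \<in> Z then \<rho> + (real (n x) - 1) * (\<rho> * h k) else 0)" if "x \<in> X" for x
      proof -
        have "g x (t - v n - e0) = g x ((t - e0) - v n)" by (simp add: algebra_simps)
        also have "\<dots> = g x (t - e0) - g x (v n)" by (rule linear_diff[OF g(1)[OF that]])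
        also have "g x (v n) = (if x \<in> Z then \<rho> + (real (n x) - 1) * (\<rho> * h k) else 0)"
          unfolding v_def by (rule g_sum[OF that])
        finally show ?thesis .
      qed
      have "t - v n \<in> G k"
        unfolding G_def
      proof (intro CollectI conjI ballI)
        show "t - v n \<in> H" by fact
        fix x assume "x \<in> X - Z"
        then show "\<rho> < g x (t - v n - e0)" "g x (t - v n - e0) \<le> 2 * \<rho>"
          using gx[of x] t by (auto simp: G_def)
      next
        fix x assume x: "x \<in> Z"
        then show "\<rho> * h k < g x (t - v n - e0)" "g x (t - v n - e0) \<le> 2 * (\<rho> * h k)"
          using gx[of x] nx[OF x] ZX by (auto simp: algebra_simps)
      qed
      then have "t \<in> (+) (v n) ` G k" by (intro image_eqI[of _ _ "t - v n"]) auto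
      then show "t \<in> (\<Union>n\<in>N. (+) (v n) ` G k)" using nN by auto
    qed
    have imb: "(+) (v n) ` G k \<in> sets M" for n
      using borel_translation[OF G_borel] by (simp add: \<open>sets M = sets borel\<close>)
    have "emeasure M (G 0) \<le> emeasure M (\<Union>n\<in>N. (+) (v n) ` G k)"
      using G0_sub imb finN by (intro emeasure_mono sets.finite_UN) auto
    also have "\<dots> \<le> (\<Sum>n\<in>N. emeasure M ((+) (v n) ` G k))"
      using imb finN by (intro emeasure_subadditive_finite) auto
    also have "\<dots> = (\<Sum>n\<in>N. emeasure M (G k))" by (simp add: transl vV G_borel)
    also have "\<dots> = ennreal (2 ^ (k * card Z)) * emeasure M (G k)"
      by (simp add: cardN ennreal_of_nat_eq_real_of_nat flip: ennreal_power)
    finally show ?thesis .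
  qed
  have pos: "emeasure M (G 0) > 0"
  proof -
    \<comment> \<open>Every coordinate lies in the middle of its range, so a small box around this
      point in frame coordinates maps into \<open>G 0\<close>.\<close>
    define c0 where "c0 = e0 + (\<Sum>x\<in>X. (3 / 2 * \<rho>) *\<^sub>R (x - e0))"
    have c0H: "c0 \<in> H"
      unfolding c0_def by (intro HV e0H subspace_sum subspace_scale subV VH XH)
    have gc0: "g x (c0 - e0) = 3 / 2 * \<rho>" if "x \<in> X" for x
      using g_sum[OF that, of "\<lambda>_. 3 / 2 * \<rho>"] by (simp add: c0_def)
    have "\<forall>x\<in>X. \<exists>\<eta>>0. \<forall>t. dist t c0 < \<eta> \<longrightarrow> dist (g x (t - e0)) (g x (c0 - e0)) < \<rho> / 2"
      using gm(2) \<rho>(1) unfolding continuous_on_iff by (metis UNIV_I half_gt_zero)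
    from bchoice[OF this] obtain \<eta> where \<eta>: "\<forall>x\<in>X. \<eta> x > 0 \<and> (\<forall>t. dist t c0 < \<eta> x \<longrightarrow> dist (g x (t - e0)) (g x (c0 - e0)) < \<rho> / 2)" ..
    define \<eta>0 where "\<eta>0 = Min (insert 1 (\<eta> ` X))"
    have \<eta>0: "\<eta>0 > 0" "\<And>x. x \<in> X \<Longrightarrow> \<eta>0 \<le> \<eta> x" using \<eta> finX by (auto simp: \<eta>0_def)
    obtain y0 where y0: "c0 - p = (\<Sum>i<d. y0 i *\<^sub>R e i)" using spanV[OF VH[OF c0H pH]] by blast
    define r where "r = \<eta>0 / (real d + 1)"
    have r: "r > 0" using \<eta>0 by (simp add: r_def)
    define A where "A = Pi\<^sub>E {..<d} (\<lambda>i. {y0 i - r <..< y0 i + r})"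
    have norm_e: "norm (e i) = 1" if "i < d" for i using eo[OF that that] by (simp add: norm_eq_1)
    have sub: "A \<subseteq> \<Theta> -` G 0 \<inter> space (\<Pi>\<^sub>M i\<in>{..<d}. (lborel :: real measure))"
    proof
      fix z assume z: "z \<in> A"
      have \<Theta>z: "\<Theta> z - c0 = (\<Sum>i<d. (z i - y0 i) *\<^sub>R e i)"
        using y0 by (simp add: \<Theta>_def scaleR_diff_left sum_subtractf algebra_simps)
      have "norm (\<Theta> z - c0) \<le> (\<Sum>i<d. norm ((z i - y0 i) *\<^sub>R e i))"
        unfolding \<Theta>z by (rule norm_sum)
      also have "\<dots> \<le> (\<Sum>i<d. r)"
        using z norm_e by (intro sum_mono) (force simp: A_def PiE_iff)
      also have "\<dots> = d * r" by simp
      also have "\<dots> < (real d + 1) * r" using r by simp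
      also have "\<dots> = \<eta>0" by (simp add: r_def)
      finally have close: "dist (\<Theta> z) c0 < \<eta>0" by (simp add: dist_norm)
      have \<Theta>H: "\<Theta> z \<in> H"
        unfolding \<Theta>_def by (intro HV pH subspace_sum subspace_scale subV eV) auto
      have "\<rho> < g x (\<Theta> z - e0) \<and> g x (\<Theta> z - e0) \<le> 2 * \<rho>" if x: "x \<in> X" for x
      proof -
        have "dist (g x (\<Theta> z - e0)) (g x (c0 - e0)) < \<rho> / 2"
          using \<eta> x close \<eta>0(2)[OF x] by auto
        then have "\<bar>g x (\<Theta> z - e0) - 3 / 2 * \<rho>\<bar> < \<rho> / 2" using gc0[OF x] by (simp add: dist_real_def)
        then show ?thesis by linarith
      qed
      then have "\<Theta> z \<in> G 0" using \<Theta>H ZX by (auto simp: G_def h_def)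
      then show "z \<in> \<Theta> -` G 0 \<inter> space (\<Pi>\<^sub>M i\<in>{..<d}. (lborel :: real measure))"
        using z by (auto simp: A_def space_PiM PiE_iff)
    qed
    interpret product_sigma_finite "\<lambda>_::nat. lborel :: real measure" ..
    have "emeasure (\<Pi>\<^sub>M i\<in>{..<d}. (lborel :: real measure)) A = (\<Prod>i<d. emeasure lborel {y0 i - r <..< y0 i + r})"
      unfolding A_def by (intro emeasure_PiM) auto
    also have "\<dots> = ennreal ((2 * r) ^ d)" using r by (simp add: ennreal_power)
    also have "\<dots> > 0" using r by simp
    finally have "0 < emeasure (\<Pi>\<^sub>M i\<in>{..<d}. (lborel :: real measure)) A" .
    also have "\<dots> \<le> emeasure (\<Pi>\<^sub>M i\<in>{..<d}. (lborel :: real measure)) (\<Theta> -` G 0 \<inter> space (\<Pi>\<^sub>M i\<in>{..<d}. (lborel :: real measure)))"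
    proof (rule emeasure_mono[OF sub])
      show "\<Theta> -` G 0 \<inter> space (\<Pi>\<^sub>M i\<in>{..<d}. (lborel :: real measure)) \<in> sets (\<Pi>\<^sub>M i\<in>{..<d}. (lborel :: real measure))"
        using G_borel[of 0] by measurable
    qed
    also have "\<dots> = emeasure M (G 0)" unfolding M_eq using G_borel by (subst emeasure_distr) auto
    finally show ?thesis .
  qed
  define I where "I = {j. \<forall>t\<in>E. t $ j = 0}"
  define \<sigma> where "\<sigma> = (\<Sum>j\<in>I. \<l> $ j)"
  \<comment> \<open>Order of magnitude of \<open>t $ j\<close> on \<open>G k\<close>: it shrinks
    with the distance from the face exactly when the coordinate vanishes on
    \<open>E\<close>.\<close>
  define sc where "sc k j = (if j \<in> I then h k else 1)" for k j
  have comparable: "\<exists>R\<ge>1. \<forall>k. \<forall>t\<in>G k. t $ j \<le> R * sc k j \<and> sc k j \<le> R * t $ j" for j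
  proof -
    have xj: "x $ j \<ge> 0" if "x \<in> T" for x using F_nonneg T(3) that by auto
    define s where "s = (\<Sum>x\<in>T. x $ j)"
    have s0: "s \<ge> 0" unfolding s_def using xj by (intro sum_nonneg) auto
    have tj: "t $ j = (\<Sum>x\<in>T. lam t x * x $ j)" if "t \<in> G k" for t k
    proof -
      have "t \<in> H" using that GH by blast
      from arg_cong[OF lam_rep[OF this], of "\<lambda>z. z $ j"] show ?thesis
        unfolding sum_component vector_scaleR_component real_scaleR_def .
    qed
    show ?thesis
    proof (cases "j \<in> I")
      case True
      \<comment> \<open>Otherwise the coordinate vanishes on the affine basis \<open>T\<close>,
        hence on \<open>F\<close>, contrary to \<open>F_coord\<close>.\<close>
      have "\<exists>z\<in>Z. z $ j > 0"
      proof (rule ccontr)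
        assume "\<not> (\<exists>z\<in>Z. z $ j > 0)"
        then have z0: "x $ j = 0" if "x \<in> T" for x
          using that True xj[OF that] by (cases "x \<in> E") (auto simp: Z_def I_def not_less intro: antisym)
        have form: "affine_form (\<lambda>t::real^'s. t $ j)"
          unfolding affine_form_def by (rule exI[of _ 0], rule exI[of _ "axis j 1"]) (simp add: inner_axis' fun_eq_iff)
        have "F \<subseteq> {t. t $ j = 0}"
          using affine_form_zero_affine_hull[OF form z0] T(4) hull_inc[of _ F] by auto
        then show False using F_coord by blast
      qed
      then obtain z where z: "z \<in> Z" "z $ j > 0" by auto
      have zT: "z \<in> T" using z by (simp add: Z_def)
      define R where "R = 1 + 2 * \<rho> * s + 1 / (\<rho> * z $ j)"
      have R: "R \<ge> 1" "R \<ge> 2 * \<rho> * s" "R \<ge> 1 / (\<rho> * z $ j)" using \<rho> s0 z by (auto simp: R_def)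
      show ?thesis
      proof (intro exI[of _ R] conjI R(1) allI ballI)
        fix k t assume t: "t \<in> G k"
        have "t $ j = (\<Sum>x\<in>T. lam t x * x $ j)" by (rule tj[OF t])
        also have "\<dots> \<le> (\<Sum>x\<in>T. 2 * (\<rho> * h k) * x $ j)"
        proof (intro sum_mono)
          fix x assume x: "x \<in> T"
          show "lam t x * x $ j \<le> 2 * (\<rho> * h k) * x $ j"
          proof (cases "x \<in> E")
            case True2: True
            then have "x $ j = 0" using True by (auto simp: I_def)
            then show ?thesis by simp
          next
            case False
            then show ?thesis using lam_Z(2)[OF t, of x] x xj[OF x] by (intro mult_right_mono) (auto simp: Z_def)
          qed
        qed
        also have "\<dots> = 2 * \<rho> * s * h k" by (simp add: s_def sum_distrib_left[symmetric])
        also have "\<dots> \<le> R * h k" using R h[of k] by (intro mult_right_mono) auto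
        finally show "t $ j \<le> R * sc k j" using True by (simp add: sc_def)
        have "h k = 1 / (\<rho> * z $ j) * ((\<rho> * h k) * z $ j)" using \<rho> z by simp
        also have "\<dots> \<le> R * t $ j"
        proof (rule mult_mono[OF R(3)])
          have "(\<rho> * h k) * z $ j \<le> lam t z * z $ j" using lam_Z(1)[OF t z(1)] z by (intro mult_right_mono) auto
          also have "\<dots> \<le> (\<Sum>x\<in>T. lam t x * x $ j)"
            by (rule member_le_sum) (use zT finT xj lam_pos[OF t] in \<open>auto simp: less_imp_le\<close>)
          also have "\<dots> = t $ j" by (rule tj[OF t, symmetric])
          finally show "(\<rho> * h k) * z $ j \<le> t $ j" .
        qed (use R \<rho> h[of k] z in auto)
        finally show "sc k j \<le> R * t $ j" using True by (simp add: sc_def)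
      qed
    next
      case False
      then obtain z where z: "z \<in> E" "z $ j \<noteq> 0" by (auto simp: I_def)
      have zT: "z \<in> T" using z T(2) by auto
      have zj: "z $ j > 0" using xj[OF zT] z by simp
      define R where "R = 1 + s + 1 / (\<rho> * z $ j)"
      have R: "R \<ge> 1" "R \<ge> s" "R \<ge> 1 / (\<rho> * z $ j)" using \<rho> s0 zj by (auto simp: R_def)
      show ?thesis
      proof (intro exI[of _ R] conjI R(1) allI ballI)
        fix k t assume t: "t \<in> G k"
        have lam1: "lam t x \<le> 1" if "x \<in> T" for x
        proof -
          have "lam t x \<le> (\<Sum>x\<in>T. lam t x)"
            by (rule member_le_sum) (use that finT lam_pos[OF t] in \<open>auto simp: less_imp_le\<close>)
          then show ?thesis by (simp add: lam_sum)
        qed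
        have "t $ j = (\<Sum>x\<in>T. lam t x * x $ j)" by (rule tj[OF t])
        also have "\<dots> \<le> (\<Sum>x\<in>T. 1 * x $ j)" using lam1 xj by (intro sum_mono mult_right_mono) auto
        finally have "t $ j \<le> s" by (simp add: s_def)
        then show "t $ j \<le> R * sc k j" using False R by (simp add: sc_def)
        have "1 = 1 / (\<rho> * z $ j) * (\<rho> * z $ j)" using \<rho> zj by simp
        also have "\<dots> \<le> R * t $ j"
        proof (rule mult_mono[OF R(3)])
          have "\<rho> * z $ j \<le> lam t z * z $ j" using lam_E[OF t z(1)] zj by (intro mult_right_mono) auto
          also have "\<dots> \<le> (\<Sum>x\<in>T. lam t x * x $ j)"
            by (rule member_le_sum) (use zT finT xj lam_pos[OF t] in \<open>auto simp: less_imp_le\<close>)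
          also have "\<dots> = t $ j" by (rule tj[OF t, symmetric])
          finally show "\<rho> * z $ j \<le> t $ j" .
        qed (use R \<rho> zj in auto)
        finally show "sc k j \<le> R * t $ j" using False by (simp add: sc_def)
      qed
    qed
  qed
  then have "\<forall>j. \<exists>R\<ge>1. \<forall>k. \<forall>t\<in>G k. t $ j \<le> R * sc k j \<and> sc k j \<le> R * t $ j" by blast
  from choice[OF this] obtain R where R: "\<And>j. R j \<ge> 1"
    "\<And>j k t. t \<in> G k \<Longrightarrow> t $ j \<le> R j * sc k j \<and> sc k j \<le> R j * t $ j" by blast
  define c where "c = (\<Prod>j\<in>UNIV. R j powr \<bar>\<l> $ j\<bar>)"
  have Rpos: "R j > 0" for j using R(1)[of j] by linarith
  have c: "c > 0" unfolding c_def by (intro prod_pos) (simp add: Rpos less_imp_neq[OF Rpos, symmetric])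
  have lower: "h k powr \<sigma> \<le> c * (\<Prod>j\<in>UNIV. (t $ j) powr (\<l> $ j))" if t: "t \<in> G k" for k t
  proof -
    have scp: "sc k j > 0" for j using h[of k] by (simp add: sc_def)
    have tp: "t $ j > 0" for j
    proof -
      have "R j * t $ j > 0" using R(2)[OF t, of j] scp[of j] by linarith
      then show ?thesis using Rpos[of j] by (simp add: zero_less_mult_iff)
    qed
    have "h k powr \<sigma> = (\<Prod>j\<in>I. h k powr (\<l> $ j))" unfolding \<sigma>_def using h[of k] by (simp add: powr_sum)
    also have "\<dots> = (\<Prod>j\<in>UNIV. sc k j powr (\<l> $ j))"
      by (rule prod.mono_neutral_cong_left) (auto simp: sc_def)
    also have "\<dots> \<le> (\<Prod>j\<in>UNIV. R j powr \<bar>\<l> $ j\<bar> * (t $ j) powr (\<l> $ j))"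
      using R(2)[OF t] scp tp by (intro prod_mono conjI powr_comparable) auto
    also have "\<dots> = c * (\<Prod>j\<in>UNIV. (t $ j) powr (\<l> $ j))" by (simp add: prod.distrib c_def)
    finally show ?thesis .
  qed
  show ?thesis
  proof (rule ccontr)
    assume "\<not> 0 < (\<Sum>j | \<forall>t\<in>E. t $ j = 0. \<l> $ j) + (real d + 1 - card E)"
    then have neg: "\<sigma> + card Z \<le> 0" using cardZ by (simp add: \<sigma>_def I_def)
    define W where "W t = (\<Prod>j\<in>UNIV. (t $ j) powr (\<l> $ j))" for t :: "real^'s"
    have W0: "W t \<ge> 0" for t by (simp add: W_def prod_nonneg)
    \<comment> \<open>If the exponent sum is not positive, the growth of the integrand outweighs the
      shrinking measure of the pieces. Each of the disjoint pieces then contributes at least a fixed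
      positive amount, contradicting convergence.\<close>
    have step_le: "emeasure M (G 0) \<le> ennreal (h k powr \<sigma>) * emeasure M (G k)" for k
    proof -
      have "(2::real) ^ (k * card Z) = h k powr (- real (card Z))"
        by (simp add: h_def powr_minus powr_realpow power_mult power_divide inverse_eq_divide flip: power_mult)
      also have "\<dots> \<le> h k powr \<sigma>" using neg h[of k] by (intro powr_mono') auto
      finally have "ennreal (2 ^ (k * card Z)) \<le> ennreal (h k powr \<sigma>)" by (rule ennreal_leI)
      then show ?thesis using cover[of k] by (meson mult_right_mono order_trans zero_le)
    qed
    have bound: "ennreal (real N) * emeasure M (G 0) \<le> ennreal c * (\<integral>\<^sup>+t\<in>F. ennreal (W t) \<partial>M)" for N :: nat
    proof -
      have "ennreal (real N) * emeasure M (G 0) = (\<Sum>k<N. emeasure M (G 0))"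
        by (simp add: ennreal_of_nat_eq_real_of_nat)
      also have "\<dots> \<le> (\<Sum>k<N. ennreal (h k powr \<sigma>) * emeasure M (G k))" by (intro sum_mono step_le)
      also have "\<dots> = (\<Sum>k<N. \<integral>\<^sup>+t. ennreal (h k powr \<sigma>) * indicator (G k) t \<partial>M)"
        using G_borel by (intro sum.cong refl nn_integral_cmult_indicator[symmetric]) (simp add: \<open>sets M = sets borel\<close>)
      also have "\<dots> = (\<integral>\<^sup>+t. (\<Sum>k<N. ennreal (h k powr \<sigma>) * indicator (G k) t) \<partial>M)"
      proof (rule nn_integral_sum[symmetric])
        fix k assume "k \<in> {..<N}"
        show "(\<lambda>t. ennreal (h k powr \<sigma>) * indicator (G k) t) \<in> borel_measurable M"
          using G_borel[of k] by measurable
      qed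
      also have "\<dots> \<le> (\<integral>\<^sup>+t. ennreal c * (ennreal (W t) * indicator F t) \<partial>M)"
      proof (intro nn_integral_mono)
        fix t
        show "(\<Sum>k<N. ennreal (h k powr \<sigma>) * indicator (G k) t) \<le> ennreal c * (ennreal (W t) * indicator F t)"
        proof (cases "\<exists>k. t \<in> G k")
          case True
          then obtain k where k: "t \<in> G k" by auto
          have "(\<Sum>k<N. ennreal (h k powr \<sigma>) * indicator (G k) t) \<le> (\<Sum>k'\<in>{k}. ennreal (h k' powr \<sigma>) * indicator (G k') t)"
          proof (cases "k < N")
            case True
            have "(\<Sum>k<N. ennreal (h k powr \<sigma>) * indicator (G k) t) = (\<Sum>k'\<in>{k}. ennreal (h k' powr \<sigma>) * indicator (G k') t)"
              by (rule sum.mono_neutral_right) (use True disj k in \<open>auto simp: indicator_def\<close>)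
            then show ?thesis by simp
          next
            case False
            have "(\<Sum>k<N. ennreal (h k powr \<sigma>) * indicator (G k) t) = 0"
              using False disj k by (intro sum.neutral) (auto simp: indicator_def)
            then show ?thesis by simp
          qed
          also have "\<dots> = ennreal (h k powr \<sigma>)" using k by simp
          also have "\<dots> \<le> ennreal (c * W t)" using lower[OF k] by (intro ennreal_leI) (simp add: W_def)
          also have "\<dots> = ennreal c * (ennreal (W t) * indicator F t)"
          proof -
            have "t \<in> F" using k GF by blast
            then show ?thesis using c W0 by (simp add: ennreal_mult)
          qed
          finally show ?thesis .
        next
          case False
          then show ?thesis by simp
        qed
      qed
      also have "\<dots> = ennreal c * (\<integral>\<^sup>+t\<in>F. ennreal (W t) \<partial>M)"
      proof (rule nn_integral_cmult)
        note [measurable] = F_borel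
        show "(\<lambda>t. ennreal (W t) * indicator F t) \<in> borel_measurable M"
          unfolding W_def by measurable
      qed
      finally show ?thesis .
    qed
    have "(\<integral>\<^sup>+t\<in>F. ennreal (W t) \<partial>M) < \<infinity>" using conv by (simp add: convergent_type_def W_def M_def)
    then have fin: "ennreal c * (\<integral>\<^sup>+t\<in>F. ennreal (W t) \<partial>M) < \<infinity>" by (simp add: ennreal_mult_less_top)
    define B where "B = enn2real (ennreal c * (\<integral>\<^sup>+t\<in>F. ennreal (W t) \<partial>M))"
    have B: "ennreal c * (\<integral>\<^sup>+t\<in>F. ennreal (W t) \<partial>M) = ennreal B" using fin by (simp add: B_def)
    have G0fin: "emeasure M (G 0) < \<infinity>"
    proof -
      have "emeasure M (G 0) \<le> ennreal B" using bound[of 1] B by simp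
      then show ?thesis by (rule le_less_trans) simp
    qed
    define q where "q = measure M (G 0)"
    have q: "emeasure M (G 0) = ennreal q" using G0fin by (simp add: q_def emeasure_eq_ennreal_measure)
    have q0: "q > 0" using pos q by simp
    obtain N :: nat where "N > B / q" using reals_Archimedean2 by blast
    then have N: "N * q > B" using q0 by (simp add: field_simps)
    have "ennreal (N * q) \<le> ennreal B" using bound[of N] B q q0 by (simp add: ennreal_mult)
    then have "N * q \<le> B" using B_def by (subst (asm) ennreal_le_iff) auto
    then show False using N by simp
  qed
qed

subsection \<open>Growth integrals over polytopes\<close>

lemma affine_form_component: "affine_form (\<lambda>t::real^'s. t $ j)"
  unfolding affine_form_def by (rule exI[of _ 0], rule exI[of _ "axis j 1"]) (simp add: inner_axis' fun_eq_iff)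

lemma affine_form_const_minus_sum:
  "affine_form (\<lambda>t::real^'s. b - (\<Sum>j\<in>UNIV. c j * t $ j))"
  unfolding affine_form_def
  by (rule exI[of _ b], rule exI[of _ "\<chi> j. - c j"]) (simp add: inner_vec_def fun_eq_iff sum_negf)

lemma affine_form_halfspace:
  assumes "affine_form f"
  shows "convex {t. 0 \<le> f t}" "closed {t. 0 \<le> f t}" "convex {t. f t = 0}" "closed {t. f t = 0}"
proof -
  obtain c w where f: "f = (\<lambda>t. c + w \<bullet> t)" using assms by (auto simp: affine_form_def)
  have "{t. 0 \<le> f t} = {t. w \<bullet> t \<ge> - c}" "{t. f t = 0} = {t. w \<bullet> t = - c}"
    by (auto simp: f algebra_simps)
  then show "convex {t. 0 \<le> f t}" "closed {t. 0 \<le> f t}" "convex {t. f t = 0}" "closed {t. f t = 0}"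
    by (simp_all add: convex_halfspace_ge closed_halfspace_ge convex_hyperplane closed_hyperplane)
qed

text \<open>The locale's weight for the coordinate forms alone, with no exponent loss and rate 1. On
  \<open>P\<close> the coordinate sum is the l1 norm, so the exponential decays away from the
  maximal face.\<close>

definition face_kernel :: "real ^ 's \<Rightarrow> real \<Rightarrow> real ^ 's \<Rightarrow> real \<Rightarrow> real ^ 's \<Rightarrow> real" where
  "face_kernel \<l> a \<beta> L t = exp (- L * (a - (\<Sum>j\<in>UNIV. t $ j))) * (\<Prod>j\<in>UNIV. (\<beta> $ j / L + t $ j) powr (\<l> $ j))"

definition face_mass :: "real ^ 's \<Rightarrow> (real ^ 's) set \<Rightarrow> real \<Rightarrow> real ^ 's \<Rightarrow> real \<Rightarrow> ennreal" where
  "face_mass \<l> P a \<beta> L = (\<integral>\<^sup>+t\<in>P. ennreal (face_kernel \<l> a \<beta> L t) \<partial>lborel)"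

text \<open>Instance of the locale in which the coordinates carry the exponents of
  \<open>\<l>\<close> and the constraints carry exponent 0. As \<open>F\<close> lies in no
  coordinate hyperplane, every coordinate belongs to \<open>J'\<close>, so no exponent is
  lost.\<close>

theorem face_mass_asymptotics:
  fixes \<l> :: "real ^ 's" and \<omega> :: "nat \<Rightarrow> real ^ 's"
  assumes P: "P = exponent_polytope k \<alpha> \<omega>" and bdd: "bounded P"
    and F: "F = maximal_face P" and dim_F: "aff_dim F = int d"
    and F_coord: "\<And>j. \<not> F \<subseteq> {t. t $ j = 0}" and conv: "convergent_type \<l> F"
    and a: "a = (SUP t\<in>P. l1_norm t)"
  obtains \<epsilon> c :: real where "\<epsilon> > 0"
    "\<And>\<beta>. (\<And>j. \<beta> $ j > 0) \<Longrightarrow> \<exists>K\<ge>0. \<forall>L\<ge>1. face_mass \<l> P a \<beta> L < \<infinity> \<and>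
        \<bar>L powr (CARD('s) - real d) * enn2real (face_mass \<l> P a \<beta> L) - c\<bar> \<le> K * L powr (- \<epsilon>)"
    "\<And>\<beta>. (\<And>j. \<beta> $ j > 0) \<Longrightarrow> \<exists>K\<ge>0. \<forall>L\<ge>1. \<forall>M\<ge>1. \<forall>j.
        (\<integral>\<^sup>+t\<in>P \<inter> {t. L * t $ j \<le> M}. ennreal (face_kernel \<l> a \<beta> L t) \<partial>lborel)
          \<le> ennreal (K * (M / L) powr \<epsilon> * L powr (real d - CARD('s)))"
proof -
  define J :: "('s + nat) set" where "J = range Inl \<union> Inr ` {1..k}"
  define y :: "'s + nat \<Rightarrow> real ^ 's \<Rightarrow> real" where
    "y j t = (case j of Inl j \<Rightarrow> t $ j | Inr i \<Rightarrow> 1 - (\<Sum>j\<in>UNIV. \<omega> i $ j / \<alpha> $ j * t $ j))" for j t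
  define \<tau> :: "real ^ 's \<Rightarrow> real" where "\<tau> t = a - (\<Sum>j\<in>UNIV. 1 * t $ j)" for t
  define l' :: "'s + nat \<Rightarrow> real" where "l' j = (case j of Inl j \<Rightarrow> \<l> $ j | Inr i \<Rightarrow> 0)" for j
  define J' where "J' = {j \<in> J. \<exists>t\<in>F. y j t \<noteq> 0}"
  have finJ: "finite J" by (simp add: J_def)
  have affy: "affine_form (y j)" for j
  proof (cases j)
    case (Inl i)
    then have "y j = (\<lambda>t. t $ i)" by (simp add: y_def fun_eq_iff)
    then show ?thesis by (simp add: affine_form_component)
  next
    case (Inr i)
    then have "y j = (\<lambda>t. 1 - (\<Sum>j\<in>UNIV. \<omega> i $ j / \<alpha> $ j * t $ j))" by (simp add: y_def fun_eq_iff)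
    then show ?thesis by (simp only: affine_form_const_minus_sum)
  qed
  have aff\<tau>: "affine_form \<tau>" unfolding \<tau>_def by (rule affine_form_const_minus_sum)
  have P_eq: "P = {t. \<forall>j\<in>J. 0 \<le> y j t}"
    unfolding P exponent_polytope_def J_def ball_Un by (simp add: y_def)
  have nonneg: "0 \<le> t $ j" if "t \<in> P" for t j using that by (simp add: P exponent_polytope_def)
  have l1: "l1_norm t = (\<Sum>j\<in>UNIV. t $ j)" if "t \<in> P" for t
    using nonneg[OF that] by (simp add: l1_norm_def)
  have bdd_l1: "bdd_above (l1_norm ` P)"
  proof -
    obtain K where K: "\<And>t. t \<in> P \<Longrightarrow> norm t \<le> K" using bdd bounded_iff by blast
    have "l1_norm t \<le> (\<Sum>j\<in>(UNIV::'s set). K)" if "t \<in> P" for t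
      unfolding l1_norm_def using K[OF that] by (intro sum_mono) (auto intro: order_trans[OF component_le_norm_cart])
    then show ?thesis by (auto simp: bdd_above_def)
  qed
  have \<tau>_nonneg: "0 \<le> \<tau> t" if "t \<in> P" for t
    using cSUP_upper[OF that bdd_l1] l1[OF that] by (simp add: \<tau>_def a)
  have "F \<noteq> {}" using dim_F by auto
  then obtain t0 where t0: "t0 \<in> F" by auto
  have "a = l1_norm t0"
    unfolding a using t0 bdd_l1 by (intro antisym cSUP_least cSUP_upper) (auto simp: F maximal_face_def)
  then have a_max: "\<And>u. u \<in> P \<Longrightarrow> l1_norm u \<le> a" and "t0 \<in> P" using t0 by (auto simp: F maximal_face_def)
  have F_eq: "F = {t \<in> P. \<tau> t = 0}"
  proof (intro set_eqI iffI)
    fix t assume "t \<in> F"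
    then have t: "t \<in> P" "l1_norm t0 \<le> l1_norm t" using \<open>t0 \<in> P\<close> by (auto simp: F maximal_face_def)
    then have "l1_norm t = a" using a_max[OF t(1)] \<open>a = l1_norm t0\<close> by simp
    then show "t \<in> {t \<in> P. \<tau> t = 0}" using t l1[OF t(1)] by (simp add: \<tau>_def)
  next
    fix t assume "t \<in> {t \<in> P. \<tau> t = 0}"
    then have t: "t \<in> P" "l1_norm t = a" using l1[of t] by (auto simp: \<tau>_def)
    then show "t \<in> F" using a_max by (auto simp: F maximal_face_def)
  qed
  have P_cc: "convex P" "closed P"
  proof -
    have "P = (\<Inter>j\<in>J. {t. 0 \<le> y j t})" by (auto simp: P_eq)
    then show "convex P" "closed P"
      using affine_form_halfspace(1,2)[OF affy] by (auto intro!: convex_INT closed_INT)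
  qed
  have "F = P \<inter> {t. \<tau> t = 0}" by (auto simp: F_eq)
  then have F_cc: "convex F" "closed F"
    using P_cc affine_form_halfspace(3,4)[OF aff\<tau>] by (auto intro: convex_Int closed_Int)
  have J'_Inl: "Inl j \<in> J'" for j using F_coord[of j] by (auto simp: J'_def J_def y_def)
  have loc: "0 < (\<Sum>j | j \<in> J' \<and> (\<forall>t\<in>E. y j t = 0). l' j) + (real d + 1 - card E)"
    if E: "E \<subseteq> F" "E \<noteq> {}" "\<not> affine_dependent E" "card E \<le> d" for E
  proof -
    have "(\<Sum>j | j \<in> J' \<and> (\<forall>t\<in>E. y j t = 0). l' j) = (\<Sum>j\<in>Inl ` {j. \<forall>t\<in>E. t $ j = 0}. l' j)"
    proof (rule sum.mono_neutral_right)
      show "finite {j \<in> J'. \<forall>t\<in>E. y j t = 0}" using finJ by (simp add: J'_def)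
      show "Inl ` {j. \<forall>t\<in>E. t $ j = 0} \<subseteq> {j \<in> J'. \<forall>t\<in>E. y j t = 0}"
        using J'_Inl by (auto simp: y_def)
      show "\<forall>i\<in>{j \<in> J'. \<forall>t\<in>E. y j t = 0} - Inl ` {j. \<forall>t\<in>E. t $ j = 0}. l' i = 0"
        by (auto simp: l'_def y_def split: sum.splits)
    qed
    also have "\<dots> = (\<Sum>j | \<forall>t\<in>E. t $ j = 0. \<l> $ j)" by (subst sum.reindex) (auto simp: l'_def)
    finally show ?thesis
      using convergent_type_local_integrability[OF F_cc(1) _ _ dim_F F_coord conv E] F_cc(2) nonneg
      by (auto simp: F_eq)
  qed
  interpret polytope_face J y \<tau> l' d P F J'
    by unfold_locales
      ((rule affy | fact finJ aff\<tau> P_eq bdd \<tau>_nonneg F_eq \<open>F \<noteq> {}\<close> dim_F J'_def loc)+)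
  obtain \<epsilon> c where \<epsilon>: "\<epsilon> > 0"
    and c: "\<And>a. (\<And>j. a j > 0) \<Longrightarrow> \<exists>K\<ge>0. \<forall>L\<ge>1. mass a L < \<infinity> \<and> \<bar>normalized_mass a L - c\<bar> \<le> K * L powr (- \<epsilon>)"
    and small: "\<And>a. (\<And>j. a j > 0) \<Longrightarrow> \<exists>K\<ge>0. \<forall>L\<ge>1. \<forall>M\<ge>1. \<forall>k\<in>J'.
        (\<integral>\<^sup>+t\<in>P \<inter> {t. L * y k t \<le> M}. ennreal (weight a 0 1 L t) \<partial>lborel)
          \<le> ennreal (K * (M / L) powr \<epsilon> * L powr (real d - CARD('s)))"
  proof -
    show thesis by (rule normalized_mass_asymptotics) (fact that)
  qed
  have kernel: "weight (case_sum (\<lambda>j. \<beta> $ j) (\<lambda>_. 1)) 0 1 L t = face_kernel \<l> a \<beta> L t"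
    if "t \<in> P" "L \<ge> 1" for \<beta> L t
  proof -
    have "(\<Prod>j\<in>J'. (case_sum (\<lambda>j. \<beta> $ j) (\<lambda>_. 1) j / L + y j t) powr l' j)
      = (\<Prod>j\<in>range Inl. (case_sum (\<lambda>j. \<beta> $ j) (\<lambda>_. 1) j / L + y j t) powr l' j)"
    proof (rule prod.mono_neutral_right[OF finite_J'])
      show "range Inl \<subseteq> J'" using J'_Inl by auto
      show "\<forall>i\<in>J' - range Inl. (case_sum (\<lambda>j. \<beta> $ j) (\<lambda>_. 1) i / L + y i t) powr l' i = 1"
      proof
        fix i assume i: "i \<in> J' - range Inl"
        then obtain i' where i': "i = Inr i'" by (cases i) auto
        have "y i t \<ge> 0" using i that(1) by (auto simp: P_eq J'_def)
        moreover have "1 / L > 0" using that(2) by simp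
        \<comment> \<open>Exponent 0 gives 1 only for a nonzero base, since
          \<open>0 powr 0 = 0\<close>.\<close>
        ultimately have "1 / L + y i t \<noteq> 0" by linarith
        then show "(case_sum (\<lambda>j. \<beta> $ j) (\<lambda>_. 1) i / L + y i t) powr l' i = 1"
          by (simp add: i' l'_def)
      qed
    qed
    also have "\<dots> = (\<Prod>j\<in>UNIV. (\<beta> $ j / L + t $ j) powr (\<l> $ j))"
      by (subst prod.reindex) (auto simp: y_def l'_def)
    finally show ?thesis by (simp add: weight_def face_kernel_def \<tau>_def)
  qed
  have mass_eq: "mass (case_sum (\<lambda>j. \<beta> $ j) (\<lambda>_. 1)) L = face_mass \<l> P a \<beta> L" if "L \<ge> 1" for \<beta> L
    unfolding mass_def face_mass_def
    by (intro nn_integral_cong) (auto simp: kernel[OF _ that] split: split_indicator)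
  show ?thesis
  proof (rule that[OF \<epsilon>, of c])
    fix \<beta> :: "real ^ 's" assume \<beta>: "\<And>j. \<beta> $ j > 0"
    have \<beta>': "case_sum (\<lambda>j. \<beta> $ j) (\<lambda>_. 1) j > 0" for j :: "'s + nat" using \<beta> by (cases j) auto
    show "\<exists>K\<ge>0. \<forall>L\<ge>1. face_mass \<l> P a \<beta> L < \<infinity> \<and>
        \<bar>L powr (CARD('s) - real d) * enn2real (face_mass \<l> P a \<beta> L) - c\<bar> \<le> K * L powr (- \<epsilon>)"
      using c[of "case_sum (\<lambda>j. \<beta> $ j) (\<lambda>_. 1)"] \<beta>' by (simp add: normalized_mass_def mass_eq)
    have "\<exists>K\<ge>0. \<forall>L\<ge>1. \<forall>M\<ge>1. \<forall>k\<in>J'.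
        (\<integral>\<^sup>+t\<in>P \<inter> {t. L * y k t \<le> M}. ennreal (weight (case_sum (\<lambda>j. \<beta> $ j) (\<lambda>_. 1)) 0 1 L t) \<partial>lborel)
          \<le> ennreal (K * (M / L) powr \<epsilon> * L powr (real d - CARD('s)))"
      by (rule small) (rule \<beta>')
    then obtain K where K: "K \<ge> 0" "\<forall>L\<ge>1. \<forall>M\<ge>1. \<forall>k\<in>J'.
        (\<integral>\<^sup>+t\<in>P \<inter> {t. L * y k t \<le> M}. ennreal (weight (case_sum (\<lambda>j. \<beta> $ j) (\<lambda>_. 1)) 0 1 L t) \<partial>lborel)
          \<le> ennreal (K * (M / L) powr \<epsilon> * L powr (real d - CARD('s)))"
      by (elim exE conjE) (rule that)
    show "\<exists>K\<ge>0. \<forall>L\<ge>1. \<forall>M\<ge>1. \<forall>j.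
        (\<integral>\<^sup>+t\<in>P \<inter> {t. L * t $ j \<le> M}. ennreal (face_kernel \<l> a \<beta> L t) \<partial>lborel)
          \<le> ennreal (K * (M / L) powr \<epsilon> * L powr (real d - CARD('s)))"
    proof (intro exI[of _ K] conjI K(1) allI impI)
      fix L M :: real and j :: 's assume L: "L \<ge> 1" and M: "M \<ge> 1"
      have "(\<integral>\<^sup>+t\<in>P \<inter> {t. L * t $ j \<le> M}. ennreal (face_kernel \<l> a \<beta> L t) \<partial>lborel)
        = (\<integral>\<^sup>+t\<in>P \<inter> {t. L * y (Inl j) t \<le> M}. ennreal (weight (case_sum (\<lambda>j. \<beta> $ j) (\<lambda>_. 1)) 0 1 L t) \<partial>lborel)"
        by (intro nn_integral_cong) (auto simp: kernel[OF _ L] y_def split: split_indicator)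
      then show "(\<integral>\<^sup>+t\<in>P \<inter> {t. L * t $ j \<le> M}. ennreal (face_kernel \<l> a \<beta> L t) \<partial>lborel)
          \<le> ennreal (K * (M / L) powr \<epsilon> * L powr (real d - CARD('s)))"
        using K(2)[rule_format, OF L M J'_Inl] by simp
    qed
  qed
qed

section \<open>Transfer to logarithmic coordinates\<close>

definition log_region :: "nat \<Rightarrow> (nat \<Rightarrow> real ^ 's) \<Rightarrow> real \<Rightarrow> (real ^ 's) set" where
  "log_region k \<omega> L = {u. (\<forall>j. 0 \<le> u $ j) \<and> (\<forall>i\<in>{1..k}. (\<Sum>j\<in>UNIV. \<omega> i $ j * u $ j) \<le> L)}"

lemma closed_log_region: "closed (log_region k \<omega> L)"
proof -
  have "log_region k \<omega> L = {u. \<forall>j. 0 \<le> u $ j} \<inter> (\<Inter>i\<in>{1..k}. {u. (\<Sum>j\<in>UNIV. \<omega> i $ j * u $ j) \<le> L})"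
    by (auto simp: log_region_def)
  also have "closed \<dots>"
    by (intro closed_Int closed_INT ballI closed_Collect_all closed_Collect_le continuous_intros)
  finally show ?thesis .
qed

text \<open>\<open>log_growth\<close> is \<open>growth\<close> in the logarithmic coordinates \<open>u $ j = ln (B $ j)\<close>.\<close>

definition log_growth :: "real ^ 's \<Rightarrow> real ^ 's \<Rightarrow> real ^ 's \<Rightarrow> real" where
  "log_growth \<alpha> \<l> u = (\<Prod>j\<in>UNIV. exp (\<alpha> $ j * u $ j) * (1 + u $ j) powr (\<l> $ j))"

text \<open>Substitution \<open>u $ j = L / \<alpha> $ j * t $ j\<close>. The identity
  \<open>1 + u $ j = L / \<alpha> $ j * (\<alpha> $ j / L + t $ j)\<close> is the origin of the
  shifts and of the factors \<open>\<alpha> $ j powr \<l> $ j\<close>; the exponential gives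
  \<open>exp (a * L)\<close> times the decay in the kernel. General \<open>S\<close> and
  \<open>T\<close> serve the region as well as its slices.\<close>

lemma log_growth_integral_scaling:
  fixes \<l> \<alpha> :: "real ^ 's"
  assumes \<alpha>: "\<And>j. \<alpha> $ j > 0" and L: "L \<ge> 1" and S: "S \<in> sets borel"
    and T: "\<And>t. (\<chi> j. L / \<alpha> $ j * t $ j) \<in> S \<longleftrightarrow> t \<in> T"
    and nn: "\<And>t j. t \<in> T \<Longrightarrow> 0 \<le> t $ j"
  shows "(\<integral>\<^sup>+u\<in>S. ennreal (log_growth \<alpha> \<l> u) \<partial>lborel)
    = ennreal (exp (a * L) * L powr (CARD('s) + (\<Sum>j\<in>UNIV. \<l> $ j)) / ((\<Prod>j\<in>UNIV. \<alpha> $ j) * (\<Prod>j\<in>UNIV. (\<alpha> $ j) powr (\<l> $ j))))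
      * (\<integral>\<^sup>+t\<in>T. ennreal (face_kernel \<l> a \<alpha> L t) \<partial>lborel)"
proof -
  note [measurable] = S
  have [measurable]: "log_growth \<alpha> \<l> \<in> borel_measurable borel" unfolding log_growth_def by measurable
  have meas: "(\<lambda>u. ennreal (log_growth \<alpha> \<l> u) * indicator S u) \<in> borel_measurable borel" by measurable
  define c where "c j = L / \<alpha> $ j" for j
  have c: "c j > 0" for j using \<alpha>[of j] L by (simp add: c_def)
  define C where "C = (\<Prod>j\<in>UNIV. c j powr (\<l> $ j)) * exp (a * L)"
  have C0: "C \<ge> 0" by (simp add: C_def prod_nonneg)
  have pc0: "(\<Prod>j\<in>UNIV. c j) \<ge> 0" using c by (intro prod_nonneg) (auto simp: less_imp_le)
  have pt: "log_growth \<alpha> \<l> (\<chi> j. c j * t $ j) = C * face_kernel \<l> a \<alpha> L t" if t: "t \<in> T" for t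
  proof -
    have "log_growth \<alpha> \<l> (\<chi> j. c j * t $ j)
      = (\<Prod>j\<in>UNIV. exp (L * t $ j) * (c j powr (\<l> $ j) * (\<alpha> $ j / L + t $ j) powr (\<l> $ j)))"
      unfolding log_growth_def
    proof (intro prod.cong refl)
      fix j
      have "\<alpha> $ j * (c j * t $ j) = L * t $ j" using \<alpha>[of j] by (simp add: c_def)
      moreover have "1 + c j * t $ j = c j * (\<alpha> $ j / L + t $ j)"
        using \<alpha>[of j] L by (simp add: c_def field_simps)
      moreover have "\<alpha> $ j / L + t $ j \<ge> 0" using \<alpha>[of j] L nn[OF t, of j] by (intro add_nonneg_nonneg) auto
      ultimately show "exp (\<alpha> $ j * (\<chi> j. c j * t $ j) $ j) * (1 + (\<chi> j. c j * t $ j) $ j) powr (\<l> $ j)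
        = exp (L * t $ j) * (c j powr (\<l> $ j) * (\<alpha> $ j / L + t $ j) powr (\<l> $ j))"
        using c[of j] by (simp add: powr_mult)
    qed
    also have "\<dots> = exp (L * (\<Sum>j\<in>UNIV. t $ j)) * ((\<Prod>j\<in>UNIV. c j powr (\<l> $ j)) * (\<Prod>j\<in>UNIV. (\<alpha> $ j / L + t $ j) powr (\<l> $ j)))"
      by (simp add: prod.distrib exp_sum sum_distrib_left)
    also have "exp (L * (\<Sum>j\<in>UNIV. t $ j)) = exp (a * L) * exp (- L * (a - (\<Sum>j\<in>UNIV. t $ j)))"
      by (simp add: algebra_simps flip: exp_add)
    finally show ?thesis by (simp add: C_def face_kernel_def)
  qed
  have "(\<integral>\<^sup>+u\<in>S. ennreal (log_growth \<alpha> \<l> u) \<partial>lborel)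
    = ennreal (\<Prod>j\<in>UNIV. c j) * (\<integral>\<^sup>+t. ennreal (log_growth \<alpha> \<l> (\<chi> j. c j * t $ j)) * indicator S (\<chi> j. c j * t $ j) \<partial>lborel)"
    by (rule nn_integral_diagonal[OF c meas])
  also have "(\<integral>\<^sup>+t. ennreal (log_growth \<alpha> \<l> (\<chi> j. c j * t $ j)) * indicator S (\<chi> j. c j * t $ j) \<partial>lborel)
    = (\<integral>\<^sup>+t. ennreal C * (ennreal (face_kernel \<l> a \<alpha> L t) * indicator T t) \<partial>lborel)"
  proof (intro nn_integral_cong)
    fix t
    have "indicator S (\<chi> j. c j * t $ j) = (indicator T t :: ennreal)" using T[of t] by (simp add: c_def indicator_def)
    then show "ennreal (log_growth \<alpha> \<l> (\<chi> j. c j * t $ j)) * indicator S (\<chi> j. c j * t $ j)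
      = ennreal C * (ennreal (face_kernel \<l> a \<alpha> L t) * indicator T t)"
      using pt[of t] C0 by (cases "t \<in> T") (simp_all add: ennreal_mult')
  qed
  also have "\<dots> = ennreal C * (\<integral>\<^sup>+t\<in>T. ennreal (face_kernel \<l> a \<alpha> L t) \<partial>lborel)"
  proof (rule nn_integral_cmult)
    have "T = (\<lambda>t. \<chi> j. L / \<alpha> $ j * t $ j) -` S" using T by auto
    also have "\<dots> \<in> sets borel"
    proof -
      have "(\<lambda>t::real^'s. \<chi> j. L / \<alpha> $ j * t $ j) \<in> borel_measurable borel"
        by (intro borel_measurable_continuous_onI continuous_intros)
      from measurable_sets[OF this S] show ?thesis by simp
    qed
    finally have [measurable]: "T \<in> sets borel" .
    show "(\<lambda>t. ennreal (face_kernel \<l> a \<alpha> L t) * indicator T t) \<in> borel_measurable lborel"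
      unfolding face_kernel_def by measurable
  qed
  finally have "(\<integral>\<^sup>+u\<in>S. ennreal (log_growth \<alpha> \<l> u) \<partial>lborel)
    = ennreal ((\<Prod>j\<in>UNIV. c j) * C) * (\<integral>\<^sup>+t\<in>T. ennreal (face_kernel \<l> a \<alpha> L t) \<partial>lborel)"
    using pc0 C0 by (simp add: ennreal_mult mult.assoc)
  also have "(\<Prod>j\<in>UNIV. c j) * C = exp (a * L) * L powr (CARD('s) + (\<Sum>j\<in>UNIV. \<l> $ j)) / ((\<Prod>j\<in>UNIV. \<alpha> $ j) * (\<Prod>j\<in>UNIV. (\<alpha> $ j) powr (\<l> $ j)))"
  proof -
    have "(\<Prod>j\<in>UNIV. c j) = L powr CARD('s) / (\<Prod>j\<in>UNIV. \<alpha> $ j)"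
      using L by (simp add: c_def prod_dividef powr_realpow)
    moreover have "(\<Prod>j\<in>UNIV. c j powr (\<l> $ j)) = L powr (\<Sum>j\<in>UNIV. \<l> $ j) / (\<Prod>j\<in>UNIV. (\<alpha> $ j) powr (\<l> $ j))"
    proof -
      have "(\<Prod>j\<in>UNIV. c j powr (\<l> $ j)) = (\<Prod>j\<in>UNIV. L powr (\<l> $ j) / (\<alpha> $ j) powr (\<l> $ j))"
        using L \<alpha>[THEN less_imp_le] by (intro prod.cong refl) (simp add: c_def powr_divide)
      then show ?thesis using L by (simp add: prod_dividef powr_sum)
    qed
    ultimately show ?thesis by (simp add: C_def powr_add)
  qed
  finally show ?thesis .
qed

text \<open>The power of \<open>L\<close> from the substitution splits into the one in
  \<open>H\<close> and \<open>L powr (CARD('s) - d)\<close>, the normalization under which the face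
  mass converges.\<close>

theorem log_growth_integral_asymptotics:
  fixes \<l> :: "real ^ 's" and \<omega> :: "nat \<Rightarrow> real ^ 's"
  assumes \<alpha>: "\<And>j. \<alpha> $ j > 0" and P: "P = exponent_polytope k \<alpha> \<omega>"
    and \<epsilon>: "\<epsilon> > 0"
    and lim: "\<exists>K\<ge>0. \<forall>L\<ge>1. face_mass \<l> P a \<alpha> L < \<infinity> \<and>
        \<bar>L powr (CARD('s) - real d) * enn2real (face_mass \<l> P a \<alpha> L) - c\<bar> \<le> K * L powr (- \<epsilon>)"
    and small: "\<exists>K\<ge>0. \<forall>L\<ge>1. \<forall>M\<ge>1. \<forall>j.
        (\<integral>\<^sup>+t\<in>P \<inter> {t. L * t $ j \<le> M}. ennreal (face_kernel \<l> a \<alpha> L t) \<partial>lborel)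
          \<le> ennreal (K * (M / L) powr \<epsilon> * L powr (real d - CARD('s)))"
  defines "H \<equiv> \<lambda>L. exp (a * L) * L powr (real d + (\<Sum>j\<in>UNIV. \<l> $ j))"
  shows "\<exists>K\<ge>0. \<forall>L\<ge>1. (\<integral>\<^sup>+u\<in>log_region k \<omega> L. ennreal (log_growth \<alpha> \<l> u) \<partial>lborel) < \<infinity> \<and>
      \<bar>(\<Prod>j\<in>UNIV. \<alpha> $ j) * enn2real (\<integral>\<^sup>+u\<in>log_region k \<omega> L. ennreal (log_growth \<alpha> \<l> u) \<partial>lborel)
        - c / (\<Prod>j\<in>UNIV. (\<alpha> $ j) powr (\<l> $ j)) * H L\<bar> \<le> K * (H L * L powr (- \<epsilon>))"
    and "\<exists>K\<ge>0. \<forall>L\<ge>1. \<forall>M\<ge>1. \<forall>j.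
      (\<integral>\<^sup>+u\<in>log_region k \<omega> L \<inter> {u. u $ j \<le> M}. ennreal (log_growth \<alpha> \<l> u) \<partial>lborel)
        \<le> ennreal (K * (M / L) powr \<epsilon> * H L)"
proof -
  define A where "A = (\<Prod>j\<in>UNIV. \<alpha> $ j)"
  define A' where "A' = (\<Prod>j\<in>UNIV. (\<alpha> $ j) powr (\<l> $ j))"
  have A: "A > 0" unfolding A_def using \<alpha> by (intro prod_pos) auto
  have A': "A' > 0" unfolding A'_def using \<alpha>[THEN less_imp_neq, symmetric] by (intro prod_pos) auto
  have region: "(\<chi> j. L / \<alpha> $ j * t $ j) \<in> log_region k \<omega> L \<longleftrightarrow> t \<in> P" if L: "L \<ge> 1" for t L
  proof -
    have "(\<Sum>j\<in>UNIV. \<omega> i $ j * (L / \<alpha> $ j * t $ j)) = L * (\<Sum>j\<in>UNIV. \<omega> i $ j / \<alpha> $ j * t $ j)" for i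
      by (simp add: sum_distrib_left mult_ac)
    moreover have "0 \<le> L / \<alpha> $ j * t $ j \<longleftrightarrow> 0 \<le> t $ j" for j
      using L \<alpha>[of j] by (simp add: zero_le_mult_iff zero_le_divide_iff)
    moreover have "L * S \<le> L \<longleftrightarrow> S \<le> 1" for S using L by simp
    ultimately show ?thesis by (simp add: log_region_def P exponent_polytope_def)
  qed
  have P_nonneg: "0 \<le> t $ j" if "t \<in> P" for t j using that by (simp add: P exponent_polytope_def)
  have scale: "(\<integral>\<^sup>+u\<in>log_region k \<omega> L. ennreal (log_growth \<alpha> \<l> u) \<partial>lborel)
    = ennreal (exp (a * L) * L powr (CARD('s) + (\<Sum>j\<in>UNIV. \<l> $ j)) / (A * A')) * face_mass \<l> P a \<alpha> L" if L: "L \<ge> 1" for L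
    unfolding face_mass_def A_def A'_def
    by (rule log_growth_integral_scaling[OF \<alpha> L _ region[OF L]]) (auto intro: borel_closed[OF closed_log_region] P_nonneg)
  have H_split: "exp (a * L) * L powr (CARD('s) + (\<Sum>j\<in>UNIV. \<l> $ j)) = H L * L powr (CARD('s) - real d)" for L
    by (simp add: H_def algebra_simps flip: powr_add)
  have H0: "H L \<ge> 0" for L by (simp add: H_def)
  obtain K where K: "K \<ge> 0" "\<And>L. L \<ge> 1 \<Longrightarrow> face_mass \<l> P a \<alpha> L < \<infinity>"
    "\<And>L. L \<ge> 1 \<Longrightarrow> \<bar>L powr (CARD('s) - real d) * enn2real (face_mass \<l> P a \<alpha> L) - c\<bar> \<le> K * L powr (- \<epsilon>)"
    using lim by blast
  show "\<exists>K\<ge>0. \<forall>L\<ge>1. (\<integral>\<^sup>+u\<in>log_region k \<omega> L. ennreal (log_growth \<alpha> \<l> u) \<partial>lborel) < \<infinity> \<and>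
      \<bar>(\<Prod>j\<in>UNIV. \<alpha> $ j) * enn2real (\<integral>\<^sup>+u\<in>log_region k \<omega> L. ennreal (log_growth \<alpha> \<l> u) \<partial>lborel)
        - c / (\<Prod>j\<in>UNIV. (\<alpha> $ j) powr (\<l> $ j)) * H L\<bar> \<le> K * (H L * L powr (- \<epsilon>))"
  proof (intro exI[of _ "K / A'"] conjI allI impI)
    show "0 \<le> K / A'" using K A' by simp
    fix L :: real assume L: "L \<ge> 1"
    show "(\<integral>\<^sup>+u\<in>log_region k \<omega> L. ennreal (log_growth \<alpha> \<l> u) \<partial>lborel) < \<infinity>"
      unfolding scale[OF L] using K(2)[OF L] by (simp add: ennreal_mult_less_top)
    define m where "m = L powr (CARD('s) - real d) * enn2real (face_mass \<l> P a \<alpha> L)"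
    have "A * enn2real (\<integral>\<^sup>+u\<in>log_region k \<omega> L. ennreal (log_growth \<alpha> \<l> u) \<partial>lborel) = H L / A' * m"
      unfolding scale[OF L] H_split using H0 A A' by (simp add: enn2real_mult m_def)
    then have "A * enn2real (\<integral>\<^sup>+u\<in>log_region k \<omega> L. ennreal (log_growth \<alpha> \<l> u) \<partial>lborel) - c / A' * H L = H L / A' * (m - c)"
      by (simp only: right_diff_distrib) simp
    then have "\<bar>A * enn2real (\<integral>\<^sup>+u\<in>log_region k \<omega> L. ennreal (log_growth \<alpha> \<l> u) \<partial>lborel) - c / A' * H L\<bar> = H L / A' * \<bar>m - c\<bar>"
      using H0[of L] A' by (simp add: abs_mult)
    also have "\<dots> \<le> H L / A' * (K * L powr (- \<epsilon>))"
      using K(3)[OF L] H0[of L] A' unfolding m_def by (intro mult_left_mono) auto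
    finally show "\<bar>(\<Prod>j\<in>UNIV. \<alpha> $ j) * enn2real (\<integral>\<^sup>+u\<in>log_region k \<omega> L. ennreal (log_growth \<alpha> \<l> u) \<partial>lborel)
        - c / (\<Prod>j\<in>UNIV. (\<alpha> $ j) powr (\<l> $ j)) * H L\<bar> \<le> K / A' * (H L * L powr (- \<epsilon>))"
      by (simp add: A_def A'_def mult_ac)
  qed
  obtain K' where K': "K' \<ge> 0" "\<And>L M j. L \<ge> 1 \<Longrightarrow> M \<ge> 1 \<Longrightarrow>
        (\<integral>\<^sup>+t\<in>P \<inter> {t. L * t $ j \<le> M}. ennreal (face_kernel \<l> a \<alpha> L t) \<partial>lborel)
          \<le> ennreal (K' * (M / L) powr \<epsilon> * L powr (real d - CARD('s)))"
    using small by blast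
  \<comment> \<open>Dominates 1 and every \<open>\<alpha> $ j\<close>. A slice
    \<open>u $ j \<le> M\<close> rescales to the cut-off \<open>\<alpha> $ j * M\<close>, which may
    fall below the threshold 1 of the slice bound.\<close>
  define b where "b = 1 + (\<Sum>j\<in>UNIV. \<alpha> $ j)"
  have b: "b \<ge> 1" "\<alpha> $ j \<le> b" for j
  proof -
    show "b \<ge> 1" unfolding b_def using \<alpha>[THEN less_imp_le] by (auto intro!: sum_nonneg)
    have "\<alpha> $ j \<le> (\<Sum>j\<in>UNIV. \<alpha> $ j)" by (rule member_le_sum) (use \<alpha>[THEN less_imp_le] in auto)
    then show "\<alpha> $ j \<le> b" by (simp add: b_def)
  qed
  show "\<exists>K\<ge>0. \<forall>L\<ge>1. \<forall>M\<ge>1. \<forall>j.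
      (\<integral>\<^sup>+u\<in>log_region k \<omega> L \<inter> {u. u $ j \<le> M}. ennreal (log_growth \<alpha> \<l> u) \<partial>lborel)
        \<le> ennreal (K * (M / L) powr \<epsilon> * H L)"
  proof (intro exI[of _ "K' * b powr \<epsilon> / (A * A')"] conjI allI impI)
    show "0 \<le> K' * b powr \<epsilon> / (A * A')" using K' A A' by simp
    fix L M :: real and j :: 's assume L: "L \<ge> 1" and M: "M \<ge> 1"
    have T: "(\<chi> j. L / \<alpha> $ j * t $ j) \<in> log_region k \<omega> L \<inter> {u. u $ j \<le> M} \<longleftrightarrow> t \<in> P \<inter> {t. L * t $ j \<le> \<alpha> $ j * M}" for t
      using region[OF L, of t] \<alpha>[of j] by (simp add: field_simps)
    have "closed (log_region k \<omega> L \<inter> {u. u $ j \<le> M})"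
      by (intro closed_Int closed_log_region closed_Collect_le continuous_intros)
    then have S: "log_region k \<omega> L \<inter> {u. u $ j \<le> M} \<in> sets borel" by simp
    have "(\<integral>\<^sup>+u\<in>log_region k \<omega> L \<inter> {u. u $ j \<le> M}. ennreal (log_growth \<alpha> \<l> u) \<partial>lborel)
      = ennreal (exp (a * L) * L powr (CARD('s) + (\<Sum>j\<in>UNIV. \<l> $ j)) / (A * A'))
        * (\<integral>\<^sup>+t\<in>P \<inter> {t. L * t $ j \<le> \<alpha> $ j * M}. ennreal (face_kernel \<l> a \<alpha> L t) \<partial>lborel)"
      unfolding A_def A'_def
      by (rule log_growth_integral_scaling[OF \<alpha> L S T]) (use P_nonneg in auto)
    also have "(\<integral>\<^sup>+t\<in>P \<inter> {t. L * t $ j \<le> \<alpha> $ j * M}. ennreal (face_kernel \<l> a \<alpha> L t) \<partial>lborel)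
       \<le> (\<integral>\<^sup>+t\<in>P \<inter> {t. L * t $ j \<le> b * M}. ennreal (face_kernel \<l> a \<alpha> L t) \<partial>lborel)"
    proof (intro nn_integral_mono)
      fix t
      have "\<alpha> $ j * M \<le> b * M" using b(2)[of j] M by (intro mult_right_mono) auto
      then show "ennreal (face_kernel \<l> a \<alpha> L t) * indicator (P \<inter> {t. L * t $ j \<le> \<alpha> $ j * M}) t
        \<le> ennreal (face_kernel \<l> a \<alpha> L t) * indicator (P \<inter> {t. L * t $ j \<le> b * M}) t"
        by (intro mult_left_mono) (auto split: split_indicator)
    qed
    also have "\<dots> \<le> ennreal (K' * (b * M / L) powr \<epsilon> * L powr (real d - CARD('s)))"
      using b(1) M mult_mono[of 1 b 1 M] by (intro K'(2) L) auto
    also have "ennreal (exp (a * L) * L powr (CARD('s) + (\<Sum>j\<in>UNIV. \<l> $ j)) / (A * A')) * \<dots>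
      = ennreal (K' * b powr \<epsilon> / (A * A') * (M / L) powr \<epsilon> * H L)"
    proof -
      have "(b * M / L) powr \<epsilon> = b powr \<epsilon> * (M / L) powr \<epsilon>"
        using b(1) M L powr_mult[of b "M / L" \<epsilon>] by simp
      moreover have "L powr (CARD('s) - real d) * L powr (real d - CARD('s)) = 1" using L by (simp flip: powr_add)
      then have "x * L powr (CARD('s) - real d) * (z * L powr (real d - CARD('s))) = x * z" for x z
        by (metis mult.assoc mult.commute mult_1_right)
      ultimately show ?thesis unfolding H_split using H0[of L] K' A A'
        by (simp add: ennreal_mult'[symmetric] mult_ac)
    qed
    finally show "(\<integral>\<^sup>+u\<in>log_region k \<omega> L \<inter> {u. u $ j \<le> M}. ennreal (log_growth \<alpha> \<l> u) \<partial>lborel)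
        \<le> ennreal (K' * b powr \<epsilon> / (A * A') * (M / L) powr \<epsilon> * H L)"
      by (simp add: mult_left_mono)
  qed
qed

subsection \<open>Sums over logarithmic cells\<close>

definition log_growth1 :: "real \<Rightarrow> real \<Rightarrow> real \<Rightarrow> real" where
  "log_growth1 \<alpha> l v = exp (\<alpha> * v) * (1 + v) powr l"

lemma log_growth_eq_prod: "log_growth \<alpha> \<l> u = (\<Prod>j\<in>UNIV. log_growth1 (\<alpha> $ j) (\<l> $ j) (u $ j))"
  by (simp add: log_growth_def log_growth1_def)

lemma log_growth1_pos: "v \<ge> 0 \<Longrightarrow> log_growth1 \<alpha> l v > 0"
  by (simp add: log_growth1_def)

lemma log_growth_pos: "(\<And>j. 0 \<le> u $ j) \<Longrightarrow> log_growth \<alpha> \<l> u > 0"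
  unfolding log_growth_eq_prod by (intro prod_pos log_growth1_pos)

text \<open>Factor allowed for an increase of the argument by at most 1: \<open>exp \<alpha>\<close>
  for the exponential and \<open>2 powr \<bar>l\<bar>\<close> because \<open>1 + v\<close> at most
  doubles.\<close>

definition growth_ratio :: "real \<Rightarrow> real \<Rightarrow> real" where
  "growth_ratio \<alpha> l = exp \<alpha> * 2 powr \<bar>l\<bar>"

lemma growth_ratio_ge_1: "\<alpha> \<ge> 0 \<Longrightarrow> growth_ratio \<alpha> l \<ge> 1"
  using mult_mono[of 1 "exp \<alpha>" 1 "2 powr \<bar>l\<bar>"] by (simp add: growth_ratio_def ge_one_powr_ge_zero)

lemma log_growth1_comparable:
  assumes "\<alpha> \<ge> 0" "0 \<le> v" "v \<le> w" "w \<le> v + 1"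
  shows "log_growth1 \<alpha> l w \<le> growth_ratio \<alpha> l * log_growth1 \<alpha> l v"
    and "log_growth1 \<alpha> l v \<le> growth_ratio \<alpha> l * log_growth1 \<alpha> l w"
proof -
  have "\<alpha> * w \<le> \<alpha> + \<alpha> * v" using mult_left_mono[OF assms(4,1)] by (simp add: algebra_simps)
  then have e1: "exp (\<alpha> * w) \<le> exp \<alpha> * exp (\<alpha> * v)" by (simp flip: exp_add)
  have "\<alpha> * v \<le> \<alpha> + \<alpha> * w" using mult_left_mono[OF assms(3,1)] assms(1) by linarith
  then have e2: "exp (\<alpha> * v) \<le> exp \<alpha> * exp (\<alpha> * w)" by (simp flip: exp_add)
  have p1: "(1 + w) powr l \<le> 2 powr \<bar>l\<bar> * (1 + v) powr l" and p2: "(1 + v) powr l \<le> 2 powr \<bar>l\<bar> * (1 + w) powr l"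
    using assms by (auto intro!: powr_comparable)
  show "log_growth1 \<alpha> l w \<le> growth_ratio \<alpha> l * log_growth1 \<alpha> l v"
    using mult_mono[OF e1 p1] by (simp add: log_growth1_def growth_ratio_def mult_ac)
  show "log_growth1 \<alpha> l v \<le> growth_ratio \<alpha> l * log_growth1 \<alpha> l w"
    using mult_mono[OF e2 p2] by (simp add: log_growth1_def growth_ratio_def mult_ac)
qed

lemma log_growth1_mvt:
  assumes "0 \<le> v" "v \<le> w"
  shows "\<exists>\<xi>. v \<le> \<xi> \<and> \<xi> \<le> w \<and>
    log_growth1 \<alpha> l w - log_growth1 \<alpha> l v = (w - v) * (log_growth1 \<alpha> l \<xi> * (\<alpha> + l / (1 + \<xi>)))"
proof (cases "v = w")
  case True
  then show ?thesis by auto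
next
  case False
  have "\<exists>\<xi>>v. \<xi> < w \<and> log_growth1 \<alpha> l w - log_growth1 \<alpha> l v = (w - v) * (log_growth1 \<alpha> l \<xi> * (\<alpha> + l / (1 + \<xi>)))"
  proof (rule MVT2)
    show "v < w" using False assms by simp
    fix x assume x: "v \<le> x" "x \<le> w"
    then have x0: "1 + x > 0" using assms by simp
    have "((\<lambda>v. exp (\<alpha> * v) * (1 + v) powr l) has_real_derivative
       exp (\<alpha> * x) * \<alpha> * (1 + x) powr l + exp (\<alpha> * x) * (l * (1 + x) powr (l - 1))) (at x)"
      using x0 by (auto intro!: derivative_eq_intros simp: field_simps)
    moreover have "(1 + x) powr (l - 1) = (1 + x) powr l / (1 + x)" using x0 by (simp add: powr_diff)
    ultimately show "(log_growth1 \<alpha> l has_real_derivative log_growth1 \<alpha> l x * (\<alpha> + l / (1 + x))) (at x)"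
      by (simp add: log_growth1_def[abs_def] distrib_left mult_ac)
  qed
  then show ?thesis by (metis less_imp_le)
qed

text \<open>The logarithmic derivative is \<open>\<alpha> + l / (1 + v)\<close>, so replacing it by
  \<alpha> costs a relative error \<open>1 / (1 + v)\<close>. This part does not shrink with the
  step, one reason why cells near the coordinate hyperplanes are treated separately.\<close>

lemma log_growth1_diff:
  assumes "\<alpha> \<ge> 0" "0 \<le> v" "v \<le> w" "w \<le> v + 1"
  shows "\<bar>log_growth1 \<alpha> l w - log_growth1 \<alpha> l v\<bar> \<le> (\<alpha> + \<bar>l\<bar>) * growth_ratio \<alpha> l * (w - v) * log_growth1 \<alpha> l v"
    and "\<bar>log_growth1 \<alpha> l w - log_growth1 \<alpha> l v - \<alpha> * (w - v) * log_growth1 \<alpha> l v\<bar>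
      \<le> ((\<alpha> + \<bar>l\<bar>) * (\<alpha> + 1) * growth_ratio \<alpha> l) * (w - v) * ((w - v) + 1 / (1 + v)) * log_growth1 \<alpha> l v"
proof -
  let ?g = "log_growth1 \<alpha> l" and ?R = "growth_ratio \<alpha> l"
  have R1: "?R \<ge> 1" using growth_ratio_ge_1 assms(1) .
  have gv: "?g v > 0" using log_growth1_pos assms(2) .
  have first: "\<bar>?g w' - ?g v\<bar> \<le> (\<alpha> + \<bar>l\<bar>) * ?R * (w' - v) * ?g v"
    if w': "v \<le> w'" "w' \<le> v + 1" for w'
  proof -
    obtain \<xi> where \<xi>: "v \<le> \<xi>" "\<xi> \<le> w'" "?g w' - ?g v = (w' - v) * (?g \<xi> * (\<alpha> + l / (1 + \<xi>)))"
      using log_growth1_mvt[OF assms(2) w'(1)] by blast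
    have g\<xi>: "?g \<xi> \<le> ?R * ?g v" "?g \<xi> > 0"
      using log_growth1_comparable(1)[OF assms(1,2) \<xi>(1)] log_growth1_pos[of \<xi>] \<xi> w' assms(2) by auto
    have "\<bar>l / (1 + \<xi>)\<bar> \<le> \<bar>l\<bar>"
      using \<xi>(1) assms(2) by (simp add: abs_divide divide_le_eq mult_le_cancel_left1)
    then have a: "\<bar>\<alpha> + l / (1 + \<xi>)\<bar> \<le> \<alpha> + \<bar>l\<bar>" using assms(1) by linarith
    have "\<bar>?g w' - ?g v\<bar> = (w' - v) * (?g \<xi> * \<bar>\<alpha> + l / (1 + \<xi>)\<bar>)"
      using \<xi>(3) w' g\<xi> by (simp add: abs_mult)
    also have "\<dots> \<le> (w' - v) * ((?R * ?g v) * (\<alpha> + \<bar>l\<bar>))"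
      using w' g\<xi> a R1 gv by (intro mult_left_mono mult_mono) auto
    finally show ?thesis by (simp add: mult_ac)
  qed
  show "\<bar>?g w - ?g v\<bar> \<le> (\<alpha> + \<bar>l\<bar>) * ?R * (w - v) * ?g v" using first assms by auto
  obtain \<xi> where \<xi>: "v \<le> \<xi>" "\<xi> \<le> w" "?g w - ?g v = (w - v) * (?g \<xi> * (\<alpha> + l / (1 + \<xi>)))"
    using log_growth1_mvt[OF assms(2,3)] by blast
  have g\<xi>: "?g \<xi> \<le> ?R * ?g v" "?g \<xi> > 0"
    using log_growth1_comparable(1)[OF assms(1,2) \<xi>(1)] log_growth1_pos[of \<xi>] \<xi> assms by auto
  have l\<xi>: "\<bar>l / (1 + \<xi>)\<bar> \<le> \<bar>l\<bar> / (1 + v)"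
    using \<xi>(1) assms(2) by (simp add: abs_divide divide_left_mono)
  have c0: "(\<alpha> + \<bar>l\<bar>) * ?R \<ge> 0" "(\<alpha> + \<bar>l\<bar>) * ?R * ?g v \<ge> 0" using assms(1) R1 gv by auto
  have v1: "1 / (1 + v) \<ge> 0" using assms(2) by simp
  have "\<bar>?g \<xi> * (\<alpha> + l / (1 + \<xi>)) - \<alpha> * ?g v\<bar> = \<bar>\<alpha> * (?g \<xi> - ?g v) + ?g \<xi> * (l / (1 + \<xi>))\<bar>"
    by (simp add: algebra_simps)
  also have "\<dots> \<le> \<alpha> * \<bar>?g \<xi> - ?g v\<bar> + ?g \<xi> * \<bar>l / (1 + \<xi>)\<bar>"
    using assms(1) g\<xi>(2) by (intro order_trans[OF abs_triangle_ineq]) (simp add: abs_mult)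
  also have "\<dots> \<le> \<alpha> * ((\<alpha> + \<bar>l\<bar>) * ?R * (w - v) * ?g v) + (?R * ?g v) * (\<bar>l\<bar> / (1 + v))"
  proof (intro add_mono mult_left_mono mult_mono)
    have "(\<alpha> + \<bar>l\<bar>) * ?R * (\<xi> - v) * ?g v \<le> (\<alpha> + \<bar>l\<bar>) * ?R * (w - v) * ?g v"
      using c0 gv \<xi> by (intro mult_right_mono mult_left_mono) auto
    then show "\<bar>?g \<xi> - ?g v\<bar> \<le> (\<alpha> + \<bar>l\<bar>) * ?R * (w - v) * ?g v"
      using first[OF \<xi>(1)] \<xi>(2) assms(4) by linarith
  qed (use assms(1) g\<xi> l\<xi> R1 gv in auto)
  also have "\<dots> \<le> ((\<alpha> + \<bar>l\<bar>) * (\<alpha> + 1) * ?R) * ((w - v) + 1 / (1 + v)) * ?g v"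
  proof -
    have f1: "0 \<le> (\<alpha> + \<bar>l\<bar>) * ?R * ?g v * (w - v)" using c0 assms by auto
    have f2: "(?R * ?g v) * (\<bar>l\<bar> / (1 + v)) \<le> ((\<alpha> + \<bar>l\<bar>) * (\<alpha> + 1) * ?R) * (1 / (1 + v)) * ?g v"
    proof -
      have "\<bar>l\<bar> * 1 \<le> (\<alpha> + \<bar>l\<bar>) * (\<alpha> + 1)" using assms(1) by (intro mult_mono) auto
      then have "\<bar>l\<bar> * (?R * ?g v * (1 / (1 + v))) \<le> ((\<alpha> + \<bar>l\<bar>) * (\<alpha> + 1)) * (?R * ?g v * (1 / (1 + v)))"
        using R1 gv v1 by (intro mult_right_mono) auto
      then show ?thesis by (simp add: mult_ac)
    qed
    have f3: "((\<alpha> + \<bar>l\<bar>) * (\<alpha> + 1) * ?R) * ((w - v) + 1 / (1 + v)) * ?g v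
      = \<alpha> * ((\<alpha> + \<bar>l\<bar>) * ?R * (w - v) * ?g v) + (\<alpha> + \<bar>l\<bar>) * ?R * ?g v * (w - v)
        + ((\<alpha> + \<bar>l\<bar>) * (\<alpha> + 1) * ?R) * (1 / (1 + v)) * ?g v"
      by (simp only: distrib_left distrib_right mult_1_right mult_1_left mult_ac add_ac)
    show ?thesis unfolding f3 by (rule add_mono[OF add_increasing2[OF f1 order_refl] f2])
  qed
  finally have "(w - v) * \<bar>?g \<xi> * (\<alpha> + l / (1 + \<xi>)) - \<alpha> * ?g v\<bar>
     \<le> (w - v) * (((\<alpha> + \<bar>l\<bar>) * (\<alpha> + 1) * ?R) * ((w - v) + 1 / (1 + v)) * ?g v)"
    using assms(3) by (intro mult_left_mono) auto
  moreover have "\<bar>?g w - ?g v - \<alpha> * (w - v) * ?g v\<bar> = (w - v) * \<bar>?g \<xi> * (\<alpha> + l / (1 + \<xi>)) - \<alpha> * ?g v\<bar>"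
  proof -
    have "?g w - ?g v - \<alpha> * (w - v) * ?g v = (w - v) * (?g \<xi> * (\<alpha> + l / (1 + \<xi>)) - \<alpha> * ?g v)"
      unfolding \<xi>(3) by (simp add: algebra_simps)
    then show ?thesis using assms(3) by (simp add: abs_mult)
  qed
  ultimately show "\<bar>?g w - ?g v - \<alpha> * (w - v) * ?g v\<bar>
      \<le> ((\<alpha> + \<bar>l\<bar>) * (\<alpha> + 1) * ?R) * (w - v) * ((w - v) + 1 / (1 + v)) * ?g v"
    by (simp add: mult_ac)
qed

text \<open>Dividing by \<open>B\<close> brings all factors into the unit ball, where the
  telescoping bound \<open>norm_prod_diff\<close> applies.\<close>

lemma prod_diff_bound:
  fixes a b :: "'s::finite \<Rightarrow> real"
  assumes "B \<ge> 1" "\<And>j. \<bar>a j\<bar> \<le> B" "\<And>j. \<bar>b j\<bar> \<le> B"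
  shows "\<bar>(\<Prod>j\<in>UNIV. a j) - (\<Prod>j\<in>UNIV. b j)\<bar> \<le> B ^ CARD('s) * (\<Sum>j\<in>UNIV. \<bar>a j - b j\<bar>)"
proof -
  have B0: "B > 0" using assms(1) by simp
  have "norm ((\<Prod>j\<in>UNIV. a j / B) - (\<Prod>j\<in>UNIV. b j / B)) \<le> (\<Sum>j\<in>UNIV. norm (a j / B - b j / B))"
    using assms B0 by (intro norm_prod_diff) auto
  also have "\<dots> \<le> (\<Sum>j\<in>UNIV. \<bar>a j - b j\<bar>)"
  proof (intro sum_mono)
    fix j
    have "norm (a j / B - b j / B) = \<bar>a j - b j\<bar> / B" using B0 by (simp flip: diff_divide_distrib)
    also have "\<dots> \<le> \<bar>a j - b j\<bar>" using assms(1) by (simp add: divide_le_eq mult_le_cancel_left1)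
    finally show "norm (a j / B - b j / B) \<le> \<bar>a j - b j\<bar>" .
  qed
  finally have *: "\<bar>(\<Prod>j\<in>UNIV. a j / B) - (\<Prod>j\<in>UNIV. b j / B)\<bar> \<le> (\<Sum>j\<in>UNIV. \<bar>a j - b j\<bar>)" by simp
  have "(\<Prod>j\<in>UNIV. a j) - (\<Prod>j\<in>UNIV. b j) = B ^ CARD('s) * ((\<Prod>j\<in>UNIV. a j / B) - (\<Prod>j\<in>UNIV. b j / B))"
    using B0 by (simp add: prod_dividef right_diff_distrib)
  then have "\<bar>(\<Prod>j\<in>UNIV. a j) - (\<Prod>j\<in>UNIV. b j)\<bar> = B ^ CARD('s) * \<bar>(\<Prod>j\<in>UNIV. a j / B) - (\<Prod>j\<in>UNIV. b j / B)\<bar>"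
    using B0 by (simp add: abs_mult)
  then show ?thesis using * B0 by (simp add: mult_left_mono)
qed

text \<open>All factors are divided by their values at \<open>v\<close>. The ratios stay bounded, so
  the one-dimensional estimates combine with a constant depending only on \<alpha> and
  \<open>\<l>\<close>. The last claim says that the mixed difference over a cube is its volume times
  the expected density, up to a relative error.\<close>

lemma log_growth_local_bounds:
  fixes \<alpha> \<l> :: "real ^ 's"
  assumes \<alpha>: "\<And>j. \<alpha> $ j > 0"
  obtains R where "R \<ge> 1"
    "\<And>h v u. 0 \<le> h \<Longrightarrow> h \<le> 1 \<Longrightarrow> (\<And>j. 0 \<le> v $ j) \<Longrightarrow> (\<And>j. v $ j \<le> u $ j) \<Longrightarrow> (\<And>j. u $ j \<le> v $ j + h) \<Longrightarrow>
      log_growth \<alpha> \<l> u \<le> R * log_growth \<alpha> \<l> v \<and> log_growth \<alpha> \<l> v \<le> R * log_growth \<alpha> \<l> u \<and>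
      \<bar>log_growth \<alpha> \<l> u - log_growth \<alpha> \<l> v\<bar> \<le> R * h * log_growth \<alpha> \<l> v"
    "\<And>h v M. 0 < h \<Longrightarrow> h \<le> 1 \<Longrightarrow> 0 \<le> M \<Longrightarrow> (\<And>j. M \<le> v $ j) \<Longrightarrow>
      \<bar>(\<Prod>j\<in>UNIV. log_growth1 (\<alpha> $ j) (\<l> $ j) (v $ j + h) - log_growth1 (\<alpha> $ j) (\<l> $ j) (v $ j))
        - (\<Prod>j\<in>UNIV. \<alpha> $ j) * h ^ CARD('s) * log_growth \<alpha> \<l> v\<bar>
      \<le> R * (h + 1 / (1 + M)) * (h ^ CARD('s) * log_growth \<alpha> \<l> v)"
proof -
  define C where "C j = (\<alpha> $ j + \<bar>\<l> $ j\<bar>) * (\<alpha> $ j + 1) * growth_ratio (\<alpha> $ j) (\<l> $ j)" for j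
  have C0: "C j \<ge> 0" for j
    using \<alpha>[of j] growth_ratio_ge_1[of "\<alpha> $ j" "\<l> $ j"] by (simp add: C_def)
  \<comment> \<open>One bound for all ratios that are multiplied below; \<open>2 * C j\<close> is
    there because the relative step \<open>h + 1 / (1 + M)\<close> can be as large as 2.\<close>
  define B where "B = 1 + (\<Sum>j\<in>UNIV. growth_ratio (\<alpha> $ j) (\<l> $ j) + \<alpha> $ j + 2 * C j)"
  have term0: "growth_ratio (\<alpha> $ j) (\<l> $ j) + \<alpha> $ j + 2 * C j \<ge> 0" for j
    using \<alpha>[of j] growth_ratio_ge_1[of "\<alpha> $ j" "\<l> $ j"] C0[of j] by simp
  have Bj: "growth_ratio (\<alpha> $ j) (\<l> $ j) + \<alpha> $ j + 2 * C j \<le> B" for j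
  proof -
    have "growth_ratio (\<alpha> $ j) (\<l> $ j) + \<alpha> $ j + 2 * C j \<le> (\<Sum>j\<in>UNIV. growth_ratio (\<alpha> $ j) (\<l> $ j) + \<alpha> $ j + 2 * C j)"
      by (rule member_le_sum) (use term0 in auto)
    then show ?thesis by (simp add: B_def)
  qed
  have B1: "B \<ge> 1" unfolding B_def using term0 by (simp add: sum_nonneg)
  define R0 where "R0 = (\<Prod>j\<in>UNIV. growth_ratio (\<alpha> $ j) (\<l> $ j))"
  have R0: "R0 \<ge> 1" unfolding R0_def using growth_ratio_ge_1 \<alpha>[THEN less_imp_le] by (intro prod_ge_1) auto
  define R where "R = R0 + B ^ CARD('s) * (\<Sum>j\<in>UNIV. C j)"
  have sC: "(\<Sum>j\<in>UNIV. C j) \<ge> 0" using C0 by (intro sum_nonneg) auto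
  have BC: "B ^ CARD('s) * (\<Sum>j\<in>UNIV. C j) \<ge> 0" using B1 sC by auto
  have R: "R \<ge> 1" "R \<ge> R0" "R \<ge> B ^ CARD('s) * (\<Sum>j\<in>UNIV. C j)" using R0 BC by (auto simp: R_def)
  show ?thesis
  proof (rule that[OF R(1)])
    fix h and v u :: "real^'s"
    assume h: "0 \<le> h" "h \<le> 1" and v: "\<And>j. 0 \<le> v $ j" and vu: "\<And>j. v $ j \<le> u $ j" and uv: "\<And>j. u $ j \<le> v $ j + h"
    have u0: "0 \<le> u $ j" for j using v[of j] vu[of j] by linarith
    have uv1: "u $ j \<le> v $ j + 1" for j using uv[of j] h by linarith
    have Gv: "log_growth \<alpha> \<l> v > 0" and Gu: "log_growth \<alpha> \<l> u > 0" using log_growth_pos v u0 by auto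
    have "log_growth \<alpha> \<l> u \<le> (\<Prod>j\<in>UNIV. growth_ratio (\<alpha> $ j) (\<l> $ j) * log_growth1 (\<alpha> $ j) (\<l> $ j) (v $ j))"
      unfolding log_growth_eq_prod
      using log_growth1_comparable(1)[OF less_imp_le[OF \<alpha>] v vu uv1] log_growth1_pos[OF u0]
      by (intro prod_mono conjI) (auto simp: less_imp_le)
    then have 1: "log_growth \<alpha> \<l> u \<le> R0 * log_growth \<alpha> \<l> v" by (simp add: prod.distrib R0_def log_growth_eq_prod)
    have "log_growth \<alpha> \<l> v \<le> (\<Prod>j\<in>UNIV. growth_ratio (\<alpha> $ j) (\<l> $ j) * log_growth1 (\<alpha> $ j) (\<l> $ j) (u $ j))"
      unfolding log_growth_eq_prod
      using log_growth1_comparable(2)[OF less_imp_le[OF \<alpha>] v vu uv1] log_growth1_pos[OF v]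
      by (intro prod_mono conjI) (auto simp: less_imp_le)
    then have 2: "log_growth \<alpha> \<l> v \<le> R0 * log_growth \<alpha> \<l> u" by (simp add: prod.distrib R0_def log_growth_eq_prod)
    define a where "a j = log_growth1 (\<alpha> $ j) (\<l> $ j) (u $ j) / log_growth1 (\<alpha> $ j) (\<l> $ j) (v $ j)" for j
    have gv: "log_growth1 (\<alpha> $ j) (\<l> $ j) (v $ j) > 0" for j using log_growth1_pos[OF v] .
    have a_le: "\<bar>a j\<bar> \<le> B" for j
    proof -
      have "a j \<le> growth_ratio (\<alpha> $ j) (\<l> $ j)"
        unfolding a_def using log_growth1_comparable(1)[OF less_imp_le[OF \<alpha>] v vu uv1, of j] gv[of j]
        by (simp add: divide_le_eq)
      moreover have "a j \<ge> 0" unfolding a_def using gv[of j] log_growth1_pos[OF u0, of "\<alpha> $ j" "\<l> $ j" j] by simp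
      ultimately show ?thesis using Bj[of j] \<alpha>[of j] C0[of j] by simp
    qed
    have a1: "\<bar>a j - 1\<bar> \<le> C j * h" for j
    proof -
      have "\<bar>a j - 1\<bar> = \<bar>log_growth1 (\<alpha> $ j) (\<l> $ j) (u $ j) - log_growth1 (\<alpha> $ j) (\<l> $ j) (v $ j)\<bar> / log_growth1 (\<alpha> $ j) (\<l> $ j) (v $ j)"
        using gv[of j] by (simp add: a_def diff_divide_distrib[symmetric] abs_divide field_simps)
      also have "\<dots> \<le> (\<alpha> $ j + \<bar>\<l> $ j\<bar>) * growth_ratio (\<alpha> $ j) (\<l> $ j) * (u $ j - v $ j)"
        using log_growth1_diff(1)[OF less_imp_le[OF \<alpha>] v vu uv1, where l = "\<l> $ j"] gv[of j]
        by (simp add: divide_le_eq)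
      also have "\<dots> \<le> C j * h"
      proof (rule mult_mono)
        have "0 \<le> (\<alpha> $ j + \<bar>\<l> $ j\<bar>) * growth_ratio (\<alpha> $ j) (\<l> $ j) * \<alpha> $ j"
          using \<alpha>[of j] growth_ratio_ge_1[of "\<alpha> $ j" "\<l> $ j"] by simp
        then show "(\<alpha> $ j + \<bar>\<l> $ j\<bar>) * growth_ratio (\<alpha> $ j) (\<l> $ j) \<le> C j" by (simp add: C_def algebra_simps)
      qed (use uv[of j] vu[of j] C0[of j] in auto)
      finally show ?thesis .
    qed
    have "\<bar>(\<Prod>j\<in>UNIV. a j) - (\<Prod>j\<in>(UNIV :: 's set). 1)\<bar> \<le> B ^ CARD('s) * (\<Sum>j\<in>UNIV. \<bar>a j - 1\<bar>)"
      by (rule prod_diff_bound) (use B1 a_le in auto)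
    also have "\<dots> \<le> B ^ CARD('s) * (\<Sum>j\<in>UNIV. C j * h)"
      using a1 B1 by (intro mult_left_mono sum_mono) auto
    also have "\<dots> = B ^ CARD('s) * (\<Sum>j\<in>UNIV. C j) * h" by (simp add: sum_distrib_right)
    also have "\<dots> \<le> R * h" using R(3) h by (intro mult_right_mono) auto
    finally have "\<bar>(\<Prod>j\<in>UNIV. a j) - 1\<bar> * log_growth \<alpha> \<l> v \<le> R * h * log_growth \<alpha> \<l> v"
      using Gv by (intro mult_right_mono) auto
    moreover have "\<bar>log_growth \<alpha> \<l> u - log_growth \<alpha> \<l> v\<bar> = \<bar>(\<Prod>j\<in>UNIV. a j) - 1\<bar> * log_growth \<alpha> \<l> v"
    proof -
      have "(\<Prod>j\<in>UNIV. a j) = log_growth \<alpha> \<l> u / log_growth \<alpha> \<l> v"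
        by (simp add: a_def prod_dividef log_growth_eq_prod)
      then have "log_growth \<alpha> \<l> u - log_growth \<alpha> \<l> v = ((\<Prod>j\<in>UNIV. a j) - 1) * log_growth \<alpha> \<l> v"
        using Gv by (simp add: left_diff_distrib)
      then show ?thesis using Gv by (simp add: abs_mult)
    qed
    ultimately have 3: "\<bar>log_growth \<alpha> \<l> u - log_growth \<alpha> \<l> v\<bar> \<le> R * h * log_growth \<alpha> \<l> v" by simp
    have "R0 * log_growth \<alpha> \<l> v \<le> R * log_growth \<alpha> \<l> v" "R0 * log_growth \<alpha> \<l> u \<le> R * log_growth \<alpha> \<l> u"
      using R(2) Gv Gu by auto
    then show "log_growth \<alpha> \<l> u \<le> R * log_growth \<alpha> \<l> v \<and> log_growth \<alpha> \<l> v \<le> R * log_growth \<alpha> \<l> u \<and>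
      \<bar>log_growth \<alpha> \<l> u - log_growth \<alpha> \<l> v\<bar> \<le> R * h * log_growth \<alpha> \<l> v" using 1 2 3 by linarith
  next
    fix h M :: real and v :: "real^'s"
    assume h: "0 < h" "h \<le> 1" and M: "0 \<le> M" and Mv: "\<And>j. M \<le> v $ j"
    have v: "0 \<le> v $ j" for j using M Mv[of j] by linarith
    have gv: "log_growth1 (\<alpha> $ j) (\<l> $ j) (v $ j) > 0" for j using log_growth1_pos[OF v] .
    have Gv: "log_growth \<alpha> \<l> v > 0" using log_growth_pos v by auto
    define \<eta> where "\<eta> = h + 1 / (1 + M)"
    have \<eta>: "0 \<le> \<eta>" "\<eta> \<le> 2"
    proof -
      have "1 / (1 + M) \<le> 1" using M by simp
      then show "\<eta> \<le> 2" using h by (simp add: \<eta>_def)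
      show "0 \<le> \<eta>" using h M by (simp add: \<eta>_def)
    qed
    define a where "a j = (log_growth1 (\<alpha> $ j) (\<l> $ j) (v $ j + h) - log_growth1 (\<alpha> $ j) (\<l> $ j) (v $ j)) / (h * log_growth1 (\<alpha> $ j) (\<l> $ j) (v $ j))" for j
    have a1: "\<bar>a j - \<alpha> $ j\<bar> \<le> C j * \<eta>" for j
    proof -
      let ?g = "log_growth1 (\<alpha> $ j) (\<l> $ j)"
      have hg: "h * ?g (v $ j) > 0" using h gv[of j] by simp
      have "a j - \<alpha> $ j = (?g (v $ j + h) - ?g (v $ j) - \<alpha> $ j * h * ?g (v $ j)) / (h * ?g (v $ j))"
        using h(1) gv[of j] by (simp add: a_def diff_divide_distrib)
      then have "\<bar>a j - \<alpha> $ j\<bar> = \<bar>?g (v $ j + h) - ?g (v $ j) - \<alpha> $ j * h * ?g (v $ j)\<bar> / (h * ?g (v $ j))"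
        using hg by simp
      also have "\<dots> \<le> (C j * h * (h + 1 / (1 + v $ j)) * ?g (v $ j)) / (h * ?g (v $ j))"
        using log_growth1_diff(2)[of "\<alpha> $ j" "v $ j" "v $ j + h" "\<l> $ j"] \<alpha>[of j] v[of j] h hg
        by (intro divide_right_mono) (auto simp: C_def)
      also have "\<dots> = C j * (h + 1 / (1 + v $ j))" using h gv[of j] by simp
      also have "\<dots> \<le> C j * \<eta>"
      proof (rule mult_left_mono[OF _ C0])
        have "1 / (1 + v $ j) \<le> 1 / (1 + M)" using Mv[of j] M by (intro divide_left_mono) auto
        then show "h + 1 / (1 + v $ j) \<le> \<eta>" by (simp add: \<eta>_def)
      qed
      finally show ?thesis .
    qed
    have a_le: "\<bar>a j\<bar> \<le> B" for j
    proof -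
      have "C j * \<eta> \<le> C j * 2" using \<eta> C0[of j] by (intro mult_left_mono) auto
      then show ?thesis using a1[of j] Bj[of j] \<alpha>[of j] growth_ratio_ge_1[of "\<alpha> $ j" "\<l> $ j"] by linarith
    qed
    have \<alpha>_le: "\<bar>\<alpha> $ j\<bar> \<le> B" for j
      using Bj[of j] \<alpha>[of j] growth_ratio_ge_1[of "\<alpha> $ j" "\<l> $ j"] C0[of j] by linarith
    have "\<bar>(\<Prod>j\<in>UNIV. a j) - (\<Prod>j\<in>UNIV. \<alpha> $ j)\<bar> \<le> B ^ CARD('s) * (\<Sum>j\<in>UNIV. \<bar>a j - \<alpha> $ j\<bar>)"
      by (rule prod_diff_bound) (use B1 a_le \<alpha>_le in auto)
    also have "\<dots> \<le> B ^ CARD('s) * (\<Sum>j\<in>UNIV. C j * \<eta>)"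
      using a1 B1 by (intro mult_left_mono sum_mono) auto
    also have "\<dots> = B ^ CARD('s) * (\<Sum>j\<in>UNIV. C j) * \<eta>" by (simp add: sum_distrib_right)
    also have "\<dots> \<le> R * \<eta>" using R(3) \<eta> by (intro mult_right_mono) auto
    finally have *: "\<bar>(\<Prod>j\<in>UNIV. a j) - (\<Prod>j\<in>UNIV. \<alpha> $ j)\<bar> * (h ^ CARD('s) * log_growth \<alpha> \<l> v) \<le> R * \<eta> * (h ^ CARD('s) * log_growth \<alpha> \<l> v)"
      using Gv h by (intro mult_right_mono) auto
    define \<Delta> where "\<Delta> = (\<Prod>j\<in>UNIV. log_growth1 (\<alpha> $ j) (\<l> $ j) (v $ j + h) - log_growth1 (\<alpha> $ j) (\<l> $ j) (v $ j))"
    have "(\<Prod>j\<in>UNIV. a j) = \<Delta> / (h ^ CARD('s) * log_growth \<alpha> \<l> v)"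
      by (simp add: a_def \<Delta>_def prod_dividef prod.distrib log_growth_eq_prod)
    then have "\<Delta> - (\<Prod>j\<in>UNIV. \<alpha> $ j) * h ^ CARD('s) * log_growth \<alpha> \<l> v
      = ((\<Prod>j\<in>UNIV. a j) - (\<Prod>j\<in>UNIV. \<alpha> $ j)) * (h ^ CARD('s) * log_growth \<alpha> \<l> v)"
      using Gv h by (simp add: left_diff_distrib)
    then have "\<bar>\<Delta> - (\<Prod>j\<in>UNIV. \<alpha> $ j) * h ^ CARD('s) * log_growth \<alpha> \<l> v\<bar>
      = \<bar>(\<Prod>j\<in>UNIV. a j) - (\<Prod>j\<in>UNIV. \<alpha> $ j)\<bar> * (h ^ CARD('s) * log_growth \<alpha> \<l> v)"
      using Gv h by (simp add: abs_mult)
    then show "\<bar>(\<Prod>j\<in>UNIV. log_growth1 (\<alpha> $ j) (\<l> $ j) (v $ j + h) - log_growth1 (\<alpha> $ j) (\<l> $ j) (v $ j))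
        - (\<Prod>j\<in>UNIV. \<alpha> $ j) * h ^ CARD('s) * log_growth \<alpha> \<l> v\<bar>
      \<le> R * (h + 1 / (1 + M)) * (h ^ CARD('s) * log_growth \<alpha> \<l> v)"
      using * by (simp add: \<Delta>_def \<eta>_def)
  qed
qed

text \<open>Inclusion-exclusion one coordinate at a time: \<open>T\<close> collects the coordinates
  in which the part below \<open>lo\<close> has been removed. Each removal is a difference of two
  sums of the same kind and doubles the error.\<close>

lemma box_mixed_difference:
  fixes f :: "nat ^ 's \<Rightarrow> 'a::real_normed_field" and lo hi :: "'s \<Rightarrow> real" and g :: "'s \<Rightarrow> real \<Rightarrow> 'a" and c :: 'a
  defines "X \<equiv> \<lambda>T b. {x :: nat ^ 's. \<forall>i. 1 \<le> x $ i \<and> ln (real (x $ i)) \<le> b i \<and> (i \<in> T \<longrightarrow> lo i < ln (real (x $ i)))}"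
  assumes lohi: "\<And>i. lo i \<le> hi i"
    and bound: "\<And>b. (\<And>i. b i = lo i \<or> b i = hi i) \<Longrightarrow> norm ((\<Sum>x\<in>X {} b. f x) - c * (\<Prod>i\<in>UNIV. g i (b i))) \<le> e"
    and fin: "\<And>b. finite (X {} b)"
  shows "finite T \<Longrightarrow> (\<And>i. b i = lo i \<or> b i = hi i) \<Longrightarrow> (\<And>i. i \<in> T \<Longrightarrow> b i = hi i) \<Longrightarrow>
    norm ((\<Sum>x\<in>X T b. f x) - c * (\<Prod>i\<in>UNIV. if i \<in> T then g i (hi i) - g i (lo i) else g i (b i))) \<le> 2 ^ card T * e"
proof (induction T arbitrary: b rule: finite_induct)
  case empty
  then show ?case using bound by simp
next
  case (insert j T)
  define b' where "b' = b(j := lo j)"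
  define p where "p T b i = (if i \<in> T then g i (hi i) - g i (lo i) else g i (b i))" for T b i
  have bj: "b j = hi j" using insert.prems by auto
  have finX: "finite (X T b)" for T b
    by (rule finite_subset[OF _ fin[of b]]) (auto simp: X_def)
  have sub: "X T b' \<subseteq> X T b"
  proof -
    have "b' i \<le> b i" for i using lohi[of j] bj by (simp add: b'_def)
    then show ?thesis unfolding X_def by (auto intro: order_trans)
  qed
  have eq: "X (insert j T) b = X T b - X T b'"
    using lohi[of j] bj by (auto simp: X_def b'_def not_le split: if_splits)
  have E1: "(\<Sum>x\<in>X (insert j T) b. f x) = (\<Sum>x\<in>X T b. f x) - (\<Sum>x\<in>X T b'. f x)"
    unfolding eq using finX sub by (simp add: sum_diff)
  have E2: "(\<Prod>i\<in>UNIV. p (insert j T) b i) = (\<Prod>i\<in>UNIV. p T b i) - (\<Prod>i\<in>UNIV. p T b' i)"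
  proof -
    have r: "(\<Prod>i\<in>UNIV. q i) = q j * (\<Prod>i\<in>-{j}. q i)" for q :: "'s \<Rightarrow> 'a"
      by (subst prod.remove[of UNIV j]) (auto simp: Compl_eq_Diff_UNIV)
    have "(\<Prod>i\<in>-{j}. p (insert j T) b i) = (\<Prod>i\<in>-{j}. p T b i)" "(\<Prod>i\<in>-{j}. p T b' i) = (\<Prod>i\<in>-{j}. p T b i)"
      by (rule prod.cong, simp, simp add: p_def b'_def)+
    then show ?thesis unfolding r using insert.hyps bj by (simp add: p_def b'_def left_diff_distrib)
  qed
  have "(\<Sum>x\<in>X (insert j T) b. f x) - c * (\<Prod>i\<in>UNIV. p (insert j T) b i)
     = ((\<Sum>x\<in>X T b. f x) - c * (\<Prod>i\<in>UNIV. p T b i)) - ((\<Sum>x\<in>X T b'. f x) - c * (\<Prod>i\<in>UNIV. p T b' i))"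
    unfolding E1 E2 by (simp add: algebra_simps)
  also have "norm \<dots> \<le> norm ((\<Sum>x\<in>X T b. f x) - c * (\<Prod>i\<in>UNIV. p T b i)) + norm ((\<Sum>x\<in>X T b'. f x) - c * (\<Prod>i\<in>UNIV. p T b' i))"
    by (rule norm_triangle_ineq4)
  also have "\<dots> \<le> 2 ^ card T * e + 2 ^ card T * e"
    unfolding p_def using insert.prems insert.hyps by (intro add_mono insert.IH) (auto simp: b'_def)
  finally show ?case using insert.hyps by (simp add: p_def mult_ac)
qed

section \<open>The logarithmic grid and the growth measure\<close>

lemma finite_vec_box: "finite {x :: nat ^ 's. \<forall>i. x $ i \<le> m i}"
proof -
  have "{x :: nat ^ 's. \<forall>i. x $ i \<le> m i} \<subseteq> (\<lambda>g. \<chi> i. g i) ` PiE UNIV (\<lambda>i. {..m i})"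
  proof
    fix x :: "nat ^ 's" assume "x \<in> {x. \<forall>i. x $ i \<le> m i}"
    then have "(\<lambda>i. x $ i) \<in> PiE UNIV (\<lambda>i. {..m i})" by auto
    then have "(\<chi> i. x $ i) \<in> (\<lambda>g. \<chi> i. g i) ` PiE UNIV (\<lambda>i. {..m i})" by (rule imageI)
    then show "x \<in> (\<lambda>g. \<chi> i. g i) ` PiE UNIV (\<lambda>i. {..m i})" by simp
  qed
  moreover have "finite (PiE (UNIV :: 's set) (\<lambda>i. {..m i}))" by (intro finite_PiE) auto
  ultimately show ?thesis by (meson finite_imageI finite_subset)
qed

lemma finite_real_box: "finite {x :: nat ^ 's. \<forall>i. 1 \<le> x $ i \<and> real (x $ i) \<le> B i}"
proof (rule finite_subset[OF _ finite_vec_box[of "\<lambda>i. nat \<lfloor>B i\<rfloor>"]], intro subsetI CollectI allI)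
  fix x :: "nat ^ 's" and i assume "x \<in> {x. \<forall>i. 1 \<le> x $ i \<and> real (x $ i) \<le> B i}"
  then have "real (x $ i) \<le> B i" by auto
  then show "x $ i \<le> nat \<lfloor>B i\<rfloor>" by (simp add: le_nat_floor)
qed

lemma ln_le_iff_le_exp: "1 \<le> n \<Longrightarrow> ln (real n) \<le> b \<longleftrightarrow> real n \<le> exp b"
  by (metis exp_ln exp_le_cancel_iff of_nat_0_less_iff less_le_trans zero_less_one)

definition log_vec :: "nat ^ 's \<Rightarrow> real ^ 's" where
  "log_vec x = (\<chi> j. ln (real (x $ j)))"

text \<open>\<open>nat\<close> sends the value -1 arising from \<open>u $ j = 0\<close> to 0, so
  points on a coordinate hyperplane fall into the adjacent cells.\<close>

definition cell_index :: "real \<Rightarrow> real ^ 's \<Rightarrow> nat ^ 's" where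
  "cell_index h u = (\<chi> j. nat (\<lceil>u $ j / h\<rceil> - 1))"

definition corner :: "real \<Rightarrow> nat ^ 's \<Rightarrow> real ^ 's" where
  "corner h n = (\<chi> j. real (n $ j) * h)"

text \<open>Cells are half-open to the left, as box sums run over closed boxes; the cells along the
  coordinate hyperplanes are closed.\<close>

definition cell :: "real \<Rightarrow> nat ^ 's \<Rightarrow> (real ^ 's) set" where
  "cell h n = {u. (\<forall>j. 0 \<le> u $ j) \<and> cell_index h u = n}"

definition point_cell :: "real \<Rightarrow> nat ^ 's \<Rightarrow> (nat ^ 's) set" where
  "point_cell h n = {x. (\<forall>j. 1 \<le> x $ j) \<and> cell_index h (log_vec x) = n}"

lemma nat_ceiling_eq_iff:
  fixes h u :: real
  assumes "h > 0" "u \<ge> 0"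
  shows "nat (\<lceil>u / h\<rceil> - 1) = m \<longleftrightarrow> (m = 0 \<or> real m * h < u) \<and> u \<le> real m * h + h"
proof -
  have "u / h \<le> 1 \<longleftrightarrow> u \<le> h" using assms by (simp add: field_simps)
  moreover have "real m < u / h \<longleftrightarrow> real m * h < u" "u / h \<le> real m + 1 \<longleftrightarrow> u \<le> real m * h + h"
    using assms by (simp_all add: field_simps)
  moreover have "nat (\<lceil>u / h\<rceil> - 1) = m \<longleftrightarrow> (m = 0 \<and> u / h \<le> 1) \<or> (real m < u / h \<and> u / h \<le> real m + 1)"
    using divide_nonneg_pos[OF assms(2,1)] by linarith
  ultimately show ?thesis by auto
qed

lemma cell_iff:
  assumes "h > 0"
  shows "u \<in> cell h n \<longleftrightarrow> (\<forall>j. 0 \<le> u $ j \<and> (n $ j = 0 \<or> corner h n $ j < u $ j) \<and> u $ j \<le> corner h n $ j + h)"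
  unfolding cell_def cell_index_def corner_def
  using nat_ceiling_eq_iff[OF assms] by (auto simp: vec_eq_iff)

lemma cell_bounds:
  assumes "h > 0" "u \<in> cell h n"
  shows "corner h n $ j \<le> u $ j" "u $ j \<le> corner h n $ j + h" "0 \<le> u $ j"
  using assms(2) unfolding cell_iff[OF assms(1)] by (auto simp: corner_def less_imp_le dest: spec[of _ j])

lemma corner_nonneg: "h > 0 \<Longrightarrow> 0 \<le> corner h n $ j"
  by (simp add: corner_def)

lemma cell_borel: "h > 0 \<Longrightarrow> cell h n \<in> sets borel"
proof -
  assume h: "h > 0"
  have "cell h n = (\<Inter>j\<in>UNIV. {u. 0 \<le> u $ j \<and> (n $ j = 0 \<or> corner h n $ j < u $ j) \<and> u $ j \<le> corner h n $ j + h})"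
    using cell_iff[OF h] by auto
  also have "\<dots> \<in> sets borel" by (intro sets.finite_INT) auto
  finally show ?thesis .
qed

text \<open>The cell is squeezed between an open and a closed box of equal volume.\<close>

lemma emeasure_cell:
  assumes h: "h > 0"
  shows "emeasure lborel (cell h (n :: nat ^ 's)) = ennreal (h ^ CARD('s))"
proof -
  define w :: "real ^ 's" where "w = (\<chi> j. corner h n $ j + h)"
  have Basis: "(w - corner h n) \<bullet> b = h" "corner h n \<bullet> b \<le> w \<bullet> b" if "b \<in> Basis" for b
  proof -
    obtain i where "b = axis i 1" using \<open>b \<in> Basis\<close> by (auto simp: Basis_vec_def)
    then show "(w - corner h n) \<bullet> b = h" "corner h n \<bullet> b \<le> w \<bullet> b"
      using h by (auto simp: w_def inner_axis)
  qed
  have "box (corner h n) w \<subseteq> cell h n"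
  proof
    fix u assume u: "u \<in> box (corner h n) w"
    then have "corner h n $ j < u $ j" "u $ j < corner h n $ j + h" for j by (auto simp: mem_box_cart w_def)
    moreover have "0 \<le> corner h n $ j" for j using h by (simp add: corner_def)
    ultimately show "u \<in> cell h n" unfolding cell_iff[OF h] by (meson less_imp_le order_trans)
  qed
  then have "emeasure lborel (box (corner h n) w) \<le> emeasure lborel (cell h n)"
    using cell_borel[OF h] by (intro emeasure_mono) auto
  moreover have "cell h n \<subseteq> cbox (corner h n) w"
    using cell_bounds[OF h] by (auto simp: mem_box_cart w_def)
  then have "emeasure lborel (cell h n) \<le> emeasure lborel (cbox (corner h n) w)"
    by (intro emeasure_mono) auto
  moreover have "emeasure lborel (box (corner h n) w) = ennreal (h ^ CARD('s))"
    "emeasure lborel (cbox (corner h n) w) = ennreal (h ^ CARD('s))"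
    using Basis by (simp_all add: emeasure_lborel_box emeasure_lborel_cbox)
  ultimately show ?thesis by simp
qed

text \<open>Turns the main term into a measure, so that cells, shells and slices are handled by
  additivity and monotonicity.\<close>

definition growth_measure :: "real ^ 's \<Rightarrow> real ^ 's \<Rightarrow> (real ^ 's) measure" where
  "growth_measure \<alpha> \<l> = density lborel (\<lambda>u. ennreal (log_growth \<alpha> \<l> u))"

lemma sets_growth_measure [measurable_cong, simp]: "sets (growth_measure \<alpha> \<l>) = sets borel"
  by (simp add: growth_measure_def)

lemma emeasure_growth_measure:
  assumes "S \<in> sets borel"
  shows "emeasure (growth_measure \<alpha> \<l>) S = (\<integral>\<^sup>+u\<in>S. ennreal (log_growth \<alpha> \<l> u) \<partial>lborel)"
  unfolding growth_measure_def log_growth_def using assms by (intro emeasure_density) auto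

lemma measure_cell_bounds:
  assumes h: "h > 0" and ab: "0 \<le> a" "\<And>u. u \<in> cell h n \<Longrightarrow> a \<le> log_growth \<alpha> \<l> u" "\<And>u. u \<in> cell h n \<Longrightarrow> log_growth \<alpha> \<l> u \<le> b"
    and "0 \<le> b"
  shows "emeasure (growth_measure \<alpha> \<l>) (cell h n) < \<infinity>"
    "a * h ^ CARD('s) \<le> measure (growth_measure \<alpha> \<l>) (cell h (n :: nat ^ 's))"
    "measure (growth_measure \<alpha> \<l>) (cell h n) \<le> b * h ^ CARD('s)"
proof -
  let ?\<mu> = "growth_measure \<alpha> \<l>"
  note em = emeasure_growth_measure[OF cell_borel[OF h]]
  have "ennreal a * emeasure lborel (cell h n) = (\<integral>\<^sup>+u. ennreal a * indicator (cell h n) u \<partial>lborel)"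
    using cell_borel[OF h] by (intro nn_integral_cmult_indicator[symmetric]) auto
  also have "\<dots> \<le> emeasure ?\<mu> (cell h n)"
    unfolding em using ab by (intro nn_integral_mono) (auto split: split_indicator intro!: ennreal_leI)
  finally have lo: "ennreal (a * h ^ CARD('s)) \<le> emeasure ?\<mu> (cell h n)"
    using h ab(1) by (simp add: emeasure_cell ennreal_mult)
  have "emeasure ?\<mu> (cell h n) \<le> (\<integral>\<^sup>+u. ennreal b * indicator (cell h n) u \<partial>lborel)"
    unfolding em using ab by (intro nn_integral_mono) (auto split: split_indicator intro!: ennreal_leI)
  also have "\<dots> = ennreal b * emeasure lborel (cell h n)"
    using cell_borel[OF h] by (intro nn_integral_cmult_indicator) auto
  finally have hi: "emeasure ?\<mu> (cell h n) \<le> ennreal (b * h ^ CARD('s))"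
    using h \<open>0 \<le> b\<close> by (simp add: emeasure_cell ennreal_mult)
  then show fin: "emeasure ?\<mu> (cell h n) < \<infinity>" by (rule le_less_trans) simp
  then have eq: "emeasure ?\<mu> (cell h n) = ennreal (measure ?\<mu> (cell h n))" by (simp add: emeasure_eq_ennreal_measure)
  show "a * h ^ CARD('s) \<le> measure ?\<mu> (cell h n)" using lo unfolding eq by simp
  show "measure ?\<mu> (cell h n) \<le> b * h ^ CARD('s)" using hi \<open>0 \<le> b\<close> h unfolding eq by simp
qed

lemma growth_exp: "growth \<alpha> \<l> (\<chi> i. exp (b i)) = log_growth \<alpha> \<l> (\<chi> i. b i)"
  by (simp add: growth_def log_growth_def exp_powr_real mult.commute)

lemma min_log_exp_ge:
  fixes b :: "'s::finite \<Rightarrow> real"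
  shows "(\<And>i. M \<le> b i) \<Longrightarrow> M \<le> min_log (\<chi> i. exp (b i))"
  by (simp add: min_log_def)

lemma min_log_factor_le:
  fixes b :: "'s::finite \<Rightarrow> real"
  assumes "0 \<le> M" "\<And>i. M \<le> b i" "0 \<le> \<delta>"
  shows "(1 + min_log (\<chi> i. exp (b i))) powr (- \<delta>) \<le> (1 + M) powr (- \<delta>)"
  using min_log_exp_ge[of M b] assms by (intro powr_mono2') auto

text \<open>The per-cell form of the two hypotheses on \<open>f\<close>; \<open>M\<close> is any lower bound for the logarithms of
  the corner of the cell.\<close>

definition cell_asymptotic ::
  "real ^ 's \<Rightarrow> real ^ 's \<Rightarrow> real \<Rightarrow> real \<Rightarrow> (nat ^ 's \<Rightarrow> complex) \<Rightarrow> complex \<Rightarrow> real \<Rightarrow> bool" where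
  "cell_asymptotic \<alpha> \<l> \<delta> K f c C \<longleftrightarrow> (\<forall>h n M. 0 < h \<longrightarrow> h \<le> 1 \<longrightarrow> 0 \<le> M \<longrightarrow> (\<forall>j. 1 \<le> n $ j) \<longrightarrow>
     (\<forall>j. M \<le> corner h n $ j) \<longrightarrow>
     norm ((\<Sum>x\<in>point_cell h n. f x) - c * of_real (\<Prod>j\<in>UNIV. log_growth1 (\<alpha> $ j) (\<l> $ j) (corner h n $ j + h)
        - log_growth1 (\<alpha> $ j) (\<l> $ j) (corner h n $ j)))
       \<le> K * (C * (1 + M) powr (- \<delta>) * log_growth \<alpha> \<l> (corner h n)))"

definition cell_upper_bound ::
  "real ^ 's \<Rightarrow> real ^ 's \<Rightarrow> real \<Rightarrow> real \<Rightarrow> real \<Rightarrow> (nat ^ 's \<Rightarrow> complex) \<Rightarrow> real \<Rightarrow> bool" where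
  "cell_upper_bound \<alpha> \<l> \<delta> A K f C \<longleftrightarrow> (\<forall>h n M. 0 < h \<longrightarrow> h \<le> ln 2 \<longrightarrow> 0 \<le> M \<longrightarrow>
     (\<forall>j. M \<le> corner h n $ j) \<longrightarrow>
     (\<Sum>x\<in>point_cell h n. norm (f x))
       \<le> K * (C * (h ^ CARD('s) + h powr (- A) * (1 + M) powr (- \<delta>)) * log_growth \<alpha> \<l> (corner h n)))"

lemma point_cell_iff:
  assumes h: "h > 0"
  shows "x \<in> point_cell h n \<longleftrightarrow> (\<forall>j. 1 \<le> x $ j \<and> (n $ j = 0 \<or> corner h n $ j < ln (real (x $ j)))
     \<and> ln (real (x $ j)) \<le> corner h n $ j + h)"
proof -
  have "x \<in> point_cell h n \<longleftrightarrow> (\<forall>j. 1 \<le> x $ j) \<and> log_vec x \<in> cell h n"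
    by (auto simp: point_cell_def cell_def log_vec_def)
  also have "\<dots> \<longleftrightarrow> (\<forall>j. 1 \<le> x $ j \<and> (n $ j = 0 \<or> corner h n $ j < ln (real (x $ j)))
     \<and> ln (real (x $ j)) \<le> corner h n $ j + h)"
    unfolding cell_iff[OF h] by (auto simp: log_vec_def)
  finally show ?thesis .
qed

lemma finite_point_cell: "h > 0 \<Longrightarrow> finite (point_cell h n)"
proof (rule finite_subset[OF _ finite_real_box[of "\<lambda>j. exp (corner h n $ j + h)"]])
  assume h: "h > 0"
  show "point_cell h n \<subseteq> {x. \<forall>i. 1 \<le> x $ i \<and> real (x $ i) \<le> exp (corner h n $ i + h)}"
  proof (intro subsetI CollectI allI)
    fix x i assume "x \<in> point_cell h n"
    then have "1 \<le> x $ i" "ln (real (x $ i)) \<le> corner h n $ i + h" unfolding point_cell_iff[OF h] by auto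
    then show "1 \<le> x $ i \<and> real (x $ i) \<le> exp (corner h n $ i + h)" using ln_le_iff_le_exp by blast
  qed
qed

section \<open>The hypotheses on \<open>f\<close>, cell by cell\<close>

lemma box_asymptotic_exp:
  fixes \<alpha> \<l> :: "real ^ 's" and b :: "'s \<Rightarrow> real"
  assumes box: "box_asymptotic \<alpha> \<l> \<delta> K\<^sub>1 f c C" and \<delta>: "0 \<le> \<delta>" and M: "0 \<le> M" "\<And>i. M \<le> b i"
  shows "norm ((\<Sum>x | \<forall>i. 1 \<le> x $ i \<and> ln (real (x $ i)) \<le> b i. f x) - c * of_real (log_growth \<alpha> \<l> (\<chi> i. b i)))
     \<le> \<bar>K\<^sub>1\<bar> * (C * (1 + M) powr (- \<delta>) * log_growth \<alpha> \<l> (\<chi> i. b i))"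
proof -
  have b0: "0 \<le> b i" for i using M(1) M(2)[of i] by linarith
  have C: "0 \<le> C" using box norm_ge_zero[of c] unfolding box_asymptotic_def by linarith
  define B :: "real ^ 's" where "B = (\<chi> i. exp (b i))"
  have "\<forall>i. 1 \<le> B $ i" using b0 by (simp add: B_def)
  then have "norm ((\<Sum>x | \<forall>i. 1 \<le> x $ i \<and> real (x $ i) \<le> B $ i. f x) - c * of_real (growth \<alpha> \<l> B))
         \<le> K\<^sub>1 * (C * (1 + min_log B) powr (- \<delta>) * growth \<alpha> \<l> B)"
    using box unfolding box_asymptotic_def by blast
  also have "{x. \<forall>i. 1 \<le> x $ i \<and> real (x $ i) \<le> B $ i} = {x. \<forall>i. 1 \<le> x $ i \<and> ln (real (x $ i)) \<le> b i}"
    using ln_le_iff_le_exp by (auto simp: B_def)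
  also have "growth \<alpha> \<l> B = log_growth \<alpha> \<l> (\<chi> i. b i)" unfolding B_def by (rule growth_exp)
  also have "K\<^sub>1 * (C * (1 + min_log B) powr (- \<delta>) * log_growth \<alpha> \<l> (\<chi> i. b i))
     \<le> \<bar>K\<^sub>1\<bar> * (C * (1 + M) powr (- \<delta>) * log_growth \<alpha> \<l> (\<chi> i. b i))"
    using C min_log_factor_le[OF M(1) M(2) \<delta>] log_growth_pos[of "\<chi> i. b i" \<alpha> \<l>] b0 unfolding B_def
    by (intro mult_mono mult_left_mono mult_right_mono) (auto intro!: mult_nonneg_nonneg)
  finally show ?thesis .
qed

text \<open>With all indices at least 1 the cell is half-open in every direction, hence an exact
  mixed difference of boxes. The errors at its corners are comparable to the one at the lower
  corner.\<close>

lemma cell_asymptoticI: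
  fixes \<alpha> \<l> :: "real ^ 's"
  assumes \<alpha>: "\<And>j. \<alpha> $ j > 0" and \<delta>: "0 \<le> \<delta>"
  obtains R where "R \<ge> 0"
    "\<And>K\<^sub>1 f c C. box_asymptotic \<alpha> \<l> \<delta> K\<^sub>1 f c C \<Longrightarrow> cell_asymptotic \<alpha> \<l> \<delta> (\<bar>K\<^sub>1\<bar> * R) f c C"
proof -
  obtain R where R: "R \<ge> 1"
    "\<And>h v u. 0 \<le> h \<Longrightarrow> h \<le> 1 \<Longrightarrow> (\<And>j. 0 \<le> v $ j) \<Longrightarrow> (\<And>j. v $ j \<le> u $ j) \<Longrightarrow> (\<And>j. u $ j \<le> v $ j + h) \<Longrightarrow>
      log_growth \<alpha> \<l> u \<le> R * log_growth \<alpha> \<l> v"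
    by (rule log_growth_local_bounds[of \<alpha> \<l>, OF \<alpha>]) blast
  show ?thesis
  proof (rule that[of "2 ^ CARD('s) * R"])
    show "2 ^ CARD('s) * R \<ge> 0" using R by simp
    fix K\<^sub>1 f c C assume box: "box_asymptotic \<alpha> \<l> \<delta> K\<^sub>1 f c C"
    have C: "0 \<le> C" using box norm_ge_zero[of c] unfolding box_asymptotic_def by linarith
    show "cell_asymptotic \<alpha> \<l> \<delta> (\<bar>K\<^sub>1\<bar> * (2 ^ CARD('s) * R)) f c C"
      unfolding cell_asymptotic_def
    proof (intro allI impI)
      fix h M :: real and n :: "nat ^ 's"
      assume h: "0 < h" "h \<le> 1" and M: "0 \<le> M" and n: "\<forall>j. 1 \<le> n $ j" and Mn: "\<forall>j. M \<le> corner h n $ j"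
      define lo where "lo i = corner h n $ i" for i
      define hi where "hi i = lo i + h" for i
      define g where "g i v = complex_of_real (log_growth1 (\<alpha> $ i) (\<l> $ i) v)" for i v
      define e where "e = \<bar>K\<^sub>1\<bar> * (C * (1 + M) powr (- \<delta>) * (R * log_growth \<alpha> \<l> (corner h n)))"
      have cn: "0 \<le> corner h n $ j" for j using corner_nonneg[OF h(1)] .
      have bound: "norm ((\<Sum>x | \<forall>i. 1 \<le> x $ i \<and> ln (real (x $ i)) \<le> b i \<and> (i \<in> {} \<longrightarrow> lo i < ln (real (x $ i))). f x)
          - c * (\<Prod>i\<in>UNIV. g i (b i))) \<le> e" if b: "\<And>i. b i = lo i \<or> b i = hi i" for b
      proof -
        have b': "lo i \<le> b i" "b i \<le> lo i + h" for i using b[of i] h by (auto simp: hi_def)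
        have Mb: "M \<le> b i" for i using b'(1)[of i] Mn by (auto simp: lo_def intro: order_trans)
        have "log_growth \<alpha> \<l> (\<chi> i. b i) \<le> R * log_growth \<alpha> \<l> (corner h n)"
          using b' h cn by (intro R(2)[of h]) (auto simp: lo_def)
        then have "\<bar>K\<^sub>1\<bar> * (C * (1 + M) powr (- \<delta>) * log_growth \<alpha> \<l> (\<chi> i. b i)) \<le> e"
          unfolding e_def using C by (intro mult_left_mono) auto
        moreover have "complex_of_real (log_growth \<alpha> \<l> (\<chi> i. b i)) = (\<Prod>i\<in>UNIV. g i (b i))"
          by (simp add: log_growth_eq_prod g_def)
        ultimately show ?thesis using box_asymptotic_exp[of \<alpha> \<l> \<delta> K\<^sub>1 f c C M b, OF box \<delta> M Mb] by simp
      qed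
      have fin: "finite {x :: nat ^ 's. \<forall>i. 1 \<le> x $ i \<and> ln (real (x $ i)) \<le> b i \<and> (i \<in> {} \<longrightarrow> lo i < ln (real (x $ i)))}" for b
        by (rule finite_subset[OF _ finite_real_box[of "\<lambda>i. exp (b i)"]]) (use ln_le_iff_le_exp in auto)
      have "norm ((\<Sum>x | \<forall>i. 1 \<le> x $ i \<and> ln (real (x $ i)) \<le> hi i \<and> (i \<in> UNIV \<longrightarrow> lo i < ln (real (x $ i))). f x)
        - c * (\<Prod>i\<in>UNIV. if i \<in> (UNIV :: 's set) then g i (hi i) - g i (lo i) else g i (hi i))) \<le> 2 ^ card (UNIV :: 's set) * e"
        by (rule box_mixed_difference[OF _ bound fin]) (use h in \<open>auto simp: hi_def\<close>)
      moreover have "{x. \<forall>i. 1 \<le> x $ i \<and> ln (real (x $ i)) \<le> hi i \<and> (i \<in> UNIV \<longrightarrow> lo i < ln (real (x $ i)))} = point_cell h n"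
      proof (intro set_eqI)
        fix x
        have n0: "n $ j = 0 \<longleftrightarrow> False" for j using n by (metis not_one_le_zero)
        show "x \<in> {x. \<forall>i. 1 \<le> x $ i \<and> ln (real (x $ i)) \<le> hi i \<and> (i \<in> UNIV \<longrightarrow> lo i < ln (real (x $ i)))} \<longleftrightarrow> x \<in> point_cell h n"
          unfolding point_cell_iff[OF h(1)] n0 lo_def hi_def by auto
      qed
      ultimately show "norm ((\<Sum>x\<in>point_cell h n. f x) - c * of_real (\<Prod>j\<in>UNIV. log_growth1 (\<alpha> $ j) (\<l> $ j) (corner h n $ j + h)
        - log_growth1 (\<alpha> $ j) (\<l> $ j) (corner h n $ j)))
       \<le> \<bar>K\<^sub>1\<bar> * (2 ^ CARD('s) * R) * (C * (1 + M) powr (- \<delta>) * log_growth \<alpha> \<l> (corner h n))"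
        by (simp add: g_def lo_def hi_def e_def mult_ac)
    qed
  qed
qed

text \<open>A cell of mesh \<open>h\<close> lies in the box from \<open>B\<close> to
  \<open>\<theta> * B\<close> with \<theta> = \<open>exp h\<close>; \<open>h \<le> ln 2\<close> is
  the restriction \<theta> \<le> 2.\<close>

lemma cell_upper_boundI:
  fixes \<alpha> \<l> :: "real ^ 's"
  assumes ub: "box_upper_bound \<alpha> \<l> \<delta> A K\<^sub>2 f C" and \<delta>: "0 \<le> \<delta>" and C: "0 \<le> C"
  shows "cell_upper_bound \<alpha> \<l> \<delta> A \<bar>K\<^sub>2\<bar> f C"
  unfolding cell_upper_bound_def
proof (intro allI impI)
  fix h M :: real and n :: "nat ^ 's"
  assume h: "0 < h" "h \<le> ln 2" and M: "0 \<le> M" and Mn: "\<forall>j. M \<le> corner h n $ j"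
  define B :: "real ^ 's" where "B = (\<chi> i. exp (corner h n $ i))"
  have cn: "0 \<le> corner h n $ j" for j using corner_nonneg[OF h(1)] .
  have \<theta>: "1 < exp h" "exp h \<le> 2" using h by (simp_all add: ln_ge_iff)
  have B1: "\<forall>i. 1 \<le> B $ i" using cn by (simp add: B_def)
  have fin: "finite {x. \<forall>i. 1 \<le> x $ i \<and> B $ i \<le> real (x $ i) \<and> real (x $ i) \<le> exp h * B $ i}"
    by (rule finite_subset[OF _ finite_real_box[of "\<lambda>i. exp h * B $ i"]]) auto
  have "(\<Sum>x\<in>point_cell h n. norm (f x))
    \<le> (\<Sum>x | \<forall>i. 1 \<le> x $ i \<and> B $ i \<le> real (x $ i) \<and> real (x $ i) \<le> exp h * B $ i. norm (f x))"
  proof (rule sum_mono2[OF fin])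
    show "point_cell h n \<subseteq> {x. \<forall>i. 1 \<le> x $ i \<and> B $ i \<le> real (x $ i) \<and> real (x $ i) \<le> exp h * B $ i}"
    proof (intro subsetI CollectI allI)
      fix x i assume x: "x \<in> point_cell h n"
      then have x1: "1 \<le> x $ i" and xn: "n $ i = 0 \<or> corner h n $ i < ln (real (x $ i))"
        and xh: "ln (real (x $ i)) \<le> corner h n $ i + h"
        unfolding point_cell_iff[OF h(1)] by auto
      have "real (x $ i) \<le> exp (corner h n $ i + h)" using xh ln_le_iff_le_exp[OF x1] by simp
      then have "real (x $ i) \<le> exp h * B $ i" by (simp add: B_def exp_add mult.commute)
      moreover have "B $ i \<le> real (x $ i)"
        using xn
      proof
        assume "n $ i = 0"
        then show ?thesis using x1 by (simp add: B_def corner_def)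
      next
        assume "corner h n $ i < ln (real (x $ i))"
        then have "exp (corner h n $ i) < exp (ln (real (x $ i)))" by simp
        also have "\<dots> = real (x $ i)" using x1 by simp
        finally show ?thesis by (simp add: B_def)
      qed
      ultimately show "1 \<le> x $ i \<and> B $ i \<le> real (x $ i) \<and> real (x $ i) \<le> exp h * B $ i" using x1 by simp
    qed
  qed simp
  also have "\<dots> \<le> K\<^sub>2 * (C * (ln (exp h) ^ CARD('s) + ln (exp h) powr (- A) * (1 + min_log B) powr (- \<delta>)) * growth \<alpha> \<l> B)"
    using ub \<theta> B1 unfolding box_upper_bound_def by blast
  also have "growth \<alpha> \<l> B = log_growth \<alpha> \<l> (corner h n)"
    unfolding B_def growth_exp by simp
  also have "K\<^sub>2 * (C * (ln (exp h) ^ CARD('s) + ln (exp h) powr (- A) * (1 + min_log B) powr (- \<delta>)) * log_growth \<alpha> \<l> (corner h n))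
     \<le> \<bar>K\<^sub>2\<bar> * (C * (h ^ CARD('s) + h powr (- A) * (1 + M) powr (- \<delta>)) * log_growth \<alpha> \<l> (corner h n))"
  proof -
    have "(1 + min_log B) powr (- \<delta>) \<le> (1 + M) powr (- \<delta>)"
      unfolding B_def using Mn by (intro min_log_factor_le M \<delta>) auto
    then have le: "C * (h ^ CARD('s) + h powr (- A) * (1 + min_log B) powr (- \<delta>)) * log_growth \<alpha> \<l> (corner h n)
      \<le> C * (h ^ CARD('s) + h powr (- A) * (1 + M) powr (- \<delta>)) * log_growth \<alpha> \<l> (corner h n)"
      using C log_growth_pos[OF cn, of \<alpha> \<l>] by (intro mult_right_mono mult_left_mono add_left_mono) auto
    show ?thesis
      unfolding ln_exp
    proof (rule mult_mono[OF abs_ge_self le abs_ge_zero])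
      show "0 \<le> C * (h ^ CARD('s) + h powr (- A) * (1 + min_log B) powr (- \<delta>)) * log_growth \<alpha> \<l> (corner h n)"
        using C h log_growth_pos[OF cn, of \<alpha> \<l>] by (intro mult_nonneg_nonneg add_nonneg_nonneg) auto
    qed
  qed
  finally show "(\<Sum>x\<in>point_cell h n. norm (f x))
       \<le> \<bar>K\<^sub>2\<bar> * (C * (h ^ CARD('s) + h powr (- A) * (1 + M) powr (- \<delta>)) * log_growth \<alpha> \<l> (corner h n))" .
qed

lemma sum_norm_real_nonneg:
  assumes "real_nonneg f" "\<And>x. x \<in> S \<Longrightarrow> \<forall>i. 1 \<le> x $ i"
  shows "(\<Sum>x\<in>S. norm (f x)) = norm (\<Sum>x\<in>S. f x)"
proof -
  have fx: "f x = complex_of_real (norm (f x))" if "x \<in> S" for x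
  proof -
    have "f x \<in> \<real>" "0 \<le> Re (f x)" using assms that unfolding real_nonneg_def by blast+
    then show ?thesis by (auto elim!: Reals_cases)
  qed
  have "(\<Sum>x\<in>S. f x) = complex_of_real (\<Sum>x\<in>S. norm (f x))"
    unfolding of_real_sum using fx by (intro sum.cong) auto
  then have "norm (\<Sum>x\<in>S. f x) = \<bar>\<Sum>x\<in>S. norm (f x)\<bar>" by (simp only: norm_of_real)
  then show ?thesis by (simp add: sum_nonneg)
qed

text \<open>For nonnegative values the sum of norms is the norm of the sum, so the cell asymptotic
  bounds it; its error is weakened by \<open>h powr (- A) \<ge> 1\<close>. A cell touching a
  coordinate hyperplane forces \<open>M = 0\<close>, so the required bound contains no decay and the
  sum over the whole box up to the upper corner is small enough.\<close>

lemma cell_upper_bound_nonneg: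
  fixes \<alpha> \<l> :: "real ^ 's"
  assumes \<alpha>: "\<And>j. \<alpha> $ j > 0" and \<delta>: "0 \<le> \<delta>" and A: "0 \<le> A"
  obtains R where "R \<ge> 0"
    "\<And>K\<^sub>1 f c C. box_asymptotic \<alpha> \<l> \<delta> K\<^sub>1 f c C \<Longrightarrow> real_nonneg f \<Longrightarrow>
       cell_upper_bound \<alpha> \<l> \<delta> A ((1 + \<bar>K\<^sub>1\<bar>) * R) f C"
proof -
  obtain R1 where R1: "R1 \<ge> 0"
    "\<And>K\<^sub>1 f c C. box_asymptotic \<alpha> \<l> \<delta> K\<^sub>1 f c C \<Longrightarrow> cell_asymptotic \<alpha> \<l> \<delta> (\<bar>K\<^sub>1\<bar> * R1) f c C"
    by (rule cell_asymptoticI[of \<alpha> \<delta> \<l>, OF \<alpha> \<delta>]) blast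
  obtain R2 where R2: "R2 \<ge> 1"
    "\<And>h v u. 0 \<le> h \<Longrightarrow> h \<le> 1 \<Longrightarrow> (\<And>j. 0 \<le> v $ j) \<Longrightarrow> (\<And>j. v $ j \<le> u $ j) \<Longrightarrow> (\<And>j. u $ j \<le> v $ j + h) \<Longrightarrow>
      log_growth \<alpha> \<l> u \<le> R2 * log_growth \<alpha> \<l> v"
    "\<And>h v M. 0 < h \<Longrightarrow> h \<le> 1 \<Longrightarrow> 0 \<le> M \<Longrightarrow> (\<And>j. M \<le> v $ j) \<Longrightarrow>
      \<bar>(\<Prod>j\<in>UNIV. log_growth1 (\<alpha> $ j) (\<l> $ j) (v $ j + h) - log_growth1 (\<alpha> $ j) (\<l> $ j) (v $ j))
        - (\<Prod>j\<in>UNIV. \<alpha> $ j) * h ^ CARD('s) * log_growth \<alpha> \<l> v\<bar>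
      \<le> R2 * (h + 1 / (1 + M)) * (h ^ CARD('s) * log_growth \<alpha> \<l> v)"
    by (rule log_growth_local_bounds[of \<alpha> \<l>, OF \<alpha>]) blast
  define a where "a = (\<Prod>j\<in>UNIV. \<alpha> $ j)"
  have a: "a > 0" unfolding a_def using \<alpha> by (intro prod_pos) auto
  define R where "R = R1 + 2 * R2 + a"
  have R: "R \<ge> 0" "R1 \<le> R" "R2 \<le> R" "a + 2 * R2 \<le> R" using R1 R2(1) a by (auto simp: R_def)
  show ?thesis
  proof (rule that[OF R(1)])
    fix K\<^sub>1 f c C assume box: "box_asymptotic \<alpha> \<l> \<delta> K\<^sub>1 f c C" and nn: "real_nonneg f"
    have cC: "norm c \<le> C" using box by (simp add: box_asymptotic_def)
    then have C: "0 \<le> C" using norm_ge_zero[of c] by linarith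
    show "cell_upper_bound \<alpha> \<l> \<delta> A ((1 + \<bar>K\<^sub>1\<bar>) * R) f C"
      unfolding cell_upper_bound_def
    proof (intro allI impI)
      fix h M :: real and n :: "nat ^ 's"
      assume h: "0 < h" "h \<le> ln 2" and M: "0 \<le> M" and Mn: "\<forall>j. M \<le> corner h n $ j"
      have h1: "h \<le> 1" using h(2) ln_2_less_1 by linarith
      have cn: "0 \<le> corner h n $ j" for j using corner_nonneg[OF h(1)] .
      define G where "G = log_growth \<alpha> \<l> (corner h n)"
      have G: "G > 0" unfolding G_def using log_growth_pos[OF cn] .
      define m where "m = (1 + M) powr (- \<delta>)"
      have m: "0 \<le> m" by (simp add: m_def)
      have hA: "1 \<le> h powr (- A)"
      proof -
        have "h powr 0 \<le> h powr (- A)" using h h1 A by (intro powr_mono') auto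
        then show ?thesis using h by simp
      qed
      have "(\<Sum>x\<in>point_cell h n. norm (f x)) \<le> (1 + \<bar>K\<^sub>1\<bar>) * R * (C * (h ^ CARD('s) + h powr (- A) * m) * G)"
      proof (cases "\<forall>j. 1 \<le> n $ j")
        case True
        define \<Delta> where "\<Delta> = (\<Prod>j\<in>UNIV. log_growth1 (\<alpha> $ j) (\<l> $ j) (corner h n $ j + h)
          - log_growth1 (\<alpha> $ j) (\<l> $ j) (corner h n $ j))"
        have "norm ((\<Sum>x\<in>point_cell h n. f x) - c * of_real \<Delta>) \<le> \<bar>K\<^sub>1\<bar> * R1 * (C * m * G)"
          using R1(2)[OF box] h h1 M True Mn unfolding cell_asymptotic_def \<Delta>_def m_def G_def by blast
        moreover have "\<bar>\<Delta>\<bar> \<le> (a + 2 * R2) * (h ^ CARD('s) * G)"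
        proof -
          \<comment> \<open>The estimate is used with lower bound 0 for the corner: for an upper
            bound a bounded relative error is enough.\<close>
          have "\<bar>\<Delta> - a * h ^ CARD('s) * G\<bar> \<le> R2 * (h + 1 / (1 + 0)) * (h ^ CARD('s) * G)"
            unfolding \<Delta>_def a_def G_def using h h1 cn by (intro R2(3)) auto
          also have "\<dots> \<le> R2 * 2 * (h ^ CARD('s) * G)"
            using h1 h G R2(1) by (intro mult_right_mono mult_left_mono) auto
          finally have "\<bar>\<Delta>\<bar> \<le> R2 * 2 * (h ^ CARD('s) * G) + \<bar>a * h ^ CARD('s) * G\<bar>" by linarith
          also have "\<bar>a * h ^ CARD('s) * G\<bar> = a * (h ^ CARD('s) * G)" using a h G by (simp add: abs_mult)
          finally show ?thesis by (simp add: algebra_simps)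
        qed
        then have "norm (c * of_real \<Delta>) \<le> C * ((a + 2 * R2) * (h ^ CARD('s) * G))"
          unfolding norm_mult norm_of_real using cC C by (intro mult_mono) auto
        ultimately have "norm (\<Sum>x\<in>point_cell h n. f x) \<le> C * ((a + 2 * R2) * (h ^ CARD('s) * G)) + \<bar>K\<^sub>1\<bar> * R1 * (C * m * G)"
          using norm_triangle_sub[of "\<Sum>x\<in>point_cell h n. f x" "c * of_real \<Delta>"] by linarith
        also have "\<dots> \<le> C * (((1 + \<bar>K\<^sub>1\<bar>) * R) * (h ^ CARD('s) * G)) + (1 + \<bar>K\<^sub>1\<bar>) * R * (C * (h powr (- A) * m) * G)"
        proof (rule add_mono)
          have "a + 2 * R2 \<le> (1 + \<bar>K\<^sub>1\<bar>) * R" using R(1,4) by (simp add: distrib_right add_increasing2)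
          then show "C * ((a + 2 * R2) * (h ^ CARD('s) * G)) \<le> C * (((1 + \<bar>K\<^sub>1\<bar>) * R) * (h ^ CARD('s) * G))"
            using C G h by (intro mult_left_mono mult_right_mono) auto
          have "1 * m \<le> h powr (- A) * m" using hA m by (intro mult_right_mono) auto
          then show "\<bar>K\<^sub>1\<bar> * R1 * (C * m * G) \<le> (1 + \<bar>K\<^sub>1\<bar>) * R * (C * (h powr (- A) * m) * G)"
            using R R1(1) C G m by (intro mult_mono mult_left_mono) auto
        qed
        also have "\<dots> = (1 + \<bar>K\<^sub>1\<bar>) * R * (C * (h ^ CARD('s) + h powr (- A) * m) * G)" by (simp add: algebra_simps)
        finally show ?thesis
          using sum_norm_real_nonneg[OF nn, of "point_cell h n"] unfolding point_cell_iff[OF h(1)] by simp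
      next
        case False
        then obtain j where "n $ j = 0" by (metis not_less_eq_eq le_0_eq One_nat_def)
        then have "M = 0" using Mn[rule_format, of j] M by (simp add: corner_def)
        then have m1: "m = 1" by (simp add: m_def)
        define b where "b i = corner h n $ i + h" for i
        define S where "S = {x :: nat ^ 's. \<forall>i. 1 \<le> x $ i \<and> ln (real (x $ i)) \<le> b i}"
        have finS: "finite S" unfolding S_def
          by (rule finite_subset[OF _ finite_real_box[of "\<lambda>i. exp (b i)"]]) (use ln_le_iff_le_exp in auto)
        define G' where "G' = log_growth \<alpha> \<l> (\<chi> i. b i)"
        have b0: "0 \<le> b i" for i using cn[of i] h by (simp add: b_def)
        have G': "0 < G'" "G' \<le> R2 * G"
          unfolding G'_def G_def using b0 h h1 cn by (auto intro!: log_growth_pos R2(2)[of h] simp: b_def)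
        have "(\<Sum>x\<in>point_cell h n. norm (f x)) \<le> (\<Sum>x\<in>S. norm (f x))"
          by (rule sum_mono2[OF finS]) (auto simp: S_def b_def point_cell_iff[OF h(1)])
        also have "\<dots> = norm (\<Sum>x\<in>S. f x)" by (rule sum_norm_real_nonneg[OF nn]) (auto simp: S_def)
        also have "\<dots> \<le> norm (c * of_real G') + \<bar>K\<^sub>1\<bar> * (C * 1 * G')"
        proof -
          have "norm ((\<Sum>x\<in>S. f x) - c * of_real G') \<le> \<bar>K\<^sub>1\<bar> * (C * (1 + 0) powr (- \<delta>) * G')"
            unfolding S_def G'_def using b0 by (intro box_asymptotic_exp[OF box \<delta>]) auto
          then show ?thesis using norm_triangle_sub[of "\<Sum>x\<in>S. f x" "c * of_real G'"] by simp
        qed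
        also have "\<dots> \<le> C * G' + \<bar>K\<^sub>1\<bar> * (C * 1 * G')"
          using cC G' by (intro add_right_mono) (auto simp: norm_mult intro!: mult_right_mono)
        also have "\<dots> = (1 + \<bar>K\<^sub>1\<bar>) * (C * G')" by (simp add: algebra_simps)
        also have "\<dots> \<le> (1 + \<bar>K\<^sub>1\<bar>) * (C * (R * G))"
        proof -
          have "G' \<le> R * G" using G'(2) mult_right_mono[OF R(3), of G] G by linarith
          then show ?thesis using C by (intro mult_left_mono) auto
        qed
        also have "\<dots> = (1 + \<bar>K\<^sub>1\<bar>) * R * (C * 1 * G)" by simp
        also have "\<dots> \<le> (1 + \<bar>K\<^sub>1\<bar>) * R * (C * (h ^ CARD('s) + h powr (- A) * m) * G)"
        proof -
          have "1 \<le> h ^ CARD('s) + h powr (- A) * m" using hA m1 h by (simp add: add_increasing)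
          then show ?thesis using R(1) C G by (intro mult_left_mono mult_right_mono) auto
        qed
        finally show ?thesis .
      qed
      then show "(\<Sum>x\<in>point_cell h n. norm (f x))
        \<le> (1 + \<bar>K\<^sub>1\<bar>) * R * (C * (h ^ CARD('s) + h powr (- A) * (1 + M) powr (- \<delta>)) * log_growth \<alpha> \<l> (corner h n))"
        by (simp add: m_def G_def)
    qed
  qed
qed

section \<open>Comparison of sum and integral over the region\<close>

lemma log_region_mono: "L \<le> L' \<Longrightarrow> log_region k \<omega> L \<subseteq> log_region k \<omega> L'"
  by (auto simp: log_region_def intro: order_trans)

text \<open>Nonnegative coefficients make the region a down-set. Hence the upper corner of a cell
  decides whether the cell lies inside, and a cell meeting the region has its lower corner
  there.\<close>

lemma log_region_downward:
  assumes \<omega>: "\<And>i j. i \<in> {1..k} \<Longrightarrow> 0 \<le> \<omega> i $ j" and u: "u \<in> log_region k \<omega> L"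
    and v: "\<And>j. 0 \<le> v $ j" "\<And>j. v $ j \<le> u $ j"
  shows "v \<in> log_region k \<omega> L"
  unfolding log_region_def
proof (intro CollectI conjI allI ballI v(1))
  fix i assume i: "i \<in> {1..k}"
  have "(\<Sum>j\<in>UNIV. \<omega> i $ j * v $ j) \<le> (\<Sum>j\<in>UNIV. \<omega> i $ j * u $ j)"
    using \<omega>[OF i] v by (intro sum_mono mult_left_mono) auto
  also have "\<dots> \<le> L" using u i by (auto simp: log_region_def)
  finally show "(\<Sum>j\<in>UNIV. \<omega> i $ j * v $ j) \<le> L" .
qed

lemma bounded_log_region:
  fixes \<alpha> :: "real ^ 's"
  assumes \<alpha>: "\<And>j. \<alpha> $ j > 0" and bdd: "bounded (exponent_polytope k \<alpha> \<omega>)" and L: "L > 0"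
  obtains b where "\<And>u j. u \<in> log_region k \<omega> L \<Longrightarrow> u $ j \<le> b j"
proof -
  obtain B where B: "\<And>t. t \<in> exponent_polytope k \<alpha> \<omega> \<Longrightarrow> norm t \<le> B" using bdd bounded_iff by blast
  show ?thesis
  proof (rule that[of "\<lambda>j. L * B / \<alpha> $ j"])
    fix u j assume u: "u \<in> log_region k \<omega> L"
    define t where "t = (\<chi> j. \<alpha> $ j * u $ j / L)"
    have "t \<in> exponent_polytope k \<alpha> \<omega>"
      unfolding exponent_polytope_def
    proof (intro CollectI conjI allI ballI)
      fix j show "0 \<le> t $ j" using u \<alpha>[of j] L by (simp add: t_def log_region_def)
    next
      fix i assume i: "i \<in> {1..k}"
      have "(\<Sum>j\<in>UNIV. \<omega> i $ j / \<alpha> $ j * t $ j) = (\<Sum>j\<in>UNIV. \<omega> i $ j * u $ j) / L"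
        unfolding sum_divide_distrib using \<alpha>[THEN less_imp_neq] by (intro sum.cong) (auto simp: t_def)
      also have "\<dots> \<le> 1" using u i L by (auto simp: log_region_def)
      finally show "(\<Sum>j\<in>UNIV. \<omega> i $ j / \<alpha> $ j * t $ j) \<le> 1" .
    qed
    then have "t $ j \<le> B" using B[of t] component_le_norm_cart[of t j] by linarith
    then show "u $ j \<le> L * B / \<alpha> $ j" using \<alpha>[of j] L by (simp add: t_def field_simps)
  qed
qed

text \<open>The three error terms belong to the interior cells, to the shell in which a constraint
  may be crossed, and to the cells with a corner coordinate below \<open>M\<close>. Expressing a
  cell bound through the measure of the cell, which is of order \<open>h ^ CARD('s)\<close> times
  the growth, produces the negative powers of \<open>h\<close>.\<close>

theorem log_cell_discretization:
  fixes \<alpha> \<l> :: "real ^ 's"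
  assumes \<alpha>: "\<And>j. \<alpha> $ j > 0" and \<omega>: "\<And>i j. i \<in> {1..k} \<Longrightarrow> 0 \<le> \<omega> i $ j"
    and bdd: "bounded (exponent_polytope k \<alpha> \<omega>)" and \<delta>: "0 \<le> \<delta>" and A: "0 \<le> A"
    and fin: "\<And>L. L \<ge> 1 \<Longrightarrow> emeasure (growth_measure \<alpha> \<l>) (log_region k \<omega> L) < \<infinity>"
  obtains \<kappa> R where "\<kappa> \<ge> 1" "R \<ge> 0"
    "\<And>K f c C h M L. 0 \<le> K \<Longrightarrow> norm c \<le> C \<Longrightarrow> cell_asymptotic \<alpha> \<l> \<delta> K f c C \<Longrightarrow> cell_upper_bound \<alpha> \<l> \<delta> A K f C \<Longrightarrow>
      0 < h \<Longrightarrow> h \<le> ln 2 \<Longrightarrow> 1 \<le> M \<Longrightarrow> 1 \<le> L - \<kappa> * h \<Longrightarrow>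
      norm ((\<Sum>x | (\<forall>j. 1 \<le> x $ j) \<and> log_vec x \<in> log_region k \<omega> L. f x)
          - c * of_real ((\<Prod>j\<in>UNIV. \<alpha> $ j) * measure (growth_measure \<alpha> \<l>) (log_region k \<omega> L)))
      \<le> (1 + K) * R * C *
        ((h + 1 / M + h powr (- real CARD('s)) * M powr (- \<delta>)) * measure (growth_measure \<alpha> \<l>) (log_region k \<omega> L)
        + (1 + h powr (- A - real CARD('s)) * M powr (- \<delta>)) *
          (measure (growth_measure \<alpha> \<l>) (log_region k \<omega> (L + \<kappa> * h)) - measure (growth_measure \<alpha> \<l>) (log_region k \<omega> (L - \<kappa> * h)))
        + h powr (- A - real CARD('s)) *
          (\<Sum>j\<in>UNIV. measure (growth_measure \<alpha> \<l>) (log_region k \<omega> (L + \<kappa> * h) \<inter> {u. u $ j \<le> M + 1})))"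
proof -
  obtain R0 where R0: "R0 \<ge> 1"
    "\<And>h v u. 0 \<le> h \<Longrightarrow> h \<le> 1 \<Longrightarrow> (\<And>j. 0 \<le> v $ j) \<Longrightarrow> (\<And>j. v $ j \<le> u $ j) \<Longrightarrow> (\<And>j. u $ j \<le> v $ j + h) \<Longrightarrow>
      log_growth \<alpha> \<l> u \<le> R0 * log_growth \<alpha> \<l> v \<and> log_growth \<alpha> \<l> v \<le> R0 * log_growth \<alpha> \<l> u \<and>
      \<bar>log_growth \<alpha> \<l> u - log_growth \<alpha> \<l> v\<bar> \<le> R0 * h * log_growth \<alpha> \<l> v"
    "\<And>h v M. 0 < h \<Longrightarrow> h \<le> 1 \<Longrightarrow> 0 \<le> M \<Longrightarrow> (\<And>j. M \<le> v $ j) \<Longrightarrow>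
      \<bar>(\<Prod>j\<in>UNIV. log_growth1 (\<alpha> $ j) (\<l> $ j) (v $ j + h) - log_growth1 (\<alpha> $ j) (\<l> $ j) (v $ j))
        - (\<Prod>j\<in>UNIV. \<alpha> $ j) * h ^ CARD('s) * log_growth \<alpha> \<l> v\<bar>
      \<le> R0 * (h + 1 / (1 + M)) * (h ^ CARD('s) * log_growth \<alpha> \<l> v)"
    by (rule log_growth_local_bounds[of \<alpha> \<l>, OF \<alpha>]) blast
  \<comment> \<open>Moving by at most \<open>h\<close> in each coordinate changes a constraint by at
    most \<open>\<kappa> * h\<close>; the added 1 ensures \<kappa> \<ge> 1.\<close>
  define \<kappa> where "\<kappa> = 1 + (\<Sum>i\<in>{1..k}. \<Sum>j\<in>UNIV. \<omega> i $ j)"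
  have \<omega>_sum: "(\<Sum>j\<in>UNIV. \<omega> i $ j) \<le> \<kappa> - 1" if "i \<in> {1..k}" for i
    unfolding \<kappa>_def using that \<omega> by (auto intro!: member_le_sum sum_nonneg)
  have \<kappa>: "\<kappa> \<ge> 1" unfolding \<kappa>_def using \<omega> by (auto intro!: sum_nonneg)
  define p where "p = (\<Prod>j\<in>UNIV. \<alpha> $ j)"
  have p: "p > 0" unfolding p_def using \<alpha> by (intro prod_pos) auto
  define R where "R = (1 + R0 + p * R0) * R0 + p + 2 * R0"
  have R: "R \<ge> 0" "R \<ge> (1 + R0 + p * R0) * R0" "R \<ge> p + 2 * R0" using R0(1) p by (auto simp: R_def)
  let ?\<mu> = "measure (growth_measure \<alpha> \<l>)" and ?D = "log_region k \<omega>"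
  show ?thesis
  proof (rule that[OF \<kappa> R(1)])
    fix K :: real and f :: "nat ^ 's \<Rightarrow> complex" and c :: complex and C h M L :: real
    assume K: "0 \<le> K" and cC: "norm c \<le> C" and E1: "cell_asymptotic \<alpha> \<l> \<delta> K f c C"
      and E2: "cell_upper_bound \<alpha> \<l> \<delta> A K f C" and h: "0 < h" "h \<le> ln 2" and M: "1 \<le> M" and L: "1 \<le> L - \<kappa> * h"
    have C: "0 \<le> C" using cC norm_ge_zero[of c] by linarith
    have h1: "h \<le> 1" using h(2) ln_2_less_1 by linarith
    have \<kappa>h: "\<kappa> * h > 0" using \<kappa> h by simp
    have L1: "1 \<le> L" "1 \<le> L + \<kappa> * h" using L \<kappa>h by linarith+
    define s where "s = CARD('s)"
    define v where "v n = corner h n" for n :: "nat ^ 's"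
    define G where "G n = log_growth \<alpha> \<l> (v n)" for n
    have v0: "0 \<le> v n $ j" for n j unfolding v_def by (rule corner_nonneg[OF h(1)])
    have G0: "G n > 0" for n unfolding G_def by (rule log_growth_pos[OF v0])
    define w where "w n = ?\<mu> (cell h n)" for n
    have w_fin: "emeasure (growth_measure \<alpha> \<l>) (cell h n) < \<infinity>"
      and w_lo: "h ^ s * G n \<le> R0 * w n" and w_diff: "\<bar>h ^ s * G n - w n\<bar> \<le> R0 * h * (h ^ s * G n)" for n
    proof -
      have b: "log_growth \<alpha> \<l> u \<le> R0 * G n \<and> G n \<le> R0 * log_growth \<alpha> \<l> u \<and> \<bar>log_growth \<alpha> \<l> u - G n\<bar> \<le> R0 * h * G n"
        if "u \<in> cell h n" for u
        unfolding G_def v_def using cell_bounds[OF h(1) that] h h1 corner_nonneg[OF h(1)] by (intro R0(2)) auto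
      have R00: "R0 > 0" using R0(1) by simp
      have 1: "G n / R0 \<le> log_growth \<alpha> \<l> u" "log_growth \<alpha> \<l> u \<le> (1 + R0 * h) * G n" "(1 - R0 * h) * G n \<le> log_growth \<alpha> \<l> u"
        if "u \<in> cell h n" for u
        using b[OF that] R00 by (simp_all add: divide_le_eq algebra_simps abs_le_iff)
      have 2: "0 \<le> G n / R0" "0 \<le> (1 + R0 * h) * G n" using G0[of n] R00 h by auto
      show "emeasure (growth_measure \<alpha> \<l>) (cell h n) < \<infinity>"
        by (rule measure_cell_bounds(1)[OF h(1) 2(1) 1(1,2) 2(2)])
      have "G n / R0 * h ^ s \<le> w n" unfolding w_def s_def
        by (rule measure_cell_bounds(2)[OF h(1) 2(1) 1(1,2) 2(2)])
      then show "h ^ s * G n \<le> R0 * w n" using R00 by (simp add: field_simps)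
      have hi: "w n \<le> (1 + R0 * h) * G n * h ^ s" unfolding w_def s_def
        by (rule measure_cell_bounds(3)[OF h(1) 2(1) 1(1,2) 2(2)])
      \<comment> \<open>\<open>R0 * h\<close> may exceed 1; the lower bound is then negative and
        holds trivially.\<close>
      have lo: "(1 - R0 * h) * G n * h ^ s \<le> w n"
      proof (cases "0 \<le> (1 - R0 * h) * G n")
        case True
        show ?thesis unfolding w_def s_def
          by (rule measure_cell_bounds(2)[OF h(1) True 1(3,2) 2(2)])
      next
        case False
        then have "(1 - R0 * h) * G n * h ^ s \<le> 0" using h by (simp add: mult_nonpos_nonneg)
        then show ?thesis unfolding w_def using measure_nonneg[of "growth_measure \<alpha> \<l>" "cell h n"] by linarith
      qed
      show "\<bar>h ^ s * G n - w n\<bar> \<le> R0 * h * (h ^ s * G n)" using hi lo by (simp add: abs_le_iff algebra_simps)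
    qed
    have w0: "0 \<le> w n" for n by (simp add: w_def)
    define U where "U N = (\<Union>n\<in>N. cell h n)" for N :: "(nat ^ 's) set"
    have U_borel: "finite N \<Longrightarrow> U N \<in> sets borel" for N
      unfolding U_def using cell_borel[OF h(1)] by (intro sets.finite_UN) auto
    have U_measure: "?\<mu> (U N) = (\<Sum>n\<in>N. w n)" if "finite N" for N
      unfolding U_def w_def
    proof (rule measure_finite_Union[OF that])
      show "cell h ` N \<subseteq> sets (growth_measure \<alpha> \<l>)" using cell_borel[OF h(1)] by auto
      show "disjoint_family_on (cell h) N" by (auto simp: disjoint_family_on_def cell_def)
      show "emeasure (growth_measure \<alpha> \<l>) (cell h n) \<noteq> \<infinity>" for n using w_fin[of n] by simp
    qed
    have D_borel: "?D L' \<in> sets borel" for L' by (rule borel_closed[OF closed_log_region])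
    have D_fm: "S \<in> fmeasurable (growth_measure \<alpha> \<l>)" if "S \<subseteq> ?D L'" "S \<in> sets borel" "1 \<le> L'" for S L'
    proof (rule fmeasurableI)
      have "emeasure (growth_measure \<alpha> \<l>) S \<le> emeasure (growth_measure \<alpha> \<l>) (?D L')"
        using that D_borel by (intro emeasure_mono) auto
      then show "emeasure (growth_measure \<alpha> \<l>) S < \<infinity>" using fin[OF that(3)] by (rule le_less_trans)
    qed (use that in auto)
    have mono: "?\<mu> S \<le> ?\<mu> S'" if "S \<subseteq> S'" "S \<in> sets borel" "S' \<in> sets borel" "S' \<subseteq> ?D L'" "1 \<le> L'" for S S' L'
      using that D_fm[OF that(4,3,5)] by (intro measure_mono_fmeasurable) auto
    \<comment> \<open>Contains the index of every cell meeting the region, because the region is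
      downward closed.\<close>
    define Nm where "Nm = {n. v n \<in> ?D L}"
    have finN: "finite Nm"
    proof -
      obtain b where b: "\<And>u j. u \<in> ?D L \<Longrightarrow> u $ j \<le> b j"
        by (rule bounded_log_region[OF \<alpha> bdd, of L]) (use L1 in auto)
      have "Nm \<subseteq> {n. \<forall>j. n $ j \<le> nat \<lfloor>b j / h\<rfloor>}"
      proof (intro subsetI CollectI allI)
        fix n j assume "n \<in> Nm"
        then have "real (n $ j) * h \<le> b j" using b[of "v n" j] by (simp add: Nm_def v_def corner_def)
        then have "real (n $ j) \<le> b j / h" using h by (simp add: field_simps)
        then show "n $ j \<le> nat \<lfloor>b j / h\<rfloor>" by (simp add: le_nat_floor)
      qed
      then show ?thesis by (rule finite_subset[OF _ finite_vec_box])
    qed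
    \<comment> \<open>With its upper corner in the region the whole cell is inside. What remains
      after also removing \<open>Ns\<close> are cells that may cross a constraint but stay at
      distance \<open>M\<close> from the hyperplanes.\<close>
    define Nin where "Nin = {n \<in> Nm. (\<forall>j. M \<le> v n $ j) \<and> (\<chi> j. v n $ j + h) \<in> ?D L}"
    define Ns where "Ns = {n \<in> Nm. \<exists>j. v n $ j < M}"
    define Nb where "Nb = Nm - Nin - Ns"
    have "Ns \<subseteq> Nm - Nin" unfolding Ns_def Nin_def by (auto simp flip: not_less)
    then have Nsplit: "Nm - Nin = Nb \<union> Ns" "Nb \<inter> Ns = {}" unfolding Nb_def by blast+
    have fins: "finite Nin" "finite Ns" "finite Nb" using finN by (auto simp: Nin_def Ns_def Nb_def)
    have Nb_M: "M \<le> v n $ j" if "n \<in> Nb" for n j using that by (auto simp: Nb_def Ns_def not_less)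
    have \<omega>h: "(\<Sum>j\<in>UNIV. \<omega> i $ j * (u $ j + h)) \<le> (\<Sum>j\<in>UNIV. \<omega> i $ j * u $ j) + \<kappa> * h" if "i \<in> {1..k}" for i and u :: "real ^ 's"
    proof -
      have "(\<Sum>j\<in>UNIV. \<omega> i $ j * (u $ j + h)) = (\<Sum>j\<in>UNIV. \<omega> i $ j * u $ j) + (\<Sum>j\<in>UNIV. \<omega> i $ j) * h"
        by (simp add: distrib_left sum.distrib sum_distrib_right)
      also have "(\<Sum>j\<in>UNIV. \<omega> i $ j) * h \<le> \<kappa> * h" using \<omega>_sum[OF that] h by (intro mult_right_mono) auto
      finally show ?thesis by simp
    qed
    have cell_sub: "u \<in> ?D (L + \<kappa> * h)" if u: "u \<in> cell h n" and n: "n \<in> Nm" for u n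
      unfolding log_region_def
    proof (intro CollectI conjI allI ballI)
      show "0 \<le> u $ j" for j using cell_bounds(3)[OF h(1) u] .
      fix i assume i: "i \<in> {1..k}"
      have "(\<Sum>j\<in>UNIV. \<omega> i $ j * u $ j) \<le> (\<Sum>j\<in>UNIV. \<omega> i $ j * (v n $ j + h))"
        using cell_bounds(2)[OF h(1) u] \<omega>[OF i] by (intro sum_mono mult_left_mono) (auto simp: v_def)
      also have "\<dots> \<le> (\<Sum>j\<in>UNIV. \<omega> i $ j * v n $ j) + \<kappa> * h" by (rule \<omega>h[OF i])
      also have "\<dots> \<le> L + \<kappa> * h" using n i by (auto simp: Nm_def log_region_def)
      finally show "(\<Sum>j\<in>UNIV. \<omega> i $ j * u $ j) \<le> L + \<kappa> * h" .
    qed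
    have U_in: "U Nin \<subseteq> ?D L"
    proof
      fix u assume "u \<in> U Nin"
      then obtain n where n: "n \<in> Nin" "u \<in> cell h n" by (auto simp: U_def)
      have "(\<chi> j. v n $ j + h) \<in> ?D L" using n by (simp add: Nin_def)
      from log_region_downward[OF \<omega> this, of u] show "u \<in> ?D L"
        using cell_bounds[OF h(1) n(2)] by (simp add: v_def)
    qed
    have index_Nm: "cell_index h u \<in> Nm" if "u \<in> ?D L" for u
    proof -
      have u: "u \<in> cell h (cell_index h u)" using that by (simp add: cell_def log_region_def)
      show ?thesis
        unfolding Nm_def using log_region_downward[OF \<omega> that v0] cell_bounds(1)[OF h(1) u] by (auto simp: v_def)
    qed
    have D_cover: "?D L \<subseteq> U Nin \<union> (U Nb \<union> U Ns)"
    proof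
      fix u assume u: "u \<in> ?D L"
      have "u \<in> cell h (cell_index h u)" using u by (simp add: cell_def log_region_def)
      then show "u \<in> U Nin \<union> (U Nb \<union> U Ns)" using index_Nm[OF u] Nsplit(1) by (auto simp: U_def)
    qed
    have Ub: "U Nb \<subseteq> ?D (L + \<kappa> * h) - ?D (L - \<kappa> * h)"
    proof
      fix u assume "u \<in> U Nb"
      then obtain n where n: "n \<in> Nb" "u \<in> cell h n" by (auto simp: U_def)
      have nm: "n \<in> Nm" using n(1) by (simp add: Nb_def)
      have "(\<chi> j. v n $ j + h) \<notin> ?D L" using n(1) nm Nb_M[OF n(1)] by (auto simp: Nb_def Nin_def)
      moreover have "0 \<le> v n $ j + h" for j using v0[of n j] h by simp
      ultimately obtain i where i: "i \<in> {1..k}" "L < (\<Sum>j\<in>UNIV. \<omega> i $ j * (v n $ j + h))"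
        by (auto simp: log_region_def not_le)
      have "(\<Sum>j\<in>UNIV. \<omega> i $ j * v n $ j) \<le> (\<Sum>j\<in>UNIV. \<omega> i $ j * u $ j)"
        using cell_bounds(1)[OF h(1) n(2)] \<omega>[OF i(1)] by (intro sum_mono mult_left_mono) (auto simp: v_def)
      then have "L - \<kappa> * h < (\<Sum>j\<in>UNIV. \<omega> i $ j * u $ j)" using i(2) \<omega>h[OF i(1), of "v n"] by linarith
      then have "u \<notin> ?D (L - \<kappa> * h)" using i(1) by (auto simp: log_region_def not_le)
      then show "u \<in> ?D (L + \<kappa> * h) - ?D (L - \<kappa> * h)" using cell_sub[OF n(2) nm] by simp
    qed
    have Us: "U Ns \<subseteq> (\<Union>j\<in>UNIV. ?D (L + \<kappa> * h) \<inter> {u. u $ j \<le> M + 1})"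
    proof
      fix u assume "u \<in> U Ns"
      then obtain n j where n: "n \<in> Nm" "v n $ j < M" "u \<in> cell h n" by (auto simp: U_def Ns_def)
      have "u $ j \<le> M + 1" using cell_bounds(2)[OF h(1) n(3), of j] n(2) h1 by (simp add: v_def)
      then show "u \<in> (\<Union>j\<in>UNIV. ?D (L + \<kappa> * h) \<inter> {u. u $ j \<le> M + 1})" using cell_sub[OF n(3,1)] by auto
    qed
    define mb where "mb = ?\<mu> (?D (L + \<kappa> * h)) - ?\<mu> (?D (L - \<kappa> * h))"
    define ms where "ms = (\<Sum>j\<in>UNIV. ?\<mu> (?D (L + \<kappa> * h) \<inter> {u. u $ j \<le> M + 1}))"
    have Ub_le: "?\<mu> (U Nb) \<le> mb"
    proof -
      have sub: "?D (L - \<kappa> * h) \<subseteq> ?D (L + \<kappa> * h)" using \<kappa>h by (intro log_region_mono) simp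
      have "?\<mu> (U Nb) \<le> ?\<mu> (?D (L + \<kappa> * h) - ?D (L - \<kappa> * h))"
        using Ub fins D_borel L1 by (intro mono[where L' = "L + \<kappa> * h"] U_borel) auto
      also have "\<dots> = mb" unfolding mb_def
        using fin[OF L1(2)] D_borel sub by (intro measure_Diff) auto
      finally show ?thesis .
    qed
    have Us_le: "?\<mu> (U Ns) \<le> ms"
    proof -
      have cl: "?D (L + \<kappa> * h) \<inter> {u. u $ j \<le> M + 1} \<in> sets borel" for j
        by (intro borel_closed closed_Int closed_log_region closed_Collect_le continuous_intros)
      have "?\<mu> (U Ns) \<le> ?\<mu> (\<Union>j\<in>UNIV. ?D (L + \<kappa> * h) \<inter> {u. u $ j \<le> M + 1})"
        using Us fins L1 cl by (intro mono[where L' = "L + \<kappa> * h"] U_borel sets.finite_UN) auto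
      also have "\<dots> \<le> ms" unfolding ms_def
        using cl L1 by (intro measure_UNION_le) (auto)
      finally show ?thesis .
    qed
    define X where "X = {x :: nat ^ 's. (\<forall>j. 1 \<le> x $ j) \<and> log_vec x \<in> ?D L}"
    define ix where "ix x = cell_index h (log_vec x)" for x :: "nat ^ 's"
    have X_ix: "ix ` X \<subseteq> Nm" using index_Nm by (auto simp: X_def ix_def)
    have finX: "finite X"
    proof (rule finite_subset)
      show "X \<subseteq> (\<Union>n\<in>Nm. point_cell h n)" using X_ix by (auto simp: X_def ix_def point_cell_def)
      show "finite (\<Union>n\<in>Nm. point_cell h n)" using finN finite_point_cell[OF h(1)] by auto
    qed
    define S where "S n = (\<Sum>x\<in>{x \<in> X. ix x = n}. f x)" for n
    have S_total: "(\<Sum>x\<in>X. f x) = (\<Sum>n\<in>Nin. S n) + ((\<Sum>n\<in>Nb. S n) + (\<Sum>n\<in>Ns. S n))"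
    proof -
      have "(\<Sum>x\<in>X. f x) = (\<Sum>n\<in>Nm. S n)" unfolding S_def by (rule sum.group[OF finX finN X_ix, symmetric])
      also have "\<dots> = (\<Sum>n\<in>Nin. S n) + (\<Sum>n\<in>Nm - Nin. S n)"
        using finN by (subst sum.subset_diff[of Nin Nm]) (auto simp: Nin_def)
      also have "(\<Sum>n\<in>Nm - Nin. S n) = (\<Sum>n\<in>Nb. S n) + (\<Sum>n\<in>Ns. S n)"
        unfolding Nsplit(1) using fins Nsplit(2) by (intro sum.union_disjoint) auto
      finally show ?thesis .
    qed
    have S_norm: "norm (S n) \<le> (\<Sum>x\<in>point_cell h n. norm (f x))" for n
    proof -
      have "norm (S n) \<le> (\<Sum>x\<in>{x \<in> X. ix x = n}. norm (f x))" unfolding S_def by (rule norm_sum)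
      also have "\<dots> \<le> (\<Sum>x\<in>point_cell h n. norm (f x))"
        by (rule sum_mono2[OF finite_point_cell[OF h(1)]]) (auto simp: X_def ix_def point_cell_def)
      finally show ?thesis .
    qed
    \<comment> \<open>\<open>h powr (- A)\<close> measured in units of the cell volume
      \<open>h ^ s\<close>.\<close>
    define q where "q = h powr (- A - real s)"
    define m where "m = M powr (- \<delta>)"
    have m0: "0 \<le> m" "m \<le> 1"
    proof -
      have "M powr (- \<delta>) \<le> M powr 0" using M \<delta> by (intro powr_mono) auto
      then show "m \<le> 1" using M by (simp add: m_def)
    qed (simp add: m_def)
    have hA: "h powr (- A) = q * h ^ s" using h by (simp add: q_def powr_realpow[symmetric] flip: powr_add)
    have q1: "1 \<le> q"
    proof -
      have "h powr 0 \<le> h powr (- A - real s)" using h h1 A by (intro powr_mono') auto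
      then show ?thesis using h by (simp add: q_def)
    qed
    have mM: "(1 + M') powr (- \<delta>) \<le> m" if "M' = M" for M'
      unfolding m_def that using M \<delta> by (intro powr_mono2') auto
    have Nb_bound: "norm (S n) \<le> K * C * R0 * (1 + q * m) * w n" if n: "n \<in> Nb" for n
    proof -
      have "norm (S n) \<le> K * (C * (h ^ s + h powr (- A) * (1 + M) powr (- \<delta>)) * G n)"
        using S_norm[of n] E2 h M Nb_M[OF n] unfolding cell_upper_bound_def G_def v_def s_def
        by (meson order_trans zero_le_one)
      also have "\<dots> \<le> K * (C * (h ^ s + h powr (- A) * m) * G n)"
        using K C G0[of n] mM[of M] by (intro mult_left_mono mult_right_mono add_left_mono) auto
      also have "\<dots> = K * C * (1 + q * m) * (h ^ s * G n)" by (simp add: hA algebra_simps)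
      also have "\<dots> \<le> K * C * (1 + q * m) * (R0 * w n)"
        using K C q1 m0 by (intro mult_left_mono w_lo) auto
      finally show ?thesis by (simp add: mult_ac)
    qed
    \<comment> \<open>Close to a hyperplane the corner logarithms have no better lower bound than 0,
      so \<delta> gives no saving; smallness comes from the measure of the slices.\<close>
    have Ns_bound: "norm (S n) \<le> K * C * R0 * (2 * q) * w n" for n
    proof -
      have "norm (S n) \<le> K * (C * (h ^ s + h powr (- A) * (1 + 0) powr (- \<delta>)) * G n)"
        using S_norm[of n] E2 h v0[of n] unfolding cell_upper_bound_def G_def v_def s_def
        by (meson order_trans order_refl)
      also have "\<dots> = K * C * (1 + q) * (h ^ s * G n)" by (simp add: hA algebra_simps)
      also have "\<dots> \<le> K * C * (2 * q) * (R0 * w n)"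
        using K C q1 G0[of n] h by (intro mult_mono mult_left_mono w_lo) auto
      finally show ?thesis by (simp add: mult_ac)
    qed
    define \<eta> where "\<eta> = h + 1 / M + h powr (- real s) * m"
    have \<eta>0: "0 \<le> \<eta>" "h \<le> \<eta>" "1 / M \<le> \<eta>" "h powr (- real s) * m \<le> \<eta>" "h + 1 / M \<le> \<eta>"
      using h M m0 by (auto simp: \<eta>_def)
    have Nin_bound: "norm (S n - c * of_real (p * w n)) \<le> (1 + K) * C * ((1 + R0 + p * R0) * R0) * \<eta> * w n" if n: "n \<in> Nin" for n
    proof -
      have vM: "M \<le> v n $ j" for j using n by (simp add: Nin_def)
      have n1: "\<forall>j. 1 \<le> n $ j"
      proof
        fix j
        have "0 < v n $ j" using vM[of j] M by linarith
        then show "1 \<le> n $ j" by (cases "n $ j") (auto simp: v_def corner_def)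
      qed
      have S_eq: "S n = (\<Sum>x\<in>point_cell h n. f x)"
        unfolding S_def
      proof (intro sum.cong refl set_eqI iffI)
        fix x assume x: "x \<in> point_cell h n"
        then have "log_vec x \<in> cell h n" by (auto simp: point_cell_def cell_def log_vec_def)
        then have "log_vec x \<in> ?D L" using U_in n by (auto simp: U_def)
        then show "x \<in> {x \<in> X. ix x = n}" using x by (auto simp: X_def ix_def point_cell_def)
      qed (auto simp: X_def ix_def point_cell_def)
      define \<Delta> where "\<Delta> = (\<Prod>j\<in>UNIV. log_growth1 (\<alpha> $ j) (\<l> $ j) (corner h n $ j + h)
        - log_growth1 (\<alpha> $ j) (\<l> $ j) (corner h n $ j))"
      have e1: "norm (S n - c * of_real \<Delta>) \<le> K * C * (\<eta> * (h ^ s * G n))"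
      proof -
        have "norm (S n - c * of_real \<Delta>) \<le> K * (C * (1 + M) powr (- \<delta>) * G n)"
          using E1 h(1) h1 M n1 vM unfolding cell_asymptotic_def \<Delta>_def S_eq G_def v_def by auto
        also have "\<dots> \<le> K * (C * m * G n)"
          using K C G0[of n] mM[of M] by (intro mult_left_mono mult_right_mono) auto
        \<comment> \<open>The error in the cell asymptotic is not proportional to the volume;
          expressing it in units of \<open>h ^ s\<close> costs \<open>h powr (- s)\<close>.\<close>
        also have "m = (h powr (- real s) * m) * h ^ s"
          using h by (simp add: powr_minus powr_realpow)
        also have "K * (C * ((h powr (- real s) * m) * h ^ s) * G n) \<le> K * (C * (\<eta> * h ^ s) * G n)"
          using K C G0[of n] h \<eta>0 by (intro mult_left_mono mult_right_mono) auto
        finally show ?thesis by (simp add: mult_ac)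
      qed
      have e2: "\<bar>\<Delta> - p * w n\<bar> \<le> (R0 + p * R0) * (\<eta> * (h ^ s * G n))"
      proof -
        have "\<bar>\<Delta> - p * h ^ s * G n\<bar> \<le> R0 * (h + 1 / (1 + M)) * (h ^ s * G n)"
          unfolding \<Delta>_def p_def s_def G_def v_def using h(1) h1 M vM by (intro R0(3)) (auto simp: v_def)
        also have "\<dots> \<le> R0 * \<eta> * (h ^ s * G n)"
        proof -
          have "1 / (1 + M) \<le> 1 / M" using M by (intro divide_left_mono) auto
          then have "h + 1 / (1 + M) \<le> \<eta>" using \<eta>0(5) by linarith
          then show ?thesis using R0(1) G0[of n] h by (intro mult_right_mono mult_left_mono) auto
        qed
        finally have "\<bar>\<Delta> - p * (h ^ s * G n)\<bar> \<le> R0 * (\<eta> * (h ^ s * G n))" by (simp add: mult.assoc)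
        moreover have "\<bar>p * (h ^ s * G n) - p * w n\<bar> \<le> p * R0 * (\<eta> * (h ^ s * G n))"
        proof -
          have "\<bar>p * (h ^ s * G n) - p * w n\<bar> = p * \<bar>h ^ s * G n - w n\<bar>"
            using p by (simp add: abs_mult flip: right_diff_distrib)
          also have "\<dots> \<le> p * (R0 * h * (h ^ s * G n))" using p w_diff by (intro mult_left_mono) auto
          also have "\<dots> \<le> p * (R0 * \<eta> * (h ^ s * G n))"
            using p R0(1) \<eta>0 G0[of n] h by (intro mult_left_mono mult_right_mono) auto
          finally show ?thesis by (simp add: mult_ac)
        qed
        ultimately have "\<bar>\<Delta> - p * w n\<bar> \<le> R0 * (\<eta> * (h ^ s * G n)) + p * R0 * (\<eta> * (h ^ s * G n))" by linarith
        then show ?thesis by (simp add: distrib_right)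
      qed
      have "norm (S n - c * of_real (p * w n)) \<le> norm (S n - c * of_real \<Delta>) + norm (c * of_real (\<Delta> - p * w n))"
        using norm_triangle_ineq[of "S n - c * of_real \<Delta>" "c * of_real (\<Delta> - p * w n)"] by (simp add: algebra_simps)
      also have "norm (c * of_real (\<Delta> - p * w n)) \<le> C * ((R0 + p * R0) * (\<eta> * (h ^ s * G n)))"
        unfolding norm_mult norm_of_real using cC C e2 by (intro mult_mono) auto
      also have "norm (S n - c * of_real \<Delta>) + C * ((R0 + p * R0) * (\<eta> * (h ^ s * G n)))
        \<le> K * C * (\<eta> * (h ^ s * G n)) + C * ((R0 + p * R0) * (\<eta> * (h ^ s * G n)))" using e1 by simp
      also have "\<dots> = C * (K + (R0 + p * R0)) * \<eta> * (h ^ s * G n)" by (simp add: algebra_simps)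
      also have "\<dots> \<le> C * ((1 + K) * (1 + R0 + p * R0)) * \<eta> * (R0 * w n)"
      proof (rule mult_mono[OF _ w_lo])
        have "0 \<le> K * (R0 + p * R0)" using K R0(1) p by auto
        then have "K + (R0 + p * R0) \<le> (1 + K) * (1 + R0 + p * R0)" by (simp add: algebra_simps)
        then show "C * (K + (R0 + p * R0)) * \<eta> \<le> C * ((1 + K) * (1 + R0 + p * R0)) * \<eta>"
          using C \<eta>0 by (intro mult_right_mono mult_left_mono) auto
      qed (use C K R0(1) p \<eta>0 G0[of n] h in auto)
      finally show ?thesis by (simp add: mult_ac)
    qed
    have "norm ((\<Sum>x\<in>X. f x) - c * of_real (p * ?\<mu> (?D L)))
      \<le> norm (\<Sum>n\<in>Nin. S n - c * of_real (p * w n)) + (norm (\<Sum>n\<in>Nb. S n) + norm (\<Sum>n\<in>Ns. S n))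
        + norm (c * of_real (p * (?\<mu> (?D L) - ?\<mu> (U Nin))))"
    proof -
      have "(\<Sum>x\<in>X. f x) - c * of_real (p * ?\<mu> (?D L)) = (\<Sum>n\<in>Nin. S n - c * of_real (p * w n))
        + ((\<Sum>n\<in>Nb. S n) + (\<Sum>n\<in>Ns. S n)) - c * of_real (p * (?\<mu> (?D L) - ?\<mu> (U Nin)))"
        unfolding S_total U_measure[OF fins(1)]
        by (simp add: sum_subtractf sum_distrib_left algebra_simps)
      then show ?thesis
        using norm_triangle_ineq4[of "(\<Sum>n\<in>Nin. S n - c * of_real (p * w n)) + ((\<Sum>n\<in>Nb. S n) + (\<Sum>n\<in>Ns. S n))" "c * of_real (p * (?\<mu> (?D L) - ?\<mu> (U Nin)))"]
          norm_triangle_ineq[of "\<Sum>n\<in>Nin. S n - c * of_real (p * w n)" "(\<Sum>n\<in>Nb. S n) + (\<Sum>n\<in>Ns. S n)"]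
          norm_triangle_ineq[of "\<Sum>n\<in>Nb. S n" "\<Sum>n\<in>Ns. S n"] by simp
    qed
    also have "norm (\<Sum>n\<in>Nin. S n - c * of_real (p * w n)) \<le> (1 + K) * C * ((1 + R0 + p * R0) * R0) * \<eta> * ?\<mu> (?D L)"
    proof -
      have "norm (\<Sum>n\<in>Nin. S n - c * of_real (p * w n)) \<le> (\<Sum>n\<in>Nin. (1 + K) * C * ((1 + R0 + p * R0) * R0) * \<eta> * w n)"
        using Nin_bound by (intro order_trans[OF norm_sum] sum_mono) auto
      also have "\<dots> = (1 + K) * C * ((1 + R0 + p * R0) * R0) * \<eta> * ?\<mu> (U Nin)"
        unfolding U_measure[OF fins(1)] by (simp add: sum_distrib_left)
      also have "\<dots> \<le> (1 + K) * C * ((1 + R0 + p * R0) * R0) * \<eta> * ?\<mu> (?D L)"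
        using K C R0(1) p \<eta>0 U_in U_borel[OF fins(1)] D_borel L1
        by (intro mult_left_mono mono[where L' = L]) auto
      finally show ?thesis .
    qed
    also have "norm (\<Sum>n\<in>Nb. S n) \<le> K * C * R0 * (1 + q * m) * mb"
    proof -
      have "norm (\<Sum>n\<in>Nb. S n) \<le> (\<Sum>n\<in>Nb. K * C * R0 * (1 + q * m) * w n)"
        using Nb_bound by (intro order_trans[OF norm_sum] sum_mono) auto
      also have "\<dots> = K * C * R0 * (1 + q * m) * ?\<mu> (U Nb)"
        unfolding U_measure[OF fins(3)] by (simp add: sum_distrib_left)
      also have "\<dots> \<le> K * C * R0 * (1 + q * m) * mb"
        using K C R0(1) q1 m0 by (intro mult_left_mono Ub_le) auto
      finally show ?thesis .
    qed
    also have "norm (\<Sum>n\<in>Ns. S n) \<le> K * C * R0 * (2 * q) * ms"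
    proof -
      have "norm (\<Sum>n\<in>Ns. S n) \<le> (\<Sum>n\<in>Ns. K * C * R0 * (2 * q) * w n)"
        using Ns_bound by (intro order_trans[OF norm_sum] sum_mono) auto
      also have "\<dots> = K * C * R0 * (2 * q) * ?\<mu> (U Ns)"
        unfolding U_measure[OF fins(2)] by (simp add: sum_distrib_left)
      also have "\<dots> \<le> K * C * R0 * (2 * q) * ms"
        using K C R0(1) q1 by (intro mult_left_mono Us_le) auto
      finally show ?thesis .
    qed
    also have "norm (c * of_real (p * (?\<mu> (?D L) - ?\<mu> (U Nin)))) \<le> C * (p * (mb + ms))"
    proof -
      have "?\<mu> (U Nin) \<le> ?\<mu> (?D L)"
        using U_in U_borel[OF fins(1)] D_borel L1 by (intro mono[where L' = L]) auto
      moreover have "?\<mu> (?D L) \<le> ?\<mu> (U Nin) + (mb + ms)"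
      proof -
        have Ufm: "U N \<in> fmeasurable (growth_measure \<alpha> \<l>)" if "N \<subseteq> Nm" for N
        proof (rule D_fm[where L' = "L + \<kappa> * h"])
          show "U N \<subseteq> ?D (L + \<kappa> * h)" using cell_sub that by (auto simp: U_def)
          show "U N \<in> sets borel" using that finN finite_subset by (intro U_borel) blast
        qed (rule L1)
        have f: "U Nin \<in> fmeasurable (growth_measure \<alpha> \<l>)" "U Nb \<in> fmeasurable (growth_measure \<alpha> \<l>)" "U Ns \<in> fmeasurable (growth_measure \<alpha> \<l>)"
          by (rule Ufm, force simp: Nin_def Nb_def Ns_def)+
        have "?\<mu> (?D L) \<le> ?\<mu> (U Nin \<union> (U Nb \<union> U Ns))"
          using D_cover f D_borel by (intro measure_mono_fmeasurable fmeasurable.Un) auto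
        also have "\<dots> \<le> ?\<mu> (U Nin) + ?\<mu> (U Nb \<union> U Ns)"
          using f by (intro measure_Un_le fmeasurableD fmeasurable.Un)
        also have "?\<mu> (U Nb \<union> U Ns) \<le> ?\<mu> (U Nb) + ?\<mu> (U Ns)"
          using f by (intro measure_Un_le fmeasurableD fmeasurable.Un)
        finally show ?thesis using Ub_le Us_le by linarith
      qed
      ultimately have "\<bar>p * (?\<mu> (?D L) - ?\<mu> (U Nin))\<bar> \<le> p * (mb + ms)"
        using p by (simp add: abs_mult)
      then show ?thesis unfolding norm_mult norm_of_real using cC C by (intro mult_mono) auto
    qed
    finally have "norm ((\<Sum>x\<in>X. f x) - c * of_real (p * ?\<mu> (?D L)))
      \<le> (1 + K) * C * ((1 + R0 + p * R0) * R0) * \<eta> * ?\<mu> (?D L)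
        + (K * C * R0 * (1 + q * m) * mb + K * C * R0 * (2 * q) * ms) + C * (p * (mb + ms))" by simp
    also have "\<dots> \<le> (1 + K) * R * C * (\<eta> * ?\<mu> (?D L) + (1 + q * m) * mb + q * ms)"
    proof -
      have mb0: "0 \<le> mb" using Ub_le measure_nonneg[of "growth_measure \<alpha> \<l>" "U Nb"] by linarith
      have ms0: "0 \<le> ms" by (simp add: ms_def sum_nonneg)
      have "(1 + K) * C * ((1 + R0 + p * R0) * R0) * \<eta> * ?\<mu> (?D L) \<le> (1 + K) * C * R * (\<eta> * ?\<mu> (?D L))"
        unfolding mult.assoc[of _ \<eta>] using K C R(2) \<eta>0 by (intro mult_right_mono mult_left_mono) auto
      moreover have "K * C * R0 * (1 + q * m) * mb + C * p * mb \<le> (1 + K) * C * R * ((1 + q * m) * mb)"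
      proof -
        have "mb \<le> (1 + q * m) * mb" using mb0 q1 m0 by (simp add: mult_le_cancel_right1)
        then have "C * p * mb \<le> C * p * ((1 + q * m) * mb)" using C p by (intro mult_left_mono) auto
        then have "K * C * R0 * (1 + q * m) * mb + C * p * mb \<le> C * (K * R0 + p) * ((1 + q * m) * mb)"
          by (simp add: algebra_simps)
        also have "\<dots> \<le> C * ((1 + K) * R) * ((1 + q * m) * mb)"
        proof (intro mult_right_mono mult_left_mono)
          have "K * R0 + p \<le> (1 + K) * (p + 2 * R0)" using K R0(1) p by (simp add: algebra_simps add_increasing)
          also have "\<dots> \<le> (1 + K) * R" using K R(3) by (intro mult_left_mono) auto
          finally show "K * R0 + p \<le> (1 + K) * R" .
        qed (use C q1 m0 mb0 in auto)
        finally show ?thesis by (simp add: mult_ac)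
      qed
      moreover have "K * C * R0 * (2 * q) * ms + C * p * ms \<le> (1 + K) * C * R * (q * ms)"
      proof -
        have "ms \<le> q * ms" using ms0 q1 by (simp add: mult_le_cancel_right1)
        then have "C * p * ms \<le> C * p * (q * ms)" using C p by (intro mult_left_mono) auto
        then have "K * C * R0 * (2 * q) * ms + C * p * ms \<le> C * (K * (2 * R0) + p) * (q * ms)"
          by (simp add: algebra_simps)
        also have "\<dots> \<le> C * ((1 + K) * R) * (q * ms)"
        proof (intro mult_right_mono mult_left_mono)
          have "K * (2 * R0) + p \<le> (1 + K) * (p + 2 * R0)" using K R0(1) p by (simp add: algebra_simps add_increasing)
          also have "\<dots> \<le> (1 + K) * R" using K R(3) by (intro mult_left_mono) auto
          finally show "K * (2 * R0) + p \<le> (1 + K) * R" .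
        qed (use C q1 ms0 in auto)
        finally show ?thesis by (simp add: mult_ac)
      qed
      moreover have "(1 + K) * R * C * (\<eta> * ?\<mu> (?D L) + (1 + q * m) * mb + q * ms)
        = (1 + K) * C * R * (\<eta> * ?\<mu> (?D L)) + (1 + K) * C * R * ((1 + q * m) * mb) + (1 + K) * C * R * (q * ms)"
        by (simp add: algebra_simps)
      moreover have "C * (p * (mb + ms)) = C * p * mb + C * p * ms" by (simp add: algebra_simps)
      ultimately show ?thesis by linarith
    qed
    finally show "norm ((\<Sum>x | (\<forall>j. 1 \<le> x $ j) \<and> log_vec x \<in> ?D L. f x)
          - c * of_real ((\<Prod>j\<in>UNIV. \<alpha> $ j) * ?\<mu> (?D L)))
      \<le> (1 + K) * R * C *
        ((h + 1 / M + h powr (- real CARD('s)) * M powr (- \<delta>)) * ?\<mu> (?D L)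
        + (1 + h powr (- A - real CARD('s)) * M powr (- \<delta>)) * (?\<mu> (?D (L + \<kappa> * h)) - ?\<mu> (?D (L - \<kappa> * h)))
        + h powr (- A - real CARD('s)) * (\<Sum>j\<in>UNIV. ?\<mu> (?D (L + \<kappa> * h) \<inter> {u. u $ j \<le> M + 1})))"
      unfolding X_def p_def \<eta>_def q_def m_def mb_def ms_def s_def .
  qed
qed

subsection \<open>Choice of parameters\<close>

text \<open>Up to the factor \<open>exp a\<close>, \<open>H\<close> is the one-dimensional growth
  function at \<open>L - 1\<close>, so the estimates for unit steps apply;
  \<open>2 * \<eta> \<le> 1\<close> puts \<open>L - \<eta>\<close> and \<open>L + \<eta>\<close>
  within one such step.\<close>

lemma exp_powr_shift_bounds:
  fixes a q :: real
  assumes a: "0 \<le> a"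
  defines "H \<equiv> \<lambda>L. exp (a * L) * L powr q"
  obtains R where "R \<ge> 0"
    "\<And>L \<eta>. 0 \<le> \<eta> \<Longrightarrow> 2 * \<eta> \<le> 1 \<Longrightarrow> 1 \<le> L - \<eta> \<Longrightarrow>
       H (L + \<eta>) \<le> R * H L \<and> H (L - \<eta>) \<le> R * H L \<and> \<bar>H (L + \<eta>) - H (L - \<eta>)\<bar> \<le> R * \<eta> * H L"
proof -
  define g where "g = log_growth1 a q"
  define \<rho> where "\<rho> = growth_ratio a q"
  have Hg: "H L = exp a * g (L - 1)" for L
    by (simp add: H_def g_def log_growth1_def algebra_simps flip: exp_add)
  have \<rho>: "\<rho> \<ge> 1" unfolding \<rho>_def by (rule growth_ratio_ge_1[OF a])
  define R where "R = \<rho> + 2 * (a + \<bar>q\<bar>) * \<rho> * \<rho>"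
  have R: "\<rho> \<le> R" "2 * (a + \<bar>q\<bar>) * \<rho> * \<rho> \<le> R" using \<rho> a by (auto simp: R_def)
  show ?thesis
  proof (rule that)
    show "0 \<le> R" using \<rho> R by linarith
    fix L \<eta> :: real assume \<eta>: "0 \<le> \<eta>" "2 * \<eta> \<le> 1" and L: "1 \<le> L - \<eta>"
    have g0: "0 \<le> g v" for v by (simp add: g_def log_growth1_def)
    have up: "g (L + \<eta> - 1) \<le> \<rho> * g (L - 1)"
      unfolding g_def \<rho>_def by (rule log_growth1_comparable(1)[OF a]) (use \<eta> L in linarith)+
    have down: "g (L - \<eta> - 1) \<le> \<rho> * g (L - 1)"
      unfolding g_def \<rho>_def by (rule log_growth1_comparable(2)[OF a]) (use \<eta> L in linarith)+
    have "\<bar>g (L + \<eta> - 1) - g (L - \<eta> - 1)\<bar> \<le> (a + \<bar>q\<bar>) * \<rho> * ((L + \<eta> - 1) - (L - \<eta> - 1)) * g (L - \<eta> - 1)"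
      unfolding g_def \<rho>_def by (rule log_growth1_diff(1)[OF a]) (use \<eta> L in linarith)+
    also have "\<dots> = (2 * (a + \<bar>q\<bar>) * \<rho> * \<eta>) * g (L - \<eta> - 1)" by (simp add: algebra_simps)
    also have "\<dots> \<le> (2 * (a + \<bar>q\<bar>) * \<rho> * \<eta>) * (\<rho> * g (L - 1))"
      using down \<rho> a \<eta> by (intro mult_left_mono) auto
    also have "\<dots> = (2 * (a + \<bar>q\<bar>) * \<rho> * \<rho>) * (\<eta> * g (L - 1))" by (simp add: mult_ac)
    also have "\<dots> \<le> R * (\<eta> * g (L - 1))" using R(2) \<eta> g0 by (intro mult_right_mono) auto
    finally have diff: "\<bar>g (L + \<eta> - 1) - g (L - \<eta> - 1)\<bar> \<le> R * \<eta> * g (L - 1)" by (simp add: mult.assoc)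
    have \<rho>R: "\<rho> * g (L - 1) \<le> R * g (L - 1)" using R(1) g0 by (intro mult_right_mono) auto
    have "g (L + \<eta> - 1) \<le> R * g (L - 1)" "g (L - \<eta> - 1) \<le> R * g (L - 1)"
      using up down \<rho>R by linarith+
    moreover have "exp a * \<bar>g (L + \<eta> - 1) - g (L - \<eta> - 1)\<bar> \<le> exp a * (R * \<eta> * g (L - 1))"
      by (rule mult_left_mono[OF diff]) simp
    ultimately show "H (L + \<eta>) \<le> R * H L \<and> H (L - \<eta>) \<le> R * H L \<and> \<bar>H (L + \<eta>) - H (L - \<eta>)\<bar> \<le> R * \<eta> * H L"
      unfolding Hg by (simp add: abs_mult mult_ac flip: right_diff_distrib)
  qed
qed

text \<open>The mesh \<open>h = L powr (- \<tau>)\<close> and the cut-off \<open>M = L powr (1/2)\<close> balance the three error terms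
  of the discretization.\<close>

lemma discretization_parameters:
  fixes \<mu> :: "real \<Rightarrow> real" and \<nu> :: "real \<Rightarrow> real \<Rightarrow> real" and q :: real
  assumes a: "0 \<le> a" and \<epsilon>: "0 < \<epsilon>" and \<delta>: "0 < \<delta>" and A: "0 \<le> A" and s: "0 \<le> s" and \<kappa>: "0 \<le> \<kappa>" and p: "0 < p"
    and K: "0 \<le> K\<^sub>1" "0 \<le> K\<^sub>2"
  defines "H \<equiv> \<lambda>L. exp (a * L) * L powr q"
  assumes asym: "\<And>L. 1 \<le> L \<Longrightarrow> \<bar>p * \<mu> L - b * H L\<bar> \<le> K\<^sub>1 * (H L * L powr (- \<epsilon>))"
    and small: "\<And>L M. 1 \<le> L \<Longrightarrow> 1 \<le> M \<Longrightarrow> \<nu> L M \<le> K\<^sub>2 * (M / L) powr \<epsilon> * H L"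
  obtains \<tau> K L\<^sub>0 where "0 < \<tau>" "0 \<le> K" "1 \<le> L\<^sub>0"
    "\<And>L. L\<^sub>0 \<le> L \<Longrightarrow> \<exists>h M. 0 < h \<and> h \<le> ln 2 \<and> 1 \<le> M \<and> 1 \<le> L - \<kappa> * h \<and>
      (h + 1 / M + h powr (- s) * M powr (- \<delta>)) * \<mu> L
        + (1 + h powr (- A - s) * M powr (- \<delta>)) * (\<mu> (L + \<kappa> * h) - \<mu> (L - \<kappa> * h))
        + h powr (- A - s) * \<nu> (L + \<kappa> * h) (M + 1) \<le> K * (H L * L powr (- \<tau>))"
    "\<And>L. L\<^sub>0 \<le> L \<Longrightarrow> \<bar>p * \<mu> L - b * H L\<bar> \<le> K * (H L * L powr (- \<tau>))"
proof -
  obtain R where R: "R \<ge> 0"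
    "\<And>L \<eta>. 0 \<le> \<eta> \<Longrightarrow> 2 * \<eta> \<le> 1 \<Longrightarrow> 1 \<le> L - \<eta> \<Longrightarrow>
       H (L + \<eta>) \<le> R * H L \<and> H (L - \<eta>) \<le> R * H L \<and> \<bar>H (L + \<eta>) - H (L - \<eta>)\<bar> \<le> R * \<eta> * H L"
    unfolding H_def by (rule exp_powr_shift_bounds[OF a]) blast
  \<comment> \<open>The common saving: \<delta> limits the cell errors, \<epsilon> the integrals and
    slices, and the bound 1 leads to \<tau> \<le> 1/2, so that \<open>1 / M \<le> h\<close>.\<close>
  define m where "m = min \<delta> (min \<epsilon> 1)"
  \<comment> \<open>Chosen so that \<open>\<tau> * (A + s) - m / 2 = - \<tau>\<close>: then
    \<open>h powr (- (A + s)) * M powr (- m)\<close> is exactly \<open>h\<close>, and every error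
    term retains a factor \<open>h\<close>.\<close>
  define \<tau> where "\<tau> = m / (2 * (A + s + 1))"
  have m: "0 < m" "m \<le> \<delta>" "m \<le> \<epsilon>" "m \<le> 1" using \<delta> \<epsilon> by (auto simp: m_def)
  have As: "0 < A + s + 1" using A s by linarith
  have \<tau>: "0 < \<tau>" unfolding \<tau>_def using m As by (intro divide_pos_pos mult_pos_pos) auto
  have "\<tau> * (A + s + 1) = m / 2" unfolding \<tau>_def using As by (metis nonzero_mult_divide_mult_cancel_right2 times_divide_eq_left order_less_irrefl mult.commute)
  then have \<tau>m: "\<tau> * A + \<tau> * s + \<tau> = m / 2" by (simp add: distrib_left)
  have \<tau>A: "0 \<le> \<tau> * A" "0 \<le> \<tau> * s" using \<tau> A s by auto
  have \<tau>_le: "\<tau> \<le> 1 / 2" "\<tau> \<le> \<epsilon>" using \<tau>m \<tau>A m \<epsilon> by linarith+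
  \<comment> \<open>\<open>h \<le> e\<close> yields both \<open>h \<le> ln 2\<close> and
    \<open>\<kappa> * h \<le> 1 / 2\<close>; it holds from \<open>L = e powr (- 1 / \<tau>)\<close>
    on.\<close>
  define e where "e = min (ln 2) (1 / (2 * (\<kappa> + 1)))"
  have e: "0 < e" "e \<le> ln 2" "e \<le> 1 / (2 * (\<kappa> + 1))" using \<kappa> by (auto simp: e_def)
  define L\<^sub>0 where "L\<^sub>0 = max 2 (e powr (- 1 / \<tau>))"
  have H0: "0 \<le> H L" for L by (simp add: H_def)
  have H0': "0 \<le> H L * L powr t" for L t using H0 by simp
  define K where "K = 3 * ((\<bar>b\<bar> + K\<^sub>1) / p) + 2 * (\<bar>b\<bar> * R * \<kappa> + 2 * K\<^sub>1 * R * 2 powr \<epsilon>) / p + K\<^sub>2 * 2 powr \<epsilon> * R + K\<^sub>1"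
  have Kparts: "0 \<le> 3 * ((\<bar>b\<bar> + K\<^sub>1) / p)" "0 \<le> 2 * (\<bar>b\<bar> * R * \<kappa> + 2 * K\<^sub>1 * R * 2 powr \<epsilon>) / p" "0 \<le> K\<^sub>2 * 2 powr \<epsilon> * R"
    using p K R(1) \<kappa> by simp_all
  show ?thesis
  proof (rule that[OF \<tau>])
    show "0 \<le> K" unfolding K_def using Kparts K by linarith
    show "1 \<le> L\<^sub>0" by (simp add: L\<^sub>0_def)
  next
    fix L assume "L\<^sub>0 \<le> L"
    then have L: "1 \<le> L" by (simp add: L\<^sub>0_def)
    have "\<bar>p * \<mu> L - b * H L\<bar> \<le> K\<^sub>1 * (H L * L powr (- \<epsilon>))" by (rule asym[OF L])
    also have "\<dots> \<le> K\<^sub>1 * (H L * L powr (- \<tau>))"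
      using K H0 L \<tau>_le by (intro mult_left_mono powr_mono) auto
    also have "\<dots> \<le> K * (H L * L powr (- \<tau>))"
      unfolding K_def using Kparts H0' by (intro mult_right_mono) auto
    finally show "\<bar>p * \<mu> L - b * H L\<bar> \<le> K * (H L * L powr (- \<tau>))" .
  next
    fix L assume L0: "L\<^sub>0 \<le> L"
    then have L2: "2 \<le> L" and Le: "e powr (- 1 / \<tau>) \<le> L" by (auto simp: L\<^sub>0_def)
    define h where "h = L powr (- \<tau>)"
    define M where "M = L powr (1 / 2)"
    have h0: "0 < h" using L2 by (simp add: h_def)
    have he: "h \<le> e"
    proof -
      have "h \<le> (e powr (- 1 / \<tau>)) powr (- \<tau>)"
        unfolding h_def using Le e(1) \<tau> by (intro powr_mono2') auto
      then show ?thesis using e(1) \<tau> by (simp add: powr_powr)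
    qed
    define \<eta> where "\<eta> = \<kappa> * h"
    have \<eta>: "0 \<le> \<eta>" "2 * \<eta> \<le> 1"
    proof -
      have "\<kappa> * h \<le> \<kappa> * (1 / (2 * (\<kappa> + 1)))" using he e(3) \<kappa> by (intro mult_left_mono) auto
      also have "\<dots> \<le> 1 / 2" using \<kappa> by (simp add: field_simps)
      finally show "2 * \<eta> \<le> 1" by (simp add: \<eta>_def)
      show "0 \<le> \<eta>" using \<kappa> h0 by (simp add: \<eta>_def)
    qed
    have L\<eta>: "1 \<le> L - \<eta>" "1 \<le> L + \<eta>" "1 \<le> L" "L / 2 \<le> L - \<eta>" "L / 2 \<le> L + \<eta>" using L2 \<eta> by linarith+
    have M1: "1 \<le> M" unfolding M_def using L2 by (simp add: ge_one_powr_ge_zero)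
    have pw: "L powr x \<le> h" if "x \<le> - \<tau>" for x unfolding h_def using L2 that by (intro powr_mono) auto
    have hM: "h powr (- x) * M powr (- y) = L powr (\<tau> * x - y / 2)" for x y
      by (simp add: h_def M_def powr_powr flip: powr_add)
    have b1: "1 / M \<le> h"
    proof -
      have "1 / M = L powr (- (1 / 2))" using L2 by (simp add: M_def powr_minus_divide)
      also have "\<dots> \<le> h" using \<tau>_le by (intro pw) auto
      finally show ?thesis .
    qed
    have b2: "h powr (- s) * M powr (- \<delta>) \<le> h" unfolding hM
      by (rule pw) (use \<tau>m \<tau>A m in linarith)
    have b3: "h powr (- A - s) * M powr (- \<delta>) \<le> 1"
    proof -
      have "h powr (- (A + s)) * M powr (- \<delta>) \<le> h" unfolding hM
        by (rule pw) (use \<tau>m \<tau>A m in \<open>simp add: distrib_left\<close>)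
      then show ?thesis using he e(2) ln_2_less_1 by simp
    qed
    have HL: "0 \<le> H L" by (rule H0)
    have shift: "H (L + \<eta>) \<le> R * H L" "H (L - \<eta>) \<le> R * H L" "\<bar>H (L + \<eta>) - H (L - \<eta>)\<bar> \<le> R * \<eta> * H L"
      using R(2)[OF \<eta> L\<eta>(1)] by auto
    have \<mu>_le: "\<mu> L \<le> (\<bar>b\<bar> + K\<^sub>1) / p * H L"
    proof -
      have "K\<^sub>1 * (H L * L powr (- \<epsilon>)) \<le> K\<^sub>1 * (H L * 1)"
        using K HL L2 \<epsilon> by (intro mult_left_mono) (auto simp: powr_minus_divide ge_one_powr_ge_zero)
      then have "p * \<mu> L \<le> b * H L + K\<^sub>1 * H L" using asym[OF L\<eta>(3)] by linarith
      also have "\<dots> \<le> (\<bar>b\<bar> + K\<^sub>1) * H L" using HL by (simp add: distrib_right mult_right_mono)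
      finally show ?thesis using p by (simp add: field_simps)
    qed
    \<comment> \<open>The shifted scales stay above \<open>L / 2\<close>, so their saving is worse
      only by the factor \<open>2 powr \<epsilon>\<close>.\<close>
    have pow_half: "x powr (- \<epsilon>) \<le> 2 powr \<epsilon> * h" if "L / 2 \<le> x" for x
    proof -
      have "x powr (- \<epsilon>) \<le> (L / 2) powr (- \<epsilon>)" using that L2 \<epsilon> by (intro powr_mono2') auto
      also have "\<dots> = 2 powr \<epsilon> * L powr (- \<epsilon>)" using L2 by (simp add: powr_divide powr_minus field_simps)
      also have "\<dots> \<le> 2 powr \<epsilon> * h" using \<tau>_le by (intro mult_left_mono pw) auto
      finally show ?thesis .
    qed
    have side: "K\<^sub>1 * (H x * x powr (- \<epsilon>)) \<le> K\<^sub>1 * R * 2 powr \<epsilon> * (H L * h)" if "H x \<le> R * H L" "L / 2 \<le> x" for x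
    proof -
      have "H x * x powr (- \<epsilon>) \<le> (R * H L) * (2 powr \<epsilon> * h)"
        using that(1) pow_half[OF that(2)] R(1) HL by (intro mult_mono) auto
      then have "K\<^sub>1 * (H x * x powr (- \<epsilon>)) \<le> K\<^sub>1 * ((R * H L) * (2 powr \<epsilon> * h))" using K by (intro mult_left_mono)
      then show ?thesis by (simp add: mult_ac)
    qed
    \<comment> \<open>The shell has no asymptotic of its own: its main terms differ by
      \<open>O(\<eta>)\<close> relative to \<open>H L\<close>, and the two errors are already of
      order \<open>h\<close>.\<close>
    have diff: "\<mu> (L + \<eta>) - \<mu> (L - \<eta>) \<le> (\<bar>b\<bar> * R * \<kappa> + 2 * K\<^sub>1 * R * 2 powr \<epsilon>) / p * (H L * h)"
    proof -
      have "b * (H (L + \<eta>) - H (L - \<eta>)) \<le> \<bar>b\<bar> * \<bar>H (L + \<eta>) - H (L - \<eta>)\<bar>"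
        by (metis abs_ge_self abs_mult)
      also have "\<dots> \<le> \<bar>b\<bar> * (R * \<eta> * H L)" using shift(3) by (intro mult_left_mono) auto
      also have "\<dots> = \<bar>b\<bar> * R * \<kappa> * (H L * h)" by (simp add: \<eta>_def mult_ac)
      finally have "b * H (L + \<eta>) - b * H (L - \<eta>) \<le> \<bar>b\<bar> * R * \<kappa> * (H L * h)" by (simp add: right_diff_distrib)
      then have "p * \<mu> (L + \<eta>) - p * \<mu> (L - \<eta>)
          \<le> \<bar>b\<bar> * R * \<kappa> * (H L * h) + K\<^sub>1 * R * 2 powr \<epsilon> * (H L * h) + K\<^sub>1 * R * 2 powr \<epsilon> * (H L * h)"
        using asym[OF L\<eta>(2)] asym[OF L\<eta>(1)] side[OF shift(1) L\<eta>(5)] side[OF shift(2) L\<eta>(4)] by linarith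
      also have "\<dots> = (\<bar>b\<bar> * R * \<kappa> + 2 * K\<^sub>1 * R * 2 powr \<epsilon>) * (H L * h)" by (simp add: distrib_right)
      finally show ?thesis using p by (simp add: pos_le_divide_eq right_diff_distrib mult.commute)
    qed
    have \<nu>_le: "h powr (- A - s) * \<nu> (L + \<eta>) (M + 1) \<le> K\<^sub>2 * 2 powr \<epsilon> * R * (H L * h)"
    proof -
      have "((M + 1) / (L + \<eta>)) powr \<epsilon> \<le> (2 * (M / L)) powr \<epsilon>"
      proof (rule powr_mono2)
        show "(M + 1) / (L + \<eta>) \<le> 2 * (M / L)"
          using M1 L2 \<eta> by (simp add: frac_le)
      qed (use M1 L2 \<eta> \<epsilon> in auto)
      also have "\<dots> = 2 powr \<epsilon> * (M / L) powr \<epsilon>" using powr_mult[of 2 "M / L" \<epsilon>] M1 L2 by simp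
      also have "M / L = L powr (- (1 / 2))"
        using L2 powr_diff[of L "1/2" 1] by (simp add: M_def)
      also have "(L powr (- (1 / 2))) powr \<epsilon> = M powr (- \<epsilon>)" by (simp add: M_def powr_powr)
      finally have 1: "((M + 1) / (L + \<eta>)) powr \<epsilon> \<le> 2 powr \<epsilon> * M powr (- \<epsilon>)" .
      have "\<nu> (L + \<eta>) (M + 1) \<le> K\<^sub>2 * ((M + 1) / (L + \<eta>)) powr \<epsilon> * H (L + \<eta>)"
        using M1 by (intro small L\<eta>) auto
      also have "\<dots> \<le> K\<^sub>2 * (2 powr \<epsilon> * M powr (- \<epsilon>)) * (R * H L)"
        using 1 K shift(1) H0 by (intro mult_mono mult_left_mono) auto
      finally have "h powr (- (A + s)) * \<nu> (L + \<eta>) (M + 1)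
          \<le> h powr (- (A + s)) * (K\<^sub>2 * (2 powr \<epsilon> * M powr (- \<epsilon>)) * (R * H L))"
        by (rule mult_left_mono) simp
      also have "\<dots> = K\<^sub>2 * 2 powr \<epsilon> * R * H L * (h powr (- (A + s)) * M powr (- \<epsilon>))" by (simp add: mult_ac)
      also have "\<dots> \<le> K\<^sub>2 * 2 powr \<epsilon> * R * H L * h" unfolding hM
        using K R(1) HL \<tau>m m by (intro mult_left_mono pw) (auto simp: distrib_left)
      finally show ?thesis by (simp add: mult.assoc)
    qed
    have t1: "(h + 1 / M + h powr (- s) * M powr (- \<delta>)) * \<mu> L \<le> 3 * ((\<bar>b\<bar> + K\<^sub>1) / p) * (H L * h)"
    proof -
      have "(h + 1 / M + h powr (- s) * M powr (- \<delta>)) * \<mu> L \<le> (h + 1 / M + h powr (- s) * M powr (- \<delta>)) * ((\<bar>b\<bar> + K\<^sub>1) / p * H L)"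
        using h0 M1 \<mu>_le by (intro mult_left_mono add_nonneg_nonneg) auto
      also have "\<dots> \<le> (3 * h) * ((\<bar>b\<bar> + K\<^sub>1) / p * H L)"
        using b1 b2 K p HL by (intro mult_right_mono) auto
      finally show ?thesis by (simp add: mult_ac)
    qed
    have t2: "(1 + h powr (- A - s) * M powr (- \<delta>)) * (\<mu> (L + \<eta>) - \<mu> (L - \<eta>))
        \<le> 2 * (\<bar>b\<bar> * R * \<kappa> + 2 * K\<^sub>1 * R * 2 powr \<epsilon>) / p * (H L * h)"
    proof -
      have "(1 + h powr (- A - s) * M powr (- \<delta>)) * (\<mu> (L + \<eta>) - \<mu> (L - \<eta>))
          \<le> (1 + h powr (- A - s) * M powr (- \<delta>)) * ((\<bar>b\<bar> * R * \<kappa> + 2 * K\<^sub>1 * R * 2 powr \<epsilon>) / p * (H L * h))"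
        by (rule mult_left_mono[OF diff]) simp
      also have "\<dots> \<le> 2 * ((\<bar>b\<bar> * R * \<kappa> + 2 * K\<^sub>1 * R * 2 powr \<epsilon>) / p * (H L * h))"
        using b3 R(1) K \<kappa> p HL h0 by (intro mult_right_mono) auto
      finally show ?thesis by (simp only: times_divide_eq_left times_divide_eq_right mult.assoc)
    qed
    have "0 \<le> K\<^sub>1 * (H L * h)" using K HL h0 by simp
    then have "3 * ((\<bar>b\<bar> + K\<^sub>1) / p) * (H L * h) + 2 * (\<bar>b\<bar> * R * \<kappa> + 2 * K\<^sub>1 * R * 2 powr \<epsilon>) / p * (H L * h)
        + K\<^sub>2 * 2 powr \<epsilon> * R * (H L * h) \<le> K * (H L * h)"
      unfolding K_def by (simp only: distrib_right)
    then have "(h + 1 / M + h powr (- s) * M powr (- \<delta>)) * \<mu> L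
        + (1 + h powr (- A - s) * M powr (- \<delta>)) * (\<mu> (L + \<eta>) - \<mu> (L - \<eta>))
        + h powr (- A - s) * \<nu> (L + \<eta>) (M + 1) \<le> K * (H L * h)"
      using t1 t2 \<nu>_le by linarith
    then show "\<exists>h M. 0 < h \<and> h \<le> ln 2 \<and> 1 \<le> M \<and> 1 \<le> L - \<kappa> * h \<and>
      (h + 1 / M + h powr (- s) * M powr (- \<delta>)) * \<mu> L
        + (1 + h powr (- A - s) * M powr (- \<delta>)) * (\<mu> (L + \<kappa> * h) - \<mu> (L - \<kappa> * h))
        + h powr (- A - s) * \<nu> (L + \<kappa> * h) (M + 1) \<le> K * (H L * L powr (- \<tau>))"
      using h0 he e(2) M1 L\<eta>(1) unfolding h_def[symmetric] \<eta>_def by (intro exI[of _ h] exI[of _ M]) auto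
  qed
qed


section \<open>Assembly of the asymptotic formula\<close>

lemma cell_asymptotic_mono:
  assumes "cell_asymptotic \<alpha> \<l> \<delta> K f c C" "K \<le> K'" "0 \<le> C"
  shows "cell_asymptotic \<alpha> \<l> \<delta> K' f c C"
  unfolding cell_asymptotic_def
proof (intro allI impI)
  fix h M :: real and n :: "nat ^ 'a"
  assume "0 < h" "h \<le> 1" "0 \<le> M" "\<forall>j. 1 \<le> n $ j" "\<forall>j. M \<le> corner h n $ j"
  then have "norm ((\<Sum>x\<in>point_cell h n. f x) - c * of_real (\<Prod>j\<in>UNIV. log_growth1 (\<alpha> $ j) (\<l> $ j) (corner h n $ j + h)
      - log_growth1 (\<alpha> $ j) (\<l> $ j) (corner h n $ j))) \<le> K * (C * (1 + M) powr (- \<delta>) * log_growth \<alpha> \<l> (corner h n))"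
    using assms(1) unfolding cell_asymptotic_def by blast
  also have "\<dots> \<le> K' * (C * (1 + M) powr (- \<delta>) * log_growth \<alpha> \<l> (corner h n))"
    using assms(2,3) by (intro mult_right_mono) (auto simp: log_growth_def intro!: mult_nonneg_nonneg prod_nonneg)
  finally show "norm ((\<Sum>x\<in>point_cell h n. f x) - c * of_real (\<Prod>j\<in>UNIV. log_growth1 (\<alpha> $ j) (\<l> $ j) (corner h n $ j + h)
      - log_growth1 (\<alpha> $ j) (\<l> $ j) (corner h n $ j))) \<le> K' * (C * (1 + M) powr (- \<delta>) * log_growth \<alpha> \<l> (corner h n))" .
qed

lemma cell_upper_bound_mono:
  assumes "cell_upper_bound \<alpha> \<l> \<delta> A K f C" "K \<le> K'" "0 \<le> C"
  shows "cell_upper_bound \<alpha> \<l> \<delta> A K' f C"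
  unfolding cell_upper_bound_def
proof (intro allI impI)
  fix h M :: real and n :: "nat ^ 'a"
  assume h: "0 < h" "h \<le> ln 2" "0 \<le> M" "\<forall>j. M \<le> corner h n $ j"
  let ?E = "C * (h ^ CARD('a) + h powr (- A) * (1 + M) powr (- \<delta>)) * log_growth \<alpha> \<l> (corner h n)"
  have "(\<Sum>x\<in>point_cell h n. norm (f x)) \<le> K * ?E"
    using assms(1) h unfolding cell_upper_bound_def by blast
  also have "\<dots> \<le> K' * ?E"
    using assms(2,3) h by (intro mult_right_mono) (auto simp: log_growth_def intro!: mult_nonneg_nonneg add_nonneg_nonneg prod_nonneg)
  finally show "(\<Sum>x\<in>point_cell h n. norm (f x)) \<le> K' * ?E" .
qed

lemma prod_powr_le_iff:
  assumes x: "\<And>j. j \<in> J \<Longrightarrow> 1 \<le> (x j :: nat)" and B: "B > 0"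
  shows "(\<Prod>j\<in>J. real (x j) powr w j) \<le> B \<longleftrightarrow> (\<Sum>j\<in>J. w j * ln (real (x j))) \<le> ln B"
proof (cases "finite J")
  case True
  have "(\<Prod>j\<in>J. real (x j) powr w j) = exp (\<Sum>j\<in>J. w j * ln (real (x j)))"
    unfolding exp_sum[OF True] using x by (intro prod.cong) (force simp: powr_def)+
  moreover have "exp y \<le> B \<longleftrightarrow> y \<le> ln B" for y using B by (simp add: ln_ge_iff)
  ultimately show ?thesis by simp
qed (use B in simp)

text \<open>Any other positive shift in place of \<open>\<chi> j. 1\<close> gives the same limit.\<close>

definition polytope_constant :: "real ^ 's \<Rightarrow> (real ^ 's) set \<Rightarrow> real" where
  "polytope_constant \<l> P = Lim at_top (\<lambda>L. L powr (CARD('s) - real (nat (aff_dim (maximal_face P))))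
     * enn2real (face_mass \<l> P (SUP t\<in>P. l1_norm t) (\<chi> j. 1) L))"

theorem theorem2p5:
  "\<exists>c\<^sub>P :: real ^ 's \<Rightarrow> (real ^ 's) set \<Rightarrow> real.
   \<forall>(k::nat) (\<alpha> :: real ^ 's) (\<l> :: real ^ 's) (\<omega> :: nat \<Rightarrow> real ^ 's) (\<delta>::real) (A::real)
    (P :: (real ^ 's) set) (F :: (real ^ 's) set) (d::nat) (a::real) (l::real).
     k \<ge> 1 \<longrightarrow>
     (\<forall>j. \<alpha> $ j > 0) \<longrightarrow>
     (\<forall>i\<in>{1..k}. \<forall>j. \<omega> i $ j \<ge> 0) \<longrightarrow>
     0 < \<delta> \<longrightarrow> \<delta> \<le> 1 \<longrightarrow> A > 0 \<longrightarrow>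
     P = exponent_polytope k \<alpha> \<omega> \<longrightarrow>
     bounded P \<longrightarrow>
     F = maximal_face P \<longrightarrow>
     aff_dim F = int d \<longrightarrow>
     (\<forall>j. \<not> F \<subseteq> {t. t $ j = 0}) \<longrightarrow>
     convergent_type \<l> F \<longrightarrow>
     a = (SUP t\<in>P. l1_norm t) \<longrightarrow>
     l = (\<Sum>j\<in>UNIV. \<l> $ j) \<longrightarrow>
     (\<exists>\<epsilon>>0. \<forall>K\<^sub>1 K\<^sub>2 :: real. \<exists>(K::real) B\<^sub>0. B\<^sub>0 > 1 \<and>
       (\<forall>(f :: nat ^ 's \<Rightarrow> complex) (c\<^sub>f::complex) (C\<^sub>f::real).
          box_asymptotic \<alpha> \<l> \<delta> K\<^sub>1 f c\<^sub>f C\<^sub>f \<longrightarrow>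
          real_nonneg f \<or> box_upper_bound \<alpha> \<l> \<delta> A K\<^sub>2 f C\<^sub>f \<longrightarrow>
          (\<forall>B\<ge>B\<^sub>0.
             norm ((\<Sum>x | (\<forall>j. 1 \<le> x $ j) \<and>
                          (\<forall>i\<in>{1..k}. (\<Prod>j\<in>UNIV. real (x $ j) powr (\<omega> i $ j)) \<le> B). f x)
                   - c\<^sub>f * of_real (c\<^sub>P \<l> P) / of_real (\<Prod>j\<in>UNIV. (\<alpha> $ j) powr (\<l> $ j))
                       * of_real (B powr a * ln B powr (real d + l)))
               \<le> K * (C\<^sub>f * B powr a * ln B powr (real d + l - \<epsilon>)))))"
proof (intro exI[of _ polytope_constant] allI impI)
  fix k :: nat and \<alpha> \<l> :: "real ^ 's" and \<omega> :: "nat \<Rightarrow> real ^ 's" and \<delta> A :: real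
    and P F :: "(real ^ 's) set" and d :: nat and a l :: real
  assume "k \<ge> 1" and \<alpha>': "\<forall>j. \<alpha> $ j > 0" and \<omega>': "\<forall>i\<in>{1..k}. \<forall>j. \<omega> i $ j \<ge> 0" and \<delta>: "0 < \<delta>" and "\<delta> \<le> 1" and A: "A > 0"
    and P: "P = exponent_polytope k \<alpha> \<omega>" and bdd: "bounded P" and F: "F = maximal_face P" and dim_F: "aff_dim F = int d"
    and F_coord': "\<forall>j. \<not> F \<subseteq> {t. t $ j = 0}" and conv: "convergent_type \<l> F" and a: "a = (SUP t\<in>P. l1_norm t)"
    and l: "l = (\<Sum>j\<in>UNIV. \<l> $ j)"
  have \<alpha>: "\<alpha> $ j > 0" for j using \<alpha>' by blast
  have \<omega>: "0 \<le> \<omega> i $ j" if "i \<in> {1..k}" for i j using \<omega>' that by blast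
  have F_coord: "\<not> F \<subseteq> {t. t $ j = 0}" for j using F_coord' by blast
  have a0: "0 \<le> a"
  proof -
    obtain b where b: "\<And>t. t \<in> P \<Longrightarrow> norm t \<le> b" using bdd bounded_iff by blast
    have "l1_norm t \<le> (\<Sum>i\<in>(UNIV::'s set). b)" if "t \<in> P" for t
      unfolding l1_norm_def using b[OF that] by (intro sum_mono order_trans[OF component_le_norm_cart])
    then have "bdd_above (l1_norm ` P)" by (auto intro!: bdd_aboveI2)
    moreover have "0 \<in> P" by (simp add: P exponent_polytope_def)
    ultimately have "l1_norm (0 :: real ^ 's) \<le> a" unfolding a by (intro cSUP_upper)
    then show ?thesis by (simp add: l1_norm_def)
  qed
  obtain \<epsilon> c :: real where \<epsilon>: "\<epsilon> > 0"
    and lim: "\<And>\<beta>. (\<And>j. \<beta> $ j > 0) \<Longrightarrow> \<exists>K\<ge>0. \<forall>L\<ge>1. face_mass \<l> P a \<beta> L < \<infinity> \<and>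
        \<bar>L powr (CARD('s) - real d) * enn2real (face_mass \<l> P a \<beta> L) - c\<bar> \<le> K * L powr (- \<epsilon>)"
    and small: "\<And>\<beta>. (\<And>j. \<beta> $ j > 0) \<Longrightarrow> \<exists>K\<ge>0. \<forall>L\<ge>1. \<forall>M\<ge>1. \<forall>j.
        (\<integral>\<^sup>+t\<in>P \<inter> {t. L * t $ j \<le> M}. ennreal (face_kernel \<l> a \<beta> L t) \<partial>lborel)
          \<le> ennreal (K * (M / L) powr \<epsilon> * L powr (real d - CARD('s)))"
  proof -
    show thesis by (rule face_mass_asymptotics[OF P bdd F dim_F F_coord conv a]) (fact that)
  qed
  \<comment> \<open>The limit \<open>c\<close> is common to all shifts, so the value defined through
    the shift 1 is also the one that the shifts \<open>\<alpha> $ j\<close> produce.\<close>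
  have const: "polytope_constant \<l> P = c"
  proof -
    obtain K where K: "\<And>L. L \<ge> 1 \<Longrightarrow>
        \<bar>L powr (CARD('s) - real d) * enn2real (face_mass \<l> P a (\<chi> j. 1) L) - c\<bar> \<le> K * L powr (- \<epsilon>)"
      using lim[of "\<chi> j. 1"] by auto
    have "((\<lambda>L. K * L powr (- \<epsilon>)) \<longlongrightarrow> K * 0) at_top"
      using \<epsilon> by (intro tendsto_mult_left tendsto_neg_powr filterlim_ident) auto
    then have "((\<lambda>L. K * L powr (- \<epsilon>)) \<longlongrightarrow> 0) at_top" by simp
    then have "((\<lambda>L. L powr (CARD('s) - real d) * enn2real (face_mass \<l> P a (\<chi> j. 1) L) - c) \<longlongrightarrow> 0) at_top"
      by (rule Lim_null_comparison[rotated]) (use K in \<open>auto simp: eventually_at_top_linorder\<close>)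
    then have "((\<lambda>L. L powr (CARD('s) - real d) * enn2real (face_mass \<l> P a (\<chi> j. 1) L)) \<longlongrightarrow> c) at_top"
      by (simp add: LIM_zero_iff)
    moreover have "nat (aff_dim (maximal_face P)) = d" using dim_F by (simp flip: F)
    ultimately show ?thesis unfolding polytope_constant_def a by (simp add: tendsto_Lim)
  qed
  define \<mu> where "\<mu> = measure (growth_measure \<alpha> \<l>)"
  define D where "D = log_region k \<omega>"
  define p where "p = (\<Prod>j\<in>UNIV. \<alpha> $ j)"
  define b where "b = c / (\<Prod>j\<in>UNIV. (\<alpha> $ j) powr (\<l> $ j))"
  define H where "H L = exp (a * L) * L powr (real d + l)" for L
  have p: "0 < p" unfolding p_def using \<alpha> by (intro prod_pos) auto
  have D_borel: "D L \<in> sets borel" for L unfolding D_def by (rule borel_closed[OF closed_log_region])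
  have DM_borel: "D L \<inter> {u. u $ j \<le> M} \<in> sets borel" for L M j
    unfolding D_def by (intro borel_closed closed_Int closed_log_region closed_Collect_le continuous_intros)
  note D_em = emeasure_growth_measure[OF D_borel, of \<alpha> \<l>]
  note DM_em = emeasure_growth_measure[OF DM_borel, of \<alpha> \<l>]
  note region = log_growth_integral_asymptotics[OF \<alpha> P \<epsilon> lim[OF \<alpha>] small[OF \<alpha>], folded l H_def D_def p_def b_def, folded D_em DM_em]
  obtain K\<^sub>a where K\<^sub>a: "0 \<le> K\<^sub>a"
    "\<And>L. 1 \<le> L \<Longrightarrow> emeasure (growth_measure \<alpha> \<l>) (D L) < \<infinity>"
    "\<And>L. 1 \<le> L \<Longrightarrow> \<bar>p * \<mu> (D L) - b * H L\<bar> \<le> K\<^sub>a * (H L * L powr (- \<epsilon>))"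
  proof -
    have "\<exists>K\<ge>0. \<forall>L\<ge>1. emeasure (growth_measure \<alpha> \<l>) (D L) < \<infinity> \<and>
        \<bar>p * enn2real (emeasure (growth_measure \<alpha> \<l>) (D L)) - b * H L\<bar> \<le> K * (H L * L powr (- \<epsilon>))"
      using region(1) unfolding H_def .
    then obtain K where "0 \<le> K \<and> (\<forall>L\<ge>1. emeasure (growth_measure \<alpha> \<l>) (D L) < \<infinity> \<and>
        \<bar>p * enn2real (emeasure (growth_measure \<alpha> \<l>) (D L)) - b * H L\<bar> \<le> K * (H L * L powr (- \<epsilon>)))"
      by (elim exE) (rule that)
    then show thesis by (intro that[of K]) (simp_all add: \<mu>_def measure_def)
  qed
  obtain K\<^sub>s where K\<^sub>s: "0 \<le> K\<^sub>s"
    "\<And>L M j. 1 \<le> L \<Longrightarrow> 1 \<le> M \<Longrightarrow> emeasure (growth_measure \<alpha> \<l>) (D L \<inter> {u. u $ j \<le> M}) \<le> ennreal (K\<^sub>s * (M / L) powr \<epsilon> * H L)"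
  proof -
    have "\<exists>K\<ge>0. \<forall>L\<ge>1. \<forall>M\<ge>1. \<forall>j. emeasure (growth_measure \<alpha> \<l>) (D L \<inter> {u. u $ j \<le> M})
        \<le> ennreal (K * (M / L) powr \<epsilon> * H L)"
      using region(2) unfolding H_def .
    then obtain K where "0 \<le> K \<and> (\<forall>L\<ge>1. \<forall>M\<ge>1. \<forall>j. emeasure (growth_measure \<alpha> \<l>) (D L \<inter> {u. u $ j \<le> M})
        \<le> ennreal (K * (M / L) powr \<epsilon> * H L))"
      by (elim exE) (rule that)
    then show thesis by (intro that[of K]) simp_all
  qed
  have small_sum: "(\<Sum>j\<in>UNIV. \<mu> (D L \<inter> {u. u $ j \<le> M})) \<le> (CARD('s) * K\<^sub>s) * (M / L) powr \<epsilon> * H L"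
    if LM: "1 \<le> L" "1 \<le> M" for L M
  proof -
    have "\<mu> (D L \<inter> {u. u $ j \<le> M}) \<le> K\<^sub>s * (M / L) powr \<epsilon> * H L" for j
      unfolding \<mu>_def measure_def using K\<^sub>s(2)[OF LM] K\<^sub>s(1) by (intro enn2real_leI) (auto simp: H_def)
    then have "(\<Sum>j\<in>UNIV. \<mu> (D L \<inter> {u. u $ j \<le> M})) \<le> (\<Sum>j\<in>(UNIV::'s set). K\<^sub>s * (M / L) powr \<epsilon> * H L)"
      by (intro sum_mono)
    then show ?thesis by (simp add: mult.assoc)
  qed
  obtain \<kappa> R where \<kappa>: "\<kappa> \<ge> 1" and R: "R \<ge> 0"
    and discr: "\<And>K f c C h M L. 0 \<le> K \<Longrightarrow> norm c \<le> C \<Longrightarrow> cell_asymptotic \<alpha> \<l> \<delta> K f c C \<Longrightarrow> cell_upper_bound \<alpha> \<l> \<delta> A K f C \<Longrightarrow>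
      0 < h \<Longrightarrow> h \<le> ln 2 \<Longrightarrow> 1 \<le> M \<Longrightarrow> 1 \<le> L - \<kappa> * h \<Longrightarrow>
      norm ((\<Sum>x | (\<forall>j. 1 \<le> x $ j) \<and> log_vec x \<in> D L. f x) - c * of_real (p * \<mu> (D L)))
      \<le> (1 + K) * R * C *
        ((h + 1 / M + h powr (- real CARD('s)) * M powr (- \<delta>)) * \<mu> (D L)
        + (1 + h powr (- A - real CARD('s)) * M powr (- \<delta>)) * (\<mu> (D (L + \<kappa> * h)) - \<mu> (D (L - \<kappa> * h)))
        + h powr (- A - real CARD('s)) * (\<Sum>j\<in>UNIV. \<mu> (D (L + \<kappa> * h) \<inter> {u. u $ j \<le> M + 1})))"
  proof -
    show thesis
      by (rule log_cell_discretization[OF \<alpha> \<omega> bdd[unfolded P] less_imp_le[OF \<delta>] less_imp_le[OF A] K\<^sub>a(2)[unfolded D_def], folded D_def p_def \<mu>_def])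
        (assumption | fact that)+
  qed
  have \<kappa>0: "0 \<le> \<kappa>" and K\<^sub>s0: "0 \<le> CARD('s) * K\<^sub>s" using \<kappa> K\<^sub>s(1) by auto
  obtain \<tau> K\<^sub>d L\<^sub>0 where \<tau>: "0 < \<tau>" and K\<^sub>d: "0 \<le> K\<^sub>d" and L\<^sub>0: "1 \<le> L\<^sub>0"
    and err: "\<And>L. L\<^sub>0 \<le> L \<Longrightarrow> \<exists>h M. 0 < h \<and> h \<le> ln 2 \<and> 1 \<le> M \<and> 1 \<le> L - \<kappa> * h \<and>
      (h + 1 / M + h powr (- real CARD('s)) * M powr (- \<delta>)) * \<mu> (D L)
        + (1 + h powr (- A - real CARD('s)) * M powr (- \<delta>)) * (\<mu> (D (L + \<kappa> * h)) - \<mu> (D (L - \<kappa> * h)))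
        + h powr (- A - real CARD('s)) * (\<Sum>j\<in>UNIV. \<mu> (D (L + \<kappa> * h) \<inter> {u. u $ j \<le> M + 1})) \<le> K\<^sub>d * (H L * L powr (- \<tau>))"
    and main: "\<And>L. L\<^sub>0 \<le> L \<Longrightarrow> \<bar>p * \<mu> (D L) - b * H L\<bar> \<le> K\<^sub>d * (H L * L powr (- \<tau>))"
  proof -
    show thesis
      by (rule discretization_parameters[of a \<epsilon> \<delta> A "real CARD('s)" \<kappa> p K\<^sub>a "CARD('s) * K\<^sub>s" "\<lambda>L. \<mu> (D L)" b "real d + l"
            "\<lambda>L M. \<Sum>j\<in>UNIV. \<mu> (D L \<inter> {u. u $ j \<le> M})",
            OF a0 \<epsilon> \<delta> less_imp_le[OF A] of_nat_0_le_iff \<kappa>0 p K\<^sub>a(1) K\<^sub>s0 K\<^sub>a(3)[unfolded H_def] small_sum[unfolded H_def], folded H_def])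
        (assumption | fact that)+
  qed
  obtain R\<^sub>a where R\<^sub>a: "R\<^sub>a \<ge> 0"
    "\<And>K\<^sub>1 f c C. box_asymptotic \<alpha> \<l> \<delta> K\<^sub>1 f c C \<Longrightarrow> cell_asymptotic \<alpha> \<l> \<delta> (\<bar>K\<^sub>1\<bar> * R\<^sub>a) f c C"
    by (rule cell_asymptoticI[of \<alpha> \<delta> \<l>, OF \<alpha> less_imp_le[OF \<delta>]]) blast
  obtain R\<^sub>n where R\<^sub>n: "R\<^sub>n \<ge> 0"
    "\<And>K\<^sub>1 f c C. box_asymptotic \<alpha> \<l> \<delta> K\<^sub>1 f c C \<Longrightarrow> real_nonneg f \<Longrightarrow>
       cell_upper_bound \<alpha> \<l> \<delta> A ((1 + \<bar>K\<^sub>1\<bar>) * R\<^sub>n) f C"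
    by (rule cell_upper_bound_nonneg[of \<alpha> \<delta> A \<l>, OF \<alpha> less_imp_le[OF \<delta>] less_imp_le[OF A]]) blast
  show "\<exists>\<epsilon>>0. \<forall>K\<^sub>1 K\<^sub>2 :: real. \<exists>(K::real) B\<^sub>0. B\<^sub>0 > 1 \<and>
       (\<forall>(f :: nat ^ 's \<Rightarrow> complex) (c\<^sub>f::complex) (C\<^sub>f::real).
          box_asymptotic \<alpha> \<l> \<delta> K\<^sub>1 f c\<^sub>f C\<^sub>f \<longrightarrow>
          real_nonneg f \<or> box_upper_bound \<alpha> \<l> \<delta> A K\<^sub>2 f C\<^sub>f \<longrightarrow>
          (\<forall>B\<ge>B\<^sub>0.
             norm ((\<Sum>x | (\<forall>j. 1 \<le> x $ j) \<and>
                          (\<forall>i\<in>{1..k}. (\<Prod>j\<in>UNIV. real (x $ j) powr (\<omega> i $ j)) \<le> B). f x)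
                   - c\<^sub>f * of_real (polytope_constant \<l> P) / of_real (\<Prod>j\<in>UNIV. (\<alpha> $ j) powr (\<l> $ j))
                       * of_real (B powr a * ln B powr (real d + l)))
               \<le> K * (C\<^sub>f * B powr a * ln B powr (real d + l - \<epsilon>))))"
  \<comment> \<open>\<tau> was obtained before the implicit constants of the hypotheses and before
    \<open>f\<close>, as the order of quantifiers demands.\<close>
  proof (rule exI[of _ \<tau>], intro conjI allI \<tau>)
    fix K\<^sub>1 K\<^sub>2 :: real
    \<comment> \<open>One constant for both alternatives on \<open>f\<close>, dominating the cell
      asymptotic as well.\<close>
    define K\<^sub>c where "K\<^sub>c = \<bar>K\<^sub>1\<bar> * R\<^sub>a + (1 + \<bar>K\<^sub>1\<bar>) * R\<^sub>n + \<bar>K\<^sub>2\<bar>"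
    have nn: "0 \<le> \<bar>K\<^sub>1\<bar> * R\<^sub>a" "0 \<le> (1 + \<bar>K\<^sub>1\<bar>) * R\<^sub>n" using R\<^sub>a(1) R\<^sub>n(1) by simp_all
    have K\<^sub>c: "0 \<le> K\<^sub>c" "\<bar>K\<^sub>1\<bar> * R\<^sub>a \<le> K\<^sub>c" "(1 + \<bar>K\<^sub>1\<bar>) * R\<^sub>n \<le> K\<^sub>c" "\<bar>K\<^sub>2\<bar> \<le> K\<^sub>c"
      using nn unfolding K\<^sub>c_def by linarith+
    show "\<exists>(K::real) B\<^sub>0. B\<^sub>0 > 1 \<and>
       (\<forall>(f :: nat ^ 's \<Rightarrow> complex) (c\<^sub>f::complex) (C\<^sub>f::real).
          box_asymptotic \<alpha> \<l> \<delta> K\<^sub>1 f c\<^sub>f C\<^sub>f \<longrightarrow>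
          real_nonneg f \<or> box_upper_bound \<alpha> \<l> \<delta> A K\<^sub>2 f C\<^sub>f \<longrightarrow>
          (\<forall>B\<ge>B\<^sub>0.
             norm ((\<Sum>x | (\<forall>j. 1 \<le> x $ j) \<and>
                          (\<forall>i\<in>{1..k}. (\<Prod>j\<in>UNIV. real (x $ j) powr (\<omega> i $ j)) \<le> B). f x)
                   - c\<^sub>f * of_real (polytope_constant \<l> P) / of_real (\<Prod>j\<in>UNIV. (\<alpha> $ j) powr (\<l> $ j))
                       * of_real (B powr a * ln B powr (real d + l)))
               \<le> K * (C\<^sub>f * B powr a * ln B powr (real d + l - \<tau>))))"
    \<comment> \<open>\<open>(1 + K\<^sub>c) * R\<close> comes from comparing the sum with the
      integral, the added 1 from comparing the integral with its main term.\<close>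
    proof (rule exI[of _ "((1 + K\<^sub>c) * R + 1) * K\<^sub>d"], rule exI[of _ "exp L\<^sub>0"], intro conjI allI impI)
      show "exp L\<^sub>0 > 1" using L\<^sub>0 by simp
      fix f :: "nat ^ 's \<Rightarrow> complex" and c\<^sub>f :: complex and C\<^sub>f B :: real
      assume box: "box_asymptotic \<alpha> \<l> \<delta> K\<^sub>1 f c\<^sub>f C\<^sub>f"
        and alt: "real_nonneg f \<or> box_upper_bound \<alpha> \<l> \<delta> A K\<^sub>2 f C\<^sub>f" and B: "exp L\<^sub>0 \<le> B"
      have cC: "norm c\<^sub>f \<le> C\<^sub>f" using box by (simp add: box_asymptotic_def)
      then have C: "0 \<le> C\<^sub>f" using norm_ge_zero[of c\<^sub>f] by linarith
      have E1: "cell_asymptotic \<alpha> \<l> \<delta> K\<^sub>c f c\<^sub>f C\<^sub>f"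
        by (rule cell_asymptotic_mono[OF R\<^sub>a(2)[OF box] K\<^sub>c(2) C])
      have E2: "cell_upper_bound \<alpha> \<l> \<delta> A K\<^sub>c f C\<^sub>f"
        using alt
      proof
        assume "real_nonneg f"
        then show ?thesis by (rule cell_upper_bound_mono[OF R\<^sub>n(2)[OF box] K\<^sub>c(3) C])
      next
        assume "box_upper_bound \<alpha> \<l> \<delta> A K\<^sub>2 f C\<^sub>f"
        then show ?thesis by (rule cell_upper_bound_mono[OF cell_upper_boundI[OF _ less_imp_le[OF \<delta>] C] K\<^sub>c(4) C])
      qed
      define L where "L = ln B"
      have B0: "0 < B" using B exp_gt_zero[of L\<^sub>0] by linarith
      have L: "L\<^sub>0 \<le> L" unfolding L_def using B B0 by (simp add: ln_ge_iff)
      have L1: "1 \<le> L" using L L\<^sub>0 by linarith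
      have HB: "H L = B powr a * ln B powr (real d + l)" using B0 by (simp add: H_def L_def powr_def)
      have HB\<tau>: "H L * L powr (- \<tau>) = B powr a * ln B powr (real d + l - \<tau>)"
        unfolding HB unfolding L_def by (simp add: mult.assoc flip: powr_add)
      \<comment> \<open>Logarithms turn the multiplicative constraints into the linear ones of the
        region at \<open>L = ln B\<close>.\<close>
      have X: "{x. (\<forall>j. 1 \<le> x $ j) \<and> (\<forall>i\<in>{1..k}. (\<Prod>j\<in>UNIV. real (x $ j) powr (\<omega> i $ j)) \<le> B)}
          = {x. (\<forall>j. 1 \<le> x $ j) \<and> log_vec x \<in> D L}"
        using B0 unfolding D_def log_region_def log_vec_def L_def by (auto simp: prod_powr_le_iff)
      let ?S = "\<Sum>x | (\<forall>j. 1 \<le> x $ j) \<and> log_vec x \<in> D L. f x"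
      obtain h M where hM: "0 < h" "h \<le> ln 2" "1 \<le> M" "1 \<le> L - \<kappa> * h"
        "(h + 1 / M + h powr (- real CARD('s)) * M powr (- \<delta>)) * \<mu> (D L)
        + (1 + h powr (- A - real CARD('s)) * M powr (- \<delta>)) * (\<mu> (D (L + \<kappa> * h)) - \<mu> (D (L - \<kappa> * h)))
        + h powr (- A - real CARD('s)) * (\<Sum>j\<in>UNIV. \<mu> (D (L + \<kappa> * h) \<inter> {u. u $ j \<le> M + 1})) \<le> K\<^sub>d * (H L * L powr (- \<tau>))"
        using err[OF L] by (elim exE conjE) (rule that)
      have "norm (?S - c\<^sub>f * of_real (p * \<mu> (D L))) \<le> (1 + K\<^sub>c) * R * C\<^sub>f * (K\<^sub>d * (H L * L powr (- \<tau>)))"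
        by (rule order_trans[OF discr[OF K\<^sub>c(1) cC E1 E2 hM(1-4)] mult_left_mono[OF hM(5)]]) (use K\<^sub>c(1) R C in simp)
      moreover have "norm (c\<^sub>f * of_real (p * \<mu> (D L) - b * H L)) \<le> C\<^sub>f * (K\<^sub>d * (H L * L powr (- \<tau>)))"
        unfolding norm_mult norm_of_real using main[OF L] cC C by (intro mult_mono) auto
      moreover have "norm (?S - c\<^sub>f * of_real (b * H L))
          \<le> norm (?S - c\<^sub>f * of_real (p * \<mu> (D L))) + norm (c\<^sub>f * of_real (p * \<mu> (D L) - b * H L))"
        using norm_triangle_ineq[of "?S - c\<^sub>f * of_real (p * \<mu> (D L))" "c\<^sub>f * of_real (p * \<mu> (D L) - b * H L)"]
        by (simp add: algebra_simps)
      moreover have "(1 + K\<^sub>c) * R * C\<^sub>f * (K\<^sub>d * (H L * L powr (- \<tau>))) + C\<^sub>f * (K\<^sub>d * (H L * L powr (- \<tau>)))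
          = ((1 + K\<^sub>c) * R + 1) * K\<^sub>d * (C\<^sub>f * B powr a * ln B powr (real d + l - \<tau>))"
        unfolding HB\<tau> by (simp add: algebra_simps)
      ultimately have "norm (?S - c\<^sub>f * of_real (b * H L)) \<le> ((1 + K\<^sub>c) * R + 1) * K\<^sub>d * (C\<^sub>f * B powr a * ln B powr (real d + l - \<tau>))"
        by linarith
      moreover have "c\<^sub>f * of_real (b * H L) = c\<^sub>f * of_real (polytope_constant \<l> P) / of_real (\<Prod>j\<in>UNIV. (\<alpha> $ j) powr (\<l> $ j))
          * of_real (B powr a * ln B powr (real d + l))"
        unfolding b_def HB const by simp
      ultimately show "norm ((\<Sum>x | (\<forall>j. 1 \<le> x $ j) \<and>
                          (\<forall>i\<in>{1..k}. (\<Prod>j\<in>UNIV. real (x $ j) powr (\<omega> i $ j)) \<le> B). f x)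
                   - c\<^sub>f * of_real (polytope_constant \<l> P) / of_real (\<Prod>j\<in>UNIV. (\<alpha> $ j) powr (\<l> $ j))
                       * of_real (B powr a * ln B powr (real d + l)))
               \<le> ((1 + K\<^sub>c) * R + 1) * K\<^sub>d * (C\<^sub>f * B powr a * ln B powr (real d + l - \<tau>))"
        unfolding X by simp
    qed
  qed
qed

end
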